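(* Let $M$ be an isoparametric hypersurface of $\mathbb{H}^2\times\mathbb{H}^2$ (connected and orientable). Then, up to an isometry of $\mathbb{H}^2\times\mathbb{H}^2$, one of the following four cases occurs: (1) $M$ is an open part of $M_\Gamma$, where $\Gamma$ is a curve of $\mathbb{H}^2$ with constant curvature; or (2) $M$ is an open part of $M^c_{1,-1}$ for some $c\in(0,1)$; or (3) $M$ is an open part of $M^c_{1,1}$ for some $c\in(0,1)$; or (4) $M$ is an open part of $M_\tau$ for some $\tau<-1$.
   Context: $\mathbb{R}^3_1$ denotes $\mathbb{R}^3$ with the Lorentzian inner product $\langle x,y\rangle=-x_1y_1+x_2y_2+x_3y_3$, and $\mathbb{H}^2=\{x\in\mathbb{R}^3_1:\langle x,x\rangle=-1,\ x_1>0\}$. $\mathbb{H}^2\times\mathbb{H}^2\subset\mathbb{R}^3_1\times\mathbb{R}^3_1$ carries the Riemannian product metric. A hypersurface $M$ of a Riemannian manifold $(\bar N,g)$ is isoparametric if there is a function $F:\bar N\to\mathbb{R}$ with $|\nabla F|^2=f(F)$ and $\Delta F=h(F)$ for some smooth functions $f,h:\mathbb{R}\to\mathbb{R}$, such that $M=F^{-1}(l)$ for some regular value $l$ of $F$ (equivalently, locally defined parallel hypersurfaces of $M$ have constant mean curvature). Examples: for a smooth curve $\Gamma\subset\mathbb{H}^2$, $M_\Gamma=\{(x,y): x\in\Gamma,\ y\in\mathbb{H}^2\}$. For $0<c<1$, put $\gamma(r)=(\tfrac{2+r^2}{2},r,\tfrac{r^2}{2})$ and $N(r)=(-\tfrac{r^2}{2},-r,\tfrac{2-r^2}{2})$;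 $M^c_{1,-1}$ is the image of $(t,r,s)\mapsto\big(\cosh(\sqrt c\,t)\gamma(r)+\sinh(\sqrt c\,t)N(r),\ \cosh(\sqrt{1-c}\,t)\gamma(s)+\sinh(\sqrt{1-c}\,t)\tilde N(s)\big)$ with $\tilde N(s)=(\tfrac{s^2}{2},s,\tfrac{s^2-2}{2})$, and $M^c_{1,1}$ is the image of the same map with $\tilde N(s)=(-\tfrac{s^2}{2},-s,\tfrac{2-s^2}{2})$. For $\tau<-1$, $M_\tau=\{(p,q)\in\mathbb{H}^2\times\mathbb{H}^2:\langle p,q\rangle=\tau\}$ (Lorentzian inner product of $\mathbb{R}^3_1$). *)

theory Defs
  imports "HOL-Analysis.Analysis"
begin

definition lor :: "real^3 \<Rightarrow> real^3 \<Rightarrow> real" where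
  "lor x y = - x$1 * y$1 + x$2 * y$2 + x$3 * y$3"

definition H2 :: "(real^3) set" where
  "H2 = {x. lor x x = -1 \<and> x$1 > 0}"

definition HH :: "((real^3) \<times> (real^3)) set" where
  "HH = H2 \<times> H2"

fun C_k :: "nat \<Rightarrow> 'a::real_normed_vector set \<Rightarrow> ('a \<Rightarrow> 'b::real_normed_vector) \<Rightarrow> bool" where
  "C_k 0 W G = continuous_on W G"
| "C_k (Suc n) W G = (G differentiable_on W \<and>
     (\<forall>v. C_k n W (\<lambda>x. frechet_derivative G (at x) v)))"

definition smooth_on :: "'a::real_normed_vector set \<Rightarrow> ('a \<Rightarrow> 'b::real_normed_vector) \<Rightarrow> bool" where
  "smooth_on W G = (\<forall>n. C_k n W G)"

definition smooth_fun_on :: "((real^3) \<times> (real^3)) set \<Rightarrow> ((real^3) \<times> (real^3) \<Rightarrow> real) \<Rightarrow> bool" where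
  "smooth_fun_on U F = (\<exists>W G. open W \<and> U \<subseteq> W \<and> smooth_on W G \<and> (\<forall>x\<in>U. G x = F x))"

definition geo :: "real^3 \<Rightarrow> real^3 \<Rightarrow> real \<Rightarrow> real^3" where
  "geo p u t = cosh t *\<^sub>R p + sinh t *\<^sub>R u"

definition onb_at :: "real^3 \<Rightarrow> real^3 \<Rightarrow> real^3 \<Rightarrow> bool" where
  "onb_at p u v = (lor u p = 0 \<and> lor v p = 0 \<and> lor u u = 1 \<and> lor v v = 1 \<and> lor u v = 0)"

definition tb :: "real^3 \<Rightarrow> (real^3) \<times> (real^3)" where
  "tb p = (SOME (u, v). onb_at p u v)"

definition grad_sq :: "((real^3) \<times> (real^3) \<Rightarrow> real) \<Rightarrow> (real^3) \<times> (real^3) \<Rightarrow> real" where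
  "grad_sq F x = (let p = fst x; q = snd x; (u1, u2) = tb p; (w1, w2) = tb q in
      (deriv (\<lambda>t. F (geo p u1 t, q)) 0)\<^sup>2 + (deriv (\<lambda>t. F (geo p u2 t, q)) 0)\<^sup>2
    + (deriv (\<lambda>t. F (p, geo q w1 t)) 0)\<^sup>2 + (deriv (\<lambda>t. F (p, geo q w2 t)) 0)\<^sup>2)"

text \<open>Laplacian = trace of the Hessian; Hess F(e,e) is the second derivative of F along the
  geodesic with initial velocity e.\<close>
definition lap :: "((real^3) \<times> (real^3) \<Rightarrow> real) \<Rightarrow> (real^3) \<times> (real^3) \<Rightarrow> real" where
  "lap F x = (let p = fst x; q = snd x; (u1, u2) = tb p; (w1, w2) = tb q in
      deriv (deriv (\<lambda>t. F (geo p u1 t, q))) 0 + deriv (deriv (\<lambda>t. F (geo p u2 t, q))) 0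
    + deriv (deriv (\<lambda>t. F (p, geo q w1 t))) 0 + deriv (deriv (\<lambda>t. F (p, geo q w2 t))) 0)"

definition isoparametric_hypersurface :: "((real^3) \<times> (real^3)) set \<Rightarrow> bool" where
  "isoparametric_hypersurface M = (\<exists>U F f h l.
      openin (top_of_set HH) U \<and> smooth_fun_on U F \<and>
      smooth_on (UNIV::real set) f \<and> smooth_on (UNIV::real set) h \<and>
      (\<forall>x\<in>U. grad_sq F x = f (F x) \<and> lap F x = h (F x)) \<and>
      (\<forall>x\<in>U. F x = l \<longrightarrow> grad_sq F x \<noteq> 0) \<and>
      M = {x\<in>U. F x = l})"

definition hdist :: "real^3 \<Rightarrow> real^3 \<Rightarrow> real" where
  "hdist p q = arcosh (- lor p q)"

definition pdist :: "(real^3) \<times> (real^3) \<Rightarrow> (real^3) \<times> (real^3) \<Rightarrow> real" where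
  "pdist x y = sqrt ((hdist (fst x) (fst y))\<^sup>2 + (hdist (snd x) (snd y))\<^sup>2)"

definition isometry_HH :: "((real^3) \<times> (real^3) \<Rightarrow> (real^3) \<times> (real^3)) \<Rightarrow> bool" where
  "isometry_HH \<Phi> = (bij_betw \<Phi> HH HH \<and> (\<forall>x\<in>HH. \<forall>y\<in>HH. pdist (\<Phi> x) (\<Phi> y) = pdist x y))"

definition open_part :: "'a::topological_space set \<Rightarrow> 'a set \<Rightarrow> bool" where
  "open_part A X = (A \<subseteq> X \<and> openin (top_of_set X) A)"

text \<open>Smooth curve of H2 of constant geodesic curvature: image of a smooth unit speed curve
  on an open interval whose covariant acceleration gamma'' - gamma has constant length.\<close>
definition const_curv_curve :: "(real^3) set \<Rightarrow> bool" where
  "const_curv_curve \<Gamma> = (\<exists>\<gamma> I k. is_interval I \<and> open I \<and> I \<noteq> {} \<and> smooth_on I \<gamma> \<and>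
      \<Gamma> = \<gamma> ` I \<and>
      (\<forall>t\<in>I. \<gamma> t \<in> H2 \<and>
         lor (vector_derivative \<gamma> (at t)) (vector_derivative \<gamma> (at t)) = 1 \<and>
         (let a = vector_derivative (\<lambda>s. vector_derivative \<gamma> (at s)) (at t) - \<gamma> t
          in lor a a = k)))"

definition M_Gamma :: "(real^3) set \<Rightarrow> ((real^3) \<times> (real^3)) set" where
  "M_Gamma \<Gamma> = \<Gamma> \<times> H2"

definition gam :: "real \<Rightarrow> real^3" where
  "gam r = vector [(2 + r\<^sup>2) / 2, r, r\<^sup>2 / 2]"

definition Nv :: "real \<Rightarrow> real^3" where
  "Nv r = vector [- r\<^sup>2 / 2, - r, (2 - r\<^sup>2) / 2]"

definition Nt_m :: "real \<Rightarrow> real^3" where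
  "Nt_m s = vector [s\<^sup>2 / 2, s, (s\<^sup>2 - 2) / 2]"

definition Nt_p :: "real \<Rightarrow> real^3" where
  "Nt_p s = vector [- s\<^sup>2 / 2, - s, (2 - s\<^sup>2) / 2]"

definition M_c_1_m1 :: "real \<Rightarrow> ((real^3) \<times> (real^3)) set" where
  "M_c_1_m1 c = (\<lambda>(t, r, s). (cosh (sqrt c * t) *\<^sub>R gam r + sinh (sqrt c * t) *\<^sub>R Nv r,
       cosh (sqrt (1 - c) * t) *\<^sub>R gam s + sinh (sqrt (1 - c) * t) *\<^sub>R Nt_m s)) ` UNIV"

definition M_c_1_1 :: "real \<Rightarrow> ((real^3) \<times> (real^3)) set" where
  "M_c_1_1 c = (\<lambda>(t, r, s). (cosh (sqrt c * t) *\<^sub>R gam r + sinh (sqrt c * t) *\<^sub>R Nv r,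
       cosh (sqrt (1 - c) * t) *\<^sub>R gam s + sinh (sqrt (1 - c) * t) *\<^sub>R Nt_p s)) ` UNIV"

definition M_tau :: "real \<Rightarrow> ((real^3) \<times> (real^3)) set" where
  "M_tau \<tau> = {(p, q). p \<in> H2 \<and> q \<in> H2 \<and> lor p q = \<tau>}"

end

theory Submission
  imports Defs
begin

text \<open>
  Rescaling F gives locally a function d with unit gradient whose Laplacian H is a function of d.
  Write the gradient of d as a n1 + b n2 with unit vectors n1, n2 tangent to the two factors.  In the
  adapted frame the principal minors of the shape operator of the level sets satisfy a linear
  system with constant coefficients along the normal flow, and its trace is a function of d.
  It follows that the square of a^2 - b^2 is a root of a nontrivial quadratic polynomial whose
  coefficients depend on d only; hence a and b are locally constant.  The Riccati and
  Codazzi equations then leave three possibilities: b = 0 up to exchanging the factors, H is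
  constant and the level curves in both factors are horocycles, or a = b and H' = 2 - H^2.
  In each of them the frame, viewed in Minkowski space, yields a constant vector, a pair of constant
  null directions or a constant Lorentz transformation, which identifies the level set.
\<close>

subsection \<open>Smooth functions\<close>

text \<open>The quadratic polynomial is a Cayley-Hamilton identity. The volume density of the normal
  flow is a determinant of Jacobi fields in parallel directions of curvature 0, -a^2 and -b^2. It is
  therefore a combination of exponentials with exponents a + b, a - b, b - a and - a - b, whose
  coefficients have degree at most one in the time. As a^2 + b^2 = 1, the square of N + H acts on
  the minors of even order with characteristic polynomial (x^2 - 2 x + C)^2, where C = (a^2 -
  b^2)^2. Applied to the function 1, the powers of N + H only produce functions of d. The
  coefficients may vanish on parts of the domain, so a product that is zero cannot simply be
  cancelled: such an equation is differentiated once more and multiplied by a suitable factor.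
  Horospherical coordinates cover each factor, so a single open set of R^4 suffices. That set need
  not be connected although the level set is; constants are therefore transported along the level
  set, and the set is shrunk around it whenever a sign or a value has to be fixed.\<close>

lemma frechet_derivative_cong_open:
  assumes "open W" "x \<in> W" "\<And>y. y \<in> W \<Longrightarrow> f y = g y"
  shows "frechet_derivative f (at x) = frechet_derivative g (at x)"
proof -
  have "(f has_derivative D) (at x) = (g has_derivative D) (at x)" for D
    using assms by (metis has_derivative_transform_within_open)
  then show ?thesis unfolding frechet_derivative_def by simp
qed

lemma C_k_cong:
  assumes "open W" "\<And>y. y \<in> W \<Longrightarrow> f y = g y" "C_k n W f"
  shows "C_k n W g"
  using assms(2,3)
proof (induction n arbitrary: f g)
  case 0
  then show ?case by (auto intro: continuous_on_eq)
next
  case (Suc n)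
  have "g differentiable_on W"
    using Suc.prems by (auto simp: differentiable_on_def differentiable_def)
      (metis has_derivative_transform)
  moreover have "C_k n W (\<lambda>x. frechet_derivative g (at x) v)" for v
  proof (rule Suc.IH[of "\<lambda>x. frechet_derivative f (at x) v"])
    show "frechet_derivative f (at y) v = frechet_derivative g (at y) v" if "y \<in> W" for y
      using frechet_derivative_cong_open[OF assms(1) that, of f g] Suc.prems(1) by simp
  qed (use Suc.prems in auto)
  ultimately show ?case by simp
qed

lemma C_k_mono: "C_k n W f \<Longrightarrow> V \<subseteq> W \<Longrightarrow> C_k n V f"
  by (induction n arbitrary: f) (auto intro: continuous_on_subset differentiable_on_subset)

lemma C_k_Suc_imp: "C_k (Suc n) W f \<Longrightarrow> C_k n W f"
  by (induction n arbitrary: f) (auto intro: differentiable_imp_continuous_on)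

text \<open>On an open set the derivative is unique, so any formula for it may stand in for the
  \<open>frechet_derivative\<close> in the definition of \<open>C_k\<close>. The closure properties
  below exhibit such a formula and then use induction.\<close>

lemma C_k_SucI:
  assumes "open W" "\<And>x. x \<in> W \<Longrightarrow> (f has_derivative f' x) (at x)"
    "\<And>v. C_k n W (\<lambda>x. f' x v)"
  shows "C_k (Suc n) W f"
proof -
  have "f differentiable_on W"
    using assms(2) by (auto simp: differentiable_on_def differentiable_def intro: has_derivative_at_withinI)
  moreover have "C_k n W (\<lambda>x. frechet_derivative f (at x) v)" for v
    by (rule C_k_cong[OF assms(1) _ assms(3)[of v]]) (metis assms(2) frechet_derivative_at)
  ultimately show ?thesis by simp
qed

lemma C_k_SucD:
  assumes "open W" "C_k (Suc n) W f" "x \<in> W"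
  shows "(f has_derivative frechet_derivative f (at x)) (at x)"
proof -
  have "f differentiable (at x within W)"
    using assms by (simp add: differentiable_on_def)
  then have "f differentiable (at x)"
    using at_within_open[OF assms(3,1)] by simp
  then show ?thesis by (rule frechet_derivative_works[THEN iffD1])
qed

lemma C_k_const: "open W \<Longrightarrow> C_k n W (\<lambda>x. c)"
proof (induction n arbitrary: c)
  case (Suc n)
  show ?case by (rule C_k_SucI[where f' = "\<lambda>x v. 0"]) (use Suc in auto)
qed simp

lemma C_k_bounded_linear:
  assumes "open W" "bounded_linear h" "C_k n W f"
  shows "C_k n W (\<lambda>x. h (f x))"
  using assms(3)
proof (induction n arbitrary: f)
  case 0
  then show ?case using assms(2) by (auto intro: bounded_linear.continuous_on)
next
  case (Suc n)
  show ?case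
    by (rule C_k_SucI[OF assms(1), where f' = "\<lambda>x v. h (frechet_derivative f (at x) v)"])
      (use Suc bounded_linear.has_derivative[OF assms(2) C_k_SucD[OF assms(1) Suc.prems]] in auto)
qed

lemma C_k_ident: "open W \<Longrightarrow> C_k n W (\<lambda>x. x)"
proof (cases n)
  case (Suc m)
  assume "open W"
  then show ?thesis unfolding Suc
    by (intro C_k_SucI[where f' = "\<lambda>x v. v"]) (auto intro: C_k_const)
qed (auto intro: continuous_intros)

lemma C_k_add:
  assumes "open W" "C_k n W f" "C_k n W g"
  shows "C_k n W (\<lambda>x. f x + g x)"
  using assms(2,3)
proof (induction n arbitrary: f g)
  case 0
  then show ?case by (auto intro: continuous_intros)
next
  case (Suc n)
  show ?case
    by (rule C_k_SucI[OF assms(1), where f' = "\<lambda>x v. frechet_derivative f (at x) v + frechet_derivative g (at x) v"])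
      (use Suc has_derivative_add[OF C_k_SucD[OF assms(1) Suc.prems(1)] C_k_SucD[OF assms(1) Suc.prems(2)]] in auto)
qed

lemma C_k_sum:
  assumes "open W" "\<And>i. i \<in> I \<Longrightarrow> C_k n W (f i)"
  shows "C_k n W (\<lambda>x. \<Sum>i\<in>I. f i x)"
  using assms(2)
  by (induction I rule: infinite_finite_induct) (auto intro: C_k_const C_k_add assms(1))

lemma C_k_scaleR:
  fixes f :: "'a::real_normed_vector \<Rightarrow> real"
  assumes "open W" "C_k n W f" "C_k n W g"
  shows "C_k n W (\<lambda>x. f x *\<^sub>R g x)"
  using assms(2,3)
proof (induction n arbitrary: f g)
  case 0
  then show ?case by (auto intro: continuous_intros)
next
  case (Suc n)
  have *: "C_k n W f" "C_k n W g" using Suc.prems C_k_Suc_imp by auto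
  show ?case
  proof (rule C_k_SucI[OF assms(1)])
    show "((\<lambda>x. f x *\<^sub>R g x) has_derivative (\<lambda>v. f x *\<^sub>R frechet_derivative g (at x) v
        + frechet_derivative f (at x) v *\<^sub>R g x)) (at x)" if "x \<in> W" for x
      by (rule has_derivative_scaleR[OF C_k_SucD[OF assms(1) Suc.prems(1) that]
            C_k_SucD[OF assms(1) Suc.prems(2) that]])
    show "C_k n W (\<lambda>x. f x *\<^sub>R frechet_derivative g (at x) v + frechet_derivative f (at x) v *\<^sub>R g x)" for v
      by (rule C_k_add[OF assms(1) Suc.IH Suc.IH]) (use * Suc.prems in auto)
  qed
qed

lemma C_k_mult:
  fixes f g :: "'a::real_normed_vector \<Rightarrow> real"
  assumes "open W" "C_k n W f" "C_k n W g"
  shows "C_k n W (\<lambda>x. f x * g x)"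
  using C_k_scaleR[OF assms] by simp

text \<open>Expanded in the basis, the derivative of the composition is a sum of products of
  components of the derivative of \<open>f\<close> with partial derivatives of \<open>g\<close>
  composed with \<open>f\<close>. The induction generalises \<open>g\<close> and keeps
  \<open>f\<close> fixed.\<close>

lemma C_k_compose:
  fixes f :: "'a::real_normed_vector \<Rightarrow> 'b::euclidean_space"
    and g :: "'b \<Rightarrow> 'c::real_normed_vector"
  assumes "open W" "open V" "f ` W \<subseteq> V" "C_k n W f" "C_k n V g"
  shows "C_k n W (\<lambda>x. g (f x))"
  using assms(4,5)
proof (induction n arbitrary: g)
  case 0
  then show ?case using assms(3) by (auto intro: continuous_on_compose2)
next
  case (Suc n)
  let ?f' = "\<lambda>x. frechet_derivative f (at x)" and ?g' = "\<lambda>y. frechet_derivative g (at y)"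
  have d: "((\<lambda>x. g (f x)) has_derivative (\<lambda>v. \<Sum>b\<in>Basis. (?f' x v \<bullet> b) *\<^sub>R ?g' (f x) b)) (at x)"
    if "x \<in> W" for x
  proof -
    have gd: "(g has_derivative ?g' (f x)) (at (f x))"
      using C_k_SucD[OF assms(2) Suc.prems(2)] assms(3) that by blast
    have "((\<lambda>x. g (f x)) has_derivative (\<lambda>v. ?g' (f x) (?f' x v))) (at x)"
      using has_derivative_compose[OF C_k_SucD[OF assms(1) Suc.prems(1) that] gd] .
    moreover have "?g' (f x) u = (\<Sum>b\<in>Basis. (u \<bullet> b) *\<^sub>R ?g' (f x) b)" for u
    proof -
      have "linear (?g' (f x))" using gd has_derivative_linear by blast
      then show ?thesis
        by (subst euclidean_representation[symmetric, of u])
          (simp only: linear_sum linear_scale)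
    qed
    ultimately show ?thesis by (elim has_derivative_eq_rhs) (rule ext)
  qed
  have f: "C_k n W f" using Suc.prems C_k_Suc_imp by auto
  show ?case
  proof (rule C_k_SucI[OF assms(1) d])
    fix v
    have "C_k n W (\<lambda>x. ?f' x v \<bullet> b)" for b
      by (rule C_k_bounded_linear[OF assms(1) bounded_linear_inner_left]) (use Suc.prems in auto)
    moreover have "C_k n W (\<lambda>x. ?g' (f x) b)" for b
      by (rule Suc.IH[OF f, of "\<lambda>y. ?g' y b"]) (use Suc.prems in auto)
    ultimately show "C_k n W (\<lambda>x. \<Sum>b\<in>Basis. (?f' x v \<bullet> b) *\<^sub>R ?g' (f x) b)"
      by (intro C_k_sum C_k_scaleR assms(1)) auto
  qed
qed

lemma C_k_vec_iff:
  fixes f :: "'a::real_normed_vector \<Rightarrow> real^'n"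
  assumes "open W"
  shows "C_k n W f \<longleftrightarrow> (\<forall>i. C_k n W (\<lambda>x. f x $ i))"
proof
  assume *: "\<forall>i. C_k n W (\<lambda>x. f x $ i)"
  have "C_k n W (\<lambda>x. \<Sum>i\<in>UNIV. f x $ i *\<^sub>R axis i 1)"
    using * by (intro C_k_sum C_k_scaleR C_k_const assms) auto
  then show "C_k n W f"
    by (rule C_k_cong[OF assms, rotated]) (simp add: basis_expansion scalar_mult_eq_scaleR[symmetric])
next
  assume "C_k n W f"
  then show "\<forall>i. C_k n W (\<lambda>x. f x $ i)"
    by (intro allI C_k_bounded_linear[OF assms bounded_linear_vec_nth])
qed

lemma C_k_Pair:
  assumes "open W" "C_k n W f" "C_k n W g"
  shows "C_k n W (\<lambda>x. (f x, g x))"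
proof -
  have "bounded_linear (\<lambda>u::'b. (u, 0::'c))" "bounded_linear (\<lambda>u::'c. (0::'b, u))"
    by (auto intro: bounded_linear_Pair bounded_linear_ident bounded_linear_zero)
  then have "C_k n W (\<lambda>x. (f x, 0) + (0, g x))"
    by (intro C_k_add assms C_k_bounded_linear[OF assms(1), where h = "\<lambda>u::'b. (u, 0::'c)"]
        C_k_bounded_linear[OF assms(1), where h = "\<lambda>u::'c. (0::'b, u)"])
  then show ?thesis by simp
qed

lemma C_k_realI:
  fixes f f' :: "real \<Rightarrow> 'a::real_normed_vector"
  assumes "open W" "\<And>x. x \<in> W \<Longrightarrow> (f has_vector_derivative f' x) (at x)" "C_k n W f'"
  shows "C_k (Suc n) W f"
proof (rule C_k_SucI[OF assms(1)])
  show "(f has_derivative (\<lambda>v. v *\<^sub>R f' x)) (at x)" if "x \<in> W" for x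
    using assms(2)[OF that] by (simp add: has_vector_derivative_def)
  show "C_k n W (\<lambda>x. v *\<^sub>R f' x)" for v
    using C_k_scaleR[OF assms(1) C_k_const[OF assms(1)] assms(3)] .
qed

text \<open>The exponent is arbitrary because each derivative lowers it by one. Reciprocals, square
  roots and the derivative of the logarithm are all obtained from this family.\<close>

lemma C_k_powr: "C_k n {0<..} (\<lambda>x::real. x powr r)"
proof (induction n arbitrary: r)
  case 0
  then show ?case by (auto intro!: continuous_intros)
next
  case (Suc n)
  show ?case
    by (rule C_k_realI[where f' = "\<lambda>x. r * x powr (r - 1)"])
      (auto intro!: C_k_mult C_k_const Suc derivative_eq_intros
        simp: has_real_derivative_iff_has_vector_derivative[symmetric])
qed

lemma C_k_exp: "C_k n UNIV (\<lambda>x::real. exp x)"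
proof (induction n)
  case (Suc n)
  show ?case
    by (rule C_k_realI[where f' = exp])
      (use Suc in \<open>auto intro!: derivative_eq_intros
        simp: has_real_derivative_iff_has_vector_derivative[symmetric]\<close>)
qed (auto intro!: continuous_intros)

lemma C_k_sin_cos: "C_k n UNIV (\<lambda>x::real. sin x) \<and> C_k n UNIV (\<lambda>x::real. cos x)"
proof (induction n)
  case (Suc n)
  have "C_k n UNIV (\<lambda>x::real. (- 1) * sin x)"
    by (intro C_k_mult C_k_const) (use Suc in auto)
  then show ?case
    by (intro conjI C_k_realI[where f' = cos and f = sin]
        C_k_realI[where f' = "\<lambda>x. (- 1) * sin x" and f = cos])
      (use Suc in \<open>auto intro!: derivative_eq_intros
        simp: has_real_derivative_iff_has_vector_derivative[symmetric]\<close>)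
qed (auto intro!: continuous_intros)

text \<open>Mean value theorem twice, so that the mixed second difference is a value of the mixed
  second derivative near the base point.\<close>

lemma C_2_second_difference:
  fixes f :: "'a::real_normed_vector \<Rightarrow> real"
  assumes W: "open W" and f: "C_k 2 W f" and h: "0 < h"
    and ball: "\<And>s t. \<bar>s\<bar> \<le> h \<Longrightarrow> \<bar>t\<bar> \<le> h \<Longrightarrow> x + s *\<^sub>R v + t *\<^sub>R w \<in> W"
  shows "\<exists>s t. \<bar>s\<bar> \<le> h \<and> \<bar>t\<bar> \<le> h \<and>
    f (x + h *\<^sub>R v + h *\<^sub>R w) - f (x + h *\<^sub>R v) - f (x + h *\<^sub>R w) + f x
      = h * h * frechet_derivative (\<lambda>y. frechet_derivative f (at y) v) (at (x + s *\<^sub>R v + t *\<^sub>R w)) w"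
proof -
  let ?Df = "\<lambda>y. frechet_derivative f (at y)"
  let ?DDf = "\<lambda>y. frechet_derivative (\<lambda>y. frechet_derivative f (at y) v) (at y)"
  have f1: "C_k (Suc (Suc 0)) W f" using f by (simp add: numeral_2_eq_2)
  have Df: "(f has_derivative ?Df y) (at y)" if "y \<in> W" for y
    using C_k_SucD[OF W f1 that] .
  have DDf: "((\<lambda>y. ?Df y v) has_derivative ?DDf y) (at y)" if "y \<in> W" for y
    by (rule C_k_SucD[OF W _ that, of 0]) (use f1 in simp)
  have d1: "((\<lambda>s. f (x + s *\<^sub>R v + t *\<^sub>R w)) has_real_derivative ?Df (x + s *\<^sub>R v + t *\<^sub>R w) v) (at s)"
    if "\<bar>s\<bar> \<le> h" "\<bar>t\<bar> \<le> h" for s t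
  proof -
    have "((\<lambda>s. x + s *\<^sub>R v + t *\<^sub>R w) has_derivative (\<lambda>r. r *\<^sub>R v)) (at s)"
      by (auto intro!: derivative_eq_intros)
    from has_derivative_compose[OF this Df[OF ball[OF that]]]
    have "((\<lambda>s. f (x + s *\<^sub>R v + t *\<^sub>R w)) has_derivative
       (\<lambda>r. ?Df (x + s *\<^sub>R v + t *\<^sub>R w) (r *\<^sub>R v))) (at s)" .
    moreover have "?Df (x + s *\<^sub>R v + t *\<^sub>R w) (r *\<^sub>R v) = ?Df (x + s *\<^sub>R v + t *\<^sub>R w) v * r" for r
      using linear_scale[OF has_derivative_linear[OF Df[OF ball[OF that]]]] by simp
    ultimately show ?thesis by (simp add: has_field_derivative_def)
  qed
  have d2: "((\<lambda>t. ?Df (x + s *\<^sub>R v + t *\<^sub>R w) v) has_real_derivative ?DDf (x + s *\<^sub>R v + t *\<^sub>R w) w) (at t)"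
    if "\<bar>s\<bar> \<le> h" "\<bar>t\<bar> \<le> h" for s t
  proof -
    have "((\<lambda>t. x + s *\<^sub>R v + t *\<^sub>R w) has_derivative (\<lambda>r. r *\<^sub>R w)) (at t)"
      by (auto intro!: derivative_eq_intros)
    from has_derivative_compose[OF this DDf[OF ball[OF that]]]
    have "((\<lambda>t. ?Df (x + s *\<^sub>R v + t *\<^sub>R w) v) has_derivative
       (\<lambda>r. ?DDf (x + s *\<^sub>R v + t *\<^sub>R w) (r *\<^sub>R w))) (at t)" .
    moreover have "?DDf (x + s *\<^sub>R v + t *\<^sub>R w) (r *\<^sub>R w) = ?DDf (x + s *\<^sub>R v + t *\<^sub>R w) w * r" for r
      using linear_scale[OF has_derivative_linear[OF DDf[OF ball[OF that]]]] by simp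
    ultimately show ?thesis by (simp add: has_field_derivative_def)
  qed
  have "\<exists>s>0. s < h \<and> (f (x + h *\<^sub>R v + h *\<^sub>R w) - f (x + h *\<^sub>R v + 0 *\<^sub>R w))
      - (f (x + 0 *\<^sub>R v + h *\<^sub>R w) - f (x + 0 *\<^sub>R v + 0 *\<^sub>R w)) = (h - 0) *
      (?Df (x + s *\<^sub>R v + h *\<^sub>R w) v - ?Df (x + s *\<^sub>R v + 0 *\<^sub>R w) v)"
    by (rule MVT2[OF h, of "\<lambda>s. f (x + s *\<^sub>R v + h *\<^sub>R w) - f (x + s *\<^sub>R v + 0 *\<^sub>R w)"])
      (use h in \<open>auto intro!: DERIV_diff d1 d1[of _ 0, simplified]\<close>)
  then obtain s where s: "0 < s" "s < h" "(f (x + h *\<^sub>R v + h *\<^sub>R w) - f (x + h *\<^sub>R v + 0 *\<^sub>R w))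
      - (f (x + 0 *\<^sub>R v + h *\<^sub>R w) - f (x + 0 *\<^sub>R v + 0 *\<^sub>R w)) = (h - 0) *
      (?Df (x + s *\<^sub>R v + h *\<^sub>R w) v - ?Df (x + s *\<^sub>R v + 0 *\<^sub>R w) v)" by blast
  have "\<exists>t>0. t < h \<and> ?Df (x + s *\<^sub>R v + h *\<^sub>R w) v - ?Df (x + s *\<^sub>R v + 0 *\<^sub>R w) v
      = (h - 0) * ?DDf (x + s *\<^sub>R v + t *\<^sub>R w) w"
    by (rule MVT2[OF h, of "\<lambda>t. ?Df (x + s *\<^sub>R v + t *\<^sub>R w) v"]) (use s in \<open>auto intro!: d2\<close>)
  then obtain t where t: "0 < t" "t < h" "?Df (x + s *\<^sub>R v + h *\<^sub>R w) v - ?Df (x + s *\<^sub>R v + 0 *\<^sub>R w) v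
      = (h - 0) * ?DDf (x + s *\<^sub>R v + t *\<^sub>R w) w" by blast
  show ?thesis
    by (rule exI[of _ s], rule exI[of _ t]) (use s t in \<open>simp add: algebra_simps\<close>)
qed

text \<open>The same second difference is a value of either mixed derivative near \<open>x\<close>;
  continuity then excludes different values at \<open>x\<close>. This is what makes coordinate
  fields commute in the chart.\<close>

lemma C_2_symmetric:
  fixes f :: "'a::real_normed_vector \<Rightarrow> real"
  assumes W: "open W" and f: "C_k 2 W f" and x: "x \<in> W"
  shows "frechet_derivative (\<lambda>y. frechet_derivative f (at y) v) (at x) w
       = frechet_derivative (\<lambda>y. frechet_derivative f (at y) w) (at x) v"
proof -
  define P where "P v w y = frechet_derivative (\<lambda>y. frechet_derivative f (at y) v) (at y) w" for v w y
  have cont: "continuous_on W (P v w)" for v w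
    using f unfolding P_def numeral_2_eq_2 by auto
  have "P v w x = P w v x"
  proof (rule ccontr)
    assume ne: "P v w x \<noteq> P w v x"
    define \<epsilon> where "\<epsilon> = \<bar>P v w x - P w v x\<bar> / 2"
    have e: "0 < \<epsilon>" using ne by (simp add: \<epsilon>_def)
    have lim: "(P v w \<longlongrightarrow> P v w x) (at x)" for v w
      using cont[of v w] W x by (metis continuous_on_eq_continuous_at isCont_def)
    have "\<exists>r>0. \<forall>y. dist y x < r \<longrightarrow> \<bar>P v w y - P v w x\<bar> < \<epsilon>" for v w
    proof -
      have "\<exists>r>0. \<forall>y. y \<noteq> x \<and> dist y x < r \<longrightarrow> dist (P v w y) (P v w x) < \<epsilon>"
        using lim[of v w] e unfolding LIM_def by blast
      then obtain r where r: "r > 0" "\<And>y. y \<noteq> x \<Longrightarrow> dist y x < r \<Longrightarrow> dist (P v w y) (P v w x) < \<epsilon>"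
        by blast
      have "\<bar>P v w y - P v w x\<bar> < \<epsilon>" if "dist y x < r" for y
        by (cases "y = x") (use r(2)[of y] that e in \<open>auto simp: dist_real_def\<close>)
      then show ?thesis using r(1) by blast
    qed
    then obtain r1 r2 where r: "r1 > 0" "r2 > 0" "\<And>y. dist y x < r1 \<Longrightarrow> \<bar>P v w y - P v w x\<bar> < \<epsilon>"
      "\<And>y. dist y x < r2 \<Longrightarrow> \<bar>P w v y - P w v x\<bar> < \<epsilon>" by meson
    obtain r3 where r3: "r3 > 0" "ball x r3 \<subseteq> W" using W x openE by blast
    define r where "r = min r1 (min r2 r3)"
    define K where "K = norm v + norm w + 1"
    \<comment> \<open>With this step size every point of the parallelograms spanned by
      \<open>h\<close> times \<open>v\<close> and \<open>h\<close> times \<open>w\<close> has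
      distance less than \<open>r\<close> from \<open>x\<close>, since \<open>h\<close> times the
      sum of the two norms is below \<open>r\<close>.\<close>
    define h where "h = r / (2 * K)"
    have K: "K > 0" by (simp add: K_def add_nonneg_pos)
    have r0: "r > 0" using r r3 by (simp add: r_def)
    have h0: "h > 0" using r0 K by (simp add: h_def)
    have near: "dist (x + s *\<^sub>R v' + t *\<^sub>R w') x < r"
      if "\<bar>s\<bar> \<le> h" "\<bar>t\<bar> \<le> h" "norm v' + norm w' = norm v + norm w" for s t v' w'
    proof -
      have "dist (x + s *\<^sub>R v' + t *\<^sub>R w') x = norm (s *\<^sub>R v' + t *\<^sub>R w')"
        by (simp add: dist_norm)
      also have "\<dots> \<le> \<bar>s\<bar> * norm v' + \<bar>t\<bar> * norm w'"
        by (metis norm_scaleR norm_triangle_ineq)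
      also have "\<dots> \<le> h * norm v' + h * norm w'"
        using that by (intro add_mono mult_right_mono) auto
      also have "\<dots> = h * (K - 1)" using that(3) by (simp add: K_def distrib_left[symmetric])
      also have "\<dots> < h * (2 * K)" using h0 K by (intro mult_strict_left_mono) auto
      also have "\<dots> = r" using K by (simp add: h_def)
      finally show ?thesis .
    qed
    have inW: "x + s *\<^sub>R v' + t *\<^sub>R w' \<in> W"
      if "\<bar>s\<bar> \<le> h" "\<bar>t\<bar> \<le> h" "norm v' + norm w' = norm v + norm w" for s t v' w'
      using near[OF that] r3 by (auto simp: r_def dist_commute subset_iff)
    obtain s t where st: "\<bar>s\<bar> \<le> h" "\<bar>t\<bar> \<le> h"
      "f (x + h *\<^sub>R v + h *\<^sub>R w) - f (x + h *\<^sub>R v) - f (x + h *\<^sub>R w) + f x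
        = h * h * P v w (x + s *\<^sub>R v + t *\<^sub>R w)"
      using C_2_second_difference[OF W f h0, of x v w] inW unfolding P_def by blast
    obtain s' t' where st': "\<bar>s'\<bar> \<le> h" "\<bar>t'\<bar> \<le> h"
      "f (x + h *\<^sub>R w + h *\<^sub>R v) - f (x + h *\<^sub>R w) - f (x + h *\<^sub>R v) + f x
        = h * h * P w v (x + s' *\<^sub>R w + t' *\<^sub>R v)"
      using C_2_second_difference[OF W f h0, of x w v] inW[OF _ _ add.commute] unfolding P_def
      by blast
    have "h * h * P v w (x + s *\<^sub>R v + t *\<^sub>R w) = h * h * P w v (x + s' *\<^sub>R w + t' *\<^sub>R v)"
      using st(3) st'(3) by (simp add: algebra_simps)
    then have eq: "P v w (x + s *\<^sub>R v + t *\<^sub>R w) = P w v (x + s' *\<^sub>R w + t' *\<^sub>R v)"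
      using h0 by simp
    have "\<bar>P v w (x + s *\<^sub>R v + t *\<^sub>R w) - P v w x\<bar> < \<epsilon>"
      using r(3) near[OF st(1,2), of v w] by (simp add: r_def)
    moreover have "\<bar>P w v (x + s' *\<^sub>R w + t' *\<^sub>R v) - P w v x\<bar> < \<epsilon>"
      using r(4) near[OF st'(1,2) add.commute] by (simp add: r_def)
    ultimately show False using eq unfolding \<epsilon>_def by (smt (verit) field_sum_of_halves)
  qed
  then show ?thesis by (simp add: P_def)
qed

subsection \<open>Derivations and adapted frames\<close>

text \<open>An abstract algebra of smooth functions on \<open>U\<close>: calculations with vector
  fields become algebra without differentiability conditions. Reciprocals are available for positive
  functions only, so that signs have to be arranged before dividing.\<close>

locale function_ring =
  fixes U :: "'a set" and S :: "('a \<Rightarrow> real) set"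
  assumes S_const [simp, intro]: "(\<lambda>_. k) \<in> S"
    and S_add [simp, intro]: "f \<in> S \<Longrightarrow> g \<in> S \<Longrightarrow> (\<lambda>z. f z + g z) \<in> S"
    and S_mult [simp, intro]: "f \<in> S \<Longrightarrow> g \<in> S \<Longrightarrow> (\<lambda>z. f z * g z) \<in> S"
    and S_inverse [intro]: "f \<in> S \<Longrightarrow> (\<And>z. z \<in> U \<Longrightarrow> 0 < f z) \<Longrightarrow> (\<lambda>z. inverse (f z)) \<in> S"
begin

lemma S_uminus [simp, intro]: "f \<in> S \<Longrightarrow> (\<lambda>z. - f z) \<in> S"
  using S_mult[of "\<lambda>_. -1" f] by simp

lemma S_diff [simp, intro]: "f \<in> S \<Longrightarrow> g \<in> S \<Longrightarrow> (\<lambda>z. f z - g z) \<in> S"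
  using S_add[of f "\<lambda>z. - g z"] by simp

lemma S_power [simp, intro]: "f \<in> S \<Longrightarrow> (\<lambda>z. f z ^ n) \<in> S"
  by (induction n) auto

text \<open>Functions are total, but only their values on \<open>U\<close> carry meaning. The last
  conjunct states that a derivation sees nothing else; it lets an identity valid on \<open>U\<close>
  be differentiated.\<close>

definition derivation :: "(('a \<Rightarrow> real) \<Rightarrow> 'a \<Rightarrow> real) \<Rightarrow> bool" where
  "derivation X \<longleftrightarrow>
    (\<forall>f\<in>S. X f \<in> S) \<and> (\<forall>k. \<forall>z\<in>U. X (\<lambda>_. k) z = 0) \<and>
    (\<forall>f\<in>S. \<forall>g\<in>S. \<forall>z\<in>U. X (\<lambda>z. f z + g z) z = X f z + X g z) \<and>
    (\<forall>f\<in>S. \<forall>g\<in>S. \<forall>z\<in>U. X (\<lambda>z. f z * g z) z = f z * X g z + X f z * g z) \<and>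
    (\<forall>f\<in>S. \<forall>g\<in>S. (\<forall>z\<in>U. f z = g z) \<longrightarrow> (\<forall>z\<in>U. X f z = X g z))"

text \<open>The analogue of \<open>has_derivative\<close> for one vector field: derivatives of
  compound expressions are assembled by introduction rules, and \<open>hd_eq\<close> differentiates
  both sides of an identity.\<close>

definition hd :: "(('a \<Rightarrow> real) \<Rightarrow> 'a \<Rightarrow> real) \<Rightarrow> ('a \<Rightarrow> real) \<Rightarrow> ('a \<Rightarrow> real) \<Rightarrow> bool" where
  "hd X f f' \<longleftrightarrow> f \<in> S \<and> (\<forall>z\<in>U. X f z = f' z)"

lemma derivation_S: "derivation X \<Longrightarrow> f \<in> S \<Longrightarrow> X f \<in> S"
  by (simp add: derivation_def)

lemma hd_self: "f \<in> S \<Longrightarrow> hd X f (X f)"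
  by (simp add: hd_def)

lemma hdI: "f \<in> S \<Longrightarrow> (\<And>z. z \<in> U \<Longrightarrow> X f z = f' z) \<Longrightarrow> hd X f f'"
  by (simp add: hd_def)

lemma hdD: "hd X f f' \<Longrightarrow> z \<in> U \<Longrightarrow> X f z = f' z"
  by (simp add: hd_def)

lemma hd_S: "hd X f f' \<Longrightarrow> f \<in> S"
  by (simp add: hd_def)

lemma hd_const: "derivation X \<Longrightarrow> hd X (\<lambda>_. k) (\<lambda>_. 0)"
  by (simp add: hd_def derivation_def)

lemma hd_add: "derivation X \<Longrightarrow> hd X f f' \<Longrightarrow> hd X g g' \<Longrightarrow> hd X (\<lambda>z. f z + g z) (\<lambda>z. f' z + g' z)"
  by (simp add: hd_def derivation_def)

lemma hd_mult: "derivation X \<Longrightarrow> hd X f f' \<Longrightarrow> hd X g g' \<Longrightarrow>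
    hd X (\<lambda>z. f z * g z) (\<lambda>z. f z * g' z + f' z * g z)"
  by (simp add: hd_def derivation_def)

lemma hd_uminus: "derivation X \<Longrightarrow> hd X f f' \<Longrightarrow> hd X (\<lambda>z. - f z) (\<lambda>z. - f' z)"
  using hd_mult[OF _ hd_const, of X f f' "-1"] by simp

lemma hd_diff: "derivation X \<Longrightarrow> hd X f f' \<Longrightarrow> hd X g g' \<Longrightarrow> hd X (\<lambda>z. f z - g z) (\<lambda>z. f' z - g' z)"
  using hd_add[OF _ _ hd_uminus, of X f f' g g'] by simp

lemma hd_power2: "derivation X \<Longrightarrow> hd X f f' \<Longrightarrow> hd X (\<lambda>z. (f z)\<^sup>2) (\<lambda>z. 2 * f z * f' z)"
  using hd_mult[of X f f' f f'] by (simp add: power2_eq_square algebra_simps)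

lemma hd_power3: "derivation X \<Longrightarrow> hd X f f' \<Longrightarrow> hd X (\<lambda>z. f z ^ 3) (\<lambda>z. 3 * f z ^ 2 * f' z)"
  using hd_mult[OF _ hd_power2, of X f f' f f'] by (simp add: power2_eq_square power3_eq_cube algebra_simps)

lemma hd_eq:
  assumes "derivation X" "hd X f f'" "hd X g g'" "\<And>z. z \<in> U \<Longrightarrow> f z = g z" "z \<in> U"
  shows "f' z = g' z"
proof -
  have "f \<in> S" "g \<in> S" "X f z = f' z" "X g z = g' z" using assms(2,3,5) by (simp_all add: hd_def)
  moreover have "X f z = X g z"
    using assms(1,4,5) calculation(1,2) unfolding derivation_def by blast
  ultimately show ?thesis by simp
qed

lemma hd_inverse:
  assumes X: "derivation X" and f: "hd X f f'" and pos: "\<And>z. z \<in> U \<Longrightarrow> 0 < f z"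
  shows "hd X (\<lambda>z. inverse (f z)) (\<lambda>z. - f' z / (f z)\<^sup>2)"
proof (rule hdI)
  show S: "(\<lambda>z. inverse (f z)) \<in> S" using hd_S[OF f] pos by blast
  fix z assume z: "z \<in> U"
  have "f z * X (\<lambda>z. inverse (f z)) z + f' z * inverse (f z) = 0"
    by (rule hd_eq[OF X hd_mult[OF X f hd_self[OF S]] hd_const[OF X, of 1] _ z]) (use pos in force)
  then show "X (\<lambda>z. inverse (f z)) z = - f' z / (f z)\<^sup>2"
    using pos[OF z] by (simp add: field_simps power2_eq_square)
qed

lemma hd_cong: "hd X f f' \<Longrightarrow> (\<And>z. z \<in> U \<Longrightarrow> f' z = g' z) \<Longrightarrow> hd X f g'"
  by (simp add: hd_def)

lemmas hd_intros = hd_const hd_add hd_mult hd_uminus hd_diff hd_power2 hd_power3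

lemma derivation_comb:
  assumes "derivation X" "derivation Y" "f \<in> S" "g \<in> S"
  shows "derivation (\<lambda>w z. f z * X w z + g z * Y w z)"
proof -
  have cong: "X v z = X w z" "Y v z = Y w z"
    if "v \<in> S" "w \<in> S" "\<And>z. z \<in> U \<Longrightarrow> v z = w z" "z \<in> U" for v w z
    using hd_eq[OF assms(1) hd_self hd_self] hd_eq[OF assms(2) hd_self hd_self] that by blast+
  show ?thesis
    unfolding derivation_def
  proof (intro conjI ballI allI impI)
    fix v w z assume "v \<in> S" "w \<in> S" "\<forall>z\<in>U. v z = w z" "z \<in> U"
    then show "f z * X v z + g z * Y v z = f z * X w z + g z * Y w z"
      using cong[of v w z] by simp
  qed (use assms derivation_S in \<open>auto simp: hdD[OF hd_const] hdD[OF hd_add[OF _ hd_self hd_self]]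
        hdD[OF hd_mult[OF _ hd_self hd_self]] algebra_simps\<close>)
qed

end

text \<open>Orthonormal frame fields n1, e1 of the first factor and n2, e2 of the second one; ri and qi are
  the values of the two connection forms on n1, e1, n2, e2.  The third group of
  assumptions is the structure equation: the curvature of each factor is -1.\<close>

locale frame_field = function_ring U S
  for U :: "'a set" and S :: "('a \<Rightarrow> real) set" +
  fixes n1 e1 n2 e2 :: "('a \<Rightarrow> real) \<Rightarrow> 'a \<Rightarrow> real"
    and r1 r2 r3 r4 q1 q2 q3 q4 :: "'a \<Rightarrow> real"
  assumes der: "derivation n1" "derivation e1" "derivation n2" "derivation e2"
    and S_conn: "r1 \<in> S" "r2 \<in> S" "r3 \<in> S" "r4 \<in> S" "q1 \<in> S" "q2 \<in> S" "q3 \<in> S" "q4 \<in> S"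
    and comm:
      "f \<in> S \<Longrightarrow> z \<in> U \<Longrightarrow> n1 (e1 f) z - e1 (n1 f) z = - r1 z * n1 f z - r2 z * e1 f z"
      "f \<in> S \<Longrightarrow> z \<in> U \<Longrightarrow> n1 (n2 f) z - n2 (n1 f) z = q1 z * e2 f z - r3 z * e1 f z"
      "f \<in> S \<Longrightarrow> z \<in> U \<Longrightarrow> n1 (e2 f) z - e2 (n1 f) z = - q1 z * n2 f z - r4 z * e1 f z"
      "f \<in> S \<Longrightarrow> z \<in> U \<Longrightarrow> e1 (n2 f) z - n2 (e1 f) z = q2 z * e2 f z + r3 z * n1 f z"
      "f \<in> S \<Longrightarrow> z \<in> U \<Longrightarrow> e1 (e2 f) z - e2 (e1 f) z = - q2 z * n2 f z + r4 z * n1 f z"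
      "f \<in> S \<Longrightarrow> z \<in> U \<Longrightarrow> n2 (e2 f) z - e2 (n2 f) z = - q3 z * n2 f z - q4 z * e2 f z"
    and curv1:
      "z \<in> U \<Longrightarrow> n1 r2 z - e1 r1 z = - (r1 z)\<^sup>2 - (r2 z)\<^sup>2 + 1"
      "z \<in> U \<Longrightarrow> n1 r3 z - n2 r1 z = q1 z * r4 z - r3 z * r2 z"
      "z \<in> U \<Longrightarrow> n1 r4 z - e2 r1 z = - q1 z * r3 z - r4 z * r2 z"
      "z \<in> U \<Longrightarrow> e1 r3 z - n2 r2 z = q2 z * r4 z + r3 z * r1 z"
      "z \<in> U \<Longrightarrow> e1 r4 z - e2 r2 z = - q2 z * r3 z + r4 z * r1 z"
      "z \<in> U \<Longrightarrow> n2 r4 z - e2 r3 z = - q3 z * r3 z - q4 z * r4 z"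
    and curv2:
      "z \<in> U \<Longrightarrow> n1 q2 z - e1 q1 z = - r1 z * q1 z - r2 z * q2 z"
      "z \<in> U \<Longrightarrow> n1 q3 z - n2 q1 z = q1 z * q4 z - r3 z * q2 z"
      "z \<in> U \<Longrightarrow> n1 q4 z - e2 q1 z = - q1 z * q3 z - r4 z * q2 z"
      "z \<in> U \<Longrightarrow> e1 q3 z - n2 q2 z = q2 z * q4 z + r3 z * q1 z"
      "z \<in> U \<Longrightarrow> e1 q4 z - e2 q2 z = - q2 z * q3 z + r4 z * q1 z"
      "z \<in> U \<Longrightarrow> n2 q4 z - e2 q3 z = - (q3 z)\<^sup>2 - (q4 z)\<^sup>2 + 1"

text \<open>A function d with unit gradient a n1 + b n2, whose Laplacian H depends on d only:
  its gradient is H1 times that of d.\<close>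

locale adapted_frame = frame_field U S n1 e1 n2 e2 r1 r2 r3 r4 q1 q2 q3 q4
  for U :: "'a set" and S n1 e1 n2 e2 r1 r2 r3 r4 q1 q2 q3 q4 +
  fixes a b d H H1 :: "'a \<Rightarrow> real"
  assumes S_data: "a \<in> S" "b \<in> S" "d \<in> S" "H \<in> S" "H1 \<in> S"
    and grad_d: "z \<in> U \<Longrightarrow> n1 d z = a z" "z \<in> U \<Longrightarrow> e1 d z = 0"
      "z \<in> U \<Longrightarrow> n2 d z = b z" "z \<in> U \<Longrightarrow> e2 d z = 0"
    and ab_unit: "z \<in> U \<Longrightarrow> (a z)\<^sup>2 + (b z)\<^sup>2 = 1"
    and lap_d: "z \<in> U \<Longrightarrow> H z = n1 a z + a z * r2 z + n2 b z + b z * q4 z"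
    and grad_H: "z \<in> U \<Longrightarrow> n1 H z = a z * H1 z" "z \<in> U \<Longrightarrow> e1 H z = 0"
      "z \<in> U \<Longrightarrow> n2 H z = b z * H1 z" "z \<in> U \<Longrightarrow> e2 H z = 0"
begin

text \<open>Each of the six commutators is applied to \<open>d\<close>, whose frame derivatives are
  known. The results express the symmetry of the Hessian of \<open>d\<close>.\<close>

lemma comm_d:
  assumes z: "z \<in> U"
  shows "e1 a z = r1 z * a z" "n1 b z = n2 a z" "e2 a z = q1 z * b z" "e1 b z = r3 z * a z"
    "q2 z * b z = r4 z * a z" "e2 b z = q3 z * b z"
proof -
  have cg: "X (n1 d) z = X a z \<and> X (n2 d) z = X b z \<and> X (e1 d) z = 0 \<and> X (e2 d) z = 0"
    if X: "derivation X" for X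
  proof -
    note S = derivation_S[OF der(1) S_data(3)] derivation_S[OF der(2) S_data(3)]
      derivation_S[OF der(3) S_data(3)] derivation_S[OF der(4) S_data(3)]
    show ?thesis
      using hd_eq[OF X hd_self[OF S(1)] hd_self[OF S_data(1)] _ z]
        hd_eq[OF X hd_self[OF S(3)] hd_self[OF S_data(2)] _ z]
        hd_eq[OF X hd_self[OF S(2)] hd_const[OF X] _ z, of 0]
        hd_eq[OF X hd_self[OF S(4)] hd_const[OF X] _ z, of 0] grad_d by auto
  qed
  note c = cg[OF der(1)] cg[OF der(2)] cg[OF der(3)] cg[OF der(4)]
  note k = comm[OF S_data(3) z]
  show "e1 a z = r1 z * a z" using k(1) c grad_d[OF z] by simp
  show "n1 b z = n2 a z" using k(2) c grad_d[OF z] by simp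
  show "e2 a z = q1 z * b z" using k(3) c grad_d[OF z] by simp
  show "e1 b z = r3 z * a z" using k(4) c grad_d[OF z] by simp
  show "q2 z * b z = r4 z * a z" using k(5) c grad_d[OF z] by simp
  show "e2 b z = q3 z * b z" using k(6) c grad_d[OF z] by simp
qed

lemma ab_unit_deriv:
  assumes "derivation X" "z \<in> U"
  shows "a z * X a z + b z * X b z = 0"
proof -
  have "2 * a z * X a z + 2 * b z * X b z = 0"
    using hd_eq[OF assms(1) hd_add[OF assms(1) hd_power2[OF assms(1) hd_self[OF S_data(1)]]
          hd_power2[OF assms(1) hd_self[OF S_data(2)]]] hd_const[OF assms(1), of 1] ab_unit assms(2)]
    by simp
  then show ?thesis by simp
qed

end

section \<open>Both gradient components positive: Riccati equation and constancy of the product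
  angle\<close>

locale generic_frame = adapted_frame +
  assumes a_pos: "z \<in> U \<Longrightarrow> 0 < a z" and b_pos: "z \<in> U \<Longrightarrow> 0 < b z"
begin

text \<open>The field a n1 + b n2 is a gradient of unit length, hence geodesic. The first two
  equations say that e1 and e2 are parallel along it, the last two contain the constancy of
  \<open>a\<close> and \<open>b\<close> along it.\<close>

lemma conn_normal:
  assumes z: "z \<in> U"
  shows "a z * r1 z + b z * r3 z = 0" "a z * q1 z + b z * q3 z = 0"
    "a z * n1 a z = - b z * n2 a z" "b z * n2 b z = - a z * n2 a z"
proof -
  have "a z * (a z * r1 z + b z * r3 z) = 0"
    using ab_unit_deriv[OF der(2) z] comm_d[OF z] by (simp add: algebra_simps)
  then show "a z * r1 z + b z * r3 z = 0" using a_pos[OF z] by simp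
  have "b z * (a z * q1 z + b z * q3 z) = 0"
    using ab_unit_deriv[OF der(4) z] comm_d[OF z] by (simp add: algebra_simps)
  then show "a z * q1 z + b z * q3 z = 0" using b_pos[OF z] by simp
  show "a z * n1 a z = - b z * n2 a z" using ab_unit_deriv[OF der(1) z] comm_d[OF z] by simp
  show "b z * n2 b z = - a z * n2 a z" using ab_unit_deriv[OF der(3) z] by simp
qed

text \<open>\<open>N\<close> is the gradient field of \<open>d\<close>; \<open>E0\<close> completes
  e1 and e2 to an orthonormal frame of the level sets.\<close>

definition "N w z = a z * n1 w z + b z * n2 w z"
definition "E0 w z = (- b z) * n1 w z + a z * n2 w z"

lemma der_N: "derivation N"
  using derivation_comb[OF der(1,3) S_data(1,2)] by (simp add: N_def[abs_def])

lemma der_E0: "derivation E0"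
  using derivation_comb[OF der(1,3) S_uminus[OF S_data(2)] S_data(1)] by (simp add: E0_def[abs_def])

text \<open>These are the functions whose differential is a multiple of that of \<open>d\<close>, so
  locally functions of \<open>d\<close>. The formulation by tangential derivatives avoids producing
  a function of one variable.\<close>

definition "basic w \<longleftrightarrow> w \<in> S \<and> (\<forall>z\<in>U. E0 w z = 0 \<and> e1 w z = 0 \<and> e2 w z = 0)"

lemma basic_grad:
  assumes "basic w" "z \<in> U"
  shows "n1 w z = a z * N w z" "n2 w z = b z * N w z"
proof -
  have *: "b z * n1 w z = a z * n2 w z" using assms by (simp add: basic_def E0_def)
  have "a z * N w z = (a z)\<^sup>2 * n1 w z + b z * (a z * n2 w z)"
    by (simp add: N_def power2_eq_square algebra_simps)
  also have "\<dots> = ((a z)\<^sup>2 + (b z)\<^sup>2) * n1 w z"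
    unfolding *[symmetric] by (simp add: power2_eq_square algebra_simps)
  finally show "n1 w z = a z * N w z" using ab_unit[OF assms(2)] by simp
  have "b z * N w z = a z * (b z * n1 w z) + (b z)\<^sup>2 * n2 w z"
    by (simp add: N_def power2_eq_square algebra_simps)
  also have "\<dots> = ((a z)\<^sup>2 + (b z)\<^sup>2) * n2 w z"
    unfolding * by (simp add: power2_eq_square algebra_simps)
  finally show "n2 w z = b z * N w z" using ab_unit[OF assms(2)] by simp
qed

text \<open>For a basic function, dw = (N w) dd. Taking the exterior derivative gives 0 = d(N w)
  wedge dd, so N w is basic again; the commutators below are this computation in the frame.\<close>

lemma basic_N:
  assumes w: "basic w"
  shows "basic (N w)"
proof -
  have S: "w \<in> S" "N w \<in> S" using w derivation_S[OF der_N] by (auto simp: basic_def)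
  note S' = derivation_S[OF der(1) S(1)] derivation_S[OF der(2) S(1)]
      derivation_S[OF der(3) S(1)] derivation_S[OF der(4) S(1)]
  have cg: "X (n1 w) z = a z * X (N w) z + X a z * N w z \<and> X (n2 w) z = b z * X (N w) z + X b z * N w z
     \<and> X (e1 w) z = 0 \<and> X (e2 w) z = 0" if X: "derivation X" and z: "z \<in> U" for X z
    using hd_eq[OF X hd_self[OF S'(1)] hd_mult[OF X hd_self[OF S_data(1)] hd_self[OF S(2)]] _ z]
      hd_eq[OF X hd_self[OF S'(3)] hd_mult[OF X hd_self[OF S_data(2)] hd_self[OF S(2)]] _ z]
      hd_eq[OF X hd_self[OF S'(2)] hd_const[OF X] _ z, of 0]
      hd_eq[OF X hd_self[OF S'(4)] hd_const[OF X] _ z, of 0] basic_grad[OF w] w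
    by (auto simp: basic_def)
  have "E0 (N w) z = 0 \<and> e1 (N w) z = 0 \<and> e2 (N w) z = 0" if z: "z \<in> U" for z
  proof (intro conjI)
    note c = cg[OF der(1) z] cg[OF der(2) z] cg[OF der(3) z] cg[OF der(4) z]
    have w0: "e1 w z = 0" "e2 w z = 0" using w z by (auto simp: basic_def)
    show "E0 (N w) z = 0"
      using comm(2)[OF S(1) z] c w0 comm_d[OF z] by (simp add: E0_def algebra_simps)
    have "a z * e1 (N w) z = 0"
      using comm(1)[OF S(1) z] c w0 comm_d[OF z] basic_grad[OF w z] by (simp add: algebra_simps)
    then show "e1 (N w) z = 0" using a_pos[OF z] by simp
    have "b z * e2 (N w) z = 0"
      using comm(6)[OF S(1) z] c w0 comm_d[OF z] basic_grad[OF w z] by (simp add: algebra_simps)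
    then show "e2 (N w) z = 0" using b_pos[OF z] by simp
  qed
  then show ?thesis using S by (simp add: basic_def)
qed

lemma basic_H: "basic H"
  using S_data grad_H by (auto simp: basic_def E0_def)

lemma basic_mult: "basic v \<Longrightarrow> basic w \<Longrightarrow> basic (\<lambda>z. v z * w z)"
  using hdD[OF hd_mult[OF der_E0 hd_self hd_self]] hdD[OF hd_mult[OF der(2) hd_self hd_self]]
    hdD[OF hd_mult[OF der(4) hd_self hd_self]] by (simp add: basic_def)

lemma basic_add: "basic v \<Longrightarrow> basic w \<Longrightarrow> basic (\<lambda>z. v z + w z)"
  using hdD[OF hd_add[OF der_E0 hd_self hd_self]] hdD[OF hd_add[OF der(2) hd_self hd_self]]
    hdD[OF hd_add[OF der(4) hd_self hd_self]] by (simp add: basic_def)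

lemma basic_const: "basic (\<lambda>_. k)"
  using hdD[OF hd_const[OF der_E0]] hdD[OF hd_const[OF der(2)]] hdD[OF hd_const[OF der(4)]]
  by (simp add: basic_def)

text \<open>Components of the Hessian of \<open>d\<close>, that is, of the shape operator of its
  level sets, in the frame \<open>E0\<close>, e1, e2, with indices 0, 1, 2. For \<open>s00\<close>
  the formula comes from n2 a = - a b s00; the reciprocals keep it in \<open>S\<close>.\<close>

definition "s00 z = - n2 a z * (inverse (a z) * inverse (b z))"
definition "s11 z = a z * r2 z"
definition "s12 z = a z * r4 z"
definition "s22 z = b z * q4 z"
definition "s02 z = - q1 z"
definition "s01 z = r3 z"

lemma n2a_s00: "z \<in> U \<Longrightarrow> n2 a z = - (a z * b z * s00 z)"
  using a_pos[of z] b_pos[of z] by (simp add: s00_def field_simps)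

lemma S_hess: "s00 \<in> S" "s11 \<in> S" "s12 \<in> S" "s22 \<in> S" "s01 \<in> S" "s02 \<in> S"
proof -
  have "(\<lambda>z. - n2 a z * (inverse (a z) * inverse (b z))) \<in> S"
    using S_data derivation_S[OF der(3)] a_pos b_pos by (intro S_mult S_uminus S_inverse) auto
  then show "s00 \<in> S" unfolding s00_def[abs_def] .
qed (use S_data S_conn in \<open>auto simp: s11_def[abs_def] s12_def[abs_def] s22_def[abs_def] s02_def[abs_def] s01_def[abs_def]\<close>)

lemma N_a: "z \<in> U \<Longrightarrow> N a z = 0" and N_b: "z \<in> U \<Longrightarrow> N b z = 0"
  using conn_normal[of z] comm_d[of z] by (simp_all add: N_def)

lemma trace_S: "z \<in> U \<Longrightarrow> H z = s00 z + s11 z + s22 z"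
proof -
  assume z: "z \<in> U"
  note p = a_pos[OF z] b_pos[OF z]
  have "n1 a z = b z * b z * s00 z"
    using conn_normal(3)[OF z] n2a_s00[OF z] p by (auto simp: field_simps)
  moreover have "n2 b z = a z * a z * s00 z"
    using conn_normal(4)[OF z] n2a_s00[OF z] p by (auto simp: field_simps)
  ultimately have "n1 a z + n2 b z = ((a z)\<^sup>2 + (b z)\<^sup>2) * s00 z"
    by (simp add: power2_eq_square algebra_simps)
  then show ?thesis using ab_unit[OF z] lap_d[OF z] by (simp add: s11_def s22_def)
qed

lemma grad_ab:
  assumes z: "z \<in> U"
  shows "n1 a z = b z * b z * s00 z" "n2 a z = - (a z * b z * s00 z)"
    "n1 b z = - (a z * b z * s00 z)" "n2 b z = a z * a z * s00 z"
proof -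
  note p = a_pos[OF z] b_pos[OF z]
  show "n1 a z = b z * b z * s00 z"
    using conn_normal(3)[OF z] n2a_s00[OF z] p by (auto simp: field_simps)
  show "n2 b z = a z * a z * s00 z"
    using conn_normal(4)[OF z] n2a_s00[OF z] p by (auto simp: field_simps)
qed (use n2a_s00[OF z] comm_d[OF z] in auto)

text \<open>The Riccati equation S' + S^2 + R = 0 along the normal, in a parallel frame. The
  curvature term has eigenvalue 0 on \<open>E0\<close>, since n1 and n2 span a flat plane, and -
  a^2, - b^2 on e1, e2.\<close>

lemma N_hess:
  assumes z: "z \<in> U"
  shows "N s00 z = - ((s00 z)\<^sup>2 + (s01 z)\<^sup>2 + (s02 z)\<^sup>2)"
    "N s01 z = - (s00 z * s01 z + s01 z * s11 z + s02 z * s12 z)"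
    "N s02 z = - (s00 z * s02 z + s01 z * s12 z + s02 z * s22 z)"
    "N s11 z = - ((s01 z)\<^sup>2 + (s11 z)\<^sup>2 + (s12 z)\<^sup>2) + (a z)\<^sup>2"
    "N s12 z = - (s01 z * s02 z + s11 z * s12 z + s12 z * s22 z)"
    "N s22 z = - ((s02 z)\<^sup>2 + (s12 z)\<^sup>2 + (s22 z)\<^sup>2) + (b z)\<^sup>2"
proof -
  note p = a_pos[OF z] b_pos[OF z]
  have dr: "a z * X r1 z + X a z * r1 z + (b z * X r3 z + X b z * r3 z) = 0" if X: "derivation X" for X
    using hd_eq[OF X hd_add[OF X hd_mult[OF X hd_self[OF S_data(1)] hd_self[OF S_conn(1)]]
          hd_mult[OF X hd_self[OF S_data(2)] hd_self[OF S_conn(3)]]] hd_const[OF X, of 0] _ z]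
      conn_normal(1) by simp
  have dq: "a z * X q1 z + X a z * q1 z + (b z * X q3 z + X b z * q3 z) = 0" if X: "derivation X" for X
    using hd_eq[OF X hd_add[OF X hd_mult[OF X hd_self[OF S_data(1)] hd_self[OF S_conn(5)]]
          hd_mult[OF X hd_self[OF S_data(2)] hd_self[OF S_conn(7)]]] hd_const[OF X, of 0] _ z]
      conn_normal(2) by simp
  have Na: "hd N a (\<lambda>_. 0)" "hd N b (\<lambda>_. 0)"
    using N_a N_b S_data by (auto intro: hdI)
  note Nr = N_def[of r2 z] N_def[of r3 z] N_def[of r4 z] N_def[of q1 z] N_def[of q4 z]
  note cn = conn_normal(1,2)[OF z] and u = ab_unit[OF z, unfolded power2_eq_square]
    and cd = comm_d[OF z] and g = grad_ab[OF z]
  have Ns11: "N s11 z = a z * N r2 z" and Ns12: "N s12 z = a z * N r4 z"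
    and Ns22: "N s22 z = b z * N q4 z" and Ns02: "N s02 z = - N q1 z"
    using hdD[OF hd_mult[OF der_N Na(1) hd_self] z, OF S_conn(2)]
      hdD[OF hd_mult[OF der_N Na(1) hd_self] z, OF S_conn(4)]
      hdD[OF hd_mult[OF der_N Na(2) hd_self] z, OF S_conn(8)]
      hdD[OF hd_uminus[OF der_N hd_self] z, OF S_conn(5)]
    by (simp_all add: s11_def[abs_def] s12_def[abs_def] s22_def[abs_def] s02_def[abs_def])
  show "N s01 z = - (s00 z * s01 z + s01 z * s11 z + s02 z * s12 z)"
  proof -
    have "N r3 z = - (s00 z * r3 z) + a z * q1 z * r4 z - a z * r3 z * r2 z"
      using Nr(2) dr[OF der(3)] curv1(2)[OF z] cn(1) u g by algebra
    then show ?thesis by (simp add: s01_def[abs_def] s11_def s02_def s12_def)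
  qed
  show "N s02 z = - (s00 z * s02 z + s01 z * s12 z + s02 z * s22 z)"
  proof -
    have "N q1 z = - (s00 z * q1 z) - b z * q1 z * q4 z + r3 z * (r4 z * a z)"
      using Nr(4) dq[OF der(1)] curv2(2)[OF z] cn(2) u g cd(5) by algebra
    then show ?thesis unfolding Ns02 by (simp add: s01_def[abs_def] s02_def s12_def s22_def)
  qed
  show "N s11 z = - ((s01 z)\<^sup>2 + (s11 z)\<^sup>2 + (s12 z)\<^sup>2) + (a z)\<^sup>2"
    unfolding Ns11 s01_def s11_def s12_def power2_eq_square
    using Nr(1) dr[OF der(2)] curv1(1,4)[OF z, unfolded power2_eq_square] cn(1) u cd(1,4,5) by algebra
  show "N s12 z = - (s01 z * s02 z + s11 z * s12 z + s12 z * s22 z)"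
    unfolding Ns12 s01_def s11_def s12_def s02_def s22_def
    using Nr(3) dr[OF der(4)] curv1(3,6)[OF z] cn u cd(3,6) by algebra
  show "N s22 z = - ((s02 z)\<^sup>2 + (s12 z)\<^sup>2 + (s22 z)\<^sup>2) + (b z)\<^sup>2"
    unfolding Ns22 s12_def s02_def s22_def power2_eq_square
    using Nr(5) dq[OF der(4)] curv2(3,6)[OF z, unfolded power2_eq_square] cn(2) u cd(3,5,6) by algebra
  show "N s00 z = - ((s00 z)\<^sup>2 + (s01 z)\<^sup>2 + (s02 z)\<^sup>2)"
  proof -
    have S: "n1 a \<in> S" "n2 a \<in> S" using derivation_S der S_data by blast+
    have eq: "N (n2 a) z = - (a z * b z * N s00 z)"
    proof -
      have "N (n2 a) z = - (a z * b z * N s00 z + (a z * 0 + 0 * b z) * s00 z)"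
        by (rule hd_eq[OF der_N hd_self[OF S(2)]
              hd_uminus[OF der_N hd_mult[OF der_N hd_mult[OF der_N Na] hd_self[OF S_hess(1)]]] _ z])
          (use n2a_s00 in auto)
      then show ?thesis by simp
    qed
    \<comment> \<open>\<open>N a\<close> vanishes identically. Its derivative along n2 contains n2
      (n1 a), which the commutator of n1 and n2 exchanges for n1 (n2 a), so that N (n2 a) and with
      it \<open>N s00\<close> appears.\<close>
    have "a z * n2 (n1 a) z + n2 a z * n1 a z + (b z * n2 (n2 a) z + n2 b z * n2 a z) = 0"
      using hd_eq[OF der(3) hd_add[OF der(3) hd_mult[OF der(3) hd_self[OF S_data(1)] hd_self[OF S(1)]]
            hd_mult[OF der(3) hd_self[OF S_data(2)] hd_self[OF S(2)]]] hd_const[OF der(3), of 0] _ z]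
        N_a by (simp add: N_def)
    then have "- (a z * b z * N s00 z) = a z * b z * (s00 z * s00 z + r3 z * r3 z + q1 z * q1 z)"
      using eq[unfolded N_def[of "n2 a" z]] comm(2)[OF S_data(1) z] cn(1) u g cd(1,3) by algebra
    then have "a z * b z * (N s00 z + (s00 z * s00 z + r3 z * r3 z + q1 z * q1 z)) = 0"
      by (simp add: algebra_simps)
    then show ?thesis using p by (simp add: s01_def s02_def power2_eq_square)
  qed
qed

text \<open>The 2x2 principal minors of the shape operator; together with the other principal minors
  they evolve along the normal flow by a linear system with constant coefficients.\<close>

definition "m01 z = s00 z * s11 z - (s01 z)\<^sup>2"
definition "m02 z = s00 z * s22 z - (s02 z)\<^sup>2"
definition "m12 z = s11 z * s22 z - (s12 z)\<^sup>2"
definition "m012 z = s00 z * s11 z * s22 z + 2 * (s01 z * s02 z * s12 z)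
  - s00 z * (s12 z)\<^sup>2 - s11 z * (s02 z)\<^sup>2 - s22 z * (s01 z)\<^sup>2"

lemma hd_hess:
  "hd N s00 (\<lambda>z. - ((s00 z)\<^sup>2 + (s01 z)\<^sup>2 + (s02 z)\<^sup>2))"
  "hd N s01 (\<lambda>z. - (s00 z * s01 z + s01 z * s11 z + s02 z * s12 z))"
  "hd N s02 (\<lambda>z. - (s00 z * s02 z + s01 z * s12 z + s02 z * s22 z))"
  "hd N s11 (\<lambda>z. - ((s01 z)\<^sup>2 + (s11 z)\<^sup>2 + (s12 z)\<^sup>2) + (a z)\<^sup>2)"
  "hd N s12 (\<lambda>z. - (s01 z * s02 z + s11 z * s12 z + s12 z * s22 z))"
  "hd N s22 (\<lambda>z. - ((s02 z)\<^sup>2 + (s12 z)\<^sup>2 + (s22 z)\<^sup>2) + (b z)\<^sup>2)"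
  by (rule hdI; simp add: S_hess N_hess)+

lemma hd_minors:
  "hd N m01 (\<lambda>z. m012 z + (a z)\<^sup>2 * s00 z - H z * m01 z)"
  "hd N m02 (\<lambda>z. m012 z + (b z)\<^sup>2 * s00 z - H z * m02 z)"
  "hd N m12 (\<lambda>z. m012 z + (a z)\<^sup>2 * s22 z + (b z)\<^sup>2 * s11 z - H z * m12 z)"
  "hd N m012 (\<lambda>z. (a z)\<^sup>2 * m02 z + (b z)\<^sup>2 * m01 z - H z * m012 z)"
  unfolding m01_def[abs_def] m02_def[abs_def] m12_def[abs_def] m012_def[abs_def]
  by (rule hd_cong, (rule hd_intros der_N hd_hess)+, simp add: trace_S power2_eq_square, algebra)+

lemma hd_diag:
  "hd N s00 (\<lambda>z. m01 z + m02 z - H z * s00 z)"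
  "hd N s11 (\<lambda>z. m01 z + m12 z + (a z)\<^sup>2 - H z * s11 z)"
  "hd N s22 (\<lambda>z. m02 z + m12 z + (b z)\<^sup>2 - H z * s22 z)"
  by (rule hd_cong[OF hd_hess(1)] hd_cong[OF hd_hess(4)] hd_cong[OF hd_hess(6)],
      simp add: trace_S power2_eq_square m01_def m02_def m12_def algebra_simps)+

text \<open>The operator N + H, with H acting by multiplication, maps combinations of the even
  minors 1, \<open>m01\<close>, \<open>m02\<close>, \<open>m12\<close> to combinations of the odd
  minors \<open>s00\<close>, \<open>s11\<close>, \<open>s22\<close>, \<open>m012\<close>, and these
  back to even ones. All terms with \<open>H\<close> cancel; the coefficients \<open>x0\<close>,
  ..., \<open>x3\<close> pass through because they are constant along the normal.\<close>

lemma two_step: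
  assumes "basic w"
    and x: "hd N x0 (\<lambda>_. 0)" "hd N x1 (\<lambda>_. 0)" "hd N x2 (\<lambda>_. 0)" "hd N x3 (\<lambda>_. 0)"
    and w: "\<And>z. z \<in> U \<Longrightarrow> w z = x0 z + x1 z * m01 z + x2 z * m02 z + x3 z * m12 z"
  shows "\<exists>w'. basic w' \<and> (\<forall>z\<in>U. w' z =
     ((a z)\<^sup>2 * (x0 z + (b z)\<^sup>2 * x3 z) + (b z)\<^sup>2 * (x0 z + (a z)\<^sup>2 * x3 z))
     + ((b z)\<^sup>2 * (x1 z + x2 z + x3 z) + (x0 z + (a z)\<^sup>2 * x1 z + (b z)\<^sup>2 * x2 z) + (x0 z + (b z)\<^sup>2 * x3 z)) * m01 z
     + ((a z)\<^sup>2 * (x1 z + x2 z + x3 z) + (x0 z + (a z)\<^sup>2 * x1 z + (b z)\<^sup>2 * x2 z) + (x0 z + (a z)\<^sup>2 * x3 z)) * m02 z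
     + ((x0 z + (b z)\<^sup>2 * x3 z) + (x0 z + (a z)\<^sup>2 * x3 z)) * m12 z)"
proof -
  have Na: "hd N a (\<lambda>_. 0)" "hd N b (\<lambda>_. 0)"
    using N_a N_b S_data by (auto intro: hdI)
  define v where "v z = N w z + H z * w z" for z
  have bv: "basic v" unfolding v_def[abs_def] using assms(1) basic_N basic_H basic_mult basic_add by blast
  have Nw: "N w z = x1 z * (m012 z + (a z)\<^sup>2 * s00 z - H z * m01 z)
     + x2 z * (m012 z + (b z)\<^sup>2 * s00 z - H z * m02 z)
     + x3 z * (m012 z + (a z)\<^sup>2 * s22 z + (b z)\<^sup>2 * s11 z - H z * m12 z)" if "z \<in> U" for z
  proof -
    have "N w z = 0 + (x1 z * (m012 z + (a z)\<^sup>2 * s00 z - H z * m01 z) + 0 * m01 z)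
     + (x2 z * (m012 z + (b z)\<^sup>2 * s00 z - H z * m02 z) + 0 * m02 z)
     + (x3 z * (m012 z + (a z)\<^sup>2 * s22 z + (b z)\<^sup>2 * s11 z - H z * m12 z) + 0 * m12 z)"
      by (rule hd_eq[OF der_N hd_self hd_add[OF der_N hd_add[OF der_N hd_add[OF der_N x(1)
                hd_mult[OF der_N x(2) hd_minors(1)]] hd_mult[OF der_N x(3) hd_minors(2)]]
                hd_mult[OF der_N x(4) hd_minors(3)]] _ that])
        (use assms in \<open>auto simp: basic_def\<close>)
    then show ?thesis by simp
  qed
  have v: "v z = (x1 z + x2 z + x3 z) * m012 z + (x0 z + (a z)\<^sup>2 * x1 z + (b z)\<^sup>2 * x2 z) * s00 z
     + (x0 z + (b z)\<^sup>2 * x3 z) * s11 z + (x0 z + (a z)\<^sup>2 * x3 z) * s22 z" if "z \<in> U" for z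
    unfolding v_def Nw[OF that] w[OF that] trace_S[OF that] by algebra
  have hdx: "hd N (\<lambda>z. x1 z + x2 z + x3 z) (\<lambda>_. 0)"
      "hd N (\<lambda>z. x0 z + (a z)\<^sup>2 * x1 z + (b z)\<^sup>2 * x2 z) (\<lambda>_. 0)"
      "hd N (\<lambda>z. x0 z + (b z)\<^sup>2 * x3 z) (\<lambda>_. 0)" "hd N (\<lambda>z. x0 z + (a z)\<^sup>2 * x3 z) (\<lambda>_. 0)"
    by (rule hd_cong, (rule hd_intros der_N Na x)+, simp)+
  have Nv: "N v z = (x1 z + x2 z + x3 z) * ((a z)\<^sup>2 * m02 z + (b z)\<^sup>2 * m01 z - H z * m012 z)
     + (x0 z + (a z)\<^sup>2 * x1 z + (b z)\<^sup>2 * x2 z) * (m01 z + m02 z - H z * s00 z)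
     + (x0 z + (b z)\<^sup>2 * x3 z) * (m01 z + m12 z + (a z)\<^sup>2 - H z * s11 z)
     + (x0 z + (a z)\<^sup>2 * x3 z) * (m02 z + m12 z + (b z)\<^sup>2 - H z * s22 z)" if "z \<in> U" for z
  proof -
    have "N v z = ((x1 z + x2 z + x3 z) * ((a z)\<^sup>2 * m02 z + (b z)\<^sup>2 * m01 z - H z * m012 z) + 0 * m012 z)
     + ((x0 z + (a z)\<^sup>2 * x1 z + (b z)\<^sup>2 * x2 z) * (m01 z + m02 z - H z * s00 z) + 0 * s00 z)
     + ((x0 z + (b z)\<^sup>2 * x3 z) * (m01 z + m12 z + (a z)\<^sup>2 - H z * s11 z) + 0 * s11 z)
     + ((x0 z + (a z)\<^sup>2 * x3 z) * (m02 z + m12 z + (b z)\<^sup>2 - H z * s22 z) + 0 * s22 z)"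
      by (rule hd_eq[OF der_N hd_self hd_add[OF der_N hd_add[OF der_N hd_add[OF der_N
                hd_mult[OF der_N hdx(1) hd_minors(4)] hd_mult[OF der_N hdx(2) hd_diag(1)]]
                hd_mult[OF der_N hdx(3) hd_diag(2)]] hd_mult[OF der_N hdx(4) hd_diag(3)]] _ that])
        (use bv v in \<open>auto simp: basic_def\<close>)
    then show ?thesis by simp
  qed
  show ?thesis
  proof (intro exI[of _ "\<lambda>z. N v z + H z * v z"] conjI ballI)
    show "basic (\<lambda>z. N v z + H z * v z)" using bv basic_N basic_H basic_mult basic_add by blast
    fix z assume z: "z \<in> U"
    show "N v z + H z * v z =
     ((a z)\<^sup>2 * (x0 z + (b z)\<^sup>2 * x3 z) + (b z)\<^sup>2 * (x0 z + (a z)\<^sup>2 * x3 z))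
     + ((b z)\<^sup>2 * (x1 z + x2 z + x3 z) + (x0 z + (a z)\<^sup>2 * x1 z + (b z)\<^sup>2 * x2 z) + (x0 z + (b z)\<^sup>2 * x3 z)) * m01 z
     + ((a z)\<^sup>2 * (x1 z + x2 z + x3 z) + (x0 z + (a z)\<^sup>2 * x1 z + (b z)\<^sup>2 * x2 z) + (x0 z + (a z)\<^sup>2 * x3 z)) * m02 z
     + ((x0 z + (b z)\<^sup>2 * x3 z) + (x0 z + (a z)\<^sup>2 * x3 z)) * m12 z"
      unfolding Nv[OF z] v[OF z] by algebra
  qed
qed

text \<open>This equals 1 - 4 a^2 b^2 and is the product of the eigenvalues (a + b)^2 and (a - b)^2
  of the square of N + H on the even minors.\<close>

definition "CC z = ((a z)\<^sup>2 - (b z)\<^sup>2)\<^sup>2"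

text \<open>With T the square of N + H, the identity is (T^2 - 2 T + CC)^2 applied to the function
  1. Sorted by powers of \<open>CC\<close>, its coefficients are combinations of the functions T^k
  1, which are basic because \<open>H\<close> is.\<close>

lemma product_angle_quadratic:
  "\<exists>\<beta> \<gamma>. basic \<beta> \<and> basic \<gamma> \<and> (\<forall>z\<in>U. (CC z)\<^sup>2 + \<beta> z * CC z + \<gamma> z = 0)"
proof -
  have A: "hd N (\<lambda>z. (a z)\<^sup>2) (\<lambda>_. 0)" "hd N (\<lambda>z. (b z)\<^sup>2) (\<lambda>_. 0)"
    by (rule hdI; use N_a N_b S_data hdD[OF hd_power2[OF der_N hd_self]] in simp)+
  have k: "hd N (\<lambda>_. k) (\<lambda>_. 0)" for k by (rule hd_const[OF der_N])
  have ex: "\<exists>w'. basic w' \<and> (\<forall>z\<in>U. w' z = y0 ((a z)\<^sup>2) ((b z)\<^sup>2) + y1 ((a z)\<^sup>2) ((b z)\<^sup>2) * m01 z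
        + y2 ((a z)\<^sup>2) ((b z)\<^sup>2) * m02 z + y3 ((a z)\<^sup>2) ((b z)\<^sup>2) * m12 z)"
    if "basic w" "hd N (\<lambda>z. x0 ((a z)\<^sup>2) ((b z)\<^sup>2)) (\<lambda>_. 0)" "hd N (\<lambda>z. x1 ((a z)\<^sup>2) ((b z)\<^sup>2)) (\<lambda>_. 0)"
      "hd N (\<lambda>z. x2 ((a z)\<^sup>2) ((b z)\<^sup>2)) (\<lambda>_. 0)" "hd N (\<lambda>z. x3 ((a z)\<^sup>2) ((b z)\<^sup>2)) (\<lambda>_. 0)"
      "\<And>z. z \<in> U \<Longrightarrow> w z = x0 ((a z)\<^sup>2) ((b z)\<^sup>2) + x1 ((a z)\<^sup>2) ((b z)\<^sup>2) * m01 z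
        + x2 ((a z)\<^sup>2) ((b z)\<^sup>2) * m02 z + x3 ((a z)\<^sup>2) ((b z)\<^sup>2) * m12 z"
      "\<And>A B. y0 A B = A * (x0 A B + B * x3 A B) + B * (x0 A B + A * x3 A B)"
      "\<And>A B. y1 A B = B * (x1 A B + x2 A B + x3 A B) + (x0 A B + A * x1 A B + B * x2 A B) + (x0 A B + B * x3 A B)"
      "\<And>A B. y2 A B = A * (x1 A B + x2 A B + x3 A B) + (x0 A B + A * x1 A B + B * x2 A B) + (x0 A B + A * x3 A B)"
      "\<And>A B. y3 A B = (x0 A B + B * x3 A B) + (x0 A B + A * x3 A B)"
    for w and x0 x1 x2 x3 y0 y1 y2 y3 :: "real \<Rightarrow> real \<Rightarrow> real"
    using two_step[OF that(1-6)] unfolding that(7-10) .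
  \<comment> \<open>\<open>w2\<close>, \<open>w4\<close>, \<open>w6\<close>, \<open>w8\<close> are
    the derivatives of order 2, 4, 6, 8 of the volume density of the normal flow, relative to its
    initial value. In the density, 1, \<open>m01\<close>, \<open>m02\<close>, \<open>m12\<close>
    have the coefficients cosh(at) cosh(bt), t sinh(at) cosh(bt) / a, t cosh(at) sinh(bt) / b and
    sinh(at) sinh(bt) / (ab); their derivatives at t = 0 are the polynomials in A = a^2 and B = b^2
    below.\<close>
  obtain w2 where w2: "basic w2" "\<And>z. z \<in> U \<Longrightarrow> w2 z = (a z)\<^sup>2 + (b z)\<^sup>2 + 2 * m01 z + 2 * m02 z + 2 * m12 z"
    using ex[of "\<lambda>_. 1" "\<lambda>_ _. 1" "\<lambda>_ _. 0" "\<lambda>_ _. 0" "\<lambda>_ _. 0" "\<lambda>A B. A + B" "\<lambda>_ _. 2" "\<lambda>_ _. 2" "\<lambda>_ _. 2"]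
      basic_const k by auto
  obtain w4 where w4: "basic w4" "\<And>z. z \<in> U \<Longrightarrow> w4 z = (\<lambda>A B. A\<^sup>2 + 6 * A * B + B\<^sup>2) ((a z)\<^sup>2) ((b z)\<^sup>2)
      + (\<lambda>A B. 4 * A + 12 * B) ((a z)\<^sup>2) ((b z)\<^sup>2) * m01 z + (\<lambda>A B. 12 * A + 4 * B) ((a z)\<^sup>2) ((b z)\<^sup>2) * m02 z
      + (\<lambda>A B. 4 * A + 4 * B) ((a z)\<^sup>2) ((b z)\<^sup>2) * m12 z"
    using ex[of w2 "\<lambda>A B. A + B" "\<lambda>_ _. 2" "\<lambda>_ _. 2" "\<lambda>_ _. 2" "\<lambda>A B. A\<^sup>2 + 6 * A * B + B\<^sup>2"
        "\<lambda>A B. 4 * A + 12 * B" "\<lambda>A B. 12 * A + 4 * B" "\<lambda>A B. 4 * A + 4 * B"]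
      w2 k hd_add[OF der_N A] by (auto simp: algebra_simps power2_eq_square)
  have lin: "hd N (\<lambda>z. x * (a z)\<^sup>2 + y * (b z)\<^sup>2) (\<lambda>_. 0)" for x y
    by (rule hd_cong, (rule hd_intros der_N A)+, simp)
  have quad: "hd N (\<lambda>z. x * ((a z)\<^sup>2)\<^sup>2 + y * (a z)\<^sup>2 * (b z)\<^sup>2 + t * ((b z)\<^sup>2)\<^sup>2) (\<lambda>_. 0)" for x y t
    by (rule hd_cong, (rule hd_const hd_add hd_mult der_N A | rule hd_power2[OF _ A(1)] hd_power2[OF _ A(2)])+, simp)
  have quad': "hd N (\<lambda>z. ((a z)\<^sup>2)\<^sup>2 + 6 * (a z)\<^sup>2 * (b z)\<^sup>2 + ((b z)\<^sup>2)\<^sup>2) (\<lambda>_. 0)"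
    using quad[of 1 6 1] by simp
  obtain w6 where w6: "basic w6" "\<And>z. z \<in> U \<Longrightarrow> w6 z = (\<lambda>A B. A^3 + 15 * A\<^sup>2 * B + 15 * A * B\<^sup>2 + B^3) ((a z)\<^sup>2) ((b z)\<^sup>2)
      + (\<lambda>A B. 6 * A\<^sup>2 + 60 * A * B + 30 * B\<^sup>2) ((a z)\<^sup>2) ((b z)\<^sup>2) * m01 z
      + (\<lambda>A B. 30 * A\<^sup>2 + 60 * A * B + 6 * B\<^sup>2) ((a z)\<^sup>2) ((b z)\<^sup>2) * m02 z
      + (\<lambda>A B. 6 * A\<^sup>2 + 20 * A * B + 6 * B\<^sup>2) ((a z)\<^sup>2) ((b z)\<^sup>2) * m12 z"
  proof -
    have "\<exists>w'. basic w' \<and> (\<forall>z\<in>U. w' z = (\<lambda>A B. A^3 + 15 * A\<^sup>2 * B + 15 * A * B\<^sup>2 + B^3) ((a z)\<^sup>2) ((b z)\<^sup>2)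
      + (\<lambda>A B. 6 * A\<^sup>2 + 60 * A * B + 30 * B\<^sup>2) ((a z)\<^sup>2) ((b z)\<^sup>2) * m01 z
      + (\<lambda>A B. 30 * A\<^sup>2 + 60 * A * B + 6 * B\<^sup>2) ((a z)\<^sup>2) ((b z)\<^sup>2) * m02 z
      + (\<lambda>A B. 6 * A\<^sup>2 + 20 * A * B + 6 * B\<^sup>2) ((a z)\<^sup>2) ((b z)\<^sup>2) * m12 z)"
      by (rule ex[of w4 "\<lambda>A B. A\<^sup>2 + 6 * A * B + B\<^sup>2" "\<lambda>A B. 4 * A + 12 * B" "\<lambda>A B. 12 * A + 4 * B"
            "\<lambda>A B. 4 * A + 4 * B"], rule w4(1), rule quad', rule lin, rule lin, rule lin, erule w4(2))
        (simp_all add: algebra_simps power2_eq_square power3_eq_cube)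
    then show ?thesis using that by blast
  qed
  have cubic: "hd N (\<lambda>z. ((a z)\<^sup>2)^3 + 15 * ((a z)\<^sup>2)\<^sup>2 * (b z)\<^sup>2 + 15 * (a z)\<^sup>2 * ((b z)\<^sup>2)\<^sup>2 + ((b z)\<^sup>2)^3) (\<lambda>_. 0)"
    by (rule hd_cong, (rule hd_const hd_add hd_mult der_N A
          | rule hd_power2[OF _ A(1)] hd_power2[OF _ A(2)] hd_power3[OF _ A(1)] hd_power3[OF _ A(2)])+, simp)
  obtain w8 where w8: "basic w8" "\<And>z. z \<in> U \<Longrightarrow> w8 z = (\<lambda>A B. A^4 + 28 * A^3 * B + 70 * A\<^sup>2 * B\<^sup>2 + 28 * A * B^3 + B^4) ((a z)\<^sup>2) ((b z)\<^sup>2)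
      + (\<lambda>A B. 8 * A^3 + 168 * A\<^sup>2 * B + 280 * A * B\<^sup>2 + 56 * B^3) ((a z)\<^sup>2) ((b z)\<^sup>2) * m01 z
      + (\<lambda>A B. 56 * A^3 + 280 * A\<^sup>2 * B + 168 * A * B\<^sup>2 + 8 * B^3) ((a z)\<^sup>2) ((b z)\<^sup>2) * m02 z
      + (\<lambda>A B. 8 * A^3 + 56 * A\<^sup>2 * B + 56 * A * B\<^sup>2 + 8 * B^3) ((a z)\<^sup>2) ((b z)\<^sup>2) * m12 z"
  proof -
    have "\<exists>w'. basic w' \<and> (\<forall>z\<in>U. w' z = (\<lambda>A B. A^4 + 28 * A^3 * B + 70 * A\<^sup>2 * B\<^sup>2 + 28 * A * B^3 + B^4) ((a z)\<^sup>2) ((b z)\<^sup>2)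
      + (\<lambda>A B. 8 * A^3 + 168 * A\<^sup>2 * B + 280 * A * B\<^sup>2 + 56 * B^3) ((a z)\<^sup>2) ((b z)\<^sup>2) * m01 z
      + (\<lambda>A B. 56 * A^3 + 280 * A\<^sup>2 * B + 168 * A * B\<^sup>2 + 8 * B^3) ((a z)\<^sup>2) ((b z)\<^sup>2) * m02 z
      + (\<lambda>A B. 8 * A^3 + 56 * A\<^sup>2 * B + 56 * A * B\<^sup>2 + 8 * B^3) ((a z)\<^sup>2) ((b z)\<^sup>2) * m12 z)"
      by (rule ex[of w6 "\<lambda>A B. A^3 + 15 * A\<^sup>2 * B + 15 * A * B\<^sup>2 + B^3" "\<lambda>A B. 6 * A\<^sup>2 + 60 * A * B + 30 * B\<^sup>2"
            "\<lambda>A B. 30 * A\<^sup>2 + 60 * A * B + 6 * B\<^sup>2" "\<lambda>A B. 6 * A\<^sup>2 + 20 * A * B + 6 * B\<^sup>2"],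
          rule w6(1), rule cubic, rule quad, rule quad, rule quad, erule w6(2))
        (simp_all add: algebra_simps power2_eq_square power3_eq_cube power4_eq_xxxx)
    then show ?thesis using that by blast
  qed
  show ?thesis
  proof (intro exI conjI ballI)
    show "basic (\<lambda>z. 2 * w4 z + (-4) * w2 z)" "basic (\<lambda>z. w8 z + (-4) * w6 z + 4 * w4 z)"
      by (intro basic_add basic_mult basic_const w2 w4 w6 w8)+
    fix z assume z: "z \<in> U"
    \<comment> \<open>The sum of the two eigenvalues is 2 (a^2 + b^2); only after this substitution
      is it the number 2, which accounts for the coefficients 2 and 4.\<close>
    have B: "(b z)\<^sup>2 = 1 - (a z)\<^sup>2" using ab_unit[OF z] by simp
    show "(CC z)\<^sup>2 + (2 * w4 z + (-4) * w2 z) * CC z + (w8 z + (-4) * w6 z + 4 * w4 z) = 0"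
      unfolding w2(2)[OF z] w4(2)[OF z] w6(2)[OF z] w8(2)[OF z] CC_def B by algebra
  qed
qed

text \<open>Differentiating X f * g = 0 gives c (X f)^2 + X (X f) * g = 0. After multiplication by X
  f the second term drops out and c (X f)^3 = 0 remains. The zeros of \<open>g\<close> therefore
  need no separate discussion.\<close>

lemma tangential_zero:
  assumes X: "derivation X" and f: "f \<in> S" and g: "g \<in> S"
    and 0: "\<And>z. z \<in> U \<Longrightarrow> X f z * g z = 0" "\<And>z. z \<in> U \<Longrightarrow> X g z = c * X f z" "c \<noteq> 0" and z: "z \<in> U"
  shows "X f z = 0"
proof -
  have S: "X f \<in> S" using derivation_S[OF X f] .
  have "X f z * X g z + X (X f) z * g z = 0"
    by (rule hd_eq[OF X hd_mult[OF X hd_self[OF S] hd_self[OF g]] hd_const[OF X, of 0] 0(1) z])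
  then have "X f z * (X f z * (c * X f z)) + X (X f) z * (X f z * g z) = 0"
    unfolding 0(2)[OF z, symmetric] by algebra
  then show ?thesis using 0(1)[OF z] 0(3) by simp
qed

text \<open>A tangential field annihilates both coefficients of the quadratic, so the derivative of
  \<open>CC\<close> times 2 CC + beta is zero, and \<open>tangential_zero\<close> covers a double
  root as well. A second application passes from \<open>CC\<close> to a^2 - b^2, of which it is the
  square. In the normal direction \<open>N_a\<close> suffices.\<close>

lemma a_constant:
  assumes z: "z \<in> U"
  shows "n1 a z = 0" "e1 a z = 0" "n2 a z = 0" "e2 a z = 0"
proof -
  obtain \<beta> \<gamma> where bg: "basic \<beta>" "basic \<gamma>" "\<And>z. z \<in> U \<Longrightarrow> (CC z)\<^sup>2 + \<beta> z * CC z + \<gamma> z = 0"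
    using product_angle_quadratic by blast
  have S: "CC \<in> S" "\<beta> \<in> S" "\<gamma> \<in> S" "(\<lambda>z. (a z)\<^sup>2 - (b z)\<^sup>2) \<in> S"
    using S_data bg by (auto simp: CC_def[abs_def] basic_def)
  have tang: "X a z = 0" if X: "derivation X" and X0: "\<And>z. z \<in> U \<Longrightarrow> X \<beta> z = 0" "\<And>z. z \<in> U \<Longrightarrow> X \<gamma> z = 0" for X
  proof -
    have CC: "X CC z = 0" if z: "z \<in> U" for z
    proof (rule tangential_zero[OF X S(1), of "\<lambda>z. 2 * CC z + \<beta> z" 2])
      show "(\<lambda>z. 2 * CC z + \<beta> z) \<in> S" using S by auto
      show "X CC z * (2 * CC z + \<beta> z) = 0" if z: "z \<in> U" for z
        using hd_eq[OF X hd_add[OF X hd_add[OF X hd_power2[OF X hd_self[OF S(1)]]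
                hd_mult[OF X hd_self[OF S(2)] hd_self[OF S(1)]]] hd_self[OF S(3)]] hd_const[OF X, of 0] bg(3) z]
          X0[OF z] by (simp add: algebra_simps)
      show "X (\<lambda>z. 2 * CC z + \<beta> z) z = 2 * X CC z" if z: "z \<in> U" for z
        using hdD[OF hd_add[OF X hd_mult[OF X hd_const[OF X, of 2] hd_self[OF S(1)]] hd_self[OF S(2)]] z]
          X0[OF z] by simp
    qed (use z in auto)
    have "X (\<lambda>z. (a z)\<^sup>2 - (b z)\<^sup>2) z = 0"
    proof (rule tangential_zero[OF X S(4) S(4), of 1])
      show "X (\<lambda>z. (a z)\<^sup>2 - (b z)\<^sup>2) z * ((a z)\<^sup>2 - (b z)\<^sup>2) = 0" if z: "z \<in> U" for z
        using hdD[OF hd_power2[OF X hd_self[OF S(4)]] z] CC[OF z] by (auto simp: CC_def[abs_def])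
    qed (use z in auto)
    moreover have "X (\<lambda>z. (a z)\<^sup>2 - (b z)\<^sup>2) z = 2 * a z * X a z - 2 * b z * X b z"
      using hdD[OF hd_diff[OF X hd_power2[OF X hd_self[OF S_data(1)]] hd_power2[OF X hd_self[OF S_data(2)]]] z] .
    ultimately have "a z * X a z = 0" using ab_unit_deriv[OF X z] by simp
    then show ?thesis using a_pos[OF z] by simp
  qed
  show "e1 a z = 0" "e2 a z = 0" using tang der bg by (auto simp: basic_def)
  have "E0 a z = 0" using tang[OF der_E0] bg by (auto simp: basic_def)
  then have E: "b z * n1 a z = a z * n2 a z" by (simp add: E0_def)
  have Nz: "a z * n1 a z + b z * n2 a z = 0" using N_a[OF z] by (simp add: N_def)
  show "n1 a z = 0" using E Nz ab_unit[OF z] unfolding power2_eq_square by algebra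
  show "n2 a z = 0" using E Nz ab_unit[OF z] unfolding power2_eq_square by algebra
qed

end

subsection \<open>Constant product angle\<close>

locale const_frame = generic_frame U S n1 e1 n2 e2 r1 r2 r3 r4 q1 q2 q3 q4 a b d H H1
  for U :: "'a set" and S n1 e1 n2 e2 r1 r2 r3 r4 q1 q2 q3 q4 a b d H H1 +
  fixes a0 b0 :: real
  assumes a_eq: "z \<in> U \<Longrightarrow> a z = a0" and b_eq: "z \<in> U \<Longrightarrow> b z = b0"
    and ab0_pos: "0 < a0" "0 < b0"
begin

lemma deriv_ab: "derivation X \<Longrightarrow> z \<in> U \<Longrightarrow> X a z = 0" "derivation X \<Longrightarrow> z \<in> U \<Longrightarrow> X b z = 0"
  using hd_eq[OF _ hd_self[OF S_data(1)] hd_const[of X a0] a_eq]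
    hd_eq[OF _ hd_self[OF S_data(2)] hd_const[of X b0] b_eq] by auto

lemma conn_zero:
  assumes z: "z \<in> U"
  shows "r1 z = 0" "r3 z = 0" "q1 z = 0" "q3 z = 0"
  using comm_d[OF z] deriv_ab[OF der(2) z] deriv_ab[OF der(4) z] a_pos[OF z] b_pos[OF z] by auto

lemma deriv_conn_zero:
  assumes X: "derivation X" and z: "z \<in> U"
  shows "X r1 z = 0" "X r3 z = 0" "X q1 z = 0" "X q3 z = 0"
  using hd_eq[OF X hd_self[OF S_conn(1)] hd_const[OF X, of 0] _ z]
    hd_eq[OF X hd_self[OF S_conn(3)] hd_const[OF X, of 0] _ z]
    hd_eq[OF X hd_self[OF S_conn(5)] hd_const[OF X, of 0] _ z]
    hd_eq[OF X hd_self[OF S_conn(7)] hd_const[OF X, of 0] _ z] conn_zero by auto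

text \<open>The entries \<open>s11\<close>, \<open>s22\<close> and \<open>s12\<close> of the shape
  operator. Once \<open>a\<close> and \<open>b\<close> are constant, its entries with an index 0
  vanish.\<close>

definition "al z = a0 * r2 z"
definition "be z = b0 * q4 z"
definition "mu z = a0 * r4 z"

lemma S_abm: "al \<in> S" "be \<in> S" "mu \<in> S"
  using S_conn by (auto simp: al_def[abs_def] be_def[abs_def] mu_def[abs_def])

lemma r_eqs: "z \<in> U \<Longrightarrow> r2 z = al z / a0" "z \<in> U \<Longrightarrow> q4 z = be z / b0"
  "z \<in> U \<Longrightarrow> r4 z = mu z / a0" "z \<in> U \<Longrightarrow> q2 z = mu z / b0"
  using ab0_pos comm_d(5)[of z] a_eq[of z] b_eq[of z]
  by (auto simp: al_def be_def mu_def field_simps)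

lemma H_eq: "z \<in> U \<Longrightarrow> H z = al z + be z"
  using lap_d[of z] deriv_ab[OF der(1)] deriv_ab[OF der(3)] a_eq[of z] b_eq[of z]
  by (simp add: al_def be_def)

text \<open>These are the curvature equations in the directions n1 and n2 after \<open>r1\<close>,
  \<open>r3\<close>, \<open>q1\<close> and \<open>q3\<close> have been found to vanish.\<close>

lemma hd_abm:
  "hd n1 al (\<lambda>z. (a0\<^sup>2 - (al z)\<^sup>2) / a0)" "hd n2 al (\<lambda>z. - (mu z)\<^sup>2 / b0)"
  "hd n1 mu (\<lambda>z. - (al z * mu z) / a0)" "hd n2 mu (\<lambda>z. - (be z * mu z) / b0)"
  "hd n1 be (\<lambda>z. - (mu z)\<^sup>2 / a0)" "hd n2 be (\<lambda>z. (b0\<^sup>2 - (be z)\<^sup>2) / b0)"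
proof -
  have sc: "hd X (\<lambda>z. k * r z) (\<lambda>z. k * X r z)" if "derivation X" "r \<in> S" for X r k
    using hd_mult[OF that(1) hd_const[OF that(1), of k] hd_self[OF that(2)]] by simp
  have F: "n1 r2 z = 1 - (r2 z)\<^sup>2" "n2 r2 z = - q2 z * r4 z" "n1 r4 z = - r4 z * r2 z"
    "n2 r4 z = - q4 z * r4 z" "n1 q4 z = - r4 z * q2 z" "n2 q4 z = 1 - (q4 z)\<^sup>2" if z: "z \<in> U" for z
    using curv1[OF z] curv2[OF z] conn_zero[OF z] deriv_conn_zero[OF der(1) z] deriv_conn_zero[OF der(2) z]
      deriv_conn_zero[OF der(3) z] deriv_conn_zero[OF der(4) z] by simp_all
  have q2: "q2 z = a0 * r4 z / b0" if "z \<in> U" for z using r_eqs(4)[OF that] by (simp add: mu_def)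
  note p = ab0_pos
  show "hd n1 al (\<lambda>z. (a0\<^sup>2 - (al z)\<^sup>2) / a0)"
    unfolding al_def[abs_def]
    by (rule hd_cong[OF sc[OF der(1) S_conn(2)]]) (use p in \<open>simp add: F field_simps power2_eq_square\<close>)
  show "hd n2 al (\<lambda>z. - (mu z)\<^sup>2 / b0)"
    unfolding al_def[abs_def] mu_def
    by (rule hd_cong[OF sc[OF der(3) S_conn(2)]]) (use p in \<open>simp add: F q2 field_simps power2_eq_square\<close>)
  show "hd n1 mu (\<lambda>z. - (al z * mu z) / a0)"
    unfolding mu_def[abs_def] al_def
    by (rule hd_cong[OF sc[OF der(1) S_conn(4)]]) (use p in \<open>simp add: F field_simps power2_eq_square\<close>)
  show "hd n2 mu (\<lambda>z. - (be z * mu z) / b0)"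
    unfolding mu_def[abs_def] be_def
    by (rule hd_cong[OF sc[OF der(3) S_conn(4)]]) (use p in \<open>simp add: F field_simps power2_eq_square\<close>)
  show "hd n1 be (\<lambda>z. - (mu z)\<^sup>2 / a0)"
    unfolding be_def[abs_def] mu_def
    by (rule hd_cong[OF sc[OF der(1) S_conn(8)]]) (use p in \<open>simp add: F q2 field_simps power2_eq_square\<close>)
  show "hd n2 be (\<lambda>z. (b0\<^sup>2 - (be z)\<^sup>2) / b0)"
    unfolding be_def[abs_def]
    by (rule hd_cong[OF sc[OF der(3) S_conn(8)]]) (use p in \<open>simp add: F field_simps power2_eq_square\<close>)
qed

text \<open>The curvature equations for the pair e1, e2. Both involve the same function
  \<open>mu\<close> because a0 r4 = b0 q2, by the symmetry of the Hessian.\<close>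

lemma codazzi:
  assumes z: "z \<in> U"
  shows "e1 mu z = e2 al z" "e1 be z = e2 mu z"
proof -
  have sc: "X (\<lambda>z. k * r z) z = k * X r z" if "derivation X" "r \<in> S" for X r k
    using hdD[OF hd_mult[OF that(1) hd_const[OF that(1), of k] hd_self[OF that(2)]] z] by simp
  note c0 = conn_zero[OF z] deriv_conn_zero[OF der(1) z] deriv_conn_zero[OF der(2) z]
    deriv_conn_zero[OF der(3) z] deriv_conn_zero[OF der(4) z]
  show "e1 mu z = e2 al z"
    using curv1(5)[OF z] c0 sc[OF der(2) S_conn(4)] sc[OF der(4) S_conn(2)]
    by (simp add: al_def[abs_def] mu_def[abs_def])
  have "mu z = b0 * q2 z" if "z \<in> U" for z using r_eqs(4)[OF that] ab0_pos by simp
  then have "e2 mu z = b0 * e2 q2 z + 0 * q2 z"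
    by (rule hd_eq[OF der(4) hd_self[OF S_abm(3)]
          hd_mult[OF der(4) hd_const[OF der(4)] hd_self[OF S_conn(6)]] _ z])
  then show "e1 be z = e2 mu z"
    using curv2(5)[OF z] c0 sc[OF der(2) S_conn(8)] by (simp add: be_def[abs_def])
qed

lemma inv0: "a0 * inverse a0 = 1" "b0 * inverse b0 = 1"
  using ab0_pos by auto

lemma hd_H: "hd n1 H (\<lambda>z. a z * H1 z)"
  by (rule hdI) (use S_data grad_H in auto)

lemma H1_eqs:
  assumes z: "z \<in> U"
  shows "a0\<^sup>2 - (al z)\<^sup>2 - (mu z)\<^sup>2 = a0\<^sup>2 * H1 z" "b0\<^sup>2 - (be z)\<^sup>2 - (mu z)\<^sup>2 = b0\<^sup>2 * H1 z"
proof -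
  have "n1 H z = (a0\<^sup>2 - (al z)\<^sup>2) / a0 + - (mu z)\<^sup>2 / a0"
    by (rule hd_eq[OF der(1) hd_self[OF S_data(4)] hd_add[OF der(1) hd_abm(1,5)] H_eq z])
  then show "a0\<^sup>2 - (al z)\<^sup>2 - (mu z)\<^sup>2 = a0\<^sup>2 * H1 z"
    using grad_H(1)[OF z] a_eq[OF z] inv0 unfolding divide_inverse by algebra
  have "n2 H z = - (mu z)\<^sup>2 / b0 + (b0\<^sup>2 - (be z)\<^sup>2) / b0"
    by (rule hd_eq[OF der(3) hd_self[OF S_data(4)] hd_add[OF der(3) hd_abm(2,6)] H_eq z])
  then show "b0\<^sup>2 - (be z)\<^sup>2 - (mu z)\<^sup>2 = b0\<^sup>2 * H1 z"
    using grad_H(3)[OF z] b_eq[OF z] inv0 unfolding divide_inverse by algebra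
qed

text \<open>Eliminating \<open>H1\<close> from \<open>H1_eqs\<close> leaves b0^2 (al^2 + mu^2) =
  a0^2 (be^2 + mu^2). Its derivatives along n1 and n2 are again algebraic in \<open>al\<close>,
  \<open>be\<close>, \<open>mu\<close>.\<close>

lemma H1_eqs':
  assumes z: "z \<in> U"
  shows "b0\<^sup>2 * al z * H1 z = - (mu z)\<^sup>2 * H z" "a0\<^sup>2 * be z * H1 z = - (mu z)\<^sup>2 * H z"
proof -
  have eq: "b0\<^sup>2 * ((al z)\<^sup>2 + (mu z)\<^sup>2) = a0\<^sup>2 * ((be z)\<^sup>2 + (mu z)\<^sup>2)" if "z \<in> U" for z
    using H1_eqs[OF that] by algebra
  note p = ab0_pos
  have "b0\<^sup>2 * (2 * al z * ((a0\<^sup>2 - (al z)\<^sup>2) / a0) + 2 * mu z * (- (al z * mu z) / a0))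
      + 0 * ((al z)\<^sup>2 + (mu z)\<^sup>2)
    = a0\<^sup>2 * (2 * be z * (- (mu z)\<^sup>2 / a0) + 2 * mu z * (- (al z * mu z) / a0))
      + 0 * ((be z)\<^sup>2 + (mu z)\<^sup>2)"
    by (rule hd_eq[OF der(1) hd_mult[OF der(1) hd_const[OF der(1)] hd_add[OF der(1)
              hd_power2[OF der(1) hd_abm(1)] hd_power2[OF der(1) hd_abm(3)]]]
          hd_mult[OF der(1) hd_const[OF der(1)] hd_add[OF der(1)
              hd_power2[OF der(1) hd_abm(5)] hd_power2[OF der(1) hd_abm(3)]]] eq z])
  then have "b0\<^sup>2 * al z * (a0\<^sup>2 - (al z)\<^sup>2 - (mu z)\<^sup>2) = - a0\<^sup>2 * (mu z)\<^sup>2 * (al z + be z)"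
    using inv0 unfolding divide_inverse by algebra
  then have "a0\<^sup>2 * (b0\<^sup>2 * al z * H1 z + (mu z)\<^sup>2 * H z) = 0"
    using H1_eqs(1)[OF z] H_eq[OF z] by algebra
  then show "b0\<^sup>2 * al z * H1 z = - (mu z)\<^sup>2 * H z" using p by simp
  have "b0\<^sup>2 * (2 * al z * (- (mu z)\<^sup>2 / b0) + 2 * mu z * (- (be z * mu z) / b0))
      + 0 * ((al z)\<^sup>2 + (mu z)\<^sup>2)
    = a0\<^sup>2 * (2 * be z * ((b0\<^sup>2 - (be z)\<^sup>2) / b0) + 2 * mu z * (- (be z * mu z) / b0))
      + 0 * ((be z)\<^sup>2 + (mu z)\<^sup>2)"
    by (rule hd_eq[OF der(3) hd_mult[OF der(3) hd_const[OF der(3)] hd_add[OF der(3)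
              hd_power2[OF der(3) hd_abm(2)] hd_power2[OF der(3) hd_abm(4)]]]
          hd_mult[OF der(3) hd_const[OF der(3)] hd_add[OF der(3)
              hd_power2[OF der(3) hd_abm(6)] hd_power2[OF der(3) hd_abm(4)]]] eq z])
  then have "a0\<^sup>2 * be z * (b0\<^sup>2 - (be z)\<^sup>2 - (mu z)\<^sup>2) = - b0\<^sup>2 * (mu z)\<^sup>2 * (al z + be z)"
    using inv0 unfolding divide_inverse by algebra
  then have "b0\<^sup>2 * (a0\<^sup>2 * be z * H1 z + (mu z)\<^sup>2 * H z) = 0"
    using H1_eqs(2)[OF z] H_eq[OF z] by algebra
  then show "a0\<^sup>2 * be z * H1 z = - (mu z)\<^sup>2 * H z" using p by simp
qed

lemma unit0: "z \<in> U \<Longrightarrow> a0\<^sup>2 + b0\<^sup>2 = 1"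
  using ab_unit[of z] a_eq[of z] b_eq[of z] by simp

lemma al_be_proportional:
  assumes z: "z \<in> U" and H1: "H1 z \<noteq> 0"
  shows "al z = a0\<^sup>2 * H z" "be z = b0\<^sup>2 * H z"
proof -
  have "(b0\<^sup>2 * al z - a0\<^sup>2 * be z) * H1 z = 0"
    using H1_eqs'[OF z] by (simp add: algebra_simps)
  then have "b0\<^sup>2 * al z = a0\<^sup>2 * be z" using H1 by simp
  then show "al z = a0\<^sup>2 * H z" "be z = b0\<^sup>2 * H z"
    using unit0[OF z] H_eq[OF z] by algebra+
qed

text \<open>At a point with \<open>H1\<close> nonzero, \<open>al\<close> and \<open>be\<close> are
  proportional to \<open>H\<close>, and the remaining equations force H = 0. Hence H1 H = 0
  everywhere. As n1 H = a H1, differentiating this and multiplying by \<open>H1\<close> leaves a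
  H1^3 = 0.\<close>

lemma H1_zero_if_unequal:
  assumes ne: "a0 \<noteq> b0" and z: "z \<in> U"
  shows "H1 z = 0"
proof -
  have H0: "H1 z * H z = 0" if z: "z \<in> U" for z
  proof (cases "H1 z = 0")
    case False
    note p = al_be_proportional[OF z False]
    have ne2: "a0\<^sup>2 \<noteq> b0\<^sup>2" using ne ab0_pos by (simp add: power2_eq_iff)
    have "(a0\<^sup>2 - b0\<^sup>2) * ((mu z)\<^sup>2 - a0\<^sup>2 * b0\<^sup>2 * (H z)\<^sup>2) = 0"
      using H1_eqs[OF z] p by algebra
    then have m: "(mu z)\<^sup>2 = a0\<^sup>2 * b0\<^sup>2 * (H z)\<^sup>2" using ne2 by simp
    have "a0\<^sup>2 * (H1 z - (1 - (H z)\<^sup>2)) = 0"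
      using H1_eqs(1)[OF z] m p unit0[OF z] by algebra
    then have "H1 z = 1 - (H z)\<^sup>2" using ab0_pos by simp
    then have "a0\<^sup>2 * b0\<^sup>2 * H z = 0" using H1_eqs'(1)[OF z] p m by algebra
    then show ?thesis using ab0_pos by simp
  qed simp
  have "H1 z * (a z * H1 z) + n1 H1 z * H z = 0"
    by (rule hd_eq[OF der(1) hd_mult[OF der(1) hd_self[OF S_data(5)] hd_H]
          hd_const[OF der(1), of 0] H0 z])
  then have "H1 z * (H1 z * (a z * H1 z)) + n1 H1 z * (H1 z * H z) = 0" by algebra
  then show ?thesis using H0[OF z] a_pos[OF z] by simp
qed

text \<open>Pointwise algebra only gives H1 H T = 0 with T = H1 - 2 + H^2. To remove the factor
  \<open>H\<close>, the equation is differentiated along n1, where n1 H = a H1, and multiplied by H1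
  T; what remains is a H1 (H1 T)^2 = 0.\<close>

lemma H1_alternative_if_equal:
  assumes eq: "a0 = b0" and z: "z \<in> U"
  shows "H1 z * (H1 z - 2 + (H z)\<^sup>2) = 0"
proof -
  have half: "a0\<^sup>2 = 1/2" using unit0[OF z] eq by simp
  have H0: "H1 z * H z * (H1 z - 2 + (H z)\<^sup>2) = 0" if z: "z \<in> U" for z
  proof (cases "H1 z = 0")
    case False
    note p = al_be_proportional[OF z False]
    have al: "al z = H z / 2" and ab: "a0\<^sup>2 = 1/2" "b0\<^sup>2 = 1/2" using p half eq by simp_all
    have "4 * (mu z)\<^sup>2 = 2 - (H z)\<^sup>2 - 2 * H1 z"
      using H1_eqs(1)[OF z] unfolding al ab by (simp add: field_simps)
    moreover have "H z * H1 z = - 4 * (mu z)\<^sup>2 * H z"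
      using H1_eqs'(1)[OF z] unfolding al ab by simp
    ultimately have "H z * (H1 z - 2 + (H z)\<^sup>2) = 0" by algebra
    then show ?thesis by simp
  qed simp
  let ?T = "\<lambda>z. H1 z - 2 + (H z)\<^sup>2"
  have T: "?T \<in> S" using S_data by auto
  have "H1 z * H z * n1 ?T z + (H1 z * (a z * H1 z) + n1 H1 z * H z) * ?T z = 0"
    by (rule hd_eq[OF der(1) hd_mult[OF der(1) hd_mult[OF der(1) hd_self[OF S_data(5)]
            hd_H] hd_self[OF T]] hd_const[OF der(1), of 0] H0 z])
  then have "(H1 z * H z * ?T z) * (H1 z * n1 ?T z + n1 H1 z * ?T z) + a z * H1 z * (H1 z * ?T z)\<^sup>2 = 0"
    by algebra
  then have "a z * H1 z * (H1 z * ?T z)\<^sup>2 = 0" using H0[OF z] by simp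
  then show ?thesis using a_pos[OF z] by auto
qed

lemma mu_if_equal:
  assumes eq: "a0 = b0" and z: "z \<in> U" and H1: "H1 z \<noteq> 0"
  shows "H1 z = 2 - (H z)\<^sup>2" "al z = H z / 2" "be z = H z / 2" "4 * (mu z)\<^sup>2 = (H z)\<^sup>2 - 2" "2 < (H z)\<^sup>2"
proof -
  have half: "a0\<^sup>2 = 1/2" using unit0[OF z] eq by simp
  show H1': "H1 z = 2 - (H z)\<^sup>2" using H1_alternative_if_equal[OF eq z] H1 by simp
  show al: "al z = H z / 2" "be z = H z / 2" using al_be_proportional[OF z H1] half eq by auto
  show m: "4 * (mu z)\<^sup>2 = (H z)\<^sup>2 - 2"
    using H1_eqs(1)[OF z] half al H1' by (simp add: field_simps)
  then have "0 \<le> (H z)\<^sup>2 - 2" by (metis zero_le_mult_iff zero_le_numeral zero_le_power2)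
  then show "2 < (H z)\<^sup>2" using H1' H1 by simp
qed

text \<open>Constancy of \<open>H\<close> gives H1 = 0. For h nonzero, \<open>H1_eqs'\<close>
  settles the claim at once. In the minimal case h = 0 those equations are void, and the Codazzi
  equations have to be used.\<close>

lemma mu_zero_if_H_const:
  assumes Hc: "\<And>z. z \<in> U \<Longrightarrow> H z = h" and z: "z \<in> U"
  shows "mu z = 0" "(al z)\<^sup>2 = a0\<^sup>2" "(be z)\<^sup>2 = b0\<^sup>2"
proof -
  have H1: "H1 z = 0" if z: "z \<in> U" for z
    using hd_eq[OF der(1) hd_self[OF S_data(4)] hd_const[OF der(1), of h] Hc z]
      grad_H(1)[OF z] a_pos[OF z] by simp
  show m: "mu z = 0"
  proof (cases "h = 0")
    case False
    then show ?thesis using H1_eqs'(1)[OF z] H1[OF z] Hc[OF z] by simp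
  next
    case True
    have be: "be z = - al z" if "z \<in> U" for z using H_eq[OF that] Hc[OF that] True by simp
    have sq: "(al z)\<^sup>2 + (mu z)\<^sup>2 = a0\<^sup>2" if "z \<in> U" for z
      using H1_eqs(1)[OF that] H1[OF that] by simp
    \<comment> \<open>Since be = - al, the Codazzi equations read e1 mu = e2 al and e2 mu = - e1 al,
      a Cauchy-Riemann system for \<open>al\<close> and \<open>mu\<close>. As al^2 + mu^2 is the
      constant a0^2, it has only zero derivatives along e1 and e2.\<close>
    have cz: "e1 al z = 0 \<and> e2 al z = 0" if z: "z \<in> U" for z
    proof -
      have s: "al z * X al z + mu z * X mu z = 0" if X: "derivation X" for X
        using hd_eq[OF X hd_add[OF X hd_power2[OF X hd_self[OF S_abm(1)]]
              hd_power2[OF X hd_self[OF S_abm(3)]]] hd_const[OF X] sq z] by simp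
      have b: "e1 be z = - e1 al z"
        by (rule hd_eq[OF der(2) hd_self[OF S_abm(2)] hd_uminus[OF der(2) hd_self[OF S_abm(1)]] be z])
      have "a0\<^sup>2 * e1 al z = 0" "a0\<^sup>2 * e2 al z = 0"
        using s[OF der(2)] s[OF der(4)] codazzi[OF z] b sq[OF z] by algebra+
      then show ?thesis using ab0_pos by simp
    qed
    have S: "e1 al \<in> S" "e2 al \<in> S" using derivation_S der S_abm by blast+
    \<comment> \<open>The commutator of e1 and e2 applied to \<open>al\<close>: its left side
      vanishes, and the derivatives along n1 and n2 on the right leave a positive multiple of
      mu^3.\<close>
    have "- q2 z * n2 al z + r4 z * n1 al z = 0"
      using comm(5)[OF S_abm(1) z] hd_eq[OF der(2) hd_self[OF S(2)] hd_const[OF der(2), of 0] _ z]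
        hd_eq[OF der(4) hd_self[OF S(1)] hd_const[OF der(4), of 0] _ z] cz by simp
    moreover have "n1 al z = (mu z)\<^sup>2 / a0" "n2 al z = - (mu z)\<^sup>2 / b0"
      using hdD[OF hd_abm(1) z] hdD[OF hd_abm(2) z] sq[OF z] by (auto simp: field_simps)
    ultimately have "mu z ^ 3 * (1 / a0\<^sup>2 + 1 / b0\<^sup>2) = 0"
      using r_eqs(3,4)[OF z] ab0_pos by (simp add: power2_eq_square power3_eq_cube field_simps)
    moreover have "1 / a0\<^sup>2 + 1 / b0\<^sup>2 > 0" using ab0_pos by (simp add: add_pos_pos)
    ultimately show ?thesis by simp
  qed
  show "(al z)\<^sup>2 = a0\<^sup>2" "(be z)\<^sup>2 = b0\<^sup>2" using H1_eqs[OF z] H1[OF z] m by auto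
qed

end

subsection \<open>Frames in Minkowski space\<close>

lemma lor_simps: "lor (x + y) w = lor x w + lor y w" "lor w (x + y) = lor w x + lor w y"
  "lor (c *\<^sub>R x) w = c * lor x w" "lor w (c *\<^sub>R x) = c * lor w x"
  "lor (x - y) w = lor x w - lor y w" "lor w (x - y) = lor w x - lor w y"
  "lor (- x) w = - lor x w" "lor w (- x) = - lor w x" "lor 0 w = 0" "lor w 0 = 0"
  by (simp_all add: lor_def algebra_simps)

lemma lor_commute: "lor x y = lor y x"
  by (simp add: lor_def)

definition lorentz_onb :: "real^3 \<Rightarrow> real^3 \<Rightarrow> real^3 \<Rightarrow> bool" where
  "lorentz_onb p v t \<longleftrightarrow> lor p p = -1 \<and> lor v v = 1 \<and> lor t t = 1 \<and>
     lor p v = 0 \<and> lor p t = 0 \<and> lor v t = 0"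

text \<open>The frame as vectors of Minkowski space: p1, v1, t1 are the position, n1 and e1 in the first factor.\<close>

locale positioned_frame = adapted_frame U S n1 e1 n2 e2 r1 r2 r3 r4 q1 q2 q3 q4 a b d H H1
  for U :: "'a set" and S n1 e1 n2 e2 r1 r2 r3 r4 q1 q2 q3 q4 a b d H H1 +
  fixes p1 v1 t1 p2 v2 t2 :: "'a \<Rightarrow> real^3"
  assumes hd_p1: "hd n1 (\<lambda>z. p1 z $ i) (\<lambda>z. v1 z $ i)" "hd e1 (\<lambda>z. p1 z $ i) (\<lambda>z. t1 z $ i)"
      "hd n2 (\<lambda>z. p1 z $ i) (\<lambda>_. 0)" "hd e2 (\<lambda>z. p1 z $ i) (\<lambda>_. 0)"
    and hd_v1: "hd n1 (\<lambda>z. v1 z $ i) (\<lambda>z. r1 z * t1 z $ i + p1 z $ i)" "hd e1 (\<lambda>z. v1 z $ i) (\<lambda>z. r2 z * t1 z $ i)"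
      "hd n2 (\<lambda>z. v1 z $ i) (\<lambda>z. r3 z * t1 z $ i)" "hd e2 (\<lambda>z. v1 z $ i) (\<lambda>z. r4 z * t1 z $ i)"
    and hd_t1: "hd n1 (\<lambda>z. t1 z $ i) (\<lambda>z. - r1 z * v1 z $ i)" "hd e1 (\<lambda>z. t1 z $ i) (\<lambda>z. - r2 z * v1 z $ i + p1 z $ i)"
      "hd n2 (\<lambda>z. t1 z $ i) (\<lambda>z. - r3 z * v1 z $ i)" "hd e2 (\<lambda>z. t1 z $ i) (\<lambda>z. - r4 z * v1 z $ i)"
    and hd_p2: "hd n2 (\<lambda>z. p2 z $ i) (\<lambda>z. v2 z $ i)" "hd e2 (\<lambda>z. p2 z $ i) (\<lambda>z. t2 z $ i)"
      "hd n1 (\<lambda>z. p2 z $ i) (\<lambda>_. 0)" "hd e1 (\<lambda>z. p2 z $ i) (\<lambda>_. 0)"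
    and hd_v2: "hd n2 (\<lambda>z. v2 z $ i) (\<lambda>z. q3 z * t2 z $ i + p2 z $ i)" "hd e2 (\<lambda>z. v2 z $ i) (\<lambda>z. q4 z * t2 z $ i)"
      "hd n1 (\<lambda>z. v2 z $ i) (\<lambda>z. q1 z * t2 z $ i)" "hd e1 (\<lambda>z. v2 z $ i) (\<lambda>z. q2 z * t2 z $ i)"
    and hd_t2: "hd n2 (\<lambda>z. t2 z $ i) (\<lambda>z. - q3 z * v2 z $ i)" "hd e2 (\<lambda>z. t2 z $ i) (\<lambda>z. - q4 z * v2 z $ i + p2 z $ i)"
      "hd n1 (\<lambda>z. t2 z $ i) (\<lambda>z. - q1 z * v2 z $ i)" "hd e1 (\<lambda>z. t2 z $ i) (\<lambda>z. - q2 z * v2 z $ i)"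
    and onb: "z \<in> U \<Longrightarrow> lorentz_onb (p1 z) (v1 z) (t1 z)" "z \<in> U \<Longrightarrow> lorentz_onb (p2 z) (v2 z) (t2 z)"
      "z \<in> U \<Longrightarrow> 0 < p1 z $ 1" "z \<in> U \<Longrightarrow> 0 < p2 z $ 1"
begin

definition "flat f \<longleftrightarrow> f \<in> S \<and> (\<forall>z\<in>U. n1 f z = 0 \<and> e1 f z = 0 \<and> n2 f z = 0 \<and> e2 f z = 0)"

lemma flatI: "hd n1 f (\<lambda>_. 0) \<Longrightarrow> hd e1 f (\<lambda>_. 0) \<Longrightarrow> hd n2 f (\<lambda>_. 0) \<Longrightarrow> hd e2 f (\<lambda>_. 0) \<Longrightarrow> flat f"
  by (simp add: flat_def hd_def)

text \<open>The case b = 0: the vector H p - n is multiplied by exp (- \<integral> H) along the normal flow.\<close>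

lemma one_factor:
  assumes ab: "\<And>z. z \<in> U \<Longrightarrow> a z = 1" "\<And>z. z \<in> U \<Longrightarrow> b z = 0"
  shows "z \<in> U \<Longrightarrow> H1 z = 1 - (H z)\<^sup>2"
    "hd n1 (\<lambda>z. H z * p1 z $ i - v1 z $ i) (\<lambda>z. - H z * (H z * p1 z $ i - v1 z $ i))"
    "hd e1 (\<lambda>z. H z * p1 z $ i - v1 z $ i) (\<lambda>_. 0)"
    "hd n2 (\<lambda>z. H z * p1 z $ i - v1 z $ i) (\<lambda>_. 0)"
    "hd e2 (\<lambda>z. H z * p1 z $ i - v1 z $ i) (\<lambda>_. 0)"
proof -
  have dab: "X a z = 0" "X b z = 0" if "derivation X" "z \<in> U" for X z
    using hd_eq[OF that(1) hd_self[OF S_data(1)] hd_const[OF that(1), of 1] ab(1) that(2)]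
      hd_eq[OF that(1) hd_self[OF S_data(2)] hd_const[OF that(1), of 0] ab(2) that(2)] by auto
  have r0: "r1 z = 0" "r3 z = 0" "r4 z = 0" if z: "z \<in> U" for z
    using comm_d[OF z] dab[OF der(2) z] dab[OF der(4) z] ab[OF z] by auto
  have r2: "r2 z = H z" if z: "z \<in> U" for z using lap_d[OF z] dab[OF der(1) z] dab[OF der(3) z] ab[OF z] by auto
  show H1: "H1 z = 1 - (H z)\<^sup>2" if z: "z \<in> U" for z
  proof -
    have "e1 r1 z = 0"
      using hd_eq[OF der(2) hd_self[OF S_conn(1)] hd_const[OF der(2), of 0] r0(1) z] by simp
    moreover have "n1 r2 z = n1 H z"
      by (rule hd_eq[OF der(1) hd_self[OF S_conn(2)] hd_self[OF S_data(4)] r2 z])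
    ultimately show ?thesis using curv1(1)[OF z] grad_H(1)[OF z] r0[OF z] r2[OF z] ab[OF z] by simp
  qed
  have hdH: "hd n1 H (\<lambda>z. H1 z)" "hd e1 H (\<lambda>_. 0)" "hd n2 H (\<lambda>_. 0)" "hd e2 H (\<lambda>_. 0)"
    using grad_H ab S_data by (auto intro!: hdI)
  show "hd n1 (\<lambda>z. H z * p1 z $ i - v1 z $ i) (\<lambda>z. - H z * (H z * p1 z $ i - v1 z $ i))"
    by (rule hd_cong[OF hd_diff[OF der(1) hd_mult[OF der(1) hdH(1) hd_p1(1)] hd_v1(1)]])
      (simp add: H1 r0 power2_eq_square algebra_simps)
  show "hd e1 (\<lambda>z. H z * p1 z $ i - v1 z $ i) (\<lambda>_. 0)"
    by (rule hd_cong[OF hd_diff[OF der(2) hd_mult[OF der(2) hdH(2) hd_p1(2)] hd_v1(2)]]) (simp add: r2)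
  show "hd n2 (\<lambda>z. H z * p1 z $ i - v1 z $ i) (\<lambda>_. 0)"
    by (rule hd_cong[OF hd_diff[OF der(3) hd_mult[OF der(3) hdH(3) hd_p1(3)] hd_v1(3)]]) (simp add: r0)
  show "hd e2 (\<lambda>z. H z * p1 z $ i - v1 z $ i) (\<lambda>_. 0)"
    by (rule hd_cong[OF hd_diff[OF der(4) hd_mult[OF der(4) hdH(4) hd_p1(4)] hd_v1(4)]]) (simp add: r0)
qed

text \<open>If the integral curves of e1 in the first factor are horocycles, then the null direction
  p - \<epsilon> n is constant.\<close>

lemma null_direction:
  assumes r: "\<And>z. z \<in> U \<Longrightarrow> r1 z = 0" "\<And>z. z \<in> U \<Longrightarrow> r2 z = \<epsilon>" "\<And>z. z \<in> U \<Longrightarrow> r3 z = 0"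
      "\<And>z. z \<in> U \<Longrightarrow> r4 z = 0" and \<epsilon>: "\<epsilon> * \<epsilon> = 1"
  shows "hd n1 (\<lambda>z. p1 z $ i - \<epsilon> * v1 z $ i) (\<lambda>z. - \<epsilon> * (p1 z $ i - \<epsilon> * v1 z $ i))"
    "hd e1 (\<lambda>z. p1 z $ i - \<epsilon> * v1 z $ i) (\<lambda>_. 0)"
    "hd n2 (\<lambda>z. p1 z $ i - \<epsilon> * v1 z $ i) (\<lambda>_. 0)"
    "hd e2 (\<lambda>z. p1 z $ i - \<epsilon> * v1 z $ i) (\<lambda>_. 0)"
proof -
  have \<epsilon>': "\<epsilon> * (\<epsilon> * x) = x" for x using \<epsilon> by (simp add: mult.assoc[symmetric])
  show "hd n1 (\<lambda>z. p1 z $ i - \<epsilon> * v1 z $ i) (\<lambda>z. - \<epsilon> * (p1 z $ i - \<epsilon> * v1 z $ i))"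
    by (rule hd_cong[OF hd_diff[OF der(1) hd_p1(1) hd_mult[OF der(1) hd_const[OF der(1)] hd_v1(1)]]])
      (simp add: r \<epsilon>' algebra_simps)
  show "hd e1 (\<lambda>z. p1 z $ i - \<epsilon> * v1 z $ i) (\<lambda>_. 0)"
    by (rule hd_cong[OF hd_diff[OF der(2) hd_p1(2) hd_mult[OF der(2) hd_const[OF der(2)] hd_v1(2)]]])
      (simp add: r \<epsilon>')
  show "hd n2 (\<lambda>z. p1 z $ i - \<epsilon> * v1 z $ i) (\<lambda>_. 0)"
    by (rule hd_cong[OF hd_diff[OF der(3) hd_p1(3) hd_mult[OF der(3) hd_const[OF der(3)] hd_v1(3)]]])
      (simp add: r)
  show "hd e2 (\<lambda>z. p1 z $ i - \<epsilon> * v1 z $ i) (\<lambda>_. 0)"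
    by (rule hd_cong[OF hd_diff[OF der(4) hd_p1(4) hd_mult[OF der(4) hd_const[OF der(4)] hd_v1(4)]]])
      (simp add: r)
qed

lemma null_direction2:
  assumes q: "\<And>z. z \<in> U \<Longrightarrow> q1 z = 0" "\<And>z. z \<in> U \<Longrightarrow> q2 z = 0" "\<And>z. z \<in> U \<Longrightarrow> q3 z = 0"
      "\<And>z. z \<in> U \<Longrightarrow> q4 z = \<epsilon>" and \<epsilon>: "\<epsilon> * \<epsilon> = 1"
  shows "hd n2 (\<lambda>z. p2 z $ i - \<epsilon> * v2 z $ i) (\<lambda>z. - \<epsilon> * (p2 z $ i - \<epsilon> * v2 z $ i))"
    "hd e2 (\<lambda>z. p2 z $ i - \<epsilon> * v2 z $ i) (\<lambda>_. 0)"
    "hd n1 (\<lambda>z. p2 z $ i - \<epsilon> * v2 z $ i) (\<lambda>_. 0)"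
    "hd e1 (\<lambda>z. p2 z $ i - \<epsilon> * v2 z $ i) (\<lambda>_. 0)"
proof -
  have \<epsilon>': "\<epsilon> * (\<epsilon> * x) = x" for x using \<epsilon> by (simp add: mult.assoc[symmetric])
  show "hd n2 (\<lambda>z. p2 z $ i - \<epsilon> * v2 z $ i) (\<lambda>z. - \<epsilon> * (p2 z $ i - \<epsilon> * v2 z $ i))"
    by (rule hd_cong[OF hd_diff[OF der(3) hd_p2(1) hd_mult[OF der(3) hd_const[OF der(3)] hd_v2(1)]]])
      (simp add: q \<epsilon>' algebra_simps)
  show "hd e2 (\<lambda>z. p2 z $ i - \<epsilon> * v2 z $ i) (\<lambda>_. 0)"
    by (rule hd_cong[OF hd_diff[OF der(4) hd_p2(2) hd_mult[OF der(4) hd_const[OF der(4)] hd_v2(2)]]])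
      (simp add: q \<epsilon>')
  show "hd n1 (\<lambda>z. p2 z $ i - \<epsilon> * v2 z $ i) (\<lambda>_. 0)"
    by (rule hd_cong[OF hd_diff[OF der(1) hd_p2(3) hd_mult[OF der(1) hd_const[OF der(1)] hd_v2(3)]]])
      (simp add: q)
  show "hd e1 (\<lambda>z. p2 z $ i - \<epsilon> * v2 z $ i) (\<lambda>_. 0)"
    by (rule hd_cong[OF hd_diff[OF der(2) hd_p2(4) hd_mult[OF der(2) hd_const[OF der(2)] hd_v2(4)]]])
      (simp add: q)
qed

text \<open>With a = b and H1 = 2 - H^2 the surface consists of the pairs (p, q) such that p has
  distance \<rho> from A q, where coth \<rho> = H / sqrt 2, for a Lorentz transformation A.  The vectors
  y0, y1, y2 are the images under A of p2, v2, t2; G is 1 / (2 |mu|).\<close>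

lemma congruent_factors:
  fixes w \<sigma> \<eta> :: real and m :: "'a \<Rightarrow> real"
  assumes w: "w * w = 2" and \<sigma>: "\<sigma> * \<sigma> = 1" and \<eta>: "\<eta> * \<eta> = 1"
    and m: "m \<in> S" "\<And>z. z \<in> U \<Longrightarrow> 0 < \<sigma> * m z"
    and a: "\<And>z. z \<in> U \<Longrightarrow> 2 * a z = w" "\<And>z. z \<in> U \<Longrightarrow> 2 * b z = w"
    and r: "\<And>z. z \<in> U \<Longrightarrow> r1 z = 0" "\<And>z. z \<in> U \<Longrightarrow> 2 * r2 z = w * H z" "\<And>z. z \<in> U \<Longrightarrow> r3 z = 0"
      "\<And>z. z \<in> U \<Longrightarrow> r4 z = w * m z"
    and q: "\<And>z. z \<in> U \<Longrightarrow> q1 z = 0" "\<And>z. z \<in> U \<Longrightarrow> q2 z = w * m z" "\<And>z. z \<in> U \<Longrightarrow> q3 z = 0"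
      "\<And>z. z \<in> U \<Longrightarrow> 2 * q4 z = w * H z"
    and H1: "\<And>z. z \<in> U \<Longrightarrow> H1 z = 2 - (H z)\<^sup>2" and mH: "\<And>z. z \<in> U \<Longrightarrow> 4 * (m z)\<^sup>2 = (H z)\<^sup>2 - 2"
  defines "G \<equiv> \<lambda>z. inverse (2 * (\<sigma> * m z))"
  defines "y0 \<equiv> \<lambda>z. (\<eta> * G z) *\<^sub>R (H z *\<^sub>R p1 z - w *\<^sub>R v1 z)"
    and "y1 \<equiv> \<lambda>z. (\<eta> * G z) *\<^sub>R (w *\<^sub>R p1 z - H z *\<^sub>R v1 z)"
    and "y2 \<equiv> \<lambda>z. (- \<eta> * \<sigma>) *\<^sub>R t1 z"
  shows "flat (\<lambda>z. - y0 z $ i * p2 z $ j + y1 z $ i * v2 z $ j + y2 z $ i * t2 z $ j)"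
    "z \<in> U \<Longrightarrow> lorentz_onb (y0 z) (y1 z) (y2 z)"
proof -
  have mpos: "m z \<noteq> 0" if "z \<in> U" for z using m(2)[OF that] by auto
  have \<sigma>': "\<sigma> = 1 \<or> \<sigma> = -1" using \<sigma> by (simp add: square_eq_1_iff)
  have Gm: "2 * m z * G z = \<sigma>" if "z \<in> U" for z
    using \<sigma>' mpos[OF that] by (auto simp: G_def)
  \<comment> \<open>\<open>w\<close> is a square root of 2, known only through its square, so that
    the identities stay polynomial. \<open>k\<close> is the common value of \<open>a\<close> and
    \<open>b\<close>, the reciprocal of \<open>w\<close>.\<close>
  define k where "k = w / 2"
  have kw: "k * w = 1" using w by (simp add: k_def)
  note eq0 = eq_iff_diff_eq_0[THEN iffD1]
  have F: "a z = k" "b z = k" "H1 z = 2 - H z * H z" "r1 z = 0" "r2 z = k * H z" "r3 z = 0" "r4 z = w * m z"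
    "q1 z = 0" "q2 z = w * m z" "q3 z = 0" "q4 z = k * H z" "4 * (m z * m z) = H z * H z - 2" if "z \<in> U" for z
    using a[OF that] r[OF that] q[OF that] H1[OF that] mH[OF that] by (auto simp: k_def power2_eq_square)
  have hdH: "hd n1 H (\<lambda>z. a z * H1 z)" "hd e1 H (\<lambda>_. 0)" "hd n2 H (\<lambda>z. b z * H1 z)" "hd e2 H (\<lambda>_. 0)"
    using grad_H S_data by (auto intro!: hdI)
  have dm: "4 * m z * X m z = H z * X H z" if X: "derivation X" and z: "z \<in> U" for X z
    using hd_eq[OF X hd_mult[OF X hd_const[OF X, of 4] hd_power2[OF X hd_self[OF m(1)]]]
        hd_diff[OF X hd_power2[OF X hd_self[OF S_data(4)]] hd_const[OF X, of 2]] mH z] by simp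
  have dm': "4 * m z * X m z = - 4 * x * H z * (m z)\<^sup>2" if X: "derivation X" and z: "z \<in> U"
     and XH: "X H z = x * H1 z" for X z x
    using dm[OF X z] mH[OF z] H1[OF z] XH by algebra
  have dm'': "X m z = - x * H z * m z" if X: "derivation X" and z: "z \<in> U" and XH: "X H z = x * H1 z" for X z x
  proof -
    have "m z * (X m z - (- x * H z * m z)) = 0" using dm'[OF X z XH] by (simp add: power2_eq_square algebra_simps)
    then show ?thesis using mpos[OF z] by simp
  qed
  have hdm: "hd n1 m (\<lambda>z. - a z * H z * m z)" "hd e1 m (\<lambda>_. 0)" "hd n2 m (\<lambda>z. - b z * H z * m z)" "hd e2 m (\<lambda>_. 0)"
    using dm''[OF der(1) _ grad_H(1)] dm''[OF der(2), of _ 0] dm''[OF der(3) _ grad_H(3)] dm''[OF der(4), of _ 0]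
      grad_H m by (auto intro!: hdI)
  have hdG: "hd X G (\<lambda>z. x z * H z * G z)" if X: "derivation X" and h: "hd X m (\<lambda>z. - x z * H z * m z)" for X x
  proof -
    have pos: "0 < 2 * (\<sigma> * m z)" if "z \<in> U" for z using m(2)[OF that] by simp
    have h2: "hd X (\<lambda>z. 2 * (\<sigma> * m z)) (\<lambda>z. 2 * (\<sigma> * (- x z * H z * m z)))"
      by (rule hd_cong[OF hd_mult[OF X hd_const[OF X] hd_mult[OF X hd_const[OF X] h]]]) simp
    show ?thesis unfolding G_def
      by (rule hd_cong[OF hd_inverse[OF X h2 pos]]) (use mpos \<sigma> in \<open>auto simp: field_simps power2_eq_square\<close>)
  qed
  have hdG': "hd n1 G (\<lambda>z. a z * H z * G z)" "hd e1 G (\<lambda>_. 0)" "hd n2 G (\<lambda>z. b z * H z * G z)" "hd e2 G (\<lambda>_. 0)"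
    using hdG[OF der(1) hdm(1)] hdG[OF der(2), of "\<lambda>_. 0"] hdG[OF der(3) hdm(3)] hdG[OF der(4), of "\<lambda>_. 0"] hdm by auto
  have y0i: "y0 z $ i = \<eta> * G z * (H z * p1 z $ i - w * v1 z $ i)" for z i by (simp add: y0_def)
  have y1i: "y1 z $ i = \<eta> * G z * (w * p1 z $ i - H z * v1 z $ i)" for z i by (simp add: y1_def)
  have y2i: "y2 z $ i = - \<eta> * \<sigma> * t1 z $ i" for z i by (simp add: y2_def)
  \<comment> \<open>\<open>y0\<close>, \<open>y1\<close> and \<open>y2\<close> obey the same
    derivative equations as \<open>p2\<close>, \<open>v2\<close> and \<open>t2\<close>, in all four
    directions. Two Lorentz frames with the same equations differ by a constant transformation,
    whose matrix is the tensor in the conclusion.\<close>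
  have y0: "hd n1 (\<lambda>z. y0 z $ i) (\<lambda>_. 0)" "hd e1 (\<lambda>z. y0 z $ i) (\<lambda>_. 0)"
    "hd n2 (\<lambda>z. y0 z $ i) (\<lambda>z. y1 z $ i)" "hd e2 (\<lambda>z. y0 z $ i) (\<lambda>z. y2 z $ i)" for i
    unfolding y0i y1i y2i
    subgoal apply (rule hd_cong, (rule hd_const hd_mult hd_diff der hdG'(1) hdH(1) hd_p1(1) hd_v1(1))+) subgoal premises z for z using F[OF z, THEN eq0] kw w[THEN eq0] Gm[OF z] by algebra done
    subgoal apply (rule hd_cong, (rule hd_const hd_mult hd_diff der hdG'(2) hdH(2) hd_p1(2) hd_v1(2))+) subgoal premises z for z using F[OF z, THEN eq0] kw w[THEN eq0] Gm[OF z] by algebra done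
    subgoal apply (rule hd_cong, (rule hd_const hd_mult hd_diff der hdG'(3) hdH(3) hd_p1(3) hd_v1(3))+) subgoal premises z for z using F[OF z, THEN eq0] kw w[THEN eq0] Gm[OF z] by algebra done
    subgoal apply (rule hd_cong, (rule hd_const hd_mult hd_diff der hdG'(4) hdH(4) hd_p1(4) hd_v1(4))+) subgoal premises z for z using F[OF z, THEN eq0] kw w[THEN eq0] Gm[OF z] by algebra done
    done
  have y1: "hd n1 (\<lambda>z. y1 z $ i) (\<lambda>_. 0)" "hd e1 (\<lambda>z. y1 z $ i) (\<lambda>z. w * m z * y2 z $ i)"
    "hd n2 (\<lambda>z. y1 z $ i) (\<lambda>z. y0 z $ i)" "hd e2 (\<lambda>z. y1 z $ i) (\<lambda>z. q4 z * y2 z $ i)" for i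
    unfolding y0i y1i y2i
    subgoal apply (rule hd_cong, (rule hd_const hd_mult hd_diff der hdG'(1) hdH(1) hd_p1(1) hd_v1(1))+) subgoal premises z for z using F[OF z, THEN eq0] kw w[THEN eq0] Gm[OF z] by algebra done
    subgoal apply (rule hd_cong, (rule hd_const hd_mult hd_diff der hdG'(2) hdH(2) hd_p1(2) hd_v1(2))+) subgoal premises z for z using F[OF z, THEN eq0] kw w[THEN eq0] Gm[OF z] by algebra done
    subgoal apply (rule hd_cong, (rule hd_const hd_mult hd_diff der hdG'(3) hdH(3) hd_p1(3) hd_v1(3))+) subgoal premises z for z using F[OF z, THEN eq0] kw w[THEN eq0] Gm[OF z] by algebra done
    subgoal apply (rule hd_cong, (rule hd_const hd_mult hd_diff der hdG'(4) hdH(4) hd_p1(4) hd_v1(4))+) subgoal premises z for z using F[OF z, THEN eq0] kw w[THEN eq0] Gm[OF z] by algebra done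
    done
  have y2: "hd n1 (\<lambda>z. y2 z $ i) (\<lambda>_. 0)" "hd e1 (\<lambda>z. y2 z $ i) (\<lambda>z. - (w * m z) * y1 z $ i)"
    "hd n2 (\<lambda>z. y2 z $ i) (\<lambda>_. 0)" "hd e2 (\<lambda>z. y2 z $ i) (\<lambda>z. - q4 z * y1 z $ i + y0 z $ i)" for i
    unfolding y0i y1i y2i
    subgoal apply (rule hd_cong, (rule hd_const hd_mult hd_diff der hd_t1(1))+) subgoal premises z for z using F[OF z, THEN eq0] kw w[THEN eq0] Gm[OF z] by algebra done
    subgoal apply (rule hd_cong, (rule hd_const hd_mult hd_diff der hd_t1(2))+) subgoal premises z for z using F[OF z, THEN eq0] kw w[THEN eq0] Gm[OF z] by algebra done
    subgoal apply (rule hd_cong, (rule hd_const hd_mult hd_diff der hd_t1(3))+) subgoal premises z for z using F[OF z, THEN eq0] kw w[THEN eq0] Gm[OF z] by algebra done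
    subgoal apply (rule hd_cong, (rule hd_const hd_mult hd_diff der hd_t1(4))+) subgoal premises z for z using F[OF z, THEN eq0] kw w[THEN eq0] Gm[OF z] by algebra done
    done
  show "flat (\<lambda>z. - y0 z $ i * p2 z $ j + y1 z $ i * v2 z $ j + y2 z $ i * t2 z $ j)"
    apply (rule flatI)
    subgoal apply (rule hd_cong, (rule hd_uminus hd_mult hd_add der y0(1) y1(1) y2(1) hd_p2(3) hd_v2(3) hd_t2(3))+) subgoal premises z for z using F[OF z, THEN eq0] kw w[THEN eq0] Gm[OF z] by algebra done
    subgoal apply (rule hd_cong, (rule hd_uminus hd_mult hd_add der y0(2) y1(2) y2(2) hd_p2(4) hd_v2(4) hd_t2(4))+) subgoal premises z for z using F[OF z, THEN eq0] kw w[THEN eq0] Gm[OF z] by algebra done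
    subgoal apply (rule hd_cong, (rule hd_uminus hd_mult hd_add der y0(3) y1(3) y2(3) hd_p2(1) hd_v2(1) hd_t2(1))+) subgoal premises z for z using F[OF z, THEN eq0] kw w[THEN eq0] Gm[OF z] by algebra done
    subgoal apply (rule hd_cong, (rule hd_uminus hd_mult hd_add der y0(4) y1(4) y2(4) hd_p2(2) hd_v2(2) hd_t2(2))+) by (simp add: algebra_simps)
    done
  assume z: "z \<in> U"
  have o: "lor (p1 z) (p1 z) = -1" "lor (v1 z) (v1 z) = 1" "lor (t1 z) (t1 z) = 1" "lor (p1 z) (v1 z) = 0"
    "lor (p1 z) (t1 z) = 0" "lor (v1 z) (t1 z) = 0" "lor (v1 z) (p1 z) = 0" "lor (t1 z) (p1 z) = 0" "lor (t1 z) (v1 z) = 0"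
    using onb(1)[OF z] by (auto simp: lorentz_onb_def lor_commute)
  have GG: "(G z)\<^sup>2 * ((H z)\<^sup>2 - 2) = 1"
    using Gm[OF z, THEN eq0] F(12)[OF z, THEN eq0] \<sigma>[THEN eq0] by algebra
  have s: "(\<eta> * G z) * ((\<eta> * G z) * x) = (G z)\<^sup>2 * x" for x
    using \<eta> by algebra
  show "lorentz_onb (y0 z) (y1 z) (y2 z)"
    unfolding lorentz_onb_def y0_def y1_def y2_def lor_simps s o
    by (intro conjI; (use GG[THEN eq0] w[THEN eq0] \<eta>[THEN eq0] \<sigma>[THEN eq0] in algebra | simp))
qed

end

subsection \<open>Horospherical coordinates\<close>

text \<open>X1, X2 and Y1, Y2 are the left invariant frames of the two factors, regarded as copies of the
  group of affine transformations of the line; P, F1, F2 and Q, G1, G2 are the position vectors and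
  the frames as vectors of Minkowski space.  The function d has gradient a n1 + b n2 for the unit
  vectors n1 = c X1 + s X2 and n2 = c' Y1 + s' Y2.\<close>

locale group_frame = function_ring U S
  for U :: "'a set" and S :: "('a \<Rightarrow> real) set" +
  fixes X1 X2 Y1 Y2 :: "('a \<Rightarrow> real) \<Rightarrow> 'a \<Rightarrow> real" and P F1 F2 Q G1 G2 :: "'a \<Rightarrow> real^3"
  assumes derXY: "derivation X1" "derivation X2" "derivation Y1" "derivation Y2"
    and commXY: "f \<in> S \<Longrightarrow> z \<in> U \<Longrightarrow> X1 (X2 f) z - X2 (X1 f) z = - X1 f z"
      "f \<in> S \<Longrightarrow> z \<in> U \<Longrightarrow> Y1 (Y2 f) z - Y2 (Y1 f) z = - Y1 f z"
      "f \<in> S \<Longrightarrow> z \<in> U \<Longrightarrow> X1 (Y1 f) z = Y1 (X1 f) z" "f \<in> S \<Longrightarrow> z \<in> U \<Longrightarrow> X1 (Y2 f) z = Y2 (X1 f) z"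
      "f \<in> S \<Longrightarrow> z \<in> U \<Longrightarrow> X2 (Y1 f) z = Y1 (X2 f) z" "f \<in> S \<Longrightarrow> z \<in> U \<Longrightarrow> X2 (Y2 f) z = Y2 (X2 f) z"
    and hd_P: "hd X1 (\<lambda>z. P z $ i) (\<lambda>z. F1 z $ i)" "hd X2 (\<lambda>z. P z $ i) (\<lambda>z. F2 z $ i)"
      "hd Y1 (\<lambda>z. P z $ i) (\<lambda>_. 0)" "hd Y2 (\<lambda>z. P z $ i) (\<lambda>_. 0)"
    and hd_F1: "hd X1 (\<lambda>z. F1 z $ i) (\<lambda>z. F2 z $ i + P z $ i)" "hd X2 (\<lambda>z. F1 z $ i) (\<lambda>_. 0)"
      "hd Y1 (\<lambda>z. F1 z $ i) (\<lambda>_. 0)" "hd Y2 (\<lambda>z. F1 z $ i) (\<lambda>_. 0)"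
    and hd_F2: "hd X1 (\<lambda>z. F2 z $ i) (\<lambda>z. - F1 z $ i)" "hd X2 (\<lambda>z. F2 z $ i) (\<lambda>z. P z $ i)"
      "hd Y1 (\<lambda>z. F2 z $ i) (\<lambda>_. 0)" "hd Y2 (\<lambda>z. F2 z $ i) (\<lambda>_. 0)"
    and hd_Q: "hd Y1 (\<lambda>z. Q z $ i) (\<lambda>z. G1 z $ i)" "hd Y2 (\<lambda>z. Q z $ i) (\<lambda>z. G2 z $ i)"
      "hd X1 (\<lambda>z. Q z $ i) (\<lambda>_. 0)" "hd X2 (\<lambda>z. Q z $ i) (\<lambda>_. 0)"
    and hd_G1: "hd Y1 (\<lambda>z. G1 z $ i) (\<lambda>z. G2 z $ i + Q z $ i)" "hd Y2 (\<lambda>z. G1 z $ i) (\<lambda>_. 0)"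
      "hd X1 (\<lambda>z. G1 z $ i) (\<lambda>_. 0)" "hd X2 (\<lambda>z. G1 z $ i) (\<lambda>_. 0)"
    and hd_G2: "hd Y1 (\<lambda>z. G2 z $ i) (\<lambda>z. - G1 z $ i)" "hd Y2 (\<lambda>z. G2 z $ i) (\<lambda>z. Q z $ i)"
      "hd X1 (\<lambda>z. G2 z $ i) (\<lambda>_. 0)" "hd X2 (\<lambda>z. G2 z $ i) (\<lambda>_. 0)"
    and onbXY: "lorentz_onb (P z) (F1 z) (F2 z)" "lorentz_onb (Q z) (G1 z) (G2 z)" "0 < P z $ 1" "0 < Q z $ 1"

text \<open>The rotation from the invariant frame to the adapted one is given by cosine and sine,
  since on an arbitrary domain there may be no smooth angle function.\<close>

locale rotated_frame = group_frame +
  fixes c s c' s' a b d H H1 :: "'a \<Rightarrow> real"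
  assumes S_cs: "c \<in> S" "s \<in> S" "c' \<in> S" "s' \<in> S" "a \<in> S" "b \<in> S" "d \<in> S" "H \<in> S" "H1 \<in> S"
    and cs: "z \<in> U \<Longrightarrow> c z * c z + s z * s z = 1" "z \<in> U \<Longrightarrow> c' z * c' z + s' z * s' z = 1"
    and grad: "z \<in> U \<Longrightarrow> X1 d z = a z * c z" "z \<in> U \<Longrightarrow> X2 d z = a z * s z"
      "z \<in> U \<Longrightarrow> Y1 d z = b z * c' z" "z \<in> U \<Longrightarrow> Y2 d z = b z * s' z"
    and ab1: "z \<in> U \<Longrightarrow> (a z)\<^sup>2 + (b z)\<^sup>2 = 1"
    and lapl: "z \<in> U \<Longrightarrow> H z = X1 (X1 d) z + X2 (X2 d) z - X2 d z + (Y1 (Y1 d) z + Y2 (Y2 d) z - Y2 d z)"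
    and gradH: "z \<in> U \<Longrightarrow> X1 H z = X1 d z * H1 z" "z \<in> U \<Longrightarrow> X2 H z = X2 d z * H1 z"
      "z \<in> U \<Longrightarrow> Y1 H z = Y1 d z * H1 z" "z \<in> U \<Longrightarrow> Y2 H z = Y2 d z * H1 z"
begin

definition "n1 w z = c z * X1 w z + s z * X2 w z"
definition "e1 w z = - s z * X1 w z + c z * X2 w z"
definition "n2 w z = c' z * Y1 w z + s' z * Y2 w z"
definition "e2 w z = - s' z * Y1 w z + c' z * Y2 w z"

text \<open>The derivative of the rotation angle: the 1-form c ds - s dc evaluated on
  \<open>V\<close>.\<close>

definition "rot V z = c z * V s z - s z * V c z"
definition "rot' V z = c' z * V s' z - s' z * V c' z"

text \<open>Connection form of the rotated frame: derivative of the angle plus the connection form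
  of the invariant frame. The latter is 1 on X1 and 0 on X2, hence \<open>c\<close> on n1 and
  \<open>- s\<close> on e1.\<close>

definition "r1 z = rot n1 z + c z"
definition "r2 z = rot e1 z - s z"
definition "r3 z = rot n2 z"
definition "r4 z = rot e2 z"
definition "q1 z = rot' n1 z"
definition "q2 z = rot' e1 z"
definition "q3 z = rot' n2 z + c' z"
definition "q4 z = rot' e2 z - s' z"

definition "v1 z = c z *\<^sub>R F1 z + s z *\<^sub>R F2 z"
definition "t1 z = - s z *\<^sub>R F1 z + c z *\<^sub>R F2 z"
definition "v2 z = c' z *\<^sub>R G1 z + s' z *\<^sub>R G2 z"
definition "t2 z = - s' z *\<^sub>R G1 z + c' z *\<^sub>R G2 z"

lemma ders: "derivation n1" "derivation e1" "derivation n2" "derivation e2"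
  using derivation_comb[OF derXY(1,2) S_cs(1,2)] derivation_comb[OF derXY(1,2) S_uminus[OF S_cs(2)] S_cs(1)]
    derivation_comb[OF derXY(3,4) S_cs(3,4)] derivation_comb[OF derXY(3,4) S_uminus[OF S_cs(4)] S_cs(3)]
  by (simp_all add: n1_def[abs_def] e1_def[abs_def] n2_def[abs_def] e2_def[abs_def])

lemma S_rot: "derivation V \<Longrightarrow> rot V \<in> S" "derivation V \<Longrightarrow> rot' V \<in> S"
  using S_cs derivation_S by (auto simp: rot_def[abs_def] rot'_def[abs_def])

lemma deriv_cs:
  assumes V: "derivation V" and z: "z \<in> U"
  shows "V c z = - s z * rot V z" "V s z = c z * rot V z" "V c' z = - s' z * rot' V z" "V s' z = c' z * rot' V z"
proof -
  have "(c z * V c z + V c z * c z) + (s z * V s z + V s z * s z) = 0"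
    by (rule hd_eq[OF V hd_add[OF V hd_mult[OF V hd_self hd_self] hd_mult[OF V hd_self hd_self]] hd_const[OF V] cs(1) z])
      (use S_cs in auto)
  then have o: "c z * V c z + s z * V s z = 0" by algebra
  show "V c z = - s z * rot V z" unfolding rot_def using o cs(1)[OF z, THEN eq_iff_diff_eq_0[THEN iffD1]] by algebra
  show "V s z = c z * rot V z" unfolding rot_def using o cs(1)[OF z, THEN eq_iff_diff_eq_0[THEN iffD1]] by algebra
  have "(c' z * V c' z + V c' z * c' z) + (s' z * V s' z + V s' z * s' z) = 0"
    by (rule hd_eq[OF V hd_add[OF V hd_mult[OF V hd_self hd_self] hd_mult[OF V hd_self hd_self]] hd_const[OF V] cs(2) z])
      (use S_cs in auto)
  then have o: "c' z * V c' z + s' z * V s' z = 0" by algebra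
  show "V c' z = - s' z * rot' V z" unfolding rot'_def using o cs(2)[OF z, THEN eq_iff_diff_eq_0[THEN iffD1]] by algebra
  show "V s' z = c' z * rot' V z" unfolding rot'_def using o cs(2)[OF z, THEN eq_iff_diff_eq_0[THEN iffD1]] by algebra
qed

lemma expand:
  assumes V: "derivation V" and f: "f \<in> S" and z: "z \<in> U"
  shows "V (n1 f) z = c z * V (X1 f) z + V c z * X1 f z + (s z * V (X2 f) z + V s z * X2 f z)"
    "V (e1 f) z = - s z * V (X1 f) z - V s z * X1 f z + (c z * V (X2 f) z + V c z * X2 f z)"
    "V (n2 f) z = c' z * V (Y1 f) z + V c' z * Y1 f z + (s' z * V (Y2 f) z + V s' z * Y2 f z)"
    "V (e2 f) z = - s' z * V (Y1 f) z - V s' z * Y1 f z + (c' z * V (Y2 f) z + V c' z * Y2 f z)"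
proof -
  have S: "X1 f \<in> S" "X2 f \<in> S" "Y1 f \<in> S" "Y2 f \<in> S" using derXY derivation_S f by auto
  note h = hd_mult[OF V hd_self hd_self] hd_mult[OF V hd_uminus[OF V hd_self] hd_self]
  show "V (n1 f) z = c z * V (X1 f) z + V c z * X1 f z + (s z * V (X2 f) z + V s z * X2 f z)"
    using hdD[OF hd_add[OF V h(1)[OF S_cs(1) S(1)] h(1)[OF S_cs(2) S(2)]] z] by (simp add: n1_def[abs_def])
  show "V (n2 f) z = c' z * V (Y1 f) z + V c' z * Y1 f z + (s' z * V (Y2 f) z + V s' z * Y2 f z)"
    using hdD[OF hd_add[OF V h(1)[OF S_cs(3) S(3)] h(1)[OF S_cs(4) S(4)]] z] by (simp add: n2_def[abs_def])
  show "V (e1 f) z = - s z * V (X1 f) z - V s z * X1 f z + (c z * V (X2 f) z + V c z * X2 f z)"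
    using hdD[OF hd_add[OF V h(2)[OF S_cs(2) S(1)] h(1)[OF S_cs(1) S(2)]] z] by (simp add: e1_def[abs_def])
  show "V (e2 f) z = - s' z * V (Y1 f) z - V s' z * Y1 f z + (c' z * V (Y2 f) z + V c' z * Y2 f z)"
    using hdD[OF hd_add[OF V h(2)[OF S_cs(4) S(3)] h(1)[OF S_cs(3) S(4)]] z] by (simp add: e2_def[abs_def])
qed

lemma commutators:
  assumes f: "f \<in> S" and z: "z \<in> U"
  shows "n1 (e1 f) z - e1 (n1 f) z = - r1 z * n1 f z - r2 z * e1 f z"
      "n1 (n2 f) z - n2 (n1 f) z = q1 z * e2 f z - r3 z * e1 f z"
      "n1 (e2 f) z - e2 (n1 f) z = - q1 z * n2 f z - r4 z * e1 f z"
      "e1 (n2 f) z - n2 (e1 f) z = q2 z * e2 f z + r3 z * n1 f z"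
      "e1 (e2 f) z - e2 (e1 f) z = - q2 z * n2 f z + r4 z * n1 f z"
      "n2 (e2 f) z - e2 (n2 f) z = - q3 z * n2 f z - q4 z * e2 f z"
proof -
  note eq0 = eq_iff_diff_eq_0[THEN iffD1]
  note ex = expand[OF ders(1) f z] expand[OF ders(2) f z] expand[OF ders(3) f z] expand[OF ders(4) f z]
  note dc = deriv_cs[OF ders(1) z] deriv_cs[OF ders(2) z] deriv_cs[OF ders(3) z] deriv_cs[OF ders(4) z]
  note nd = n1_def[of "X1 f"] n1_def[of "X2 f"] n1_def[of "Y1 f"] n1_def[of "Y2 f"]
     e1_def[of "X1 f"] e1_def[of "X2 f"] e1_def[of "Y1 f"] e1_def[of "Y2 f"]
     n2_def[of "X1 f"] n2_def[of "X2 f"] n2_def[of "Y1 f"] n2_def[of "Y2 f"]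
     e2_def[of "X1 f"] e2_def[of "X2 f"] e2_def[of "Y1 f"] e2_def[of "Y2 f"]
     n1_def[of f] e1_def[of f] n2_def[of f] e2_def[of f]
  note cm = commXY[OF f z]
  show "n1 (e1 f) z - e1 (n1 f) z = - r1 z * n1 f z - r2 z * e1 f z"
    unfolding ex dc nd r1_def r2_def using cm(1)[THEN eq0] cs(1)[OF z, THEN eq0] by algebra
  show "n1 (n2 f) z - n2 (n1 f) z = q1 z * e2 f z - r3 z * e1 f z"
    unfolding ex dc nd q1_def r3_def cm(3-6) by algebra
  show "n1 (e2 f) z - e2 (n1 f) z = - q1 z * n2 f z - r4 z * e1 f z"
    unfolding ex dc nd q1_def r4_def cm(3-6) by algebra
  show "e1 (n2 f) z - n2 (e1 f) z = q2 z * e2 f z + r3 z * n1 f z"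
    unfolding ex dc nd q2_def r3_def cm(3-6) by algebra
  show "e1 (e2 f) z - e2 (e1 f) z = - q2 z * n2 f z + r4 z * n1 f z"
    unfolding ex dc nd q2_def r4_def cm(3-6) by algebra
  show "n2 (e2 f) z - e2 (n2 f) z = - q3 z * n2 f z - q4 z * e2 f z"
    unfolding ex dc nd q3_def q4_def using cm(2)[THEN eq0] cs(2)[OF z, THEN eq0] by algebra
qed

text \<open>The 1-form c ds - s dc is closed when c^2 + s^2 = 1: the terms with first derivatives of
  both arguments cancel, and only the commutator of \<open>V\<close> and \<open>W\<close>
  remains.\<close>

lemma curvature_rot:
  assumes V: "derivation V" and W: "derivation W" and z: "z \<in> U"
  shows "V (rot W) z - W (rot V) z = c z * (V (W s) z - W (V s) z) - s z * (V (W c) z - W (V c) z)"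
    "V (rot' W) z - W (rot' V) z = c' z * (V (W s') z - W (V s') z) - s' z * (V (W c') z - W (V c') z)"
proof -
  have e: "A (rot B) z = (c z * A (B s) z + A c z * B s z) - (s z * A (B c) z + A s z * B c z) \<and>
     A (rot' B) z = (c' z * A (B s') z + A c' z * B s' z) - (s' z * A (B c') z + A s' z * B c' z)"
    if A: "derivation A" and B: "derivation B" for A B
    using hdD[OF hd_diff[OF A hd_mult[OF A hd_self hd_self] hd_mult[OF A hd_self hd_self]] z,
        OF S_cs(1) derivation_S[OF B S_cs(2)] S_cs(2) derivation_S[OF B S_cs(1)]]
      hdD[OF hd_diff[OF A hd_mult[OF A hd_self hd_self] hd_mult[OF A hd_self hd_self]] z,
        OF S_cs(3) derivation_S[OF B S_cs(4)] S_cs(4) derivation_S[OF B S_cs(3)]]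
    by (simp add: rot_def[abs_def] rot'_def[abs_def])
  note ex = e[OF V W] e[OF W V]
  note dc = deriv_cs[OF V z] deriv_cs[OF W z]
  show "V (rot W) z - W (rot V) z = c z * (V (W s) z - W (V s) z) - s z * (V (W c) z - W (V c) z)"
    using ex unfolding dc by algebra
  show "V (rot' W) z - W (rot' V) z = c' z * (V (W s') z - W (V s') z) - s' z * (V (W c') z - W (V c') z)"
    using ex unfolding dc by algebra
qed

lemma deriv_r:
  assumes V: "derivation V" and z: "z \<in> U"
  shows "V r1 z = V (rot n1) z + V c z" "V r2 z = V (rot e1) z - V s z" "V r3 z = V (rot n2) z" "V r4 z = V (rot e2) z"
    "V q1 z = V (rot' n1) z" "V q2 z = V (rot' e1) z" "V q3 z = V (rot' n2) z + V c' z" "V q4 z = V (rot' e2) z - V s' z"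
  using hdD[OF hd_add[OF V hd_self hd_self] z, OF S_rot(1)[OF ders(1)] S_cs(1)]
    hdD[OF hd_diff[OF V hd_self hd_self] z, OF S_rot(1)[OF ders(2)] S_cs(2)]
    hdD[OF hd_add[OF V hd_self hd_self] z, OF S_rot(2)[OF ders(3)] S_cs(3)]
    hdD[OF hd_diff[OF V hd_self hd_self] z, OF S_rot(2)[OF ders(4)] S_cs(4)]
  by (simp_all add: r1_def[abs_def] r2_def[abs_def] r3_def[abs_def] r4_def[abs_def] q1_def[abs_def]
      q2_def[abs_def] q3_def[abs_def] q4_def[abs_def])

lemma curvatures:
  assumes z: "z \<in> U"
  shows "n1 r2 z - e1 r1 z = - (r1 z)\<^sup>2 - (r2 z)\<^sup>2 + 1"
      "n1 r3 z - n2 r1 z = q1 z * r4 z - r3 z * r2 z"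
      "n1 r4 z - e2 r1 z = - q1 z * r3 z - r4 z * r2 z"
      "e1 r3 z - n2 r2 z = q2 z * r4 z + r3 z * r1 z"
      "e1 r4 z - e2 r2 z = - q2 z * r3 z + r4 z * r1 z"
      "n2 r4 z - e2 r3 z = - q3 z * r3 z - q4 z * r4 z"
      "n1 q2 z - e1 q1 z = - r1 z * q1 z - r2 z * q2 z"
      "n1 q3 z - n2 q1 z = q1 z * q4 z - r3 z * q2 z"
      "n1 q4 z - e2 q1 z = - q1 z * q3 z - r4 z * q2 z"
      "e1 q3 z - n2 q2 z = q2 z * q4 z + r3 z * q1 z"
      "e1 q4 z - e2 q2 z = - q2 z * q3 z + r4 z * q1 z"
      "n2 q4 z - e2 q3 z = - (q3 z)\<^sup>2 - (q4 z)\<^sup>2 + 1"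
proof -
  note eq0 = eq_iff_diff_eq_0[THEN iffD1]
  note u = cs(1)[OF z, THEN eq0] cs(2)[OF z, THEN eq0]
  note dr = deriv_r[OF ders(1) z] deriv_r[OF ders(2) z] deriv_r[OF ders(3) z] deriv_r[OF ders(4) z]
  note dc = deriv_cs[OF ders(1) z] deriv_cs[OF ders(2) z] deriv_cs[OF ders(3) z] deriv_cs[OF ders(4) z]
  note k = curvature_rot[OF _ _ z]
  note ck = commutators[OF S_cs(1) z] commutators[OF S_cs(2) z] commutators[OF S_cs(3) z] commutators[OF S_cs(4) z]
  note rd = r1_def[of z] r2_def[of z] r3_def[of z] r4_def[of z] q1_def[of z] q2_def[of z] q3_def[of z] q4_def[of z]
  show "n1 r2 z - e1 r1 z = - (r1 z)\<^sup>2 - (r2 z)\<^sup>2 + 1"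
    using k(1)[OF ders(1,2)] u unfolding dr ck dc rd by algebra
  show "n1 r3 z - n2 r1 z = q1 z * r4 z - r3 z * r2 z"
    using k(1)[OF ders(1,3)] u unfolding dr ck dc rd by algebra
  show "n1 r4 z - e2 r1 z = - q1 z * r3 z - r4 z * r2 z"
    using k(1)[OF ders(1,4)] u unfolding dr ck dc rd by algebra
  show "e1 r3 z - n2 r2 z = q2 z * r4 z + r3 z * r1 z"
    using k(1)[OF ders(2,3)] u unfolding dr ck dc rd by algebra
  show "e1 r4 z - e2 r2 z = - q2 z * r3 z + r4 z * r1 z"
    using k(1)[OF ders(2,4)] u unfolding dr ck dc rd by algebra
  show "n2 r4 z - e2 r3 z = - q3 z * r3 z - q4 z * r4 z"
    using k(1)[OF ders(3,4)] u unfolding dr ck dc rd by algebra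
  show "n1 q2 z - e1 q1 z = - r1 z * q1 z - r2 z * q2 z"
    using k(2)[OF ders(1,2)] u unfolding dr ck dc rd by algebra
  show "n1 q3 z - n2 q1 z = q1 z * q4 z - r3 z * q2 z"
    using k(2)[OF ders(1,3)] u unfolding dr ck dc rd by algebra
  show "n1 q4 z - e2 q1 z = - q1 z * q3 z - r4 z * q2 z"
    using k(2)[OF ders(1,4)] u unfolding dr ck dc rd by algebra
  show "e1 q3 z - n2 q2 z = q2 z * q4 z + r3 z * q1 z"
    using k(2)[OF ders(2,3)] u unfolding dr ck dc rd by algebra
  show "e1 q4 z - e2 q2 z = - q2 z * q3 z + r4 z * q1 z"
    using k(2)[OF ders(2,4)] u unfolding dr ck dc rd by algebra
  show "n2 q4 z - e2 q3 z = - (q3 z)\<^sup>2 - (q4 z)\<^sup>2 + 1"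
    using k(2)[OF ders(3,4)] u unfolding dr ck dc rd by algebra
qed

lemma grad_adapted:
  assumes z: "z \<in> U"
  shows "n1 d z = a z" "e1 d z = 0" "n2 d z = b z" "e2 d z = 0"
    "n1 H z = a z * H1 z" "e1 H z = 0" "n2 H z = b z * H1 z" "e2 H z = 0"
  unfolding n1_def e1_def n2_def e2_def gradH[OF z] grad[OF z]
  using cs[OF z, THEN eq_iff_diff_eq_0[THEN iffD1]] by (algebra | simp)+

text \<open>In \<open>lapl\<close> the term - X2 d comes from the covariant derivative of X1 along
  itself, which is X2, and likewise for Y2. Rotating the frame absorbs these terms into
  \<open>r2\<close> and \<open>q4\<close>.\<close>

lemma lap_adapted:
  assumes z: "z \<in> U"
  shows "H z = n1 a z + a z * r2 z + n2 b z + b z * q4 z"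
proof -
  have e: "V (X1 d) z = a z * V c z + V a z * c z" "V (X2 d) z = a z * V s z + V a z * s z"
    "V (Y1 d) z = b z * V c' z + V b z * c' z" "V (Y2 d) z = b z * V s' z + V b z * s' z" if V: "derivation V" for V
  proof -
    have S: "X1 d \<in> S" "X2 d \<in> S" "Y1 d \<in> S" "Y2 d \<in> S" using derXY derivation_S S_cs by auto
    note h = hd_mult[OF V hd_self hd_self]
    show "V (X1 d) z = a z * V c z + V a z * c z"
      by (rule hd_eq[OF V hd_self[OF S(1)] h[OF S_cs(5) S_cs(1)] grad(1) z])
    show "V (X2 d) z = a z * V s z + V a z * s z"
      by (rule hd_eq[OF V hd_self[OF S(2)] h[OF S_cs(5) S_cs(2)] grad(2) z])
    show "V (Y1 d) z = b z * V c' z + V b z * c' z"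
      by (rule hd_eq[OF V hd_self[OF S(3)] h[OF S_cs(6) S_cs(3)] grad(3) z])
    show "V (Y2 d) z = b z * V s' z + V b z * s' z"
      by (rule hd_eq[OF V hd_self[OF S(4)] h[OF S_cs(6) S_cs(4)] grad(4) z])
  qed
  note dc = deriv_cs[OF derXY(1) z] deriv_cs[OF derXY(2) z] deriv_cs[OF derXY(3) z] deriv_cs[OF derXY(4) z]
  have r: "rot e1 z = - s z * rot X1 z + c z * rot X2 z" "rot' e2 z = - s' z * rot' Y1 z + c' z * rot' Y2 z"
    unfolding rot_def rot'_def e1_def e2_def by algebra+
  show ?thesis
    unfolding lapl[OF z] e[OF derXY(1)] e[OF derXY(2)] e[OF derXY(3)] e[OF derXY(4)] dc grad[OF z]
      r2_def q4_def r n1_def n2_def by algebra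
qed

sublocale pos: positioned_frame U S n1 e1 n2 e2 r1 r2 r3 r4 q1 q2 q3 q4 a b d H H1 P v1 t1 Q v2 t2
proof
  show "r1 \<in> S" "r2 \<in> S" "r3 \<in> S" "r4 \<in> S" "q1 \<in> S" "q2 \<in> S" "q3 \<in> S" "q4 \<in> S"
    using S_rot[OF ders(1)] S_rot[OF ders(2)] S_rot[OF ders(3)] S_rot[OF ders(4)] S_cs
    by (auto simp: r1_def[abs_def] r2_def[abs_def] r3_def[abs_def] r4_def[abs_def] q1_def[abs_def]
      q2_def[abs_def] q3_def[abs_def] q4_def[abs_def])
  have vd: "v1 z $ i = c z * F1 z $ i + s z * F2 z $ i" "t1 z $ i = - s z * F1 z $ i + c z * F2 z $ i"
    "v2 z $ i = c' z * G1 z $ i + s' z * G2 z $ i" "t2 z $ i = - s' z * G1 z $ i + c' z * G2 z $ i" for z i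
    by (simp_all add: v1_def t1_def v2_def t2_def)
  have nV: "hd n1 f (\<lambda>z. c z * f1 z + s z * f2 z)" "hd e1 f (\<lambda>z. - s z * f1 z + c z * f2 z)"
    if "hd X1 f f1" "hd X2 f f2" for f f1 f2
    using that by (auto simp: hd_def n1_def e1_def)
  have nV': "hd n2 f (\<lambda>z. c' z * f1 z + s' z * f2 z)" "hd e2 f (\<lambda>z. - s' z * f1 z + c' z * f2 z)"
    if "hd Y1 f f1" "hd Y2 f f2" for f f1 f2
    using that by (auto simp: hd_def n2_def e2_def)
  fix i :: 3
  show "hd n1 (\<lambda>z. P z $ i) (\<lambda>z. v1 z $ i)" "hd e1 (\<lambda>z. P z $ i) (\<lambda>z. t1 z $ i)"
      "hd n2 (\<lambda>z. P z $ i) (\<lambda>_. 0)" "hd e2 (\<lambda>z. P z $ i) (\<lambda>_. 0)"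
    using nV[OF hd_P(1,2)] nV'[OF hd_P(3,4)] unfolding vd by simp_all
  show "hd n2 (\<lambda>z. Q z $ i) (\<lambda>z. v2 z $ i)" "hd e2 (\<lambda>z. Q z $ i) (\<lambda>z. t2 z $ i)"
      "hd n1 (\<lambda>z. Q z $ i) (\<lambda>_. 0)" "hd e1 (\<lambda>z. Q z $ i) (\<lambda>_. 0)"
    using nV'[OF hd_Q(1,2)] nV[OF hd_Q(3,4)] unfolding vd by simp_all
  have hdcs: "hd V c (\<lambda>z. - s z * rot V z)" "hd V s (\<lambda>z. c z * rot V z)"
    "hd V c' (\<lambda>z. - s' z * rot' V z)" "hd V s' (\<lambda>z. c' z * rot' V z)" if "derivation V" for V
    using deriv_cs[OF that] S_cs by (auto intro!: hdI)
  note rd = r1_def r2_def r3_def r4_def q1_def q2_def q3_def q4_def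
  have V: "hd V (\<lambda>z. v1 z $ i) (\<lambda>z. rot V z * t1 z $ i + c z * g1 z + s z * g2 z)"
    "hd V (\<lambda>z. t1 z $ i) (\<lambda>z. - rot V z * v1 z $ i - s z * g1 z + c z * g2 z)"
    if V: "derivation V" and g: "hd V (\<lambda>z. F1 z $ i) g1" "hd V (\<lambda>z. F2 z $ i) g2" for V g1 g2
    unfolding vd
    by (rule hd_cong, (rule hd_add hd_mult hd_uminus V g hdcs[OF V])+, simp add: algebra_simps)+
  have V': "hd V (\<lambda>z. v2 z $ i) (\<lambda>z. rot' V z * t2 z $ i + c' z * g1 z + s' z * g2 z)"
    "hd V (\<lambda>z. t2 z $ i) (\<lambda>z. - rot' V z * v2 z $ i - s' z * g1 z + c' z * g2 z)"
    if V: "derivation V" and g: "hd V (\<lambda>z. G1 z $ i) g1" "hd V (\<lambda>z. G2 z $ i) g2" for V g1 g2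
    unfolding vd
    by (rule hd_cong, (rule hd_add hd_mult hd_uminus V g hdcs[OF V])+, simp add: algebra_simps)+
  have alg: "x = y" if "(c z * c z + s z * s z - 1 = 0 \<Longrightarrow> c' z * c' z + s' z * s' z - 1 = 0 \<Longrightarrow> x = y)" "z \<in> U" for x y :: real and z
    using that cs[of z] by simp
  show "hd n1 (\<lambda>z. v1 z $ i) (\<lambda>z. r1 z * t1 z $ i + P z $ i)"
    by (rule hd_cong[OF V(1)[OF ders(1) nV(1)[OF hd_F1(1,2)] nV(1)[OF hd_F2(1,2)]]], unfold rd vd, erule alg[rotated], (algebra | simp add: algebra_simps))
  show "hd e1 (\<lambda>z. v1 z $ i) (\<lambda>z. r2 z * t1 z $ i)"
    by (rule hd_cong[OF V(1)[OF ders(2) nV(2)[OF hd_F1(1,2)] nV(2)[OF hd_F2(1,2)]]], unfold rd vd, erule alg[rotated], (algebra | simp add: algebra_simps))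
  show "hd n1 (\<lambda>z. t1 z $ i) (\<lambda>z. - r1 z * v1 z $ i)"
    by (rule hd_cong[OF V(2)[OF ders(1) nV(1)[OF hd_F1(1,2)] nV(1)[OF hd_F2(1,2)]]], unfold rd vd, erule alg[rotated], (algebra | simp add: algebra_simps))
  show "hd e1 (\<lambda>z. t1 z $ i) (\<lambda>z. - r2 z * v1 z $ i + P z $ i)"
    by (rule hd_cong[OF V(2)[OF ders(2) nV(2)[OF hd_F1(1,2)] nV(2)[OF hd_F2(1,2)]]], unfold rd vd, erule alg[rotated], (algebra | simp add: algebra_simps))
  show "hd n2 (\<lambda>z. v1 z $ i) (\<lambda>z. r3 z * t1 z $ i)" "hd e2 (\<lambda>z. v1 z $ i) (\<lambda>z. r4 z * t1 z $ i)"
      "hd n2 (\<lambda>z. t1 z $ i) (\<lambda>z. - r3 z * v1 z $ i)" "hd e2 (\<lambda>z. t1 z $ i) (\<lambda>z. - r4 z * v1 z $ i)"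
    using V[OF ders(3) nV'(1)[OF hd_F1(3,4)] nV'(1)[OF hd_F2(3,4)]] V[OF ders(4) nV'(2)[OF hd_F1(3,4)] nV'(2)[OF hd_F2(3,4)]]
    unfolding rd by simp_all
  show "hd n2 (\<lambda>z. v2 z $ i) (\<lambda>z. q3 z * t2 z $ i + Q z $ i)"
    by (rule hd_cong[OF V'(1)[OF ders(3) nV'(1)[OF hd_G1(1,2)] nV'(1)[OF hd_G2(1,2)]]], unfold rd vd, erule alg[rotated], (algebra | simp add: algebra_simps))
  show "hd e2 (\<lambda>z. v2 z $ i) (\<lambda>z. q4 z * t2 z $ i)"
    by (rule hd_cong[OF V'(1)[OF ders(4) nV'(2)[OF hd_G1(1,2)] nV'(2)[OF hd_G2(1,2)]]], unfold rd vd, erule alg[rotated], (algebra | simp add: algebra_simps))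
  show "hd n2 (\<lambda>z. t2 z $ i) (\<lambda>z. - q3 z * v2 z $ i)"
    by (rule hd_cong[OF V'(2)[OF ders(3) nV'(1)[OF hd_G1(1,2)] nV'(1)[OF hd_G2(1,2)]]], unfold rd vd, erule alg[rotated], (algebra | simp add: algebra_simps))
  show "hd e2 (\<lambda>z. t2 z $ i) (\<lambda>z. - q4 z * v2 z $ i + Q z $ i)"
    by (rule hd_cong[OF V'(2)[OF ders(4) nV'(2)[OF hd_G1(1,2)] nV'(2)[OF hd_G2(1,2)]]], unfold rd vd, erule alg[rotated], (algebra | simp add: algebra_simps))
  show "hd n1 (\<lambda>z. v2 z $ i) (\<lambda>z. q1 z * t2 z $ i)" "hd e1 (\<lambda>z. v2 z $ i) (\<lambda>z. q2 z * t2 z $ i)"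
      "hd n1 (\<lambda>z. t2 z $ i) (\<lambda>z. - q1 z * v2 z $ i)" "hd e1 (\<lambda>z. t2 z $ i) (\<lambda>z. - q2 z * v2 z $ i)"
    using V'[OF ders(1) nV(1)[OF hd_G1(3,4)] nV(1)[OF hd_G2(3,4)]] V'[OF ders(2) nV(2)[OF hd_G1(3,4)] nV(2)[OF hd_G2(3,4)]]
    unfolding rd by simp_all
next
  fix z assume z: "z \<in> U"
  have ex: "lorentz_onb p (x *\<^sub>R f + y *\<^sub>R g) (- y *\<^sub>R f + x *\<^sub>R g)" if "lorentz_onb p f g" "x * x + y * y = 1" for p f g x y
    using that unfolding lorentz_onb_def lor_simps by (simp add: lor_commute[of g f] algebra_simps)
  show "lorentz_onb (P z) (v1 z) (t1 z)" "lorentz_onb (Q z) (v2 z) (t2 z)"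
    unfolding v1_def t1_def v2_def t2_def using ex[OF onbXY(1) cs(1)[OF z]] ex[OF onbXY(2) cs(2)[OF z]] by auto
qed (erule (1) commutators | erule curvatures grad_adapted ab1 lap_adapted | rule ders S_cs onbXY)+

end

section \<open>The ring of smooth functions and the invariant fields on the parameter space\<close>

type_synonym pt = "(real \<times> real) \<times> (real \<times> real)"

lemma smooth_on_const: "open W \<Longrightarrow> smooth_on W (\<lambda>_. k)"
  by (simp add: smooth_on_def C_k_const)

lemma smooth_on_add: "open W \<Longrightarrow> smooth_on W f \<Longrightarrow> smooth_on W g \<Longrightarrow> smooth_on W (\<lambda>z. f z + g z)"
  by (simp add: smooth_on_def C_k_add)

lemma smooth_on_mult:
  fixes f g :: "'a::real_normed_vector \<Rightarrow> real"
  shows "open W \<Longrightarrow> smooth_on W f \<Longrightarrow> smooth_on W g \<Longrightarrow> smooth_on W (\<lambda>z. f z * g z)"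
  by (simp add: smooth_on_def C_k_mult)

lemma smooth_on_compose:
  fixes f :: "'a::real_normed_vector \<Rightarrow> 'b::euclidean_space"
  shows "open W \<Longrightarrow> open V \<Longrightarrow> f ` W \<subseteq> V \<Longrightarrow> smooth_on W f \<Longrightarrow> smooth_on V g \<Longrightarrow> smooth_on W (\<lambda>x. g (f x))"
  by (simp add: smooth_on_def C_k_compose)

lemma smooth_on_linear: "open W \<Longrightarrow> bounded_linear f \<Longrightarrow> smooth_on W f"
  using C_k_bounded_linear[OF _ _ C_k_ident, of W f] by (simp add: smooth_on_def)

lemma smooth_on_mono: "smooth_on W f \<Longrightarrow> V \<subseteq> W \<Longrightarrow> smooth_on V f"
  by (auto simp: smooth_on_def intro: C_k_mono)

lemma smooth_on_cong: "open W \<Longrightarrow> (\<And>y. y \<in> W \<Longrightarrow> f y = g y) \<Longrightarrow> smooth_on W f \<Longrightarrow> smooth_on W g"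
  unfolding smooth_on_def using C_k_cong by metis

lemma smooth_on_frechet: "smooth_on W f \<Longrightarrow> smooth_on W (\<lambda>z. frechet_derivative f (at z) v)"
  unfolding smooth_on_def
proof
  fix n assume "\<forall>n. C_k n W f"
  then have "C_k (Suc n) W f" by blast
  then show "C_k n W (\<lambda>z. frechet_derivative f (at z) v)" by simp
qed

lemma smooth_on_has_derivative:
  "open W \<Longrightarrow> smooth_on W f \<Longrightarrow> z \<in> W \<Longrightarrow> (f has_derivative frechet_derivative f (at z)) (at z)"
  unfolding smooth_on_def using C_k_SucD by metis

lemma smooth_on_powr:
  fixes f :: "'a::real_normed_vector \<Rightarrow> real"
  assumes "open W" "smooth_on W f" "\<And>z. z \<in> W \<Longrightarrow> 0 < f z"
  shows "smooth_on W (\<lambda>z. f z powr r)"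
  by (rule smooth_on_compose[OF assms(1), of "{0<..}" f "\<lambda>x. x powr r"])
    (use assms C_k_powr in \<open>auto simp: smooth_on_def\<close>)

lemma smooth_on_exp:
  fixes f :: "'a::real_normed_vector \<Rightarrow> real"
  assumes "open W" "smooth_on W f"
  shows "smooth_on W (\<lambda>z. exp (f z))"
  by (rule smooth_on_compose[OF assms(1), of UNIV f exp])
    (use assms C_k_exp in \<open>auto simp: smooth_on_def\<close>)

definition Sm :: "pt set \<Rightarrow> (pt \<Rightarrow> real) set" where
  "Sm U = {w. smooth_on U w}"

lemma function_ring_Sm:
  assumes "open U" shows "function_ring U (Sm U)"
proof
  fix f assume f: "f \<in> Sm U" "\<And>z. z \<in> U \<Longrightarrow> 0 < f z"
  have "smooth_on U (\<lambda>z. f z powr (-1))" by (rule smooth_on_powr[OF assms]) (use f in \<open>simp_all add: Sm_def\<close>)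
  then have "smooth_on U (\<lambda>z. inverse (f z))"
  proof (rule smooth_on_cong[OF assms, rotated])
    fix z assume "z \<in> U"
    then have "0 < f z" by (rule f(2))
    then show "f z powr - 1 = inverse (f z)" by (simp add: powr_minus)
  qed
  then show "(\<lambda>z. inverse (f z)) \<in> Sm U" by (simp add: Sm_def)
qed (use assms in \<open>auto simp: Sm_def intro: smooth_on_const smooth_on_add smooth_on_mult\<close>)

lemma derivation_frechet:
  assumes U: "open U"
  shows "function_ring.derivation U (Sm U) (\<lambda>w z. frechet_derivative w (at z) v)"
proof -
  interpret function_ring U "Sm U" by (rule function_ring_Sm[OF U])
  have hd: "(f has_derivative frechet_derivative f (at z)) (at z)" if "f \<in> Sm U" "z \<in> U" for f z
    using smooth_on_has_derivative[OF U, of f z] that by (simp add: Sm_def)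
  have eq: "frechet_derivative f (at z) v = f' v" if "(f has_derivative f') (at z)" for f :: "pt \<Rightarrow> real" and f' z
    using frechet_derivative_at[OF that] by simp
  show ?thesis unfolding derivation_def
  proof (intro conjI ballI allI impI)
    fix f g z assume f: "f \<in> Sm U" and g: "g \<in> Sm U" and z: "z \<in> U"
    show "frechet_derivative (\<lambda>z. f z + g z) (at z) v = frechet_derivative f (at z) v + frechet_derivative g (at z) v"
      by (rule eq[OF has_derivative_add[OF hd[OF f z] hd[OF g z]]])
    show "frechet_derivative (\<lambda>z. f z * g z) (at z) v
        = f z * frechet_derivative g (at z) v + frechet_derivative f (at z) v * g z"
      by (rule eq[OF has_derivative_mult[OF hd[OF f z] hd[OF g z]]])
    assume "\<forall>z\<in>U. f z = g z"
    then show "frechet_derivative f (at z) v = frechet_derivative g (at z) v"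
      using frechet_derivative_cong_open[OF U z, of f g] by simp
  qed (auto simp: Sm_def smooth_on_frechet frechet_derivative_const)
qed

text \<open>In coordinates (x, t) the metric of the hyperbolic plane is dt^2 + e^(-2t) dx^2, so e^t
  d/dx and d/dt are orthonormal. Their commutator is - X1, the relation of the affine group.\<close>

definition "X1 w z = exp (snd (fst z)) * frechet_derivative w (at z) ((1, 0), (0, 0))" for w :: "pt \<Rightarrow> real"
definition "X2 w z = frechet_derivative w (at z) ((0, 1), (0, 0))" for w :: "pt \<Rightarrow> real"
definition "Y1 w z = exp (snd (snd z)) * frechet_derivative w (at z) ((0, 0), (1, 0))" for w :: "pt \<Rightarrow> real"
definition "Y2 w z = frechet_derivative w (at z) ((0, 0), (0, 1))" for w :: "pt \<Rightarrow> real"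

text \<open>Horospherical coordinates: for fixed t the points hp (x, t) form a horocycle.\<close>

definition hp :: "real \<times> real \<Rightarrow> real^3" where
  "hp y = vector [(exp (snd y) + (1 + (fst y)\<^sup>2) * exp (- snd y)) / 2, fst y * exp (- snd y),
     (exp (snd y) + ((fst y)\<^sup>2 - 1) * exp (- snd y)) / 2]"

definition hf1 :: "real \<times> real \<Rightarrow> real^3" where
  "hf1 y = vector [fst y, 1, fst y]"

definition hf2 :: "real \<times> real \<Rightarrow> real^3" where
  "hf2 y = vector [(exp (snd y) - (1 + (fst y)\<^sup>2) * exp (- snd y)) / 2, - (fst y * exp (- snd y)),
     (exp (snd y) - ((fst y)\<^sup>2 - 1) * exp (- snd y)) / 2]"

lemma hp_nth: "hp y $ 1 = (exp (snd y) + (1 + (fst y)\<^sup>2) * exp (- snd y)) / 2" "hp y $ 2 = fst y * exp (- snd y)"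
    "hp y $ 3 = (exp (snd y) + ((fst y)\<^sup>2 - 1) * exp (- snd y)) / 2"
  and hf1_nth: "hf1 y $ 1 = fst y" "hf1 y $ 2 = 1" "hf1 y $ 3 = fst y"
  and hf2_nth: "hf2 y $ 1 = (exp (snd y) - (1 + (fst y)\<^sup>2) * exp (- snd y)) / 2" "hf2 y $ 2 = - (fst y * exp (- snd y))"
    "hf2 y $ 3 = (exp (snd y) - ((fst y)\<^sup>2 - 1) * exp (- snd y)) / 2"
  by (simp_all add: hp_def hf1_def hf2_def)

lemma lorentz_onb_chart: "lorentz_onb (hp y) (hf1 y) (hf2 y)"
proof -
  \<comment> \<open>In terms of the halved exponentials all components are polynomials, and 4 E e =
    1 is the only relation the verification needs.\<close>
  define E e where "E = exp (snd y) / 2" and "e = exp (- snd y) / 2"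
  have Ee: "4 * E * e - 1 = 0" by (simp add: E_def e_def exp_add[symmetric])
  have n: "hp y $ 1 = E + (1 + (fst y)\<^sup>2) * e" "hp y $ 2 = 2 * fst y * e" "hp y $ 3 = E + ((fst y)\<^sup>2 - 1) * e"
    "hf2 y $ 1 = E - (1 + (fst y)\<^sup>2) * e" "hf2 y $ 2 = - (2 * fst y * e)" "hf2 y $ 3 = E - ((fst y)\<^sup>2 - 1) * e"
    by (simp_all add: hp_nth hf2_nth E_def e_def field_simps)
  show ?thesis
    unfolding lorentz_onb_def lor_def n hf1_nth
    by (intro conjI; (use Ee in algebra | simp add: algebra_simps power2_eq_square))
qed

lemma hp_in_H2: "hp y \<in> H2"
proof -
  have "0 < hp y $ 1" unfolding hp_nth by (intro divide_pos_pos add_pos_nonneg mult_nonneg_nonneg) auto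
  then show ?thesis using lorentz_onb_chart[of y] by (simp add: H2_def lorentz_onb_def)
qed

text \<open>All components of the frame are polynomials in the horizontal coordinates and the
  exponentials of plus and minus the vertical ones. Their four derivatives, collected in
  \<open>B\<close>, determine everything else by the rules for \<open>hd\<close>.\<close>

lemma group_frame_chart:
  assumes U: "open U"
  shows "group_frame U (Sm U) X1 X2 Y1 Y2 (\<lambda>z. hp (fst z)) (\<lambda>z. hf1 (fst z)) (\<lambda>z. hf2 (fst z))
    (\<lambda>z. hp (snd z)) (\<lambda>z. hf1 (snd z)) (\<lambda>z. hf2 (snd z))"
proof -
  interpret function_ring U "Sm U" by (rule function_ring_Sm[OF U])
  define ep :: "pt \<Rightarrow> real" where "ep z = exp (snd (fst z))" for z
  define em :: "pt \<Rightarrow> real" where "em z = exp (- snd (fst z))" for z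
  define fp :: "pt \<Rightarrow> real" where "fp z = exp (snd (snd z))" for z
  define fm :: "pt \<Rightarrow> real" where "fm z = exp (- snd (snd z))" for z
  define xx :: "pt \<Rightarrow> real" where "xx z = fst (fst z)" for z
  define yy :: "pt \<Rightarrow> real" where "yy z = fst (snd z)" for z
  have lin: "bounded_linear (\<lambda>z::pt. fst (fst z))" "bounded_linear (\<lambda>z::pt. snd (fst z))"
    "bounded_linear (\<lambda>z::pt. fst (snd z))" "bounded_linear (\<lambda>z::pt. snd (snd z))"
    "bounded_linear (\<lambda>z::pt. - snd (fst z))" "bounded_linear (\<lambda>z::pt. - snd (snd z))"
    by (intro bounded_linear_minus bounded_linear_compose[OF bounded_linear_fst bounded_linear_fst]
      bounded_linear_compose[OF bounded_linear_snd bounded_linear_fst]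
      bounded_linear_compose[OF bounded_linear_fst bounded_linear_snd]
      bounded_linear_compose[OF bounded_linear_snd bounded_linear_snd])+
  have S: "ep \<in> Sm U" "em \<in> Sm U" "fp \<in> Sm U" "fm \<in> Sm U" "xx \<in> Sm U" "yy \<in> Sm U"
    unfolding Sm_def ep_def[abs_def] em_def[abs_def] fp_def[abs_def] fm_def[abs_def] xx_def[abs_def] yy_def[abs_def]
    using smooth_on_exp[OF U smooth_on_linear[OF U lin(2)]] smooth_on_exp[OF U smooth_on_linear[OF U lin(5)]]
      smooth_on_exp[OF U smooth_on_linear[OF U lin(4)]] smooth_on_exp[OF U smooth_on_linear[OF U lin(6)]]
      smooth_on_linear[OF U lin(1)] smooth_on_linear[OF U lin(3)] by simp_all
  have D: "frechet_derivative ep (at z) v = ep z * snd (fst v)" "frechet_derivative em (at z) v = - (em z * snd (fst v))"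
    "frechet_derivative fp (at z) v = fp z * snd (snd v)" "frechet_derivative fm (at z) v = - (fm z * snd (snd v))"
    "frechet_derivative xx (at z) v = fst (fst v)" "frechet_derivative yy (at z) v = fst (snd v)" for z v :: pt
  proof -
    have eq: "frechet_derivative f (at z) v = f' v" if "(f has_derivative f') (at z)" for f :: "pt \<Rightarrow> real" and f'
      using frechet_derivative_at[OF that] by simp
    show "frechet_derivative ep (at z) v = ep z * snd (fst v)"
      by (rule eq) (auto simp: ep_def[abs_def] intro!: derivative_eq_intros)
    show "frechet_derivative em (at z) v = - (em z * snd (fst v))"
      by (rule eq) (auto simp: em_def[abs_def] intro!: derivative_eq_intros)
    show "frechet_derivative fp (at z) v = fp z * snd (snd v)"
      by (rule eq) (auto simp: fp_def[abs_def] intro!: derivative_eq_intros)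
    show "frechet_derivative fm (at z) v = - (fm z * snd (snd v))"
      by (rule eq) (auto simp: fm_def[abs_def] intro!: derivative_eq_intros)
    show "frechet_derivative xx (at z) v = fst (fst v)"
      by (rule eq) (auto simp: xx_def[abs_def] intro!: derivative_eq_intros)
    show "frechet_derivative yy (at z) v = fst (snd v)"
      by (rule eq) (auto simp: yy_def[abs_def] intro!: derivative_eq_intros)
  qed
  have pq0: "ep z * em z = 1" "fp z * fm z = 1" for z
    by (simp_all add: ep_def em_def fp_def fm_def exp_add[symmetric])
  have pq: "ep z * em z = 1" "fp z * fm z = 1" "em z * ep z = 1" "fm z * fp z = 1"
    "ep z * (em z * x) = x" "fp z * (fm z * x) = x" "em z * (ep z * x) = x" "fm z * (fp z * x) = x" for z x
    using pq0[of z] pq0[of z, THEN arg_cong[of _ _ "\<lambda>y. y * x"]] by (simp_all add: ac_simps)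
  have B: "hd X1 xx ep" "hd X2 xx (\<lambda>_. 0)" "hd Y1 xx (\<lambda>_. 0)" "hd Y2 xx (\<lambda>_. 0)"
    "hd X1 ep (\<lambda>_. 0)" "hd X2 ep ep" "hd Y1 ep (\<lambda>_. 0)" "hd Y2 ep (\<lambda>_. 0)"
    "hd X1 em (\<lambda>_. 0)" "hd X2 em (\<lambda>z. - em z)" "hd Y1 em (\<lambda>_. 0)" "hd Y2 em (\<lambda>_. 0)"
    "hd Y1 yy fp" "hd Y2 yy (\<lambda>_. 0)" "hd X1 yy (\<lambda>_. 0)" "hd X2 yy (\<lambda>_. 0)"
    "hd Y1 fp (\<lambda>_. 0)" "hd Y2 fp fp" "hd X1 fp (\<lambda>_. 0)" "hd X2 fp (\<lambda>_. 0)"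
    "hd Y1 fm (\<lambda>_. 0)" "hd Y2 fm (\<lambda>z. - fm z)" "hd X1 fm (\<lambda>_. 0)" "hd X2 fm (\<lambda>_. 0)"
    by (rule hdI; simp add: S D X1_def X2_def Y1_def Y2_def; simp add: ep_def fp_def)+
  have der: "derivation X1" "derivation X2" "derivation Y1" "derivation Y2"
  proof -
    note d = derivation_frechet[OF U]
    show "derivation X1"
      using derivation_comb[OF d[of "((1,0),(0,0))"] d[of "((1,0),(0,0))"] S(1) S_const[of 0]]
      by (simp add: X1_def[abs_def] ep_def)
    show "derivation Y1"
      using derivation_comb[OF d[of "((0,0),(1,0))"] d[of "((0,0),(1,0))"] S(3) S_const[of 0]]
      by (simp add: Y1_def[abs_def] fp_def)
    show "derivation X2" "derivation Y2" using d by (simp_all add: X2_def[abs_def] Y2_def[abs_def])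
  qed
  have c: "hp (fst z) $ 1 = 1/2 * (ep z + (1 + xx z * xx z) * em z)" "hp (fst z) $ 2 = xx z * em z"
    "hp (fst z) $ 3 = 1/2 * (ep z + (xx z * xx z - 1) * em z)"
    "hf1 (fst z) $ 1 = xx z" "hf1 (fst z) $ 2 = 1" "hf1 (fst z) $ 3 = xx z"
    "hf2 (fst z) $ 1 = 1/2 * (ep z - (1 + xx z * xx z) * em z)" "hf2 (fst z) $ 2 = - (xx z * em z)"
    "hf2 (fst z) $ 3 = 1/2 * (ep z - (xx z * xx z - 1) * em z)"
    "hp (snd z) $ 1 = 1/2 * (fp z + (1 + yy z * yy z) * fm z)" "hp (snd z) $ 2 = yy z * fm z"
    "hp (snd z) $ 3 = 1/2 * (fp z + (yy z * yy z - 1) * fm z)"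
    "hf1 (snd z) $ 1 = yy z" "hf1 (snd z) $ 2 = 1" "hf1 (snd z) $ 3 = yy z"
    "hf2 (snd z) $ 1 = 1/2 * (fp z - (1 + yy z * yy z) * fm z)" "hf2 (snd z) $ 2 = - (yy z * fm z)"
    "hf2 (snd z) $ 3 = 1/2 * (fp z - (yy z * yy z - 1) * fm z)" for z
    by (simp_all add: hp_nth hf1_nth hf2_nth ep_def em_def fp_def fm_def xx_def yy_def power2_eq_square)
  have C2: "C_k 2 U f" if "f \<in> Sm U" for f using that by (simp add: Sm_def smooth_on_def)
  \<comment> \<open>Coordinate derivatives commute by \<open>C_2_symmetric\<close>; the commutator -
    X1 then comes solely from the factor e^t in X1, as - Y1 does from the factor in Y1.\<close>
  have sw: "frechet_derivative (\<lambda>y. frechet_derivative f (at y) v) (at z) w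
       = frechet_derivative (\<lambda>y. frechet_derivative f (at y) w) (at z) v" if "f \<in> Sm U" "z \<in> U" for f v w z
    using C_2_symmetric[OF U C2] that by blast
  have Sf: "(\<lambda>y. frechet_derivative f (at y) v) \<in> Sm U" if "f \<in> Sm U" for f v
    using that by (simp add: Sm_def smooth_on_frechet)
  have mX: "frechet_derivative (X1 f) (at z) w = ep z * frechet_derivative (\<lambda>y. frechet_derivative f (at y) ((1,0),(0,0))) (at z) w
        + ep z * snd (fst w) * frechet_derivative f (at z) ((1,0),(0,0))"
      "frechet_derivative (Y1 f) (at z) w = fp z * frechet_derivative (\<lambda>y. frechet_derivative f (at y) ((0,0),(1,0))) (at z) w
        + fp z * snd (snd w) * frechet_derivative f (at z) ((0,0),(1,0))" if "f \<in> Sm U" "z \<in> U" for f w z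
    using hdD[OF hd_mult[OF derivation_frechet[OF U, of w] hd_self[OF S(1)]
          hd_self[OF Sf[OF that(1), of "((1,0),(0,0))"]]] that(2)]
      hdD[OF hd_mult[OF derivation_frechet[OF U, of w] hd_self[OF S(3)]
          hd_self[OF Sf[OF that(1), of "((0,0),(1,0))"]]] that(2)]
    by (simp_all add: X1_def[abs_def] Y1_def[abs_def] ep_def[symmetric] fp_def[symmetric] D)
  have X2': "X2 f = (\<lambda>y. frechet_derivative f (at y) ((0,1),(0,0)))" "Y2 f = (\<lambda>y. frechet_derivative f (at y) ((0,0),(0,1)))" for f
    by (simp_all add: X2_def[abs_def] Y2_def[abs_def])
  have X1': "X1 f z = ep z * frechet_derivative f (at z) ((1,0),(0,0))" "Y1 f z = fp z * frechet_derivative f (at z) ((0,0),(1,0))" for f z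
    by (simp_all add: X1_def Y1_def ep_def fp_def)
  show ?thesis
  proof
    fix f z assume fz: "f \<in> Sm U" "z \<in> U"
    note s1 = sw[OF fz, of "((1,0),(0,0))"] sw[OF fz, of "((0,1),(0,0))" "((0,0),(1,0))"]
      sw[OF fz, of "((0,1),(0,0))" "((0,0),(0,1))"] sw[OF fz, of "((0,0),(1,0))" "((0,0),(0,1))"]
    show "X1 (X2 f) z - X2 (X1 f) z = - X1 f z" "Y1 (Y2 f) z - Y2 (Y1 f) z = - Y1 f z"
      "X1 (Y1 f) z = Y1 (X1 f) z" "X1 (Y2 f) z = Y2 (X1 f) z"
      "X2 (Y1 f) z = Y1 (X2 f) z" "X2 (Y2 f) z = Y2 (X2 f) z"
      unfolding X1' X2' mX[OF fz] s1 by simp_all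
  next
    have hds:
      "\<forall>i. hd X1 (\<lambda>z. hp (fst z) $ i) (\<lambda>z. hf1 (fst z) $ i)"
      "\<forall>i. hd X2 (\<lambda>z. hp (fst z) $ i) (\<lambda>z. hf2 (fst z) $ i)"
      "\<forall>i. hd Y1 (\<lambda>z. hp (fst z) $ i) (\<lambda>_. 0)"
      "\<forall>i. hd Y2 (\<lambda>z. hp (fst z) $ i) (\<lambda>_. 0)"
      "\<forall>i. hd X1 (\<lambda>z. hf1 (fst z) $ i) (\<lambda>z. hf2 (fst z) $ i + hp (fst z) $ i)"
      "\<forall>i. hd X2 (\<lambda>z. hf1 (fst z) $ i) (\<lambda>_. 0)"
      "\<forall>i. hd Y1 (\<lambda>z. hf1 (fst z) $ i) (\<lambda>_. 0)"
      "\<forall>i. hd Y2 (\<lambda>z. hf1 (fst z) $ i) (\<lambda>_. 0)"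
      "\<forall>i. hd X1 (\<lambda>z. hf2 (fst z) $ i) (\<lambda>z. - hf1 (fst z) $ i)"
      "\<forall>i. hd X2 (\<lambda>z. hf2 (fst z) $ i) (\<lambda>z. hp (fst z) $ i)"
      "\<forall>i. hd Y1 (\<lambda>z. hf2 (fst z) $ i) (\<lambda>_. 0)"
      "\<forall>i. hd Y2 (\<lambda>z. hf2 (fst z) $ i) (\<lambda>_. 0)"
      "\<forall>i. hd Y1 (\<lambda>z. hp (snd z) $ i) (\<lambda>z. hf1 (snd z) $ i)"
      "\<forall>i. hd Y2 (\<lambda>z. hp (snd z) $ i) (\<lambda>z. hf2 (snd z) $ i)"
      "\<forall>i. hd X1 (\<lambda>z. hp (snd z) $ i) (\<lambda>_. 0)"
      "\<forall>i. hd X2 (\<lambda>z. hp (snd z) $ i) (\<lambda>_. 0)"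
      "\<forall>i. hd Y1 (\<lambda>z. hf1 (snd z) $ i) (\<lambda>z. hf2 (snd z) $ i + hp (snd z) $ i)"
      "\<forall>i. hd Y2 (\<lambda>z. hf1 (snd z) $ i) (\<lambda>_. 0)"
      "\<forall>i. hd X1 (\<lambda>z. hf1 (snd z) $ i) (\<lambda>_. 0)"
      "\<forall>i. hd X2 (\<lambda>z. hf1 (snd z) $ i) (\<lambda>_. 0)"
      "\<forall>i. hd Y1 (\<lambda>z. hf2 (snd z) $ i) (\<lambda>z. - hf1 (snd z) $ i)"
      "\<forall>i. hd Y2 (\<lambda>z. hf2 (snd z) $ i) (\<lambda>z. hp (snd z) $ i)"
      "\<forall>i. hd X1 (\<lambda>z. hf2 (snd z) $ i) (\<lambda>_. 0)"
      "\<forall>i. hd X2 (\<lambda>z. hf2 (snd z) $ i) (\<lambda>_. 0)"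
      by (unfold forall_3 c, (intro conjI | (rule hd_cong, (rule hd_const hd_add hd_diff hd_mult hd_uminus der B)+,
          (simp add: algebra_simps pq; fail | simp add: field_simps pq; fail | algebra)))+)
    fix i :: 3
    show "hd X1 (\<lambda>z. hp (fst z) $ i) (\<lambda>z. hf1 (fst z) $ i)"
      "hd X2 (\<lambda>z. hp (fst z) $ i) (\<lambda>z. hf2 (fst z) $ i)"
      "hd Y1 (\<lambda>z. hp (fst z) $ i) (\<lambda>_. 0)"
      "hd Y2 (\<lambda>z. hp (fst z) $ i) (\<lambda>_. 0)"
      "hd X1 (\<lambda>z. hf1 (fst z) $ i) (\<lambda>z. hf2 (fst z) $ i + hp (fst z) $ i)"
      "hd X2 (\<lambda>z. hf1 (fst z) $ i) (\<lambda>_. 0)"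
      "hd Y1 (\<lambda>z. hf1 (fst z) $ i) (\<lambda>_. 0)"
      "hd Y2 (\<lambda>z. hf1 (fst z) $ i) (\<lambda>_. 0)"
      "hd X1 (\<lambda>z. hf2 (fst z) $ i) (\<lambda>z. - hf1 (fst z) $ i)"
      "hd X2 (\<lambda>z. hf2 (fst z) $ i) (\<lambda>z. hp (fst z) $ i)"
      "hd Y1 (\<lambda>z. hf2 (fst z) $ i) (\<lambda>_. 0)"
      "hd Y2 (\<lambda>z. hf2 (fst z) $ i) (\<lambda>_. 0)"
      "hd Y1 (\<lambda>z. hp (snd z) $ i) (\<lambda>z. hf1 (snd z) $ i)"
      "hd Y2 (\<lambda>z. hp (snd z) $ i) (\<lambda>z. hf2 (snd z) $ i)"
      "hd X1 (\<lambda>z. hp (snd z) $ i) (\<lambda>_. 0)"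
      "hd X2 (\<lambda>z. hp (snd z) $ i) (\<lambda>_. 0)"
      "hd Y1 (\<lambda>z. hf1 (snd z) $ i) (\<lambda>z. hf2 (snd z) $ i + hp (snd z) $ i)"
      "hd Y2 (\<lambda>z. hf1 (snd z) $ i) (\<lambda>_. 0)"
      "hd X1 (\<lambda>z. hf1 (snd z) $ i) (\<lambda>_. 0)"
      "hd X2 (\<lambda>z. hf1 (snd z) $ i) (\<lambda>_. 0)"
      "hd Y1 (\<lambda>z. hf2 (snd z) $ i) (\<lambda>z. - hf1 (snd z) $ i)"
      "hd Y2 (\<lambda>z. hf2 (snd z) $ i) (\<lambda>z. hp (snd z) $ i)"
      "hd X1 (\<lambda>z. hf2 (snd z) $ i) (\<lambda>_. 0)"
      "hd X2 (\<lambda>z. hf2 (snd z) $ i) (\<lambda>_. 0)"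
      by (rule hds[rule_format])+
  qed (use der hp_in_H2 lorentz_onb_chart in \<open>auto simp: H2_def\<close>)
qed

section \<open>Gradient and Laplacian of the product expressed in the chart\<close>

lemma lorentz_onb_expand:
  assumes "lorentz_onb p f t"
  shows "v = (- lor v p) *\<^sub>R p + lor v f *\<^sub>R f + lor v t *\<^sub>R t"
proof -
  define M :: "real^3^3" where "M = (\<chi> i j. if j = 1 then p$i else if j = 2 then f$i else t$i)"
  \<comment> \<open>\<open>N\<close> is the Lorentz adjoint of the matrix \<open>M\<close> with
    columns \<open>p\<close>, \<open>f\<close>, \<open>t\<close>. Orthonormality says that it is a
    left inverse; the expansion needs it as a right inverse, which is the same for square
    matrices.\<close>
  define N :: "real^3^3" where "N = (\<chi> i j. (if i = 1 then -1 else 1) * (if j = 1 then -1 else 1) * M$j$i)"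
  have "N ** M = mat 1"
    using assms unfolding lorentz_onb_def lor_def
    by (simp add: vec_eq_iff matrix_matrix_mult_def sum_3 N_def M_def mat_def forall_3 algebra_simps)
  then have "M ** N = mat 1" by (simp add: matrix_left_right_inverse)
  then have "v = M *v (N *v v)" by (simp add: matrix_vector_mul_assoc)
  then show ?thesis
    by (simp add: vec_eq_iff matrix_vector_mult_def sum_3 N_def M_def forall_3 lor_def algebra_simps)
qed

text \<open>\<open>tb\<close> chooses an unspecified orthonormal basis, so \<open>grad_sq\<close>
  and \<open>lap\<close> can be compared with the chart frame only up to an orthogonal change of
  basis. \<open>\<epsilon>\<close> is its determinant.\<close>

lemma onb_at_rotation:
  assumes "lorentz_onb p f g" "onb_at p u v"
  shows "\<exists>c s \<epsilon>. c * c + s * s = 1 \<and> \<epsilon> * \<epsilon> = 1 \<and> u = c *\<^sub>R f + s *\<^sub>R g \<and> v = \<epsilon> *\<^sub>R (- s *\<^sub>R f + c *\<^sub>R g)"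
proof -
  define c s x y where "c = lor u f" "s = lor u g" "x = lor v f" "y = lor v g"
  have u: "u = c *\<^sub>R f + s *\<^sub>R g" and v: "v = x *\<^sub>R f + y *\<^sub>R g"
    using lorentz_onb_expand[OF assms(1), of u] lorentz_onb_expand[OF assms(1), of v] assms(2)
    by (simp_all add: onb_at_def c_s_x_y_def)
  have fg: "lor f f = 1" "lor g g = 1" "lor f g = 0" "lor g f = 0"
    using assms(1) by (auto simp: lorentz_onb_def lor_commute)
  have cs: "c * c + s * s = 1" "x * x + y * y = 1" "c * x + s * y = 0"
    using assms(2) unfolding onb_at_def u v lor_simps fg by (auto simp: mult.commute)
  define \<epsilon> where "\<epsilon> = c * y - s * x"
  note eq0 = eq_iff_diff_eq_0[THEN iffD1]
  have "\<epsilon> * \<epsilon> = 1" "x = - \<epsilon> * s" "y = \<epsilon> * c"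
    unfolding \<epsilon>_def using cs[THEN eq0] by algebra+
  then show ?thesis using cs(1) u v
    by (intro exI[of _ c] exI[of _ s] exI[of _ \<epsilon>]) (auto simp: algebra_simps)
qed

text \<open>Lying on the hyperboloid is the identity cosh^2 - sinh^2 = 1. For the upper sheet one
  needs |u1| < p1: the square of u2 p3 - u3 p2 equals p1^2 - u1^2 - 1 and is nonnegative.\<close>

lemma geo_in_H2:
  assumes p: "p \<in> H2" and u: "lor u p = 0" "lor u u = 1"
  shows "geo p u t \<in> H2"
proof -
  have c: "(cosh t)\<^sup>2 - (sinh t)\<^sup>2 = 1" by (simp add: hyperbolic_pythagoras)
  have pp: "lor p p = -1" "0 < p $ 1" using p by (auto simp: H2_def)
  have "lor (geo p u t) (geo p u t) = - 1"
    unfolding geo_def lor_simps using pp u c by (simp add: lor_commute[of p u] power2_eq_square)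
  moreover have "0 < geo p u t $ 1"
  proof -
    have "(p$1)\<^sup>2 = 1 + (p$2)\<^sup>2 + (p$3)\<^sup>2" "(u$1)\<^sup>2 = (u$2)\<^sup>2 + (u$3)\<^sup>2 - 1" "u$1 * p$1 = u$2 * p$2 + u$3 * p$3"
      using pp u by (auto simp: lor_def power2_eq_square)
    moreover have "0 \<le> (u$2 * p$3 - u$3 * p$2)\<^sup>2" by simp
    ultimately have "0 \<le> (p$1)\<^sup>2 - (u$1)\<^sup>2 - 1"
    proof -
      assume a: "(p$1)\<^sup>2 = 1 + (p$2)\<^sup>2 + (p$3)\<^sup>2" "(u$1)\<^sup>2 = (u$2)\<^sup>2 + (u$3)\<^sup>2 - 1" "u$1 * p$1 = u$2 * p$2 + u$3 * p$3"
        and b: "0 \<le> (u$2 * p$3 - u$3 * p$2)\<^sup>2"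
      have "(u$2 * p$3 - u$3 * p$2)\<^sup>2 = ((p$1)\<^sup>2 - 1) * ((u$1)\<^sup>2 + 1) - (u$1 * p$1)\<^sup>2"
        using a by (simp add: power2_eq_square algebra_simps)
      also have "\<dots> = (p$1)\<^sup>2 - (u$1)\<^sup>2 - 1" by (simp add: power2_eq_square algebra_simps)
      finally show ?thesis using b by simp
    qed
    then have "\<bar>u$1\<bar>\<^sup>2 < (p$1)\<^sup>2" by simp
    then have "\<bar>u$1\<bar> < p$1" by (rule power2_less_imp_less) (use pp(2) in simp)
    moreover have "\<bar>sinh t\<bar>\<^sup>2 < (cosh t)\<^sup>2" using c by simp
    then have "\<bar>sinh t\<bar> < cosh t" by (rule power2_less_imp_less) simp
    ultimately have "\<bar>sinh t * u$1\<bar> < cosh t * p$1"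
      unfolding abs_mult by (intro mult_strict_mono') auto
    then show ?thesis by (simp add: geo_def)
  qed
  ultimately show ?thesis by (simp add: H2_def)
qed

definition D2 :: "('a::real_normed_vector \<Rightarrow> real) \<Rightarrow> 'a \<Rightarrow> 'a \<Rightarrow> 'a \<Rightarrow> real" where
  "D2 G x a b = frechet_derivative (\<lambda>y. frechet_derivative G (at y) a) (at x) b"

context
  fixes W :: "'a::euclidean_space set" and G :: "'a \<Rightarrow> real"
  assumes W: "open W" and G: "smooth_on W G"
begin

lemma DG: "y \<in> W \<Longrightarrow> (G has_derivative frechet_derivative G (at y)) (at y)"
  using smooth_on_has_derivative[OF W G] .

lemma DG_lin: "y \<in> W \<Longrightarrow> linear (frechet_derivative G (at y))"
  using DG has_derivative_linear by blast

lemma DDG: "y \<in> W \<Longrightarrow> ((\<lambda>y. frechet_derivative G (at y) a) has_derivative D2 G y a) (at y)"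
  unfolding D2_def[abs_def] using smooth_on_has_derivative[OF W smooth_on_frechet[OF G]] .

lemma D2_lin2: "y \<in> W \<Longrightarrow> linear (D2 G y a)"
  using DDG has_derivative_linear by blast

lemma D2_comb:
  assumes y: "y \<in> W"
  shows "D2 G y (c *\<^sub>R a + s *\<^sub>R b) v = c * D2 G y a v + s * D2 G y b v"
proof -
  have "((\<lambda>y. c * frechet_derivative G (at y) a + s * frechet_derivative G (at y) b) has_derivative
      (\<lambda>v. c * D2 G y a v + s * D2 G y b v)) (at y)"
    by (auto intro!: derivative_eq_intros DDG[OF y])
  then have "((\<lambda>y. frechet_derivative G (at y) (c *\<^sub>R a + s *\<^sub>R b)) has_derivative
      (\<lambda>v. c * D2 G y a v + s * D2 G y b v)) (at y)"
    by (rule has_derivative_transform_within_open[OF _ W y])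
      (simp add: linear_add[OF DG_lin] linear_scale[OF DG_lin])
  from fun_cong[OF has_derivative_unique[OF DDG[OF y] this]] show ?thesis .
qed

text \<open>\<open>F\<close> is known only on the hyperboloids and \<open>G\<close> is an ambient
  extension. A geodesic has ambient acceleration equal to its moving component, hence the
  first-order term in direction \<open>A\<close> besides the second derivative in direction
  \<open>B\<close>.\<close>

lemma hyperbola_derivs:
  fixes A B C :: 'a
  defines "\<sigma> \<equiv> \<lambda>t. cosh t *\<^sub>R A + sinh t *\<^sub>R B + C"
  assumes T: "open T" "0 \<in> T" and eq: "\<And>t. t \<in> T \<Longrightarrow> \<sigma> t \<in> W" "\<And>t. t \<in> T \<Longrightarrow> F (\<sigma> t) = G (\<sigma> t)"
  shows "deriv (\<lambda>t. F (\<sigma> t)) 0 = frechet_derivative G (at (A + C)) B"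
    "deriv (deriv (\<lambda>t. F (\<sigma> t))) 0 = frechet_derivative G (at (A + C)) A + D2 G (A + C) B B"
proof -
  have s: "(\<sigma> has_derivative (\<lambda>h. h *\<^sub>R (sinh t *\<^sub>R A + cosh t *\<^sub>R B))) (at t)" for t
    unfolding \<sigma>_def by (auto intro!: derivative_eq_intros simp: algebra_simps)
  define \<phi> where "\<phi> t = sinh t * frechet_derivative G (at (\<sigma> t)) A + cosh t * frechet_derivative G (at (\<sigma> t)) B" for t
  have d1: "((\<lambda>t. F (\<sigma> t)) has_real_derivative \<phi> t) (at t)" if t: "t \<in> T" for t
  proof -
    note lin = DG_lin[OF eq(1)[OF t]]
    have "((\<lambda>t. G (\<sigma> t)) has_derivative (\<lambda>h. frechet_derivative G (at (\<sigma> t)) (h *\<^sub>R (sinh t *\<^sub>R A + cosh t *\<^sub>R B)))) (at t)"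
      by (rule has_derivative_compose[OF s DG[OF eq(1)[OF t]]])
    moreover have "(\<lambda>h. frechet_derivative G (at (\<sigma> t)) (h *\<^sub>R (sinh t *\<^sub>R A + cosh t *\<^sub>R B))) = (*) (\<phi> t)"
      by (simp add: fun_eq_iff linear_scale[OF lin] linear_add[OF lin] \<phi>_def algebra_simps)
    ultimately have "((\<lambda>t. G (\<sigma> t)) has_real_derivative \<phi> t) (at t)" by (simp add: has_field_derivative_def)
    then show ?thesis
      by (rule has_field_derivative_transform_within_open[OF _ T(1) t]) (use eq in auto)
  qed
  have s0: "\<sigma> 0 = A + C" by (simp add: \<sigma>_def)
  show "deriv (\<lambda>t. F (\<sigma> t)) 0 = frechet_derivative G (at (A + C)) B"
    using DERIV_imp_deriv[OF d1[OF T(2)]] by (simp add: \<phi>_def s0)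
  have g: "((\<lambda>t. frechet_derivative G (at (\<sigma> t)) a) has_real_derivative D2 G (A + C) a B) (at 0)" for a
  proof -
    have "((\<lambda>t. frechet_derivative G (at (\<sigma> t)) a) has_derivative (\<lambda>h. D2 G (\<sigma> 0) a (h *\<^sub>R (sinh 0 *\<^sub>R A + cosh 0 *\<^sub>R B)))) (at 0)"
      by (rule has_derivative_compose[OF s DDG[OF eq(1)[OF T(2)]]])
    moreover have "D2 G (\<sigma> 0) a (h *\<^sub>R (sinh 0 *\<^sub>R A + cosh 0 *\<^sub>R B)) = D2 G (A + C) a B * h" for h
      using linear_scale[OF D2_lin2[OF eq(1)[OF T(2)]]] by (simp add: s0)
    ultimately show ?thesis by (simp add: has_field_derivative_def)
  qed
  have "(\<phi> has_real_derivative (frechet_derivative G (at (A + C)) A + D2 G (A + C) B B)) (at 0)"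
    unfolding \<phi>_def[abs_def]
    by (rule derivative_eq_intros g refl)+ (simp add: s0)
  then have "(deriv (\<lambda>t. F (\<sigma> t)) has_real_derivative (frechet_derivative G (at (A + C)) A + D2 G (A + C) B B)) (at 0)"
    by (rule has_field_derivative_transform_within_open[OF _ T]) (use DERIV_imp_deriv[OF d1] in auto)
  then show "deriv (deriv (\<lambda>t. F (\<sigma> t))) 0 = frechet_derivative G (at (A + C)) A + D2 G (A + C) B B"
    by (rule DERIV_imp_deriv)
qed

text \<open>Base point and direction move simultaneously. Expanding the direction in the standard
  basis reduces the claim to the product rule for scalar functions.\<close>

lemma DG_along:
  fixes \<Psi> A :: "'b::real_normed_vector \<Rightarrow> 'a"
  assumes z: "\<Psi> z \<in> W" and \<Psi>: "(\<Psi> has_derivative \<Psi>') (at z)" and A: "(A has_derivative A') (at z)"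
    and V: "open V" "z \<in> V" "\<Psi> ` V \<subseteq> W"
  shows "((\<lambda>y. frechet_derivative G (at (\<Psi> y)) (A y)) has_derivative
     (\<lambda>v. frechet_derivative G (at (\<Psi> z)) (A' v) + D2 G (\<Psi> z) (A z) (\<Psi>' v))) (at z)"
proof -
  have rep: "frechet_derivative G (at y) a = (\<Sum>b\<in>Basis. (a \<bullet> b) * frechet_derivative G (at y) b)" if "y \<in> W" for y a
  proof -
    have "frechet_derivative G (at y) (\<Sum>b\<in>Basis. (a \<bullet> b) *\<^sub>R b) = (\<Sum>b\<in>Basis. (a \<bullet> b) * frechet_derivative G (at y) b)"
      by (simp add: linear_sum[OF DG_lin[OF that]] linear_scale[OF DG_lin[OF that]])
    then show ?thesis by (simp add: euclidean_representation)
  qed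
  have rep2: "D2 G (\<Psi> z) a v = (\<Sum>b\<in>Basis. (a \<bullet> b) * D2 G (\<Psi> z) b v)" for a v
  proof -
    have "((\<lambda>y. \<Sum>b\<in>Basis. (a \<bullet> b) * frechet_derivative G (at y) b) has_derivative
        (\<lambda>v. \<Sum>b\<in>Basis. (a \<bullet> b) * D2 G (\<Psi> z) b v)) (at (\<Psi> z))"
      by (auto intro!: derivative_eq_intros DDG[OF z])
    then have "((\<lambda>y. frechet_derivative G (at y) a) has_derivative
        (\<lambda>v. \<Sum>b\<in>Basis. (a \<bullet> b) * D2 G (\<Psi> z) b v)) (at (\<Psi> z))"
      by (rule has_derivative_transform_within_open[OF _ W z]) (simp add: rep[symmetric])
    from fun_cong[OF has_derivative_unique[OF DDG[OF z] this]] show ?thesis .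
  qed
  have "((\<lambda>y. \<Sum>b\<in>Basis. (A y \<bullet> b) * frechet_derivative G (at (\<Psi> y)) b) has_derivative
     (\<lambda>v. \<Sum>b\<in>Basis. (A z \<bullet> b) * D2 G (\<Psi> z) b (\<Psi>' v) + (A' v \<bullet> b) * frechet_derivative G (at (\<Psi> z)) b)) (at z)"
    by (intro has_derivative_sum has_derivative_mult has_derivative_inner_left A
        has_derivative_compose[OF \<Psi> DDG[OF z]])
  then have "((\<lambda>y. frechet_derivative G (at (\<Psi> y)) (A y)) has_derivative
     (\<lambda>v. \<Sum>b\<in>Basis. (A z \<bullet> b) * D2 G (\<Psi> z) b (\<Psi>' v) + (A' v \<bullet> b) * frechet_derivative G (at (\<Psi> z)) b)) (at z)"
    by (rule has_derivative_transform_within_open[OF _ V(1,2)]) (use V(3) in \<open>auto simp: rep[symmetric]\<close>)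
  then show ?thesis
    by (rule has_derivative_eq_rhs)
      (auto simp: fun_eq_iff rep[OF z, of "A' _"] rep2[of "A z"] sum.distrib)
qed

end

lemma vec3_as_sum: "(v::real^3) = v$1 *\<^sub>R axis 1 1 + v$2 *\<^sub>R axis 2 1 + v$3 *\<^sub>R axis 3 1"
  by (simp add: vec_eq_iff forall_3 axis_def)

lemma has_derivative_chart:
  "(hp has_derivative (\<lambda>h. (fst h * exp (- snd y)) *\<^sub>R hf1 y + snd h *\<^sub>R hf2 y)) (at y)"
  "(hf1 has_derivative (\<lambda>h. (fst h * exp (- snd y)) *\<^sub>R (hf2 y + hp y))) (at y)"
  "(hf2 has_derivative (\<lambda>h. (fst h * exp (- snd y)) *\<^sub>R (- hf1 y) + snd h *\<^sub>R hp y)) (at y)"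
proof -
  have ee: "exp (- snd y) * exp (snd y) = 1" by (simp add: exp_add[symmetric])
  have e: "exp (snd y) * exp (- snd y) = 1" by (simp add: exp_add[symmetric])
  show "(hp has_derivative (\<lambda>h. (fst h * exp (- snd y)) *\<^sub>R hf1 y + snd h *\<^sub>R hf2 y)) (at y)"
    by (subst vec3_as_sum[of "hp _", abs_def], unfold hp_nth)
      (auto intro!: derivative_eq_intros simp: vec_eq_iff forall_3 axis_def hf1_nth hf2_nth fun_eq_iff
        field_simps power2_eq_square)
  show "(hf1 has_derivative (\<lambda>h. (fst h * exp (- snd y)) *\<^sub>R (hf2 y + hp y))) (at y)"
    by (subst vec3_as_sum[of "hf1 _", abs_def], unfold hf1_nth)
      (auto intro!: derivative_eq_intros simp: vec_eq_iff forall_3 axis_def hp_nth hf2_nth fun_eq_iff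
        field_simps power2_eq_square ee e)
  show "(hf2 has_derivative (\<lambda>h. (fst h * exp (- snd y)) *\<^sub>R (- hf1 y) + snd h *\<^sub>R hp y)) (at y)"
    by (subst vec3_as_sum[of "hf2 _", abs_def], unfold hf2_nth)
      (auto intro!: derivative_eq_intros simp: vec_eq_iff forall_3 axis_def hf1_nth hp_nth fun_eq_iff
        field_simps power2_eq_square)
qed

definition chart :: "pt \<Rightarrow> (real^3) \<times> (real^3)" where
  "chart z = (hp (fst z), hp (snd z))"

lemma has_derivative_chart':
  "(chart has_derivative (\<lambda>h. ((fst (fst h) * exp (- snd (fst z))) *\<^sub>R hf1 (fst z) + snd (fst h) *\<^sub>R hf2 (fst z),
     (fst (snd h) * exp (- snd (snd z))) *\<^sub>R hf1 (snd z) + snd (snd h) *\<^sub>R hf2 (snd z)))) (at z)"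
  unfolding chart_def[abs_def]
  by (intro has_derivative_Pair has_derivative_compose[OF has_derivative_fst[OF has_derivative_ident] has_derivative_chart(1)]
      has_derivative_compose[OF has_derivative_snd[OF has_derivative_ident] has_derivative_chart(1)])

lemma continuous_chart: "continuous_on A chart"
  unfolding continuous_on_eq_continuous_within
  by (intro ballI has_derivative_continuous[OF has_derivative_at_withinI[OF has_derivative_chart']])

lemma C_k_hp:
  fixes f :: "'a::real_normed_vector \<Rightarrow> real \<times> real"
  assumes "open U" "\<And>n. C_k n U (\<lambda>z. fst (f z))" "\<And>n. C_k n U (\<lambda>z. snd (f z))"
  shows "C_k n U (\<lambda>z. hp (f z))"
proof -
  have e: "C_k n U (\<lambda>z. exp (snd (f z)))" "C_k n U (\<lambda>z. exp (- snd (f z)))"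
    using smooth_on_exp[OF assms(1), of "\<lambda>z. snd (f z)"] smooth_on_exp[OF assms(1), of "\<lambda>z. - snd (f z)"]
      assms(3) C_k_mult[OF assms(1) C_k_const[OF assms(1), of _ "-1"] assms(3)] by (auto simp: smooth_on_def)
  have c: "hp y $ 1 = 1/2 * (exp (snd y) + (1 + fst y * fst y) * exp (- snd y))" "hp y $ 2 = fst y * exp (- snd y)"
    "hp y $ 3 = 1/2 * (exp (snd y) + (-1 + fst y * fst y) * exp (- snd y))" for y
    by (auto simp: hp_nth power2_eq_square)
  show ?thesis
    unfolding C_k_vec_iff[OF assms(1)] forall_3 c
    by (intro conjI C_k_mult[OF assms(1)] C_k_add[OF assms(1)] C_k_const[OF assms(1)] assms(2) e)
qed

lemma smooth_chart: "open U \<Longrightarrow> smooth_on U chart"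
proof -
  assume U: "open U"
  have lin: "bounded_linear (\<lambda>z::pt. fst (fst z))" "bounded_linear (\<lambda>z::pt. snd (fst z))"
    "bounded_linear (\<lambda>z::pt. fst (snd z))" "bounded_linear (\<lambda>z::pt. snd (snd z))"
    by (intro bounded_linear_compose[OF bounded_linear_fst bounded_linear_fst]
      bounded_linear_compose[OF bounded_linear_snd bounded_linear_fst]
      bounded_linear_compose[OF bounded_linear_fst bounded_linear_snd]
      bounded_linear_compose[OF bounded_linear_snd bounded_linear_snd])+
  have "C_k n U (\<lambda>z. fst (fst z))" "C_k n U (\<lambda>z. snd (fst z))" "C_k n U (\<lambda>z. fst (snd z))" "C_k n U (\<lambda>z. snd (snd z))" for n
    using lin[THEN smooth_on_linear[OF U]] by (auto simp: smooth_on_def)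
  then have "C_k n U (\<lambda>z. (hp (fst z), hp (snd z)))" for n
    by (intro C_k_Pair[OF U] C_k_hp[OF U])
  then show ?thesis by (simp add: smooth_on_def chart_def[abs_def])
qed

context
  fixes W :: "((real^3) \<times> (real^3)) set" and G :: "(real^3) \<times> (real^3) \<Rightarrow> real" and V :: "pt set"
  assumes W: "open W" and G: "smooth_on W G" and V: "open V" "chart ` V \<subseteq> W"
begin

lemma XY_chart:
  assumes z: "z \<in> V"
  defines "D \<equiv> frechet_derivative G (at (chart z))"
  shows "X1 (\<lambda>z. G (chart z)) z = D (hf1 (fst z), 0)" "X2 (\<lambda>z. G (chart z)) z = D (hf2 (fst z), 0)"
    "Y1 (\<lambda>z. G (chart z)) z = D (0, hf1 (snd z))" "Y2 (\<lambda>z. G (chart z)) z = D (0, hf2 (snd z))"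
proof -
  have zW: "chart z \<in> W" using V z by auto
  note lin = DG_lin[OF W G zW]
  have e: "exp t * exp (- t) = 1" for t :: real by (simp add: exp_add[symmetric])
  note d = frechet_derivative_at[OF has_derivative_compose[OF has_derivative_chart' DG[OF W G zW]], symmetric]
  have sc: "D (r *\<^sub>R x, 0) = r * D (x, 0)" "D (0, r *\<^sub>R x) = r * D (0, x)" for r x
    using linear_scale[OF lin, of r "(x, 0)"] linear_scale[OF lin, of r "(0, x)"] by (simp_all add: D_def)
  show "X1 (\<lambda>z. G (chart z)) z = D (hf1 (fst z), 0)" "X2 (\<lambda>z. G (chart z)) z = D (hf2 (fst z), 0)"
    "Y1 (\<lambda>z. G (chart z)) z = D (0, hf1 (snd z))" "Y2 (\<lambda>z. G (chart z)) z = D (0, hf2 (snd z))"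
    unfolding X1_def X2_def Y1_def Y2_def d D_def[symmetric]
    by (simp_all add: sc e mult.assoc[symmetric])
qed

lemma XY_along_chart:
  fixes A :: "pt \<Rightarrow> (real^3) \<times> (real^3)"
  assumes z: "z \<in> V" and A: "(A has_derivative A') (at z)"
    and f: "\<And>z. z \<in> V \<Longrightarrow> f z = frechet_derivative G (at (chart z)) (A z)"
  defines "D \<equiv> frechet_derivative G (at (chart z))" and "B \<equiv> D2 G (chart z) (A z)"
  shows "X1 f z = D (exp (snd (fst z)) *\<^sub>R A' ((1,0),(0,0))) + B (hf1 (fst z), 0)"
    "X2 f z = D (A' ((0,1),(0,0))) + B (hf2 (fst z), 0)"
    "Y1 f z = D (exp (snd (snd z)) *\<^sub>R A' ((0,0),(1,0))) + B (0, hf1 (snd z))"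
    "Y2 f z = D (A' ((0,0),(0,1))) + B (0, hf2 (snd z))"
proof -
  have zW: "chart z \<in> W" using V z by auto
  note lin = DG_lin[OF W G zW] D2_lin2[OF W G zW]
  have e: "exp t * exp (- t) = 1" for t :: real by (simp add: exp_add[symmetric])
  have "(f has_derivative (\<lambda>v. D (A' v) + B ((fst (fst v) * exp (- snd (fst z))) *\<^sub>R hf1 (fst z) + snd (fst v) *\<^sub>R hf2 (fst z),
     (fst (snd v) * exp (- snd (snd z))) *\<^sub>R hf1 (snd z) + snd (snd v) *\<^sub>R hf2 (snd z)))) (at z)"
    unfolding D_def B_def
    by (rule has_derivative_transform_within_open[OF DG_along[OF W G zW has_derivative_chart' A V(1) z V(2)] V(1) z])
      (simp add: f)
  note d = frechet_derivative_at[OF this, symmetric]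
  have sc: "B (r *\<^sub>R x, 0) = r * B (x, 0)" "B (0, r *\<^sub>R x) = r * B (0, x)" for r x
    using linear_scale[OF lin(2), of "A z" r "(x, 0)"] linear_scale[OF lin(2), of "A z" r "(0, x)"] by (simp_all add: B_def)
  have sD: "D (r *\<^sub>R x) = r * D x" for r x
    using linear_scale[OF lin(1), of r x] by (simp add: D_def)
  show "X1 f z = D (exp (snd (fst z)) *\<^sub>R A' ((1,0),(0,0))) + B (hf1 (fst z), 0)"
    "X2 f z = D (A' ((0,1),(0,0))) + B (hf2 (fst z), 0)"
    "Y1 f z = D (exp (snd (snd z)) *\<^sub>R A' ((0,0),(1,0))) + B (0, hf1 (snd z))"
    "Y2 f z = D (A' ((0,0),(0,1))) + B (0, hf2 (snd z))"
    unfolding X1_def X2_def Y1_def Y2_def d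
    by (simp_all add: sc sD e distrib_left mult.assoc[symmetric])
qed

text \<open>The first-order terms are the ambient derivatives of the frame vectors along themselves:
  hf2 + hp in the horocyclic direction and hp in the geodesic one.\<close>

lemma XXYY_chart:
  assumes z: "z \<in> V"
  defines "w \<equiv> \<lambda>z. G (chart z)" and "D \<equiv> frechet_derivative G (at (chart z))" and "B \<equiv> \<lambda>a. D2 G (chart z) a a"
  shows "X1 (X1 w) z = D (hf2 (fst z), 0) + D (hp (fst z), 0) + B (hf1 (fst z), 0)"
    "X2 (X2 w) z = D (hp (fst z), 0) + B (hf2 (fst z), 0)"
    "Y1 (Y1 w) z = D (0, hf2 (snd z)) + D (0, hp (snd z)) + B (0, hf1 (snd z))"
    "Y2 (Y2 w) z = D (0, hp (snd z)) + B (0, hf2 (snd z))"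
proof -
  have zW: "chart z \<in> W" using V z by auto
  have e: "exp t * exp (- t) = 1" for t :: real by (simp add: exp_add[symmetric])
  have add: "D (x + y, 0) = D (x, 0) + D (y, 0)" "D (0, x + y) = D (0, x) + D (0, y)" for x y
    using linear_add[OF DG_lin[OF W G zW], of "(x, 0)" "(y, 0)"] linear_add[OF DG_lin[OF W G zW], of "(0, x)" "(0, y)"]
    by (simp_all add: D_def)
  have d1: "((\<lambda>z. (g (fst z), 0 :: real^3)) has_derivative (\<lambda>h. (g' (fst h), 0))) (at z)"
    if "(g has_derivative g') (at (fst z))" for g :: "real \<times> real \<Rightarrow> real^3" and g'
    by (intro has_derivative_Pair has_derivative_compose[OF has_derivative_fst[OF has_derivative_ident] that] has_derivative_const)
  have d2: "((\<lambda>z. (0 :: real^3, g (snd z))) has_derivative (\<lambda>h. (0, g' (snd h)))) (at z)"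
    if "(g has_derivative g') (at (snd z))" for g :: "real \<times> real \<Rightarrow> real^3" and g'
    by (intro has_derivative_Pair has_derivative_compose[OF has_derivative_snd[OF has_derivative_ident] that] has_derivative_const)
  note XY = XY_chart[folded w_def]
  show "X1 (X1 w) z = D (hf2 (fst z), 0) + D (hp (fst z), 0) + B (hf1 (fst z), 0)"
    using XY_along_chart(1)[OF z d1[OF has_derivative_chart(2)] XY(1)] e
    by (simp add: D_def[symmetric] B_def add[symmetric])
  show "X2 (X2 w) z = D (hp (fst z), 0) + B (hf2 (fst z), 0)"
    using XY_along_chart(2)[OF z d1[OF has_derivative_chart(3)] XY(2)]
    by (simp add: D_def[symmetric] B_def)
  show "Y1 (Y1 w) z = D (0, hf2 (snd z)) + D (0, hp (snd z)) + B (0, hf1 (snd z))"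
    using XY_along_chart(3)[OF z d2[OF has_derivative_chart(2)] XY(3)] e
    by (simp add: D_def[symmetric] B_def add[symmetric])
  show "Y2 (Y2 w) z = D (0, hp (snd z)) + B (0, hf2 (snd z))"
    using XY_along_chart(4)[OF z d2[OF has_derivative_chart(3)] XY(4)]
    by (simp add: D_def[symmetric] B_def)
qed

end

lemma tb_hp: "onb_at (hp y) (fst (tb (hp y))) (snd (tb (hp y)))"
proof -
  have "onb_at (hp y) (hf1 y) (hf2 y)"
    using lorentz_onb_chart[of y] by (auto simp: onb_at_def lorentz_onb_def lor_commute)
  then have "case (hf1 y, hf2 y) of (u, v) \<Rightarrow> onb_at (hp y) u v" by simp
  then have "case tb (hp y) of (u, v) \<Rightarrow> onb_at (hp y) u v" unfolding tb_def by (rule someI)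
  then show ?thesis by (simp add: case_prod_beta)
qed

text \<open>Both descriptions of the Laplacian equal the ambient trace of the second derivative over
  the tangent spaces plus twice the derivatives in the directions of the two position vectors. In
  the chart, the term - X2 w cancels the part of X1 (X1 w) in direction \<open>hf2\<close>, and
  similarly for the second factor.\<close>

lemma chart_pullback:
  assumes U: "openin (top_of_set HH) U" and F: "smooth_fun_on U F"
  shows "\<exists>w. open (chart -` U) \<and> smooth_on (chart -` U) w \<and> (\<forall>z\<in>chart -` U. w z = F (chart z) \<and>
      grad_sq F (chart z) = (X1 w z)\<^sup>2 + (X2 w z)\<^sup>2 + (Y1 w z)\<^sup>2 + (Y2 w z)\<^sup>2 \<and>
      lap F (chart z) = X1 (X1 w) z + X2 (X2 w) z - X2 w z + (Y1 (Y1 w) z + Y2 (Y2 w) z - Y2 w z))"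
proof -
  obtain W G where WG: "open W" "U \<subseteq> W" "smooth_on W G" "\<And>x. x \<in> U \<Longrightarrow> G x = F x"
    using F unfolding smooth_fun_on_def by blast
  obtain T where T: "open T" "U = HH \<inter> T" using U by (auto simp: openin_open)
  have HH: "chart z \<in> HH" for z by (simp add: chart_def HH_def hp_in_H2)
  have VT: "chart -` U = chart -` T"
  proof (rule set_eqI)
    show "z \<in> chart -` U \<longleftrightarrow> z \<in> chart -` T" for z using HH[of z] by (simp add: T(2))
  qed
  have oV: "open (chart -` U)" unfolding VT using T(1) continuous_chart by (simp add: open_vimage)
  have VW: "chart ` (chart -` U) \<subseteq> W" using WG by auto
  define w where "w = (\<lambda>z. G (chart z))"
  have sw: "smooth_on (chart -` U) w" unfolding w_def
    by (rule smooth_on_compose[OF oV WG(1) VW smooth_chart[OF oV] WG(3)])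
  have main: "grad_sq F (chart z) = (X1 w z)\<^sup>2 + (X2 w z)\<^sup>2 + (Y1 w z)\<^sup>2 + (Y2 w z)\<^sup>2 \<and>
      lap F (chart z) = X1 (X1 w) z + X2 (X2 w) z - X2 w z + (Y1 (Y1 w) z + Y2 (Y2 w) z - Y2 w z)" if z: "z \<in> chart -` U" for z
  proof -
    define p q where "p = hp (fst z)" and "q = hp (snd z)"
    have cz: "chart z = (p, q)" by (simp add: chart_def p_def q_def)
    have zW: "(p, q) \<in> W" using WG(2) z cz by (metis subsetD vimage_eq)
    have pq: "p \<in> H2" "q \<in> H2" by (simp_all add: p_def q_def hp_in_H2)
    define D where "D = frechet_derivative G (at (p, q))"
    define B where "B a = D2 G (p, q) a a" for a
    \<comment> \<open>\<open>U\<close> is relatively open, so a geodesic starting in it stays there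
      for small times, and along it \<open>F\<close> agrees with the smooth extension
      \<open>G\<close>.\<close>
    have ev: "\<exists>S. open S \<and> 0 \<in> S \<and> (\<forall>t\<in>S. \<sigma> t \<in> W \<and> F (\<sigma> t) = G (\<sigma> t))"
      if "continuous_on UNIV \<sigma>" "\<sigma> 0 = (p, q)" "\<And>t. \<sigma> t \<in> HH" for \<sigma> :: "real \<Rightarrow> (real^3) \<times> (real^3)"
    proof (intro exI[of _ "\<sigma> -` T"] conjI ballI)
      show "open (\<sigma> -` T)" using that(1) T(1) by (simp add: open_vimage)
      show "0 \<in> \<sigma> -` T" using that(2) z T cz by auto
      fix t assume "t \<in> \<sigma> -` T"
      then have "\<sigma> t \<in> U" using that(3) T by auto
      then show "\<sigma> t \<in> W" "F (\<sigma> t) = G (\<sigma> t)" using WG by auto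
    qed
    have g1: "deriv (\<lambda>t. F (geo p u t, q)) 0 = D (u, 0) \<and> deriv (deriv (\<lambda>t. F (geo p u t, q))) 0 = D (p, 0) + B (u, 0)"
      if u: "lor u p = 0" "lor u u = 1" for u
    proof -
      have s: "(\<lambda>t. cosh t *\<^sub>R (p, 0) + sinh t *\<^sub>R (u, 0) + (0, q)) = (\<lambda>t. (geo p u t, q))"
        by (simp add: geo_def fun_eq_iff)
      obtain S where S: "open S" "0 \<in> S" "\<And>t. t \<in> S \<Longrightarrow> (geo p u t, q) \<in> W \<and> F (geo p u t, q) = G (geo p u t, q)"
      proof -
        have "continuous_on UNIV (\<lambda>t. (geo p u t, q))" by (auto simp: geo_def intro!: continuous_intros)
        moreover have "(geo p u t, q) \<in> HH" for t using geo_in_H2[OF pq(1) u] pq(2) by (simp add: HH_def)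
        ultimately show ?thesis using ev[of "\<lambda>t. (geo p u t, q)"] that by (auto simp: geo_def)
      qed
      show ?thesis
        using hyperbola_derivs[OF WG(1,3) S(1,2), of "(p, 0)" "(u, 0)" "(0, q)" F] S(3) unfolding s[THEN fun_cong]
        by (simp add: D_def B_def)
    qed
    have g2: "deriv (\<lambda>t. F (p, geo q u t)) 0 = D (0, u) \<and> deriv (deriv (\<lambda>t. F (p, geo q u t))) 0 = D (0, q) + B (0, u)"
      if u: "lor u q = 0" "lor u u = 1" for u
    proof -
      have s: "(\<lambda>t. cosh t *\<^sub>R (0, q) + sinh t *\<^sub>R (0, u) + (p, 0)) = (\<lambda>t. (p, geo q u t))"
        by (simp add: geo_def fun_eq_iff)
      obtain S where S: "open S" "0 \<in> S" "\<And>t. t \<in> S \<Longrightarrow> (p, geo q u t) \<in> W \<and> F (p, geo q u t) = G (p, geo q u t)"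
      proof -
        have "continuous_on UNIV (\<lambda>t. (p, geo q u t))" by (auto simp: geo_def intro!: continuous_intros)
        moreover have "(p, geo q u t) \<in> HH" for t using geo_in_H2[OF pq(2) u] pq(1) by (simp add: HH_def)
        ultimately show ?thesis using ev[of "\<lambda>t. (p, geo q u t)"] that by (auto simp: geo_def)
      qed
      show ?thesis
        using hyperbola_derivs[OF WG(1,3) S(1,2), of "(0, q)" "(0, u)" "(p, 0)" F] S(3) unfolding s[THEN fun_cong]
        by (simp add: D_def B_def)
    qed
    \<comment> \<open>The length of a linear form and the trace of a bilinear form do not depend on
      the orthonormal basis; this removes the choice made in \<open>tb\<close>.\<close>
    have quad: "(D (i u))\<^sup>2 + (D (i v))\<^sup>2 = (D (i f))\<^sup>2 + (D (i g))\<^sup>2 \<and> B (i u) + B (i v) = B (i f) + B (i g)"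
      if i: "linear i" and o: "lorentz_onb x f g" "onb_at x u v" for i :: "real^3 \<Rightarrow> (real^3) \<times> (real^3)" and x f g u v
    proof -
      obtain c s \<epsilon> where cs: "c * c + s * s = 1" "\<epsilon> * \<epsilon> = 1" and uv: "u = c *\<^sub>R f + s *\<^sub>R g" "v = (- \<epsilon> * s) *\<^sub>R f + (\<epsilon> * c) *\<^sub>R g"
        using onb_at_rotation[OF o] by (auto simp: algebra_simps)
      have Dl: "D (i (x *\<^sub>R f + y *\<^sub>R g)) = x * D (i f) + y * D (i g)" for x y
        using DG_lin[OF WG(1,3) zW] i by (simp add: D_def linear_add linear_scale)
      have Bl: "B (i (x *\<^sub>R f + y *\<^sub>R g)) = x * (x * D2 G (p, q) (i f) (i f) + y * D2 G (p, q) (i f) (i g))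
         + y * (x * D2 G (p, q) (i g) (i f) + y * D2 G (p, q) (i g) (i g))" for x y
        unfolding B_def linear_add[OF i] linear_scale[OF i] D2_comb[OF WG(1,3) zW]
        using D2_lin2[OF WG(1,3) zW] by (simp add: linear_add linear_scale)
      note eq0 = eq_iff_diff_eq_0[THEN iffD1]
      show ?thesis unfolding uv Dl Bl unfolding B_def using cs[THEN eq0] by (intro conjI; algebra)
    qed
    have lin: "linear (\<lambda>u::real^3. (u, 0::real^3))" "linear (\<lambda>u::real^3. (0::real^3, u))"
      by (auto intro!: linearI)
    obtain u1 u2 w1 w2 where tb: "tb p = (u1, u2)" "tb q = (w1, w2)" by (meson surj_pair)
    have o: "onb_at p u1 u2" "onb_at q w1 w2" using tb_hp[of "fst z"] tb_hp[of "snd z"] tb by (simp_all add: p_def q_def)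
    have Q: "(D (u1, 0))\<^sup>2 + (D (u2, 0))\<^sup>2 = (D (hf1 (fst z), 0))\<^sup>2 + (D (hf2 (fst z), 0))\<^sup>2"
      "B (u1, 0) + B (u2, 0) = B (hf1 (fst z), 0) + B (hf2 (fst z), 0)"
      "(D (0, w1))\<^sup>2 + (D (0, w2))\<^sup>2 = (D (0, hf1 (snd z)))\<^sup>2 + (D (0, hf2 (snd z)))\<^sup>2"
      "B (0, w1) + B (0, w2) = B (0, hf1 (snd z)) + B (0, hf2 (snd z))"
      using quad[OF lin(1) lorentz_onb_chart o(1)[unfolded p_def]] quad[OF lin(2) lorentz_onb_chart o(2)[unfolded q_def]] by auto
    note XY = XY_chart[OF WG(1,3) oV VW z, folded w_def, unfolded cz, folded D_def]
    note XXYY = XXYY_chart[OF WG(1,3) oV VW z, folded w_def, unfolded cz, folded D_def B_def p_def q_def]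
    have L: "lor u1 p = 0" "lor u1 u1 = 1" "lor u2 p = 0" "lor u2 u2 = 1" "lor w1 q = 0" "lor w1 w1 = 1" "lor w2 q = 0" "lor w2 w2 = 1"
      using o by (auto simp: onb_at_def)
    note gs = g1[OF L(1,2)] g1[OF L(3,4)] g2[OF L(5,6)] g2[OF L(7,8)]
    have "grad_sq F (chart z) = ((D (u1, 0))\<^sup>2 + (D (u2, 0))\<^sup>2) + ((D (0, w1))\<^sup>2 + (D (0, w2))\<^sup>2)"
      unfolding grad_sq_def cz using gs by (simp add: tb)
    moreover have "lap F (chart z) = 2 * D (p, 0) + (B (u1, 0) + B (u2, 0)) + 2 * D (0, q) + (B (0, w1) + B (0, w2))"
      unfolding lap_def cz using gs by (simp add: tb)
    ultimately show ?thesis unfolding Q XY XXYY by simp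
  qed
  show ?thesis
    by (intro exI[of _ w] conjI ballI oV sw main[THEN conjunct1] main[THEN conjunct2]) (use WG in \<open>auto simp: w_def\<close>)
qed

section \<open>Functions of one variable and locally constant functions\<close>

lemma smooth_antiderivative:
  fixes g :: "real \<Rightarrow> real"
  assumes J: "open J" "l \<in> J" and g: "smooth_on J g"
  shows "\<exists>e>0. {l-e<..<l+e} \<subseteq> J \<and> (\<exists>\<phi>. smooth_on {l-e<..<l+e} \<phi> \<and> \<phi> l = 0 \<and>
    (\<forall>x\<in>{l-e<..<l+e}. (\<phi> has_real_derivative g x) (at x)))"
proof -
  obtain e where e: "e > 0" "cball l e \<subseteq> J" using J open_contains_cball by blast
  have cb: "{l-e..l+e} \<subseteq> J" using e by (auto simp: cball_eq_atLeastAtMost)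
  have "C_k 0 J g" using g unfolding smooth_on_def by blast
  then have "continuous_on {l-e..l+e} g" using cb continuous_on_subset by auto
  then obtain \<phi> where \<phi>: "\<And>x. x \<in> {l-e..l+e} \<Longrightarrow> (\<phi> has_vector_derivative g x) (at x within {l-e..l+e})"
    using antiderivative_continuous by blast
  have d: "((\<lambda>x. \<phi> x - \<phi> l) has_real_derivative g x) (at x)" if "x \<in> {l-e<..<l+e}" for x
  proof -
    have "x \<in> {l-e..l+e}" "x \<in> interior {l-e..l+e}" using that by auto
    then have "(\<phi> has_vector_derivative g x) (at x)" using \<phi>[of x] at_within_interior by metis
    then have "(\<phi> has_real_derivative g x) (at x)" by (simp add: has_real_derivative_iff_has_vector_derivative)
    from DERIV_diff[OF this DERIV_const] show ?thesis by simp
  qed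
  have o: "open {l-e<..<l+e}" by simp
  have "C_k n {l-e<..<l+e} (\<lambda>x. \<phi> x - \<phi> l)" for n
  proof (cases n)
    case 0
    show ?thesis unfolding 0 C_k.simps
      by (rule continuous_at_imp_continuous_on) (use d DERIV_isCont in blast)
  next
    case (Suc m)
    have "C_k m {l-e<..<l+e} g"
      using g C_k_mono[of m J g] cb unfolding smooth_on_def by (meson dual_order.trans greaterThanLessThan_subseteq_atLeastAtMost_iff order_refl)
    then show ?thesis unfolding Suc
      by (rule C_k_realI[OF o, rotated]) (use d in \<open>simp add: has_real_derivative_iff_has_vector_derivative\<close>)
  qed
  then show ?thesis using e cb d
    by (intro exI[of _ e] conjI exI[of _ "\<lambda>x. \<phi> x - \<phi> l"]) (auto simp: smooth_on_def)
qed

lemma smooth_on_real_derivative: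
  fixes g :: "real \<Rightarrow> real"
  assumes "open J" "smooth_on J g"
  shows "\<exists>g'. smooth_on J g' \<and> (\<forall>x\<in>J. (g has_real_derivative g' x) (at x))"
proof (intro exI[of _ "\<lambda>x. frechet_derivative g (at x) 1"] conjI ballI)
  show "smooth_on J (\<lambda>x. frechet_derivative g (at x) 1)" using smooth_on_frechet[OF assms(2)] .
  fix x assume "x \<in> J"
  note d = smooth_on_has_derivative[OF assms \<open>x \<in> J\<close>]
  have "frechet_derivative g (at x) h = frechet_derivative g (at x) 1 * h" for h
    using linear_scale[OF has_derivative_linear[OF d], of h 1] by simp
  then show "(g has_real_derivative frechet_derivative g (at x) 1) (at x)"
    unfolding has_field_derivative_def by (intro has_derivative_eq_rhs[OF d] ext)
qed

lemma XY_compose: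
  fixes \<phi> :: "real \<Rightarrow> real"
  assumes V: "open V" and w: "w \<in> Sm V" and z: "z \<in> V" and \<phi>: "(\<phi> has_real_derivative g) (at (w z))"
  shows "X1 (\<lambda>z. \<phi> (w z)) z = g * X1 w z" "X2 (\<lambda>z. \<phi> (w z)) z = g * X2 w z"
    "Y1 (\<lambda>z. \<phi> (w z)) z = g * Y1 w z" "Y2 (\<lambda>z. \<phi> (w z)) z = g * Y2 w z"
proof -
  have "(w has_derivative frechet_derivative w (at z)) (at z)"
    using smooth_on_has_derivative[OF V _ z] w by (simp add: Sm_def)
  from has_derivative_compose[OF this \<phi>[unfolded has_field_derivative_def]]
  have d: "frechet_derivative (\<lambda>z. \<phi> (w z)) (at z) = (\<lambda>v. g * frechet_derivative w (at z) v)"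
    by (rule frechet_derivative_at[symmetric])
  show "X1 (\<lambda>z. \<phi> (w z)) z = g * X1 w z" "X2 (\<lambda>z. \<phi> (w z)) z = g * X2 w z"
    "Y1 (\<lambda>z. \<phi> (w z)) z = g * Y1 w z" "Y2 (\<lambda>z. \<phi> (w z)) z = g * Y2 w z"
    by (simp_all add: X1_def X2_def Y1_def Y2_def d)
qed

lemma Sm_compose:
  assumes "open V" "w \<in> Sm V" "open J" "w ` V \<subseteq> J" "smooth_on J \<phi>"
  shows "(\<lambda>z. \<phi> (w z)) \<in> Sm V"
  using smooth_on_compose[OF assms(1,3,4) _ assms(5)] assms(2) by (simp add: Sm_def)

lemma frechet_zero:
  assumes V: "open V" and f: "f \<in> Sm V" and z: "z \<in> V"
    and 0: "X1 f z = 0" "X2 f z = 0" "Y1 f z = 0" "Y2 f z = 0"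
  shows "(f has_derivative (\<lambda>_. 0)) (at z)"
proof -
  have d: "(f has_derivative frechet_derivative f (at z)) (at z)"
    using smooth_on_has_derivative[OF V _ z] f by (simp add: Sm_def)
  have l: "linear (frechet_derivative f (at z))" using has_derivative_linear[OF d] .
  have "frechet_derivative f (at z) v = 0" for v
  proof -
    have v: "v = fst (fst v) *\<^sub>R ((1,0),(0,0)) + snd (fst v) *\<^sub>R ((0,1),(0,0))
      + fst (snd v) *\<^sub>R ((0,0),(1,0)) + snd (snd v) *\<^sub>R ((0,0),(0,1))" by (simp add: prod_eq_iff)
    from arg_cong[OF this, of "frechet_derivative f (at z)"] show ?thesis
      unfolding linear_add[OF l] linear_scale[OF l] using 0 by (simp add: X1_def X2_def Y1_def Y2_def)
  qed
  then have "frechet_derivative f (at z) = (\<lambda>_. 0)" by auto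
  then show ?thesis using d by simp
qed

text \<open>The locally constant smooth functions. On a disconnected \<open>V\<close> such a
  function need not be constant.\<close>

definition "XYflat V f \<longleftrightarrow> f \<in> Sm V \<and> (\<forall>z\<in>V. X1 f z = 0 \<and> X2 f z = 0 \<and> Y1 f z = 0 \<and> Y2 f z = 0)"

lemma XYflat_local:
  assumes "open V" "XYflat V f" "ball z e \<subseteq> V" "y \<in> ball z e"
  shows "f y = f z"
proof -
  have "z \<in> ball z e" using assms(4) by (metis centre_in_ball less_le_trans mem_ball not_le zero_le_dist)
  have "\<exists>c. \<forall>x\<in>ball z e. f x = c"
  proof (rule has_derivative_zero_constant[OF convex_ball])
    fix x assume "x \<in> ball z e"
    then have x: "x \<in> V" using assms(3) by blast
    have "(f has_derivative (\<lambda>_. 0)) (at x)"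
      using frechet_zero[OF assms(1) _ x, of f] assms(2) x unfolding XYflat_def by blast
    then show "(f has_derivative (\<lambda>h. 0)) (at x within ball z e)" by (rule has_derivative_at_withinI)
  qed
  then show ?thesis using assms(4) \<open>z \<in> ball z e\<close> by metis
qed

text \<open>\<open>C\<close> will be the connected level set, which is not open, while derivatives
  are known on the open set \<open>V\<close> around it. Balls in \<open>V\<close> provide local
  constancy, and connectedness of \<open>C\<close> does the rest.\<close>

lemma XYflat_connected:
  assumes V: "open V" and f: "XYflat V f" and C: "connected C" "C \<subseteq> V" "x \<in> C" "y \<in> C"
  shows "f x = f y"
proof (rule connected_local_const[OF C(1,3,4)], rule ballI)
  fix a assume "a \<in> C"
  then have "a \<in> V" using C by auto
  then obtain e where e: "e > 0" "ball a e \<subseteq> V" using V openE by blast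
  have "eventually (\<lambda>b. b \<in> ball a e) (at a within C)"
    unfolding eventually_at using e(1) by (intro exI[of _ e]) (simp add: dist_commute)
  then show "\<forall>\<^sub>F b in at a within C. f a = f b"
    by eventually_elim (use XYflat_local[OF V f e(2)] in auto)
qed

lemma XYflat_level_open:
  assumes V: "open V" and f: "XYflat V f"
  shows "open {z\<in>V. f z = c}"
  unfolding open_contains_ball
proof
  fix z assume z: "z \<in> {z\<in>V. f z = c}"
  then obtain e where e: "e > 0" "ball z e \<subseteq> V" using V openE by blast
  have "y \<in> V \<and> f y = c" if "y \<in> ball z e" for y
    using XYflat_local[OF V f e(2) that] z that e(2) by blast
  then show "\<exists>e>0. ball z e \<subseteq> {z\<in>V. f z = c}" using e(1) by blast
qed

lemma Sm_continuous: "open V \<Longrightarrow> f \<in> Sm V \<Longrightarrow> continuous_on V f"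
  unfolding Sm_def smooth_on_def using C_k.simps(1) by blast

lemma open_Sm_pos: "open V \<Longrightarrow> f \<in> Sm V \<Longrightarrow> open {z\<in>V. 0 < f z}"
  using continuous_open_preimage[OF Sm_continuous, of V f "{0<..}"] by (simp add: vimage_def Int_def)

lemma Sm_mono: "f \<in> Sm V \<Longrightarrow> W \<subseteq> V \<Longrightarrow> f \<in> Sm W"
  by (auto simp: Sm_def intro: smooth_on_mono)

subsection \<open>Isoparametric functions in the chart\<close>

text \<open>The function w is an isoparametric function in the chart, d = \<phi> \<circ> w its normalisation to a unit
  gradient, and \<psi> \<circ> w the Laplacian of d.\<close>

locale iso_chart =
  fixes V :: "pt set" and J :: "real set" and w :: "pt \<Rightarrow> real" and \<phi> g \<psi> \<kappa> :: "real \<Rightarrow> real" and l :: real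
  assumes V: "open V" and J: "open J" "l \<in> J" and w: "w \<in> Sm V" "w ` V \<subseteq> J"
    and smooth: "smooth_on J \<phi>" "smooth_on J g" "smooth_on J \<psi>" "smooth_on J \<kappa>"
    and phi: "x \<in> J \<Longrightarrow> (\<phi> has_real_derivative g x) (at x)" "x \<in> J \<Longrightarrow> 0 < g x"
    and psi: "x \<in> J \<Longrightarrow> (\<psi> has_real_derivative \<kappa> x * g x) (at x)"
    and unit: "z \<in> V \<Longrightarrow> (X1 (\<lambda>z. \<phi> (w z)) z)\<^sup>2 + (X2 (\<lambda>z. \<phi> (w z)) z)\<^sup>2
       + ((Y1 (\<lambda>z. \<phi> (w z)) z)\<^sup>2 + (Y2 (\<lambda>z. \<phi> (w z)) z)\<^sup>2) = 1"
    and lapl: "z \<in> V \<Longrightarrow> \<psi> (w z) = X1 (X1 (\<lambda>z. \<phi> (w z))) z + X2 (X2 (\<lambda>z. \<phi> (w z))) z - X2 (\<lambda>z. \<phi> (w z)) z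
       + (Y1 (Y1 (\<lambda>z. \<phi> (w z))) z + Y2 (Y2 (\<lambda>z. \<phi> (w z))) z - Y2 (\<lambda>z. \<phi> (w z)) z)"
begin

definition "d z = \<phi> (w z)"
definition "H z = \<psi> (w z)"
definition "H1 z = \<kappa> (w z)"
text \<open>\<open>A\<close> and \<open>B\<close> are the squares of the gradient components
  \<open>a\<close> and \<open>b\<close>. They are smooth everywhere, whereas the components
  themselves may fail to be so at their zeros.\<close>

definition "A z = X1 d z * X1 d z + X2 d z * X2 d z"
definition "B z = Y1 d z * Y1 d z + Y2 d z * Y2 d z"

lemma restrict: "open V' \<Longrightarrow> V' \<subseteq> V \<Longrightarrow> iso_chart V' J w \<phi> g \<psi> \<kappa> l"
  using iso_chart_axioms Sm_mono[of w V V'] unfolding iso_chart_def by (auto 0 3)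

sublocale group_frame V "Sm V" X1 X2 Y1 Y2 "\<lambda>z. hp (fst z)" "\<lambda>z. hf1 (fst z)" "\<lambda>z. hf2 (fst z)"
    "\<lambda>z. hp (snd z)" "\<lambda>z. hf1 (snd z)" "\<lambda>z. hf2 (snd z)"
  by (rule group_frame_chart[OF V])

lemma S_dH: "d \<in> Sm V" "H \<in> Sm V" "H1 \<in> Sm V"
  using Sm_compose[OF V w(1) J(1) w(2)] smooth by (auto simp: d_def[abs_def] H_def[abs_def] H1_def[abs_def])

lemma S_Xd: "X1 d \<in> Sm V" "X2 d \<in> Sm V" "Y1 d \<in> Sm V" "Y2 d \<in> Sm V" "A \<in> Sm V" "B \<in> Sm V"
  using derivation_S derXY S_dH by (auto simp: A_def[abs_def] B_def[abs_def])

lemma AB: "z \<in> V \<Longrightarrow> A z + B z = 1" "0 \<le> A z" "0 \<le> B z"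
  using unit[of z] by (auto simp: A_def B_def d_def[abs_def] power2_eq_square)

lemma grad_H:
  assumes z: "z \<in> V"
  shows "X1 H z = X1 d z * H1 z" "X2 H z = X2 d z * H1 z" "Y1 H z = Y1 d z * H1 z" "Y2 H z = Y2 d z * H1 z"
proof -
  have x: "w z \<in> J" using w z by auto
  show "X1 H z = X1 d z * H1 z" "X2 H z = X2 d z * H1 z" "Y1 H z = Y1 d z * H1 z" "Y2 H z = Y2 d z * H1 z"
    unfolding H_def[abs_def] d_def[abs_def] XY_compose[OF V w(1) z psi[OF x]] XY_compose[OF V w(1) z phi(1)[OF x]]
    by (simp_all add: H1_def)
qed

lemma lap_dH: "z \<in> V \<Longrightarrow> H z = X1 (X1 d) z + X2 (X2 d) z - X2 d z + (Y1 (Y1 d) z + Y2 (Y2 d) z - Y2 d z)"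
  using lapl[of z] by (simp add: H_def d_def[abs_def])

lemma rotated_frameI:
  assumes S: "c \<in> Sm V" "s \<in> Sm V" "c' \<in> Sm V" "s' \<in> Sm V" "a \<in> Sm V" "b \<in> Sm V"
    and cs: "\<And>z. z \<in> V \<Longrightarrow> c z * c z + s z * s z = 1" "\<And>z. z \<in> V \<Longrightarrow> c' z * c' z + s' z * s' z = 1"
    and gr: "\<And>z. z \<in> V \<Longrightarrow> X1 d z = a z * c z" "\<And>z. z \<in> V \<Longrightarrow> X2 d z = a z * s z"
      "\<And>z. z \<in> V \<Longrightarrow> Y1 d z = b z * c' z" "\<And>z. z \<in> V \<Longrightarrow> Y2 d z = b z * s' z"
    and ab: "\<And>z. z \<in> V \<Longrightarrow> (a z)\<^sup>2 + (b z)\<^sup>2 = 1"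
  shows "rotated_frame V (Sm V) X1 X2 Y1 Y2 (\<lambda>z. hp (fst z)) (\<lambda>z. hf1 (fst z)) (\<lambda>z. hf2 (fst z))
    (\<lambda>z. hp (snd z)) (\<lambda>z. hf1 (snd z)) (\<lambda>z. hf2 (snd z)) c s c' s' a b d H H1"
  by unfold_locales (fact S_dH | erule lap_dH | erule grad_H | fact assms | erule assms)+

definition "a z = A z powr (1/2)"
definition "b z = B z powr (1/2)"

lemma generic_rotated_frame:
  assumes pos: "\<And>z. z \<in> V \<Longrightarrow> 0 < A z" "\<And>z. z \<in> V \<Longrightarrow> 0 < B z"
  shows "rotated_frame V (Sm V) X1 X2 Y1 Y2 (\<lambda>z. hp (fst z)) (\<lambda>z. hf1 (fst z)) (\<lambda>z. hf2 (fst z))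
    (\<lambda>z. hp (snd z)) (\<lambda>z. hf1 (snd z)) (\<lambda>z. hf2 (snd z))
    (\<lambda>z. inverse (a z) * X1 d z) (\<lambda>z. inverse (a z) * X2 d z) (\<lambda>z. inverse (b z) * Y1 d z) (\<lambda>z. inverse (b z) * Y2 d z)
    a b d H H1"
    and "\<And>z. z \<in> V \<Longrightarrow> 0 < a z" and "\<And>z. z \<in> V \<Longrightarrow> 0 < b z"
proof -
  have aa: "a z * a z = A z" "0 < a z" if "z \<in> V" for z
    using pos(1)[OF that] by (simp_all add: a_def powr_half_sqrt)
  have bb: "b z * b z = B z" "0 < b z" if "z \<in> V" for z
    using pos(2)[OF that] by (simp_all add: b_def powr_half_sqrt)
  show "\<And>z. z \<in> V \<Longrightarrow> 0 < a z" "\<And>z. z \<in> V \<Longrightarrow> 0 < b z" using aa bb by auto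
  have S: "a \<in> Sm V" "b \<in> Sm V"
    unfolding a_def[abs_def] b_def[abs_def] Sm_def
    by (auto intro!: smooth_on_powr[OF V] simp del: split_paired_All) (use S_Xd pos in \<open>auto simp: Sm_def\<close>)
  have inv: "inverse (a z) * (inverse (a z) * A z) = 1" "inverse (b z) * (inverse (b z) * B z) = 1" if "z \<in> V" for z
    using aa(2)[OF that] bb(2)[OF that] unfolding aa(1)[OF that, symmetric] bb(1)[OF that, symmetric] by (simp_all add: field_simps)
  show "rotated_frame V (Sm V) X1 X2 Y1 Y2 (\<lambda>z. hp (fst z)) (\<lambda>z. hf1 (fst z)) (\<lambda>z. hf2 (fst z))
    (\<lambda>z. hp (snd z)) (\<lambda>z. hf1 (snd z)) (\<lambda>z. hf2 (snd z))
    (\<lambda>z. inverse (a z) * X1 d z) (\<lambda>z. inverse (a z) * X2 d z) (\<lambda>z. inverse (b z) * Y1 d z) (\<lambda>z. inverse (b z) * Y2 d z)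
    a b d H H1"
  proof (rule rotated_frameI)
    fix z assume z: "z \<in> V"
    show "inverse (a z) * X1 d z * (inverse (a z) * X1 d z) + inverse (a z) * X2 d z * (inverse (a z) * X2 d z) = 1"
      using inv(1)[OF z] by (simp add: A_def algebra_simps)
    show "inverse (b z) * Y1 d z * (inverse (b z) * Y1 d z) + inverse (b z) * Y2 d z * (inverse (b z) * Y2 d z) = 1"
      using inv(2)[OF z] by (simp add: B_def algebra_simps)
    show "X1 d z = a z * (inverse (a z) * X1 d z)" "X2 d z = a z * (inverse (a z) * X2 d z)"
      "Y1 d z = b z * (inverse (b z) * Y1 d z)" "Y2 d z = b z * (inverse (b z) * Y2 d z)"
      using aa(2)[OF z] bb(2)[OF z] by (auto simp: field_simps)
    show "(a z)\<^sup>2 + (b z)\<^sup>2 = 1" using aa(1)[OF z] bb(1)[OF z] AB(1)[OF z] by (simp add: power2_eq_square)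
  qed (use S S_Xd aa(2) bb(2) in \<open>auto intro!: S_mult S_inverse\<close>)
qed

text \<open>\<open>a_constant\<close> gives the derivatives of \<open>a\<close> in the adapted
  frame; rotating back within each factor gives those in the chart fields.\<close>

lemma A_flat_generic:
  assumes pos: "\<And>z. z \<in> V \<Longrightarrow> 0 < A z" "\<And>z. z \<in> V \<Longrightarrow> 0 < B z" and z: "z \<in> V"
  shows "X1 A z = 0 \<and> X2 A z = 0 \<and> Y1 A z = 0 \<and> Y2 A z = 0"
proof -
  interpret R: rotated_frame V "Sm V" X1 X2 Y1 Y2 "\<lambda>z. hp (fst z)" "\<lambda>z. hf1 (fst z)" "\<lambda>z. hf2 (fst z)"
    "\<lambda>z. hp (snd z)" "\<lambda>z. hf1 (snd z)" "\<lambda>z. hf2 (snd z)"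
    "\<lambda>z. inverse (a z) * X1 d z" "\<lambda>z. inverse (a z) * X2 d z" "\<lambda>z. inverse (b z) * Y1 d z" "\<lambda>z. inverse (b z) * Y2 d z"
    a b d H H1
    using generic_rotated_frame(1)[OF pos] .
  interpret Gf: generic_frame V "Sm V" R.n1 R.e1 R.n2 R.e2 R.r1 R.r2 R.r3 R.r4 R.q1 R.q2 R.q3 R.q4 a b d H H1
    by unfold_locales (use generic_rotated_frame(2,3)[OF pos] in auto)
  have x: "f1 = 0 \<and> f2 = 0" if "c * f1 + s * f2 = 0" "- s * f1 + c * f2 = 0" "c * c + s * s = 1" for c s f1 f2 :: real
    using that(1,2) that(3)[THEN eq_iff_diff_eq_0[THEN iffD1]] by algebra
  have a0: "X1 a z = 0 \<and> X2 a z = 0" "Y1 a z = 0 \<and> Y2 a z = 0"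
    using Gf.a_constant[OF z] x[OF _ _ R.cs(1)[OF z]] x[OF _ _ R.cs(2)[OF z]]
    unfolding R.n1_def R.e1_def R.n2_def R.e2_def by blast+
  have Aa: "A z = a z * a z" if "z \<in> V" for z using pos(1)[OF that] by (simp add: a_def powr_half_sqrt)
  have "X A z = a z * X a z + X a z * a z" if "derivation X" for X
    by (rule hd_eq[OF that hd_self[OF S_Xd(5)] hd_mult[OF that hd_self hd_self] Aa z]) (use R.S_cs in auto)
  from this[OF derXY(1)] this[OF derXY(2)] this[OF derXY(3)] this[OF derXY(4)] show ?thesis using a0 by simp
qed

text \<open>On the open set where \<open>A\<close> and \<open>B\<close> are positive this is the
  generic case. At any other point A is 0 or 1, hence minimal or maximal because A + B = 1 with both
  nonnegative, and its differential vanishes there. So the three regimes of the product angle cannot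
  meet within a component.\<close>

lemma A_flat: "XYflat V A"
  unfolding XYflat_def
proof (intro conjI ballI)
  show "A \<in> Sm V" by (rule S_Xd)
  fix z assume z: "z \<in> V"
  have "X1 A z = 0 \<and> X2 A z = 0 \<and> Y1 A z = 0 \<and> Y2 A z = 0"
  proof (cases "0 < A z \<and> 0 < B z")
    case True
    define V' where "V' = {z\<in>{z\<in>V. 0 < A z}. 0 < B z}"
    have o: "open {z\<in>V. 0 < A z}" using open_Sm_pos[OF V S_Xd(5)] .
    have o': "open V'" unfolding V'_def by (rule open_Sm_pos[OF o Sm_mono[OF S_Xd(6)]]) auto
    interpret R: iso_chart V' J w \<phi> g \<psi> \<kappa> l by (rule restrict[OF o']) (auto simp: V'_def)
    have "z \<in> V'" using True z by (simp add: V'_def)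
    moreover have "0 < A y" "0 < B y" if "y \<in> V'" for y using that by (simp_all add: V'_def)
    ultimately show ?thesis using R.A_flat_generic[of z] by metis
  next
    case False
    then have "A z = 0 \<or> A z = 1" using AB(1)[OF z] AB(2)[of z] AB(3)[of z] by auto
    have d: "(A has_derivative frechet_derivative A (at z)) (at z)"
      using smooth_on_has_derivative[OF V _ z] S_Xd(5) by (simp add: Sm_def)
    have "(\<forall>y\<in>V. A y \<le> A z) \<or> (\<forall>y\<in>V. A z \<le> A y)"
      using \<open>A z = 0 \<or> A z = 1\<close> AB by (smt (verit, best))
    then have "frechet_derivative A (at z) = (\<lambda>v. 0)"
      by (rule differential_zero_maxmin[OF z V d])
    then show ?thesis by (simp add: X1_def X2_def Y1_def Y2_def)
  qed
  then show "X1 A z = 0" "X2 A z = 0" "Y1 A z = 0" "Y2 A z = 0" by auto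
qed

end

section \<open>Identifying a level set from locally constant data; the cylinder case\<close>

lemma isolated_level:
  fixes \<Theta> :: "real \<Rightarrow> real"
  assumes "(\<Theta> has_real_derivative D) (at l)" "D \<noteq> 0"
  shows "\<exists>\<delta>>0. \<forall>x. \<bar>x - l\<bar> < \<delta> \<longrightarrow> \<Theta> x = \<Theta> l \<longrightarrow> x = l"
proof -
  have "((\<lambda>x. (\<Theta> x - \<Theta> l) / (x - l)) \<longlongrightarrow> D) (at l)"
    using assms(1) by (simp add: has_field_derivative_iff)
  then have "eventually (\<lambda>x. (\<Theta> x - \<Theta> l) / (x - l) \<noteq> 0) (at l)"
    using assms(2) by (rule tendsto_imp_eventually_ne)
  then obtain \<delta> where "\<delta> > 0" "\<And>x. x \<noteq> l \<Longrightarrow> dist x l < \<delta> \<Longrightarrow> (\<Theta> x - \<Theta> l) / (x - l) \<noteq> 0"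
    unfolding eventually_at by blast
  then show ?thesis by (intro exI[of _ \<delta>]) (auto simp: dist_real_def)
qed

text \<open>Reversed Cauchy-Schwarz: if \<open>q\<close> is not spacelike and its time component is
  not positive, then its product with a point of the upper sheet is nonnegative.\<close>

lemma H2_lor_neg:
  assumes p: "p \<in> H2" and q: "lor q q \<le> 0" and "lor p q < 0"
  shows "0 < q $ 1"
proof (rule ccontr)
  assume "\<not> 0 < q $ 1"
  then have q1: "q $ 1 \<le> 0" by simp
  have pp: "(p$1)\<^sup>2 = 1 + (p$2)\<^sup>2 + (p$3)\<^sup>2" "0 < p$1" using p by (auto simp: H2_def lor_def power2_eq_square)
  have qq: "(q$2)\<^sup>2 + (q$3)\<^sup>2 \<le> (q$1)\<^sup>2" using q by (simp add: lor_def power2_eq_square)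
  have "(p$2 * q$2 + p$3 * q$3)\<^sup>2 + (p$2 * q$3 - p$3 * q$2)\<^sup>2 = ((p$2)\<^sup>2 + (p$3)\<^sup>2) * ((q$2)\<^sup>2 + (q$3)\<^sup>2)"
    by (simp add: power2_eq_square algebra_simps)
  then have "(p$2 * q$2 + p$3 * q$3)\<^sup>2 \<le> ((p$2)\<^sup>2 + (p$3)\<^sup>2) * ((q$2)\<^sup>2 + (q$3)\<^sup>2)"
    by (metis le_add_same_cancel1 zero_le_power2)
  also have "\<dots> \<le> (p$1)\<^sup>2 * (q$1)\<^sup>2" using pp qq by (intro mult_mono) auto
  also have "\<dots> = (p$1 * (- q$1))\<^sup>2" by (simp add: power2_eq_square)
  finally have "\<bar>p$2 * q$2 + p$3 * q$3\<bar> \<le> \<bar>p$1 * (- q$1)\<bar>"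
    by (rule abs_le_square_iff[THEN iffD2])
  moreover have "0 \<le> p$1 * (- q$1)" using pp(2) q1 by (intro mult_nonneg_nonneg) auto
  ultimately have "\<bar>p$2 * q$2 + p$3 * q$3\<bar> \<le> p$1 * (- q$1)" by simp
  then have "0 \<le> lor p q" by (auto simp: lor_def abs_le_iff)
  then show False using assms(3) by simp
qed

text \<open>If the product were nonnegative, p - q would be timelike with negative product with
  \<open>p\<close>, so p1 > q1 by \<open>H2_lor_neg\<close>; exchanging the points gives q1 >
  p1.\<close>

lemma H2_lor_lt_0:
  assumes p: "p \<in> H2" and q: "q \<in> H2"
  shows "lor p q < 0"
proof (rule ccontr)
  assume a: "\<not> lor p q < 0"
  have pq: "lor p p = -1" "lor q q = -1" using p q by (auto simp: H2_def)
  have "0 < (p - q) $ 1"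
    using H2_lor_neg[OF p, of "p - q"] a pq by (simp add: lor_simps lor_commute[of q p])
  moreover have "0 < (q - p) $ 1"
    using H2_lor_neg[OF q, of "q - p"] a pq by (simp add: lor_simps lor_commute[of q p])
  ultimately show False by simp
qed

lemma connected_sign:
  fixes f :: "'a::topological_space \<Rightarrow> real"
  assumes "connected C" "continuous_on C f" "\<And>z. z \<in> C \<Longrightarrow> f z \<noteq> 0" "x \<in> C" "y \<in> C" "0 < f x"
  shows "0 < f y"
proof (rule ccontr)
  assume "\<not> 0 < f y"
  have "connected (f ` C)" using assms connected_continuous_image by blast
  then have "0 \<in> f ` C"
    using assms(4-6) \<open>\<not> 0 < f y\<close> connectedD_interval[of "f ` C" "f y" "f x" 0] by auto
  then show False using assms(3) by auto
qed

lemma connected_unit_sign: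
  fixes f :: "'a::topological_space \<Rightarrow> real"
  assumes "connected C" "continuous_on C f" "\<And>z. z \<in> C \<Longrightarrow> f z \<noteq> 0" "x \<in> C"
  shows "\<exists>\<sigma>. \<sigma> * \<sigma> = 1 \<and> (\<forall>y\<in>C. 0 < \<sigma> * f y)"
proof (cases "0 < f x")
  case True
  then show ?thesis using connected_sign[OF assms(1-3) assms(4)] by (intro exI[of _ 1]) auto
next
  case False
  then have "0 < - f x" using assms(3,4) by force
  then have "0 < - f y" if "y \<in> C" for y
    using connected_sign[OF assms(1) continuous_on_minus[OF assms(2)] _ assms(4) that] assms(3) by auto
  then show ?thesis by (intro exI[of _ "-1"]) auto
qed

context rotated_frame
begin

lemma flat_XY: "pos.flat f \<Longrightarrow> z \<in> U \<Longrightarrow> X1 f z = 0 \<and> X2 f z = 0 \<and> Y1 f z = 0 \<and> Y2 f z = 0"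
proof -
  assume f: "pos.flat f" "z \<in> U"
  have x: "f1 = 0 \<and> f2 = 0" if "x * f1 + y * f2 = 0" "- y * f1 + x * f2 = 0" "x * x + y * y = 1" for x y f1 f2 :: real
    using that(1,2) that(3)[THEN eq_iff_diff_eq_0[THEN iffD1]] by algebra
  show ?thesis
    using f x[OF _ _ cs(1)[OF f(2)]] x[OF _ _ cs(2)[OF f(2)]]
    unfolding pos.flat_def n1_def e1_def n2_def e2_def by blast
qed

end

context iso_chart
begin

text \<open>The level set lies in \<open>T\<close>, and near each of its points it fills
  \<open>T\<close>. This is openness of the level set in \<open>T\<close>, phrased so that
  \<open>T\<close> may contain further points farther away.\<close>

definition "local_level T \<longleftrightarrow> (\<forall>z\<in>V. w z = l \<longrightarrow> z \<in> T \<and> (\<exists>e>0. ball z e \<subseteq> V \<and> (\<forall>y\<in>ball z e. y \<in> T \<longrightarrow> w y = l)))"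

lemma local_level_restrict:
  assumes "iso_chart.local_level V' w l T" "iso_chart V' J w \<phi> g \<psi> \<kappa> l" "V' \<subseteq> V" "\<And>z. z \<in> V \<Longrightarrow> w z = l \<Longrightarrow> z \<in> V'"
  shows "local_level T"
  using assms(1,3,4) unfolding local_level_def iso_chart.local_level_def[OF assms(2)] by (meson order_trans)

text \<open>The defining equation of \<open>T\<close> usually controls only some function
  \<open>\<Theta>\<close> of \<open>w\<close>. A nonzero derivative of \<open>\<Theta>\<close> at
  \<open>l\<close> makes \<open>l\<close> isolated among the solutions, and continuity of
  \<open>w\<close> keeps the nearby values in that range.\<close>

lemma local_levelI:
  assumes T: "\<And>z. z \<in> V \<Longrightarrow> w z = l \<Longrightarrow> z \<in> T"
    and \<Theta>: "(\<Theta> has_real_derivative D) (at l)" "D \<noteq> 0"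
    and e: "\<And>z. z \<in> V \<Longrightarrow> w z = l \<Longrightarrow> \<exists>e>0. ball z e \<subseteq> V \<and> (\<forall>y\<in>ball z e. y \<in> T \<longrightarrow> \<Theta> (w y) = \<Theta> l)"
  shows "local_level T"
  unfolding local_level_def
proof (intro ballI impI conjI)
  fix z assume z: "z \<in> V" "w z = l"
  show "z \<in> T" using T z .
  obtain e where e: "e > 0" "ball z e \<subseteq> V" "\<And>y. y \<in> ball z e \<Longrightarrow> y \<in> T \<Longrightarrow> \<Theta> (w y) = \<Theta> l" using e[OF z] by blast
  obtain \<delta> where \<delta>: "\<delta> > 0" "\<And>x. \<bar>x - l\<bar> < \<delta> \<Longrightarrow> \<Theta> x = \<Theta> l \<Longrightarrow> x = l" using isolated_level[OF \<Theta>] by blast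
  have "isCont w z" using Sm_continuous[OF V w(1)] V z(1) continuous_on_eq_continuous_at by blast
  then obtain e' where e': "e' > 0" "\<And>y. dist y z < e' \<Longrightarrow> dist (w y) (w z) < \<delta>"
    using \<delta>(1) unfolding continuous_at_eps_delta by blast
  have "w y = l" if "y \<in> ball z (min e e')" "y \<in> T" for y
    using e(3)[of y] \<delta>(2)[of "w y"] e'(2)[of y] that z(2) by (simp add: dist_commute dist_real_def)
  then show "\<exists>e>0. ball z e \<subseteq> V \<and> (\<forall>y\<in>ball z e. y \<in> T \<longrightarrow> w y = l)"
    using e e' by (intro exI[of _ "min e e'"]) auto
qed

text \<open>Only the level set is required to be connected. The second statement extends the value
  to a full neighbourhood, where points of the target outside the level set have to be
  compared.\<close>

lemma level_const:
  assumes conn: "connected {z\<in>V. w z = l}" and z0: "z0 \<in> V" "w z0 = l" and f: "XYflat V f" and z: "z \<in> V" "w z = l"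
  shows "f z = f z0" "\<exists>e>0. ball z e \<subseteq> V \<and> (\<forall>y\<in>ball z e. f y = f z0)"
proof -
  show 1: "f z = f z0" using XYflat_connected[OF V f conn, of z z0] z z0 by auto
  obtain e where e: "e > 0" "ball z e \<subseteq> V" using V z openE by blast
  then show "\<exists>e>0. ball z e \<subseteq> V \<and> (\<forall>y\<in>ball z e. f y = f z0)"
    using XYflat_local[OF V f e(2)] 1 by (intro exI[of _ e]) auto
qed

lemma level_const_vec:
  fixes f :: "'i::finite \<Rightarrow> pt \<Rightarrow> real"
  assumes conn: "connected {z\<in>V. w z = l}" and z0: "z0 \<in> V" "w z0 = l" and f: "\<And>i. XYflat V (f i)" and z: "z \<in> V" "w z = l"
  shows "\<And>i. f i z = f i z0" "\<exists>e>0. ball z e \<subseteq> V \<and> (\<forall>y\<in>ball z e. \<forall>i. f i y = f i z0)"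
proof -
  show 1: "f i z = f i z0" for i using XYflat_connected[OF V f conn, of z z0] z z0 by auto
  obtain e where e: "e > 0" "ball z e \<subseteq> V" using V z openE by blast
  then show "\<exists>e>0. ball z e \<subseteq> V \<and> (\<forall>y\<in>ball z e. \<forall>i. f i y = f i z0)"
    using XYflat_local[OF V f e(2)] 1 by (intro exI[of _ e]) auto
qed

text \<open>exp (E w) is an integrating factor: it grows along the normal at rate \<open>H\<close>,
  exactly as fast as H p - n decays. Their product is therefore a constant vector, equal to k p - v
  on the level set, and the level set is cut out by a linear equation in the first factor.\<close>

lemma cylinder_case:
  assumes conn: "connected {z\<in>V. w z = l}" and z0: "z0 \<in> V" "w z0 = l" and A1: "\<And>z. z \<in> V \<Longrightarrow> A z = 1"
    and E: "smooth_on J E" "E l = 0" "\<And>x. x \<in> J \<Longrightarrow> (E has_real_derivative \<psi> x * g x) (at x)"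
  shows "\<exists>p v t k. lorentz_onb p v t \<and> p \<in> H2 \<and> local_level {z. lor (hp (fst z)) (k *\<^sub>R p - v) = - k}"
proof -
  have B0: "Y1 d z = 0" "Y2 d z = 0" if "z \<in> V" for z
    using AB(1)[OF that] A1[OF that] by (auto simp: B_def add_nonneg_eq_0_iff)
  have "rotated_frame V (Sm V) X1 X2 Y1 Y2 (\<lambda>z. hp (fst z)) (\<lambda>z. hf1 (fst z)) (\<lambda>z. hf2 (fst z))
    (\<lambda>z. hp (snd z)) (\<lambda>z. hf1 (snd z)) (\<lambda>z. hf2 (snd z)) (X1 d) (X2 d) (\<lambda>_. 1) (\<lambda>_. 0) (\<lambda>_. 1) (\<lambda>_. 0) d H H1"
    by (rule rotated_frameI) (use S_Xd A1 B0 in \<open>auto simp: A_def\<close>)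
  then interpret R: rotated_frame V "Sm V" X1 X2 Y1 Y2 "\<lambda>z. hp (fst z)" "\<lambda>z. hf1 (fst z)" "\<lambda>z. hf2 (fst z)"
    "\<lambda>z. hp (snd z)" "\<lambda>z. hf1 (snd z)" "\<lambda>z. hf2 (snd z)" "X1 d" "X2 d" "\<lambda>_. 1" "\<lambda>_. 0" "\<lambda>_. 1" "\<lambda>_. 0" d H H1 .
  define ew where "ew z = exp (E (w z))" for z
  have S_ew: "ew \<in> Sm V"
    using smooth_on_exp[OF V, of "\<lambda>z. E (w z)"] Sm_compose[OF V w(1) J(1) w(2) E(1)] by (simp add: Sm_def ew_def[abs_def])
  have Xew: "X1 ew z = H z * ew z * X1 d z" "X2 ew z = H z * ew z * X2 d z"
    "Y1 ew z = H z * ew z * Y1 d z" "Y2 ew z = H z * ew z * Y2 d z" if z: "z \<in> V" for z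
  proof -
    have x: "w z \<in> J" using w z by auto
    have e: "((\<lambda>x. exp (E x)) has_real_derivative (exp (E (w z)) * (\<psi> (w z) * g (w z)))) (at (w z))"
      by (rule DERIV_fun_exp[OF E(3)[OF x]])
    show "X1 ew z = H z * ew z * X1 d z" "X2 ew z = H z * ew z * X2 d z"
      "Y1 ew z = H z * ew z * Y1 d z" "Y2 ew z = H z * ew z * Y2 d z"
      unfolding ew_def[abs_def] d_def[abs_def] XY_compose[OF V w(1) z e] XY_compose[OF V w(1) z phi(1)[OF x]]
      by (simp_all add: H_def)
  qed
  have hdew: "hd R.n1 ew (\<lambda>z. H z * ew z)" "hd R.e1 ew (\<lambda>_. 0)" "hd R.n2 ew (\<lambda>_. 0)" "hd R.e2 ew (\<lambda>_. 0)"
  proof -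
    have "R.n1 ew z = H z * ew z" "R.e1 ew z = 0" "R.n2 ew z = 0" "R.e2 ew z = 0" if z: "z \<in> V" for z
    proof -
      have "R.n1 ew z = H z * ew z * (X1 d z * X1 d z + X2 d z * X2 d z)"
        unfolding R.n1_def Xew[OF z] by algebra
      then show "R.n1 ew z = H z * ew z" using R.cs(1)[OF z] by simp
      show "R.e1 ew z = 0" unfolding R.e1_def Xew[OF z] by algebra
      show "R.n2 ew z = 0" "R.e2 ew z = 0" unfolding R.n2_def R.e2_def Xew[OF z] B0[OF z] by simp_all
    qed
    then show "hd R.n1 ew (\<lambda>z. H z * ew z)" "hd R.e1 ew (\<lambda>_. 0)" "hd R.n2 ew (\<lambda>_. 0)" "hd R.e2 ew (\<lambda>_. 0)"
      using S_ew by (auto intro!: hdI)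
  qed
  note of = R.pos.one_factor[OF refl refl]
  define \<xi> where "\<xi> i z = ew z * (H z * hp (fst z) $ i - R.v1 z $ i)" for i z
  have flat: "XYflat V (\<xi> i)" for i
  proof -
    have "R.pos.flat (\<xi> i)"
      unfolding \<xi>_def[abs_def]
      apply (rule R.pos.flatI)
      subgoal by (rule hd_cong[OF hd_mult[OF R.ders(1) hdew(1) of(2)]]) (simp add: algebra_simps)
      subgoal by (rule hd_cong[OF hd_mult[OF R.ders(2) hdew(2) of(3)]]) simp
      subgoal by (rule hd_cong[OF hd_mult[OF R.ders(3) hdew(3) of(4)]]) simp
      subgoal by (rule hd_cong[OF hd_mult[OF R.ders(4) hdew(4) of(5)]]) simp
      done
    then show ?thesis using R.flat_XY unfolding XYflat_def R.pos.flat_def by blast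
  qed
  define k where "k = \<psi> l"
  define p v where "p = hp (fst z0)" and "v = R.v1 z0"
  have ew1: "ew z = 1" if "w z = l" for z using that E(2) by (simp add: ew_def)
  have \<xi>0: "\<xi> i z0 = (k *\<^sub>R p - v) $ i" for i
    using ew1[OF z0(2)] z0 by (simp add: \<xi>_def H_def k_def p_def v_def)
  have lp: "lor (hp (fst y)) (k *\<^sub>R p - v) = - (exp (E (w y)) * \<psi> (w y))" if y: "y \<in> V" "\<And>i. \<xi> i y = \<xi> i z0" for y
  proof -
    have "k *\<^sub>R p - v = ew y *\<^sub>R (H y *\<^sub>R hp (fst y) - R.v1 y)"
      using y(2) unfolding \<xi>0 by (simp add: vec_eq_iff \<xi>_def)
    moreover have "lor (hp (fst y)) (hp (fst y)) = -1" "lor (hp (fst y)) (R.v1 y) = 0"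
      using R.pos.onb(1)[OF y(1)] by (auto simp: lorentz_onb_def)
    ultimately show ?thesis by (simp add: lor_simps ew_def H_def)
  qed
  have "local_level {z. lor (hp (fst z)) (k *\<^sub>R p - v) = - k}"
  \<comment> \<open>Near the level set, the product of the position with the constant vector equals
    this \<open>\<Theta>\<close> of \<open>w\<close>. Its derivative at \<open>l\<close> is - g
    (kappa + psi^2), and kappa = 1 - psi^2 there.\<close>
  proof (rule local_levelI[where \<Theta> = "\<lambda>x. - (exp (E x) * \<psi> x)" and D = "- g l"])
    fix z assume z: "z \<in> V" "w z = l"
    have c: "\<xi> i z = \<xi> i z0" for i using level_const(1)[OF conn z0 flat z] .
    show "z \<in> {z. lor (hp (fst z)) (k *\<^sub>R p - v) = - k}" using lp[OF z(1) c] z(2) E(2) by (simp add: k_def)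
    obtain e where e: "e > 0" "ball z e \<subseteq> V" "\<And>y i. y \<in> ball z e \<Longrightarrow> \<xi> i y = \<xi> i z0"
      using level_const_vec(2)[OF conn z0, of \<xi>, OF flat z] by blast
    show "\<exists>e>0. ball z e \<subseteq> V \<and> (\<forall>y\<in>ball z e. y \<in> {z. lor (hp (fst z)) (k *\<^sub>R p - v) = - k} \<longrightarrow>
        - (exp (E (w y)) * \<psi> (w y)) = - (exp (E l) * \<psi> l))"
    proof (intro exI[of _ e] conjI ballI impI e)
      fix y assume y: "y \<in> ball z e" "y \<in> {z. lor (hp (fst z)) (k *\<^sub>R p - v) = - k}"
      have "y \<in> V" using e(2) y(1) by blast
      then show "- (exp (E (w y)) * \<psi> (w y)) = - (exp (E l) * \<psi> l)"
        using lp[OF _ e(3)[OF y(1)]] y(2) E(2) by (simp add: k_def)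
    qed
  next
    have k: "\<kappa> l = 1 - (\<psi> l)\<^sup>2" using of(1)[OF z0(1)] z0(2) by (simp add: H1_def H_def)
    show "((\<lambda>x. - (exp (E x) * \<psi> x)) has_real_derivative - g l) (at l)"
      by (auto intro!: derivative_eq_intros E(3)[OF J(2)] psi[OF J(2)] simp: E(2) k power2_eq_square algebra_simps)
    show "- g l \<noteq> 0" using phi(2)[OF J(2)] by simp
  qed
  then show ?thesis using R.pos.onb(1)[OF z0(1)] hp_in_H2[of "fst z0"] unfolding p_def v_def by blast
qed

end

section \<open>Constant product angle with both components positive: surfaces M_tau and horocycle
  products\<close>

lemma gronwall_zero:
  fixes y :: "real \<Rightarrow> real"
  assumes d: "\<And>t. 0 \<le> t \<Longrightarrow> t \<le> 1 \<Longrightarrow> (y has_real_derivative y' t) (at t)"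
    and C: "\<And>t. 0 \<le> t \<Longrightarrow> t \<le> 1 \<Longrightarrow> \<bar>y' t\<bar> \<le> C * \<bar>y t\<bar>" and y0: "y 0 = 0"
  shows "y 1 = 0"
proof -
  \<comment> \<open>The weight exp (- 2 C t) compensates the possible growth of the square of
    \<open>y\<close>, so the weighted square is nonincreasing and starts at zero.\<close>
  have "(y 1)\<^sup>2 * exp (- (2 * C * 1)) \<le> (y 0)\<^sup>2 * exp (- (2 * C * 0))"
  proof (rule DERIV_nonpos_imp_nonincreasing[of 0 1 "\<lambda>t. (y t)\<^sup>2 * exp (- (2 * C * t))"])
    fix t :: real assume t: "0 \<le> t" "t \<le> 1"
    have "((\<lambda>t. (y t)\<^sup>2 * exp (- (2 * C * t))) has_real_derivative (2 * (y t * y' t - C * (y t)\<^sup>2)) * exp (- (2 * C * t))) (at t)"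
      by (auto intro!: derivative_eq_intros d[OF t] simp: algebra_simps)
    moreover have "y t * y' t \<le> \<bar>y t\<bar> * \<bar>y' t\<bar>" by (metis abs_ge_self abs_mult)
    moreover have "\<bar>y t\<bar> * \<bar>y' t\<bar> \<le> \<bar>y t\<bar> * (C * \<bar>y t\<bar>)" using C[OF t] by (intro mult_left_mono) auto
    moreover have "\<bar>y t\<bar> * (C * \<bar>y t\<bar>) = C * (y t)\<^sup>2" by (simp add: power2_eq_square)
    ultimately show "\<exists>u. ((\<lambda>t. (y t)\<^sup>2 * exp (- (2 * C * t))) has_real_derivative u) (at t) \<and> u \<le> 0"
      by (intro exI conjI) (auto intro!: mult_nonpos_nonneg)
  qed simp
  then have "(y 1)\<^sup>2 * exp (- (2 * C)) \<le> 0" using y0 by simp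
  then show ?thesis by (simp add: mult_le_0_iff)
qed

lemma smooth_on_ln:
  fixes f :: "'a::real_normed_vector \<Rightarrow> real"
  assumes "open W" "smooth_on W f" "\<And>z. z \<in> W \<Longrightarrow> 0 < f z"
  shows "smooth_on W (\<lambda>z. ln (f z))"
proof -
  have "C_k n {0<..} (\<lambda>x::real. ln x)" for n
  proof (cases n)
    case (Suc m)
    show ?thesis unfolding Suc
    proof (rule C_k_realI[OF _ _ C_k_powr[of m "-1"]])
      fix x :: real assume "x \<in> {0<..}"
      then have "(ln has_real_derivative x powr -1) (at x)"
        by (auto intro!: derivative_eq_intros simp: powr_minus divide_inverse)
      then show "(ln has_vector_derivative x powr -1) (at x)" by (simp add: has_real_derivative_iff_has_vector_derivative)
    qed simp
  qed (auto intro!: continuous_intros)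
  then show ?thesis
    by (intro smooth_on_compose[OF assms(1), of "{0<..}" f ln]) (use assms in \<open>auto simp: smooth_on_def\<close>)
qed

locale iso_chart_const = iso_chart +
  fixes A0 :: real
  assumes A0: "0 < A0" "A0 < 1" and A_eq: "z \<in> V \<Longrightarrow> A z = A0"
begin

lemma AB_pos: "z \<in> V \<Longrightarrow> 0 < A z" "z \<in> V \<Longrightarrow> 0 < B z"
  using A0 A_eq[of z] AB(1)[of z] by auto

sublocale R: rotated_frame V "Sm V" X1 X2 Y1 Y2 "\<lambda>z. hp (fst z)" "\<lambda>z. hf1 (fst z)" "\<lambda>z. hf2 (fst z)"
    "\<lambda>z. hp (snd z)" "\<lambda>z. hf1 (snd z)" "\<lambda>z. hf2 (snd z)"
    "\<lambda>z. inverse (a z) * X1 d z" "\<lambda>z. inverse (a z) * X2 d z" "\<lambda>z. inverse (b z) * Y1 d z" "\<lambda>z. inverse (b z) * Y2 d z"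
    a b d H H1
  by (rule generic_rotated_frame(1)[OF AB_pos])

sublocale K: const_frame V "Sm V" R.n1 R.e1 R.n2 R.e2 R.r1 R.r2 R.r3 R.r4 R.q1 R.q2 R.q3 R.q4 a b d H H1
    "A0 powr (1/2)" "(1 - A0) powr (1/2)"
proof unfold_locales
  fix z assume z: "z \<in> V"
  show "0 < a z" "0 < b z" using generic_rotated_frame(2,3)[OF AB_pos] z by blast+
  show "a z = A0 powr (1/2)" using A_eq[OF z] by (simp add: a_def)
  have "B z = 1 - A0" using A_eq[OF z] AB(1)[OF z] by simp
  then show "b z = (1 - A0) powr (1/2)" by (simp add: b_def)
qed (use A0 in auto)

lemma restrict_const: "open V' \<Longrightarrow> V' \<subseteq> V \<Longrightarrow> iso_chart_const V' J w \<phi> g \<psi> \<kappa> l A0"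
proof -
  assume V': "open V'" "V' \<subseteq> V"
  interpret I: iso_chart V' J w \<phi> g \<psi> \<kappa> l by (rule restrict[OF V'])
  show ?thesis using V' A0 A_eq by unfold_locales auto
qed

text \<open>\<open>congruent_factors\<close> supplies the Lorentz transformation; here its entries
  are fixed along the level set and the distance between a point and the image of its partner is
  computed. That distance depends on \<open>H\<close> alone, and \<open>H\<close> separates levels
  because its derivative is nonzero.\<close>

lemma tau_core:
  assumes conn: "connected {z\<in>V. w z = l}" and z0: "z0 \<in> V" "w z0 = l"
    and H1: "\<And>z. z \<in> V \<Longrightarrow> H1 z \<noteq> 0"
    and \<sigma>: "\<sigma> * \<sigma> = 1" "\<And>z. z \<in> V \<Longrightarrow> 0 < \<sigma> * K.mu z" and \<eta>: "\<eta> * \<eta> = 1" "\<And>z. z \<in> V \<Longrightarrow> 0 < \<eta> * H z"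
  shows "\<exists>L \<tau>. \<tau> < -1 \<and> linear L \<and> (\<forall>u v. lor (L u) (L v) = lor u v) \<and> (\<forall>q\<in>H2. L q \<in> H2) \<and>
    local_level {z. lor (hp (fst z)) (L (hp (snd z))) = \<tau>}"
proof -
  define a0 b0 where "a0 = A0 powr (1/2)" and "b0 = (1 - A0) powr (1/2)"
  have ab: "a0 = b0" using K.H1_zero_if_unequal[OF _ z0(1)] H1[OF z0(1)] unfolding a0_def b0_def by blast
  note F = K.mu_if_equal[OF ab[unfolded a0_def b0_def] _ H1]
  have a0: "0 < a0" "2 * a0\<^sup>2 = 1" using K.ab0_pos K.unit0[OF z0(1)] ab unfolding a0_def[symmetric] b0_def[symmetric] by auto
  define s2 where "s2 = sqrt 2"
  have s2: "s2 * s2 = 2" "0 < s2" by (simp_all add: s2_def)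
  have as: "a0 * s2 = 1"
  proof -
    have "(a0 * s2)\<^sup>2 = 1" using a0(2) s2(1) by (simp add: power2_eq_square algebra_simps)
    then show ?thesis using a0 s2(2) by (simp add: power2_eq_1_iff) (smt (verit) mult_pos_pos)
  qed
  have a2: "2 * a0 = s2" using as s2(1) by algebra
  have inv: "x / a0 = s2 * x" for x using as a0(1) by (simp add: field_simps)
  note r_eqs = K.r_eqs[folded a0_def b0_def, folded ab, unfolded inv]
  have asm: "\<And>z. z \<in> V \<Longrightarrow> 2 * a z = s2" "\<And>z. z \<in> V \<Longrightarrow> 2 * b z = s2"
    "\<And>z. z \<in> V \<Longrightarrow> 2 * R.r2 z = s2 * H z" "\<And>z. z \<in> V \<Longrightarrow> 2 * R.q4 z = s2 * H z"
    "\<And>z. z \<in> V \<Longrightarrow> R.r4 z = s2 * K.mu z" "\<And>z. z \<in> V \<Longrightarrow> R.q2 z = s2 * K.mu z"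
    "\<And>z. z \<in> V \<Longrightarrow> H1 z = 2 - (H z)\<^sup>2" "\<And>z. z \<in> V \<Longrightarrow> 4 * (K.mu z)\<^sup>2 = (H z)\<^sup>2 - 2"
  proof -
    fix z assume z: "z \<in> V"
    show "2 * a z = s2" using K.a_eq[OF z, folded a0_def] a2 by simp
    show "2 * b z = s2" using K.b_eq[OF z, folded b0_def] a2 ab by simp
    show "2 * R.r2 z = s2 * H z" "2 * R.q4 z = s2 * H z"
      using r_eqs(1,2)[OF z] F(2,3)[OF z z] unfolding a0_def[symmetric] b0_def[symmetric] ab by simp_all
    show "R.r4 z = s2 * K.mu z" "R.q2 z = s2 * K.mu z" using r_eqs(3,4)[OF z] unfolding a0_def by simp_all
    show "H1 z = 2 - (H z)\<^sup>2" "4 * (K.mu z)\<^sup>2 = (H z)\<^sup>2 - 2" using F(1,4)[OF z z] .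
  qed
  define G where "G z = inverse (2 * (\<sigma> * K.mu z))" for z
  define y0 where "y0 z = (\<eta> * G z) *\<^sub>R (H z *\<^sub>R hp (fst z) - s2 *\<^sub>R R.v1 z)" for z
  define y1 where "y1 z = (\<eta> * G z) *\<^sub>R (s2 *\<^sub>R hp (fst z) - H z *\<^sub>R R.v1 z)" for z
  define y2 where "y2 z = (- \<eta> * \<sigma>) *\<^sub>R R.t1 z" for z
  \<comment> \<open>Entry (i, j) of the tensor in \<open>congruent_factors\<close>. The index is a
    pair so that one flat family covers all nine entries.\<close>
  define en where "en ij z = - y0 z $ (fst ij) * hp (snd z) $ (snd ij) + y1 z $ (fst ij) * R.v2 z $ (snd ij)
      + y2 z $ (fst ij) * R.t2 z $ (snd ij)" for ij :: "3 \<times> 3" and z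
  have CF1: "R.pos.flat (en ij)" for ij
    unfolding en_def[abs_def] y0_def y1_def y2_def G_def
    by (rule R.pos.congruent_factors(1)[OF s2(1) \<sigma>(1) \<eta>(1) K.S_abm(3)])
      (erule asm \<sigma>(2) K.conn_zero)+
  have CF2: "lorentz_onb (y0 z) (y1 z) (y2 z)" if "z \<in> V" for z
    unfolding y0_def y1_def y2_def G_def
    by (rule R.pos.congruent_factors(2)[OF s2(1) \<sigma>(1) \<eta>(1) K.S_abm(3)])
      (erule asm \<sigma>(2) K.conn_zero | rule that)+
  have flat: "XYflat V (en ij)" for ij
    using CF1[of ij] R.flat_XY[OF CF1[of ij]] unfolding XYflat_def R.pos.flat_def by blast
  \<comment> \<open>The constant tensor contracted with the Lorentz form, which explains the sign of
    the first summand. It sends the frame of the second factor at \<open>z0\<close> to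
    \<open>y0\<close>, \<open>y1\<close>, \<open>y2\<close>.\<close>
  define L where "L v = (\<chi> i. - en (i, 1) z0 * v $ 1 + en (i, 2) z0 * v $ 2 + en (i, 3) z0 * v $ 3)" for v :: "real^3"
  have linL: "linear L" by (rule linearI) (simp_all add: L_def vec_eq_iff algebra_simps)
  have L_at: "L v = (- lor v (hp (snd y))) *\<^sub>R y0 y + lor v (R.v2 y) *\<^sub>R y1 y + lor v (R.t2 y) *\<^sub>R y2 y"
    if "\<And>ij. en ij y = en ij z0" for y v
    unfolding L_def that[symmetric] by (simp add: vec_eq_iff en_def lor_def algebra_simps)
  have Lq: "L (hp (snd y)) = y0 y" if y: "y \<in> V" "\<And>ij. en ij y = en ij z0" for y
    using L_at[OF y(2)] R.pos.onb(2)[OF y(1)] by (simp add: lorentz_onb_def)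
  have Lpq: "lor (hp (fst y)) (L (hp (snd y))) = - (\<eta> * H y / (2 * (\<sigma> * K.mu y)))" if y: "y \<in> V" "\<And>ij. en ij y = en ij z0" for y
  proof -
    have o: "lor (hp (fst y)) (hp (fst y)) = -1" "lor (hp (fst y)) (R.v1 y) = 0"
      using R.pos.onb(1)[OF y(1)] by (simp_all add: lorentz_onb_def)
    show ?thesis unfolding Lq[OF y] y0_def lor_simps o G_def divide_inverse by simp
  qed
  have isoL: "lor (L u) (L v) = lor u v" for u v
  proof -
    have o: "lor (y0 z0) (y0 z0) = -1" "lor (y1 z0) (y1 z0) = 1" "lor (y2 z0) (y2 z0) = 1" "lor (y0 z0) (y1 z0) = 0"
      "lor (y0 z0) (y2 z0) = 0" "lor (y1 z0) (y2 z0) = 0" "lor (y1 z0) (y0 z0) = 0" "lor (y2 z0) (y0 z0) = 0" "lor (y2 z0) (y1 z0) = 0"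
      using CF2[OF z0(1)] by (auto simp: lorentz_onb_def lor_commute)
    have "lor (L u) (L v) = - lor u (hp (snd z0)) * lor v (hp (snd z0)) + lor u (R.v2 z0) * lor v (R.v2 z0) + lor u (R.t2 z0) * lor v (R.t2 z0)"
      unfolding L_at[of z0, OF refl] lor_simps o by simp
    also have "\<dots> = lor u ((- lor v (hp (snd z0))) *\<^sub>R hp (snd z0) + lor v (R.v2 z0) *\<^sub>R R.v2 z0 + lor v (R.t2 z0) *\<^sub>R R.t2 z0)"
      unfolding lor_simps by simp
    also have "\<dots> = lor u v" using lorentz_onb_expand[OF R.pos.onb(2)[OF z0(1)], of v] by simp
    finally show ?thesis .
  qed
  have XD: "0 < \<eta> * H z" "0 < 2 * (\<sigma> * K.mu z)" "(2 * (\<sigma> * K.mu z))\<^sup>2 = (\<eta> * H z)\<^sup>2 - 2" if z: "z \<in> V" for z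
  proof -
    show "0 < \<eta> * H z" "0 < 2 * (\<sigma> * K.mu z)" using \<sigma>(2)[OF z] \<eta>(2)[OF z] by auto
    show "(2 * (\<sigma> * K.mu z))\<^sup>2 = (\<eta> * H z)\<^sup>2 - 2"
      using F(4)[OF z z, THEN eq_iff_diff_eq_0[THEN iffD1]] \<sigma>(1)[THEN eq_iff_diff_eq_0[THEN iffD1]]
        \<eta>(1)[THEN eq_iff_diff_eq_0[THEN iffD1]] by algebra
  qed
  define \<tau> where "\<tau> = - (\<eta> * H z0 / (2 * (\<sigma> * K.mu z0)))"
  have "\<tau> < -1"
  proof -
    have "(2 * (\<sigma> * K.mu z0))\<^sup>2 < (\<eta> * H z0)\<^sup>2" using XD(3)[OF z0(1)] by simp
    then have "2 * (\<sigma> * K.mu z0) < \<eta> * H z0" by (rule power2_less_imp_less) (use XD(1)[OF z0(1)] in simp)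
    then show ?thesis using XD(2)[OF z0(1)] by (simp add: \<tau>_def)
  qed
  \<comment> \<open>A linear isometry of the Lorentz form either preserves or exchanges the two
    sheets. The image of one point decides: its product with the partner point is
    \<open>\<tau>\<close>, which is negative.\<close>
  moreover have "L q \<in> H2" if q: "q \<in> H2" for q
  proof -
    have "0 < L (hp (snd z0)) $ 1"
      by (rule H2_lor_neg[OF hp_in_H2[of "fst z0"]])
        (use isoL[of "hp (snd z0)" "hp (snd z0)"] hp_in_H2[of "snd z0"] Lpq[OF z0(1) refl] \<open>\<tau> < -1\<close> in \<open>auto simp: H2_def \<tau>_def\<close>)
    then have L0: "L (hp (snd z0)) \<in> H2" using isoL[of "hp (snd z0)" "hp (snd z0)"] hp_in_H2[of "snd z0"] by (simp add: H2_def)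
    have "lor (L (hp (snd z0))) (L q) < 0" unfolding isoL using H2_lor_lt_0[OF hp_in_H2 q] .
    then have "0 < L q $ 1" by (intro H2_lor_neg[OF L0]) (use isoL[of q q] q in \<open>auto simp: H2_def\<close>)
    then show ?thesis using isoL[of q q] q by (simp add: H2_def)
  qed
  moreover have "local_level {z. lor (hp (fst z)) (L (hp (snd z))) = \<tau>}"
  proof (rule local_levelI[OF _ psi[OF J(2)]])
    show "\<kappa> l * g l \<noteq> 0" using H1[OF z0(1)] phi(2)[OF J(2)] z0(2) by (simp add: H1_def)
    \<comment> \<open>With m^2 = x^2 - 2 the quotient x / m of positive numbers determines x:
      cross-multiplying and squaring leaves x^2 = x'^2. So the prescribed distance fixes
      \<open>H\<close>.\<close>
    have inj: "H y = H z0" if y: "y \<in> V" "\<eta> * H y / (2 * (\<sigma> * K.mu y)) = \<eta> * H z0 / (2 * (\<sigma> * K.mu z0))" for y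
    proof -
      define x m x' m' where d: "x = \<eta> * H y" "m = 2 * (\<sigma> * K.mu y)" "x' = \<eta> * H z0" "m' = 2 * (\<sigma> * K.mu z0)"
      have p: "0 < x" "0 < m" "0 < x'" "0 < m'" "m\<^sup>2 = x\<^sup>2 - 2" "m'\<^sup>2 = x'\<^sup>2 - 2" using XD[OF y(1)] XD[OF z0(1)] by (auto simp: d)
      have "x * m' = x' * m" using y(2) p unfolding d[symmetric] by (simp add: field_simps)
      then have "x\<^sup>2 * m'\<^sup>2 = x'\<^sup>2 * m\<^sup>2" by (metis power_mult_distrib)
      then have "x\<^sup>2 = x'\<^sup>2" unfolding p(5,6) by (simp add: algebra_simps)
      then have "x = x'" using p by (simp add: power2_eq_iff_nonneg)
      then show ?thesis using \<eta>(1) by (auto simp: d)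
    qed
    fix z assume z: "z \<in> V" "w z = l"
    have c: "en i z = en i z0" for i using level_const(1)[OF conn z0 flat z] .
    have "H z = H z0" using z z0 by (simp add: H_def)
    have mu: "2 * (\<sigma> * K.mu z) = 2 * (\<sigma> * K.mu z0)"
      by (rule power2_eq_imp_eq) (use XD[OF z(1)] XD[OF z0(1)] \<open>H z = H z0\<close> in simp_all)
    show "z \<in> {z. lor (hp (fst z)) (L (hp (snd z))) = \<tau>}"
      using Lpq[OF z(1) c] \<open>H z = H z0\<close> mu by (simp add: \<tau>_def)
    obtain e where e: "e > 0" "ball z e \<subseteq> V" "\<And>y i. y \<in> ball z e \<Longrightarrow> en i y = en i z0"
      using level_const_vec(2)[OF conn z0, of en, OF flat z] by blast
    show "\<exists>e>0. ball z e \<subseteq> V \<and> (\<forall>y\<in>ball z e. y \<in> {z. lor (hp (fst z)) (L (hp (snd z))) = \<tau>} \<longrightarrow> \<psi> (w y) = \<psi> l)"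
    proof (intro exI[of _ e] conjI ballI impI e)
      fix y assume y: "y \<in> ball z e" "y \<in> {z. lor (hp (fst z)) (L (hp (snd z))) = \<tau>}"
      have yV: "y \<in> V" using e(2) y(1) by blast
      then show "\<psi> (w y) = \<psi> l"
        using inj[OF yV] Lpq[OF yV e(3)[OF y(1)]] y(2) z0(2) by (simp add: H_def \<tau>_def)
    qed
  qed
  ultimately show ?thesis using linL isoL by blast
qed

text \<open>\<open>mu\<close> and \<open>H\<close> do not vanish where \<open>H1\<close> is nonzero,
  and have constant signs on the connected level set. Shrinking \<open>V\<close> makes the signs
  constant on the whole domain, as \<open>tau_core\<close> demands. The square in \<open>V1\<close>
  expresses nonvanishing as positivity.\<close>

lemma tau_case:
  assumes conn: "connected {z\<in>V. w z = l}" and z0: "z0 \<in> V" "w z0 = l" and k: "\<kappa> l \<noteq> 0"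
  shows "\<exists>L \<tau>. \<tau> < -1 \<and> linear L \<and> (\<forall>u v. lor (L u) (L v) = lor u v) \<and> (\<forall>q\<in>H2. L q \<in> H2) \<and>
    local_level {z. lor (hp (fst z)) (L (hp (snd z))) = \<tau>}"
proof -
  let ?M = "{z\<in>V. w z = l}"
  define V1 where "V1 = {z\<in>V. 0 < H1 z * H1 z}"
  have o1: "open V1" unfolding V1_def using S_dH by (intro open_Sm_pos[OF V] S_mult)
  have M1: "?M \<subseteq> V1" using k by (auto simp: V1_def H1_def zero_less_mult_iff)
  interpret I1: iso_chart_const V1 J w \<phi> g \<psi> \<kappa> l A0 by (rule restrict_const[OF o1]) (auto simp: V1_def)
  have z01: "z0 \<in> V1" using M1 z0 by auto
  have H1': "I1.H1 z \<noteq> 0" if "z \<in> V1" for z using that by (auto simp: V1_def)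
  have ab: "A0 powr (1/2) = (1 - A0) powr (1/2)" using I1.K.H1_zero_if_unequal[OF _ z01] H1'[OF z01] by blast
  have mu0: "I1.K.mu z \<noteq> 0" "I1.H z \<noteq> 0" if "z \<in> V1" for z
    using I1.K.mu_if_equal(4,5)[OF ab that H1'[OF that]] by auto
  have cont: "continuous_on ?M I1.K.mu" "continuous_on ?M I1.H"
    using Sm_continuous[OF o1] I1.K.S_abm(3) I1.S_dH(2) M1 continuous_on_subset by blast+
  obtain \<sigma> where \<sigma>: "\<sigma> * \<sigma> = 1" "\<forall>z\<in>?M. 0 < \<sigma> * I1.K.mu z"
    using connected_unit_sign[OF conn cont(1), of z0] mu0 M1 z0 by blast
  obtain \<eta> where \<eta>: "\<eta> * \<eta> = 1" "\<forall>z\<in>?M. 0 < \<eta> * I1.H z"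
    using connected_unit_sign[OF conn cont(2), of z0] mu0 M1 z0 by blast
  define V2 where "V2 = {z\<in>V1. 0 < \<sigma> * I1.K.mu z}"
  define V3 where "V3 = {z\<in>V2. 0 < \<eta> * I1.H z}"
  have o2: "open V2" unfolding V2_def by (intro open_Sm_pos[OF o1] I1.S_mult I1.S_const I1.K.S_abm(3))
  have o3: "open V3" unfolding V3_def
    by (intro open_Sm_pos[OF o2] Sm_mono[where V = V1 and W = V2] I1.S_mult I1.S_const I1.S_dH) (auto simp: V2_def)
  have V3: "V3 \<subseteq> V1" by (auto simp: V3_def V2_def)
  have M3: "?M \<subseteq> V3" using M1 \<sigma>(2) \<eta>(2) by (auto simp: V3_def V2_def)
  interpret I3: iso_chart_const V3 J w \<phi> g \<psi> \<kappa> l A0 by (rule I1.restrict_const[OF o3 V3])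
  have V3V: "V3 \<subseteq> V" using V3 by (auto simp: V1_def)
  have Meq: "{z\<in>V3. w z = l} = ?M" using M3 V3V by auto
  have "\<exists>L \<tau>. \<tau> < -1 \<and> linear L \<and> (\<forall>u v. lor (L u) (L v) = lor u v) \<and> (\<forall>q\<in>H2. L q \<in> H2) \<and>
    I3.local_level {z. lor (hp (fst z)) (L (hp (snd z))) = \<tau>}"
  proof (rule I3.tau_core[OF _ _ z0(2) _ \<sigma>(1) _ \<eta>(1)])
    show "connected {z\<in>V3. w z = l}" unfolding Meq by (rule conn)
    show "z0 \<in> V3" using M3 z0 by blast
    fix z assume z: "z \<in> V3"
    show "I3.H1 z \<noteq> 0" using H1' V3 z by blast
    show "0 < \<sigma> * I3.K.mu z" "0 < \<eta> * I3.H z" using z by (simp_all add: V3_def V2_def)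
  qed
  then show ?thesis using local_level_restrict[OF _ I3.iso_chart_axioms V3V] M3 by blast
qed

text \<open>With mu = 0 the curves of e1 and e2 have curvature 1 or -1, so they are horocycles with
  fixed ideal points \<open>\<nu>\<close> and \<open>\<omega>\<close>. The functions ln (- <p, nu>)
  and ln (- <q, omega>) are Busemann functions up to sign, and \<open>d\<close> is a combination of
  them with constant coefficients.\<close>

lemma horo_core:
  assumes conn: "connected {z\<in>V. w z = l}" and z0: "z0 \<in> V" "w z0 = l"
    and h: "\<And>z. z \<in> V \<Longrightarrow> H z = h"
    and \<epsilon>: "\<epsilon> * \<epsilon> = 1" "\<And>z. z \<in> V \<Longrightarrow> 0 < \<epsilon> * R.r2 z" and \<delta>: "\<delta> * \<delta> = 1" "\<And>z. z \<in> V \<Longrightarrow> 0 < \<delta> * R.q4 z"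
  shows "\<exists>\<nu> \<omega> \<alpha> \<beta> k. lor \<nu> \<nu> = 0 \<and> \<nu> $ 1 = 1 \<and> lor \<omega> \<omega> = 0 \<and> \<omega> $ 1 = 1 \<and> \<alpha> \<noteq> 0 \<and> \<beta> \<noteq> 0 \<and> \<alpha>\<^sup>2 + \<beta>\<^sup>2 = 1 \<and>
    local_level {z. \<alpha> * ln (- lor (hp (fst z)) \<nu>) + \<beta> * ln (- lor (hp (snd z)) \<omega>) = k}"
proof -
  define a0 b0 where "a0 = A0 powr (1/2)" and "b0 = (1 - A0) powr (1/2)"
  have ab0: "0 < a0" "0 < b0" "a0\<^sup>2 + b0\<^sup>2 = 1" using K.ab0_pos K.unit0[OF z0(1)] by (simp_all add: a0_def b0_def)
  have F: "K.mu z = 0" "(K.al z)\<^sup>2 = a0\<^sup>2" "(K.be z)\<^sup>2 = b0\<^sup>2" if "z \<in> V" for z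
    using K.mu_zero_if_H_const[of h z] h that unfolding a0_def b0_def by blast+
  have unit: "x = e" if "x\<^sup>2 = 1" "0 < e * x" "e * e = 1" for x e :: real
    using that by (auto simp: power2_eq_1_iff square_eq_1_iff)
  have r: "R.r2 z = \<epsilon>" "R.q4 z = \<delta>" "R.r4 z = 0" "R.q2 z = 0" if z: "z \<in> V" for z
  proof -
    have "K.al z = a0 * R.r2 z" "K.be z = b0 * R.q4 z" by (simp_all add: K.al_def K.be_def a0_def b0_def)
    then have "(R.r2 z)\<^sup>2 = 1" "(R.q4 z)\<^sup>2 = 1" using F(2,3)[OF z] ab0(1,2) by (simp_all add: power_mult_distrib)
    then show "R.r2 z = \<epsilon>" "R.q4 z = \<delta>" using unit \<epsilon> \<delta> z by auto
    show "R.r4 z = 0" "R.q2 z = 0" using K.r_eqs(3,4)[OF z] F(1)[OF z] by auto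
  qed
  have nd1: "hd R.n1 (\<lambda>z. hp (fst z) $ i - \<epsilon> * R.v1 z $ i) (\<lambda>z. - \<epsilon> * (hp (fst z) $ i - \<epsilon> * R.v1 z $ i))"
      "hd R.e1 (\<lambda>z. hp (fst z) $ i - \<epsilon> * R.v1 z $ i) (\<lambda>_. 0)"
      "hd R.n2 (\<lambda>z. hp (fst z) $ i - \<epsilon> * R.v1 z $ i) (\<lambda>_. 0)"
      "hd R.e2 (\<lambda>z. hp (fst z) $ i - \<epsilon> * R.v1 z $ i) (\<lambda>_. 0)" for i
    by (rule R.pos.null_direction; (erule K.conn_zero r | rule \<epsilon>(1)))+
  have nd2: "hd R.n2 (\<lambda>z. hp (snd z) $ i - \<delta> * R.v2 z $ i) (\<lambda>z. - \<delta> * (hp (snd z) $ i - \<delta> * R.v2 z $ i))"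
      "hd R.e2 (\<lambda>z. hp (snd z) $ i - \<delta> * R.v2 z $ i) (\<lambda>_. 0)"
      "hd R.n1 (\<lambda>z. hp (snd z) $ i - \<delta> * R.v2 z $ i) (\<lambda>_. 0)"
      "hd R.e1 (\<lambda>z. hp (snd z) $ i - \<delta> * R.v2 z $ i) (\<lambda>_. 0)" for i
    by (rule R.pos.null_direction2; (erule K.conn_zero r | rule \<delta>(1)))+
  define n where "n z = hp (fst z) - \<epsilon> *\<^sub>R R.v1 z" for z
  define m where "m z = hp (snd z) - \<delta> *\<^sub>R R.v2 z" for z
  have nth: "hp (fst z) $ i - \<epsilon> * R.v1 z $ i = n z $ i" "hp (snd z) $ i - \<delta> * R.v2 z $ i = m z $ i" for z i
    by (simp_all add: n_def m_def)
  note hdn = nd1[unfolded nth] and hdm = nd2[unfolded nth]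
  have null: "lor (n z) (n z) = 0" "lor (hp (fst z)) (n z) = -1" "lor (m z) (m z) = 0" "lor (hp (snd z)) (m z) = -1" if z: "z \<in> V" for z
  proof -
    have o: "lor (hp (fst z)) (hp (fst z)) = -1" "lor (R.v1 z) (R.v1 z) = 1" "lor (hp (fst z)) (R.v1 z) = 0" "lor (R.v1 z) (hp (fst z)) = 0"
      "lor (hp (snd z)) (hp (snd z)) = -1" "lor (R.v2 z) (R.v2 z) = 1" "lor (hp (snd z)) (R.v2 z) = 0" "lor (R.v2 z) (hp (snd z)) = 0"
      using R.pos.onb(1,2)[OF z] by (auto simp: lorentz_onb_def lor_commute)
    show "lor (n z) (n z) = 0" "lor (hp (fst z)) (n z) = -1" "lor (m z) (m z) = 0" "lor (hp (snd z)) (m z) = -1"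
      unfolding n_def m_def lor_simps o using \<epsilon>(1) \<delta>(1) by auto
  qed
  have pos: "0 < n z $ 1" "0 < m z $ 1" if z: "z \<in> V" for z
    using H2_lor_neg[OF hp_in_H2[of "fst z"], of "n z"] H2_lor_neg[OF hp_in_H2[of "snd z"], of "m z"] null[OF z] by auto
  \<comment> \<open>Along the normals the null vectors are only rescaled. Dividing by the first
    component, which is positive by \<open>H2_lor_neg\<close>, selects the representative of the
    null direction with first component 1.\<close>
  define \<rho> where "\<rho> i z = n z $ i * inverse (n z $ 1)" for i z
  define \<theta> where "\<theta> i z = m z $ i * inverse (m z $ 1)" for i z
  have flat: "XYflat V f" if "R.pos.flat f" for f
    using that R.flat_XY[OF that] unfolding XYflat_def R.pos.flat_def by blast
  have f\<rho>: "XYflat V (\<rho> i)" for i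
    unfolding \<rho>_def[abs_def]
    apply (rule flat, rule R.pos.flatI)
    subgoal by (rule hd_cong[OF hd_mult[OF R.ders(1) hdn(1) hd_inverse[OF R.ders(1) hdn(1) pos(1)]]])
        (use pos in \<open>auto simp: field_simps power2_eq_square\<close>)
    subgoal by (rule hd_cong[OF hd_mult[OF R.ders(2) hdn(2) hd_inverse[OF R.ders(2) hdn(2) pos(1)]]]) auto
    subgoal by (rule hd_cong[OF hd_mult[OF R.ders(3) hdn(3) hd_inverse[OF R.ders(3) hdn(3) pos(1)]]]) auto
    subgoal by (rule hd_cong[OF hd_mult[OF R.ders(4) hdn(4) hd_inverse[OF R.ders(4) hdn(4) pos(1)]]]) auto
    done
  have f\<theta>: "XYflat V (\<theta> i)" for i
    unfolding \<theta>_def[abs_def]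
    apply (rule flat, rule R.pos.flatI)
    subgoal by (rule hd_cong[OF hd_mult[OF R.ders(1) hdm(3) hd_inverse[OF R.ders(1) hdm(3) pos(2)]]]) auto
    subgoal by (rule hd_cong[OF hd_mult[OF R.ders(2) hdm(4) hd_inverse[OF R.ders(2) hdm(4) pos(2)]]]) auto
    subgoal by (rule hd_cong[OF hd_mult[OF R.ders(3) hdm(1) hd_inverse[OF R.ders(3) hdm(1) pos(2)]]])
        (use pos in \<open>auto simp: field_simps power2_eq_square\<close>)
    subgoal by (rule hd_cong[OF hd_mult[OF R.ders(4) hdm(2) hd_inverse[OF R.ders(4) hdm(2) pos(2)]]]) auto
    done
  \<comment> \<open>The logarithm of the first component of \<open>n\<close> has derivative
    \<open>- \<epsilon>\<close> along n1, and that of \<open>m\<close> has derivative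
    \<open>- \<delta>\<close> along n2. The coefficients are chosen such that both contributions
    cancel the derivatives \<open>a0\<close> and \<open>b0\<close> of \<open>d\<close>.\<close>
  define f where "f z = - (a0 * \<epsilon>) * ln (n z $ 1) + - (b0 * \<delta>) * ln (m z $ 1) - d z" for z
  have Sn: "(\<lambda>z. n z $ 1) \<in> Sm V" "(\<lambda>z. m z $ 1) \<in> Sm V" using hd_S[OF hdn(1)] hd_S[OF hdm(1)] by auto
  have Sln: "(\<lambda>z. ln (n z $ 1)) \<in> Sm V" "(\<lambda>z. ln (m z $ 1)) \<in> Sm V"
    using smooth_on_ln[OF V] Sn pos unfolding Sm_def by auto
  have hdln: "hd X (\<lambda>z. ln (u z)) (\<lambda>z. u' z / u z)"
    if X: "X = R.n1 \<or> X = R.e1 \<or> X = R.n2 \<or> X = R.e2" and u: "hd X u u'" "\<And>z. z \<in> V \<Longrightarrow> 0 < u z" "(\<lambda>z. ln (u z)) \<in> Sm V" for X u u'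
  proof (rule hdI[OF u(3)])
    fix z assume z: "z \<in> V"
    have "(ln has_real_derivative 1 / u z) (at (u z))" using u(2)[OF z] by (auto intro!: derivative_eq_intros)
    note c = XY_compose[OF V hd_S[OF u(1)] z this]
    have "R.n1 (\<lambda>z. ln (u z)) z = 1 / u z * R.n1 u z" "R.e1 (\<lambda>z. ln (u z)) z = 1 / u z * R.e1 u z"
      "R.n2 (\<lambda>z. ln (u z)) z = 1 / u z * R.n2 u z" "R.e2 (\<lambda>z. ln (u z)) z = 1 / u z * R.e2 u z"
      unfolding R.n1_def R.e1_def R.n2_def R.e2_def c by algebra+
    then have "X (\<lambda>z. ln (u z)) z = 1 / u z * X u z" using X by blast
    then show "X (\<lambda>z. ln (u z)) z = u' z / u z" using hdD[OF u(1) z] by simp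
  qed
  have ff: "XYflat V f"
  proof -
    have e1: "\<epsilon> * (\<epsilon> * x) = x" "\<delta> * (\<delta> * x) = x" for x using \<epsilon>(1) \<delta>(1) by (auto simp: mult.assoc[symmetric])
    have hdd: "hd R.n1 d (\<lambda>z. a0)" "hd R.e1 d (\<lambda>_. 0)" "hd R.n2 d (\<lambda>z. b0)" "hd R.e2 d (\<lambda>_. 0)"
      using R.grad_adapted K.a_eq K.b_eq S_dH by (auto intro!: hdI simp: a0_def b0_def)
    have N: "hd R.n1 (\<lambda>z. ln (n z $ 1)) (\<lambda>z. (- \<epsilon> * n z $ 1) / n z $ 1)" "hd R.e1 (\<lambda>z. ln (n z $ 1)) (\<lambda>z. 0 / n z $ 1)"
      "hd R.n2 (\<lambda>z. ln (n z $ 1)) (\<lambda>z. 0 / n z $ 1)" "hd R.e2 (\<lambda>z. ln (n z $ 1)) (\<lambda>z. 0 / n z $ 1)"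
      by (rule hdln[OF _ hdn(1)] hdln[OF _ hdn(2)] hdln[OF _ hdn(3)] hdln[OF _ hdn(4)]; (rule Sln | erule pos | simp))+
    have M: "hd R.n1 (\<lambda>z. ln (m z $ 1)) (\<lambda>z. 0 / m z $ 1)" "hd R.e1 (\<lambda>z. ln (m z $ 1)) (\<lambda>z. 0 / m z $ 1)"
      "hd R.n2 (\<lambda>z. ln (m z $ 1)) (\<lambda>z. (- \<delta> * m z $ 1) / m z $ 1)" "hd R.e2 (\<lambda>z. ln (m z $ 1)) (\<lambda>z. 0 / m z $ 1)"
      by (rule hdln[OF _ hdm(1)] hdln[OF _ hdm(2)] hdln[OF _ hdm(3)] hdln[OF _ hdm(4)]; (rule Sln | erule pos | simp))+
    show ?thesis unfolding f_def[abs_def]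
      apply (rule flat, rule R.pos.flatI)
      subgoal apply (rule hd_cong, rule hd_diff[OF R.ders(1) hd_add[OF R.ders(1) hd_mult[OF R.ders(1) hd_const[OF R.ders(1)] N(1)]
              hd_mult[OF R.ders(1) hd_const[OF R.ders(1)] M(1)]] hdd(1)])
        subgoal for z using pos[of z] by (simp add: e1 \<epsilon>(1) \<delta>(1)) done
      subgoal apply (rule hd_cong, rule hd_diff[OF R.ders(2) hd_add[OF R.ders(2) hd_mult[OF R.ders(2) hd_const[OF R.ders(2)] N(2)]
              hd_mult[OF R.ders(2) hd_const[OF R.ders(2)] M(2)]] hdd(2)])
        subgoal for z using pos[of z] by (simp add: e1 \<epsilon>(1) \<delta>(1)) done
      subgoal apply (rule hd_cong, rule hd_diff[OF R.ders(3) hd_add[OF R.ders(3) hd_mult[OF R.ders(3) hd_const[OF R.ders(3)] N(3)]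
              hd_mult[OF R.ders(3) hd_const[OF R.ders(3)] M(3)]] hdd(3)])
        subgoal for z using pos[of z] by (simp add: e1 \<epsilon>(1) \<delta>(1)) done
      subgoal apply (rule hd_cong, rule hd_diff[OF R.ders(4) hd_add[OF R.ders(4) hd_mult[OF R.ders(4) hd_const[OF R.ders(4)] N(4)]
              hd_mult[OF R.ders(4) hd_const[OF R.ders(4)] M(4)]] hdd(4)])
        subgoal for z using pos[of z] by (simp add: e1 \<epsilon>(1) \<delta>(1)) done
      done
  qed
  define \<nu> where "\<nu> = inverse (n z0 $ 1) *\<^sub>R n z0"
  define \<omega> where "\<omega> = inverse (m z0 $ 1) *\<^sub>R m z0"
  have nu: "\<nu> $ i = \<rho> i z0" "\<omega> $ i = \<theta> i z0" for i by (simp_all add: \<nu>_def \<omega>_def \<rho>_def \<theta>_def)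
  have props: "lor \<nu> \<nu> = 0" "\<nu> $ 1 = 1" "lor \<omega> \<omega> = 0" "\<omega> $ 1 = 1"
    using null[OF z0(1)] pos[OF z0(1)] by (simp_all add: \<nu>_def \<omega>_def lor_simps)
  define k where "k = f z0 + \<phi> l"
  have val: "a0 * \<epsilon> * ln (- lor (hp (fst y)) \<nu>) + b0 * \<delta> * ln (- lor (hp (snd y)) \<omega>) = f y + \<phi> (w y)"
    if y: "y \<in> V" "\<And>i. \<rho> i y = \<rho> i z0" "\<And>i. \<theta> i y = \<theta> i z0" for y
  proof -
    have "\<nu> = inverse (n y $ 1) *\<^sub>R n y" "\<omega> = inverse (m y $ 1) *\<^sub>R m y"
      unfolding vec_eq_iff nu y(2,3)[symmetric] by (simp_all add: \<rho>_def \<theta>_def)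
    then have "- lor (hp (fst y)) \<nu> = inverse (n y $ 1)" "- lor (hp (snd y)) \<omega> = inverse (m y $ 1)"
      using null[OF y(1)] by (simp_all add: lor_simps)
    then show ?thesis using pos[OF y(1)] by (simp add: ln_inverse f_def d_def)
  qed
  have "local_level {z. (a0 * \<epsilon>) * ln (- lor (hp (fst z)) \<nu>) + (b0 * \<delta>) * ln (- lor (hp (snd z)) \<omega>) = k}"
  proof (rule local_levelI[OF _ phi(1)[OF J(2)]])
    show "g l \<noteq> 0" using phi(2)[OF J(2)] by simp
    fix z assume z: "z \<in> V" "w z = l"
    \<comment> \<open>The index type bundles \<open>f\<close> with the components of both null
      directions, so that a single ball serves all seven functions.\<close>
    define F where "F i = (case i of None \<Rightarrow> f | Some (Inl i) \<Rightarrow> \<rho> i | Some (Inr i) \<Rightarrow> \<theta> i)" for i :: "(3 + 3) option"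
    have fF: "XYflat V (F i)" for i unfolding F_def using ff f\<rho> f\<theta> by (auto split: option.splits sum.splits)
    have c: "F i z = F i z0" for i using level_const(1)[OF conn z0 fF z] .
    show "z \<in> {z. (a0 * \<epsilon>) * ln (- lor (hp (fst z)) \<nu>) + (b0 * \<delta>) * ln (- lor (hp (snd z)) \<omega>) = k}"
      using val[OF z(1)] c[of None] c[of "Some (Inl _)"] c[of "Some (Inr _)"] z(2) by (simp add: F_def k_def)
    obtain e where e: "e > 0" "ball z e \<subseteq> V" "\<And>y i. y \<in> ball z e \<Longrightarrow> F i y = F i z0"
      using level_const_vec(2)[OF conn z0, of F, OF fF z] by blast
    show "\<exists>e>0. ball z e \<subseteq> V \<and> (\<forall>y\<in>ball z e. y \<in> {z. (a0 * \<epsilon>) * ln (- lor (hp (fst z)) \<nu>) + (b0 * \<delta>) * ln (- lor (hp (snd z)) \<omega>) = k} \<longrightarrow> \<phi> (w y) = \<phi> l)"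
    proof (intro exI[of _ e] conjI ballI impI e)
      fix y assume y: "y \<in> ball z e" "y \<in> {z. (a0 * \<epsilon>) * ln (- lor (hp (fst z)) \<nu>) + (b0 * \<delta>) * ln (- lor (hp (snd z)) \<omega>) = k}"
      have yV: "y \<in> V" using e(2) y(1) by blast
      show "\<phi> (w y) = \<phi> l"
        using val[OF yV] e(3)[OF y(1), of None] e(3)[OF y(1), of "Some (Inl _)"] e(3)[OF y(1), of "Some (Inr _)"] y(2)
        by (simp add: F_def k_def)
    qed
  qed
  moreover have "a0 * \<epsilon> \<noteq> 0" "b0 * \<delta> \<noteq> 0" "(a0 * \<epsilon>)\<^sup>2 + (b0 * \<delta>)\<^sup>2 = 1"
    using ab0 \<epsilon>(1) \<delta>(1) by (auto simp: power_mult_distrib power2_eq_square[of \<epsilon>] power2_eq_square[of \<delta>])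
  ultimately show ?thesis using props by blast
qed

lemma horo_case:
  assumes conn: "connected {z\<in>V. w z = l}" and z0: "z0 \<in> V" "w z0 = l"
    and h: "\<And>z. z \<in> V \<Longrightarrow> H z = h"
  shows "\<exists>\<nu> \<omega> \<alpha> \<beta> k. lor \<nu> \<nu> = 0 \<and> \<nu> $ 1 = 1 \<and> lor \<omega> \<omega> = 0 \<and> \<omega> $ 1 = 1 \<and> \<alpha> \<noteq> 0 \<and> \<beta> \<noteq> 0 \<and> \<alpha>\<^sup>2 + \<beta>\<^sup>2 = 1 \<and>
    local_level {z. \<alpha> * ln (- lor (hp (fst z)) \<nu>) + \<beta> * ln (- lor (hp (snd z)) \<omega>) = k}"
proof -
  let ?M = "{z\<in>V. w z = l}"
  have ne: "R.r2 z \<noteq> 0" "R.q4 z \<noteq> 0" if z: "z \<in> V" for z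
  proof -
    have F: "(K.al z)\<^sup>2 = (A0 powr (1/2))\<^sup>2" "(K.be z)\<^sup>2 = ((1 - A0) powr (1/2))\<^sup>2"
      using K.mu_zero_if_H_const(2,3)[of h z] h z by blast+
    show "R.r2 z \<noteq> 0"
    proof
      assume "R.r2 z = 0"
      then have "K.al z = 0" by (simp add: K.al_def)
      then show False using F(1) K.ab0_pos(1) by simp
    qed
    show "R.q4 z \<noteq> 0"
    proof
      assume "R.q4 z = 0"
      then have "K.be z = 0" by (simp add: K.be_def)
      then show False using F(2) K.ab0_pos(2) by simp
    qed
  qed
  have cont: "continuous_on ?M R.r2" "continuous_on ?M R.q4"
    by (rule continuous_on_subset[OF Sm_continuous[OF V R.pos.S_conn(2)]], blast,
        rule continuous_on_subset[OF Sm_continuous[OF V R.pos.S_conn(8)]], blast)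
  obtain \<epsilon> where \<epsilon>: "\<epsilon> * \<epsilon> = 1" "\<forall>z\<in>?M. 0 < \<epsilon> * R.r2 z"
    using connected_unit_sign[OF conn cont(1), of z0] ne z0 by blast
  obtain \<delta> where \<delta>: "\<delta> * \<delta> = 1" "\<forall>z\<in>?M. 0 < \<delta> * R.q4 z"
    using connected_unit_sign[OF conn cont(2), of z0] ne z0 by blast
  define V2 where "V2 = {z\<in>V. 0 < \<epsilon> * R.r2 z}"
  define V3 where "V3 = {z\<in>V2. 0 < \<delta> * R.q4 z}"
  have o2: "open V2" unfolding V2_def by (intro open_Sm_pos[OF V] S_mult S_const R.pos.S_conn)
  have o3: "open V3" unfolding V3_def
    by (intro open_Sm_pos[OF o2] Sm_mono[where V = V and W = V2] S_mult S_const R.pos.S_conn) (auto simp: V2_def)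
  have V3: "V3 \<subseteq> V" by (auto simp: V3_def V2_def)
  have M3: "?M \<subseteq> V3" using \<epsilon>(2) \<delta>(2) by (auto simp: V3_def V2_def)
  interpret I3: iso_chart_const V3 J w \<phi> g \<psi> \<kappa> l A0 by (rule restrict_const[OF o3 V3])
  have Meq: "{z\<in>V3. w z = l} = ?M" using M3 V3 by auto
  have "\<exists>\<nu> \<omega> \<alpha> \<beta> k. lor \<nu> \<nu> = 0 \<and> \<nu> $ 1 = 1 \<and> lor \<omega> \<omega> = 0 \<and> \<omega> $ 1 = 1 \<and> \<alpha> \<noteq> 0 \<and> \<beta> \<noteq> 0 \<and> \<alpha>\<^sup>2 + \<beta>\<^sup>2 = 1 \<and>
    I3.local_level {z. \<alpha> * ln (- lor (hp (fst z)) \<nu>) + \<beta> * ln (- lor (hp (snd z)) \<omega>) = k}"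
  proof (rule I3.horo_core[OF _ _ z0(2) _ \<epsilon>(1) _ \<delta>(1)])
    show "connected {z\<in>V3. w z = l}" unfolding Meq by (rule conn)
    show "z0 \<in> V3" using M3 z0 by blast
    fix z assume z: "z \<in> V3"
    show "I3.H z = h" using h V3 z by blast
    show "0 < \<epsilon> * I3.R.r2 z" "0 < \<delta> * I3.R.q4 z" using z by (simp_all add: V3_def V2_def)
  qed
  then show ?thesis using local_level_restrict[OF _ I3.iso_chart_axioms V3] M3 by blast
qed

lemma frechet_H:
  assumes z: "z \<in> V"
  shows "frechet_derivative H (at z) v = H1 z * frechet_derivative d (at z) v"
proof -
  have x: "w z \<in> J" using w z by auto
  have dw: "(w has_derivative frechet_derivative w (at z)) (at z)"
    using smooth_on_has_derivative[OF V _ z] w by (simp add: Sm_def)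
  have "(H has_derivative (\<lambda>v. \<kappa> (w z) * g (w z) * frechet_derivative w (at z) v)) (at z)"
    unfolding H_def[abs_def] by (rule has_derivative_compose[OF dw psi[OF x, unfolded has_field_derivative_def]])
  moreover have "(d has_derivative (\<lambda>v. g (w z) * frechet_derivative w (at z) v)) (at z)"
    unfolding d_def[abs_def] by (rule has_derivative_compose[OF dw phi(1)[OF x, unfolded has_field_derivative_def]])
  ultimately show ?thesis unfolding frechet_derivative_at[symmetric, OF \<open>(H has_derivative _) _\<close>]
      frechet_derivative_at[symmetric, OF \<open>(d has_derivative _) _\<close>] by (simp add: H1_def)
qed

text \<open>Where H^2 = 2 on the level set the equation H1 (H1 - 2 + H^2) = 0 does not separate the two
  solutions; there H1 is bounded by H^2 - 2, and uniqueness for this differential inequality decides.\<close>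

lemma H_sq_two_near:
  assumes eq: "A0 powr (1/2) = (1 - A0) powr (1/2)" and b: "ball z e \<subseteq> V" "y \<in> ball z e" and z: "(H z)\<^sup>2 = 2"
  shows "(H y)\<^sup>2 = 2"
proof -
  define \<sigma> where "\<sigma> t = z + t *\<^sub>R (y - z)" for t
  have inb: "\<sigma> t \<in> V" if "0 \<le> t" "t \<le> 1" for t
  proof -
    have "\<sigma> t \<in> closed_segment z y" unfolding \<sigma>_def closed_segment_def using that by (auto intro!: exI[of _ t] simp: algebra_simps)
    moreover have "closed_segment z y \<subseteq> ball z e" using b(2) by (intro closed_segment_subset) (auto intro: le_less_trans[OF zero_le_dist])
    ultimately show ?thesis using b(1) by blast
  qed
  have \<sigma>: "(\<sigma> has_derivative (\<lambda>h. h *\<^sub>R (y - z))) (at t)" for t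
    unfolding \<sigma>_def by (auto intro!: derivative_eq_intros)
  define v where "v = y - z"
  have dH: "((\<lambda>t. H (\<sigma> t)) has_real_derivative H1 (\<sigma> t) * frechet_derivative d (at (\<sigma> t)) v) (at t)" if t: "0 \<le> t" "t \<le> 1" for t
  proof -
    have D: "(H has_derivative frechet_derivative H (at (\<sigma> t))) (at (\<sigma> t))"
      using smooth_on_has_derivative[OF V _ inb[OF t]] S_dH(2) by (simp add: Sm_def)
    have "((\<lambda>t. H (\<sigma> t)) has_derivative (\<lambda>h. frechet_derivative H (at (\<sigma> t)) (h *\<^sub>R v))) (at t)"
      unfolding v_def by (rule has_derivative_compose[OF \<sigma> D])
    moreover have "frechet_derivative H (at (\<sigma> t)) (h *\<^sub>R v) = H1 (\<sigma> t) * frechet_derivative d (at (\<sigma> t)) v * h" for h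
      using linear_scale[OF has_derivative_linear[OF D], of h v] frechet_H[OF inb[OF t], of v] by simp
    ultimately show ?thesis by (simp add: has_field_derivative_def)
  qed
  \<comment> \<open>Along the segment the derivative of H^2 - 2 is \<open>q\<close> times
    \<open>H1\<close>. \<open>q\<close> is bounded by compactness and |H1| is at most |H^2 - 2|,
    which is the hypothesis of \<open>gronwall_zero\<close>.\<close>
  define q where "q z = 2 * H z * frechet_derivative d (at z) v" for z
  have "q \<in> Sm V" unfolding q_def[abs_def] using S_dH by (intro S_mult S_const) (auto simp: Sm_def smooth_on_frechet)
  then have cq: "continuous_on V q" by (rule Sm_continuous[OF V])
  have "continuous_on {0..1} \<sigma>" unfolding \<sigma>_def by (intro continuous_intros)
  then have "continuous_on {0..1} (\<lambda>t. q (\<sigma> t))"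
    by (rule continuous_on_compose2[OF cq]) (use inb in auto)
  then have "bounded ((\<lambda>t. q (\<sigma> t)) ` {0..1})" by (intro compact_imp_bounded compact_continuous_image) auto
  then obtain C where C: "\<And>t. 0 \<le> t \<Longrightarrow> t \<le> 1 \<Longrightarrow> \<bar>q (\<sigma> t)\<bar> \<le> C" unfolding bounded_iff by force
  have "(H (\<sigma> 1))\<^sup>2 - 2 = 0"
  proof (rule gronwall_zero[where y = "\<lambda>t. (H (\<sigma> t))\<^sup>2 - 2" and y' = "\<lambda>t. q (\<sigma> t) * H1 (\<sigma> t)" and C = C])
    fix t :: real assume t: "0 \<le> t" "t \<le> 1"
    show "((\<lambda>t. (H (\<sigma> t))\<^sup>2 - 2) has_real_derivative q (\<sigma> t) * H1 (\<sigma> t)) (at t)"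
      by (auto intro!: derivative_eq_intros dH[OF t] simp: q_def)
    have "\<bar>H1 (\<sigma> t)\<bar> \<le> \<bar>(H (\<sigma> t))\<^sup>2 - 2\<bar>"
      using K.H1_alternative_if_equal[OF eq inb[OF t]] by auto
    then show "\<bar>q (\<sigma> t) * H1 (\<sigma> t)\<bar> \<le> C * \<bar>(H (\<sigma> t))\<^sup>2 - 2\<bar>"
      unfolding abs_mult using C[OF t] by (intro mult_mono) auto
  qed (use z in \<open>simp add: \<sigma>_def\<close>)
  then show ?thesis by (simp add: \<sigma>_def)
qed

text \<open>If \<open>kappa\<close> vanishes at \<open>l\<close>, then \<open>H1\<close> is zero on
  the level set; it has to be zero on a neighbourhood. For unequal components this always holds. For
  equal ones H1 is 0 or 2 - H^2 at each point, and the second possibility must be excluded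
  nearby.\<close>

lemma H_const_near_level:
  assumes k: "\<kappa> l = 0"
  shows "\<exists>V'. open V' \<and> V' \<subseteq> V \<and> {z\<in>V. w z = l} \<subseteq> V' \<and> (\<forall>z\<in>V'. H z = \<psi> l)"
proof -
  have "\<exists>V'. open V' \<and> V' \<subseteq> V \<and> {z\<in>V. w z = l} \<subseteq> V' \<and> (\<forall>z\<in>V'. H1 z = 0)"
  proof (cases "A0 powr (1/2) = (1 - A0) powr (1/2)")
    case False
    then show ?thesis using V K.H1_zero_if_unequal by (intro exI[of _ V]) auto
  next
    case eq: True
    show ?thesis
    proof (cases "(\<psi> l)\<^sup>2 = 2")
      case False
      \<comment> \<open>On this set H1 differs from 2 - H^2, so only H1 = 0 is left. It contains the
        level set precisely because psi(l)^2 is not 2.\<close>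
      define V' where "V' = {z\<in>V. 0 < (2 - (H z)\<^sup>2)\<^sup>2 - (H1 z)\<^sup>2}"
      have "open V'" unfolding V'_def using S_dH by (intro open_Sm_pos[OF V] S_diff S_power S_const)
      moreover have "H1 z = 0" if z: "z \<in> V'" for z
      proof (rule ccontr)
        assume "H1 z \<noteq> 0"
        then have "H1 z = 2 - (H z)\<^sup>2" using K.H1_alternative_if_equal[OF eq, of z] z by (auto simp: V'_def)
        then show False using z by (simp add: V'_def)
      qed
      moreover have "{z\<in>V. w z = l} \<subseteq> V'" using k False by (auto simp: V'_def H_def H1_def)
      moreover have "V' \<subseteq> V" unfolding V'_def by blast
      ultimately show ?thesis by blast
    next
      case True
      define V' where "V' = interior {z\<in>V. (H z)\<^sup>2 = 2}"
      have V': "open V'" "V' \<subseteq> V" "\<And>z. z \<in> V' \<Longrightarrow> (H z)\<^sup>2 = 2" unfolding V'_def using interior_subset by auto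
      interpret I: iso_chart_const V' J w \<phi> g \<psi> \<kappa> l A0 by (rule restrict_const[OF V'(1,2)])
      have "H1 z = 0" if z: "z \<in> V'" for z
      proof -
        have H0: "H z \<noteq> 0" using V'(3)[OF z] by auto
        have "X H z = 0" if X: "I.derivation X" for X
        proof -
          have "2 * H z * X H z = 0"
            by (rule I.hd_eq[OF X I.hd_power2[OF X I.hd_self[OF I.S_dH(2)]] I.hd_const[OF X] V'(3) z])
          then show ?thesis using H0 by simp
        qed
        then have 0: "X1 d z * H1 z = 0" "X2 d z * H1 z = 0" "Y1 d z * H1 z = 0" "Y2 d z * H1 z = 0"
          using I.derXY I.grad_H[OF z] by metis+
        then show ?thesis using AB(1)[of z] z V'(2) by (auto simp: A_def B_def)
      qed
      moreover have "{z\<in>V. w z = l} \<subseteq> V'"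
      proof
        fix z assume z: "z \<in> {z\<in>V. w z = l}"
        obtain e where e: "e > 0" "ball z e \<subseteq> V" using V z openE by blast
        have "(H z)\<^sup>2 = 2" using z True by (simp add: H_def)
        then have "ball z e \<subseteq> {z\<in>V. (H z)\<^sup>2 = 2}" using H_sq_two_near[OF eq e(2)] e(2) by blast
        then show "z \<in> V'" unfolding V'_def using e(1) mem_interior by blast
      qed
      ultimately show ?thesis using V' by blast
    qed
  qed
  then obtain V' where V': "open V'" "V' \<subseteq> V" "{z\<in>V. w z = l} \<subseteq> V'" "\<And>z. z \<in> V' \<Longrightarrow> H1 z = 0" by blast
  interpret I: iso_chart_const V' J w \<phi> g \<psi> \<kappa> l A0 by (rule restrict_const[OF V'(1,2)])
  have "XYflat V' H" unfolding XYflat_def using I.S_dH I.grad_H V'(4) by auto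
  then have "open {z\<in>V'. H z = \<psi> l}" by (rule XYflat_level_open[OF V'(1)])
  then show ?thesis using V' by (intro exI[of _ "{z\<in>V'. H z = \<psi> l}"]) (auto simp: H_def)
qed

end

section \<open>Shapes of the level set and classification in the chart\<close>

definition "is_cylinder T \<longleftrightarrow> (\<exists>p v t k. lorentz_onb p v t \<and> p \<in> H2 \<and> T = {y. lor y (k *\<^sub>R p - v) = - k})"

text \<open>Null vectors are normalised by first component 1, so each represents one ideal point.
  The coefficients of the two logarithms are the signed gradient components, hence their squares add
  up to 1.\<close>

definition "is_horo T \<longleftrightarrow> (\<exists>\<nu> \<omega> \<alpha> \<beta> k. lor \<nu> \<nu> = 0 \<and> \<nu> $ 1 = 1 \<and> lor \<omega> \<omega> = 0 \<and> \<omega> $ 1 = 1 \<and>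
    \<alpha> \<noteq> 0 \<and> \<beta> \<noteq> 0 \<and> \<alpha>\<^sup>2 + \<beta>\<^sup>2 = 1 \<and> T = {x. \<alpha> * ln (- lor (fst x) \<nu>) + \<beta> * ln (- lor (snd x) \<omega>) = k})"

definition "is_tau T \<longleftrightarrow> (\<exists>L \<tau>. \<tau> < -1 \<and> linear L \<and> (\<forall>u v. lor (L u) (L v) = lor u v) \<and> (\<forall>q\<in>H2. L q \<in> H2) \<and>
    T = {x. lor (fst x) (L (snd x)) = \<tau>})"

lemma frechet_swap:
  fixes f :: "pt \<Rightarrow> real"
  assumes "open V" "f \<in> Sm V" "prod.swap z \<in> V"
  shows "frechet_derivative (\<lambda>z. f (prod.swap z)) (at z) v = frechet_derivative f (at (prod.swap z)) (prod.swap v)"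
proof -
  have l: "(prod.swap has_derivative prod.swap) (at z)" for z :: pt
  proof (rule bounded_linear_imp_has_derivative)
    show "bounded_linear (prod.swap :: pt \<Rightarrow> pt)"
      unfolding prod.swap_def by (intro bounded_linear_Pair bounded_linear_fst bounded_linear_snd)
  qed
  have "(f has_derivative frechet_derivative f (at (prod.swap z))) (at (prod.swap z))"
    using smooth_on_has_derivative[OF assms(1) _ assms(3)] assms(2) by (simp add: Sm_def)
  from frechet_derivative_at[OF has_derivative_compose[OF l this]] show ?thesis by metis
qed

lemma XY_swap:
  assumes "open V" "f \<in> Sm V" "prod.swap z \<in> V"
  shows "X1 (\<lambda>z. f (prod.swap z)) z = Y1 f (prod.swap z)" "X2 (\<lambda>z. f (prod.swap z)) z = Y2 f (prod.swap z)"
    "Y1 (\<lambda>z. f (prod.swap z)) z = X1 f (prod.swap z)" "Y2 (\<lambda>z. f (prod.swap z)) z = X2 f (prod.swap z)"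
  unfolding X1_def X2_def Y1_def Y2_def frechet_swap[OF assms] by simp_all

lemma open_swap: "open V \<Longrightarrow> open (prod.swap -` V)" for V :: "pt set"
  by (intro open_vimage) (auto simp: prod.swap_def[abs_def] intro!: continuous_intros)

context iso_chart
begin

text \<open>Exchanging the factors interchanges \<open>A\<close> and \<open>B\<close>, which reduces
  A = 0 to A = 1.\<close>

lemma iso_chart_swap: "iso_chart (prod.swap -` V) J (\<lambda>z. w (prod.swap z)) \<phi> g \<psi> \<kappa> l"
proof -
  have o: "open (prod.swap -` V)" by (rule open_swap[OF V])
  have sm: "(\<lambda>z. f (prod.swap z)) \<in> Sm (prod.swap -` V)" if "f \<in> Sm V" for f
  proof -
    have "smooth_on (prod.swap -` V) (prod.swap :: pt \<Rightarrow> pt)"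
      by (rule smooth_on_linear[OF o])
        (auto simp: prod.swap_def[abs_def] intro!: bounded_linear_Pair bounded_linear_fst bounded_linear_snd)
    then show ?thesis using smooth_on_compose[OF o V, of prod.swap f] that by (auto simp: Sm_def)
  qed
  note sw = XY_swap[OF V S_dH(1)[unfolded d_def[abs_def]]]
  have sw2: "X1 (X1 (\<lambda>z. \<phi> (w (prod.swap z)))) z = Y1 (Y1 (\<lambda>z. \<phi> (w z))) (prod.swap z)"
    "X2 (X2 (\<lambda>z. \<phi> (w (prod.swap z)))) z = Y2 (Y2 (\<lambda>z. \<phi> (w z))) (prod.swap z)"
    "Y1 (Y1 (\<lambda>z. \<phi> (w (prod.swap z)))) z = X1 (X1 (\<lambda>z. \<phi> (w z))) (prod.swap z)"
    "Y2 (Y2 (\<lambda>z. \<phi> (w (prod.swap z)))) z = X2 (X2 (\<lambda>z. \<phi> (w z))) (prod.swap z)" if z: "prod.swap z \<in> V" for z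
  proof -
    interpret T: group_frame "prod.swap -` V" "Sm (prod.swap -` V)" X1 X2 Y1 Y2 "\<lambda>z. hp (fst z)" "\<lambda>z. hf1 (fst z)" "\<lambda>z. hf2 (fst z)"
      "\<lambda>z. hp (snd z)" "\<lambda>z. hf1 (snd z)" "\<lambda>z. hf2 (snd z)" by (rule group_frame_chart[OF o])
    have zs: "z \<in> prod.swap -` V" using z by simp
    have Sd: "(\<lambda>z. \<phi> (w (prod.swap z))) \<in> Sm (prod.swap -` V)" using sm[OF S_dH(1)[unfolded d_def[abs_def]]] .
    note Sx = S_Xd(1-4)[unfolded d_def[abs_def]]
    have eq: "X (Z (\<lambda>z. \<phi> (w (prod.swap z)))) z = X (\<lambda>y. Z' (\<lambda>z. \<phi> (w z)) (prod.swap y)) z"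
      if "T.derivation X" "T.derivation Z" "Z' (\<lambda>z. \<phi> (w z)) \<in> Sm V"
        "\<And>y. prod.swap y \<in> V \<Longrightarrow> Z (\<lambda>z. \<phi> (w (prod.swap z))) y = Z' (\<lambda>z. \<phi> (w z)) (prod.swap y)" for X Z Z'
      by (rule T.hd_eq[OF that(1) T.hd_self T.hd_self _ zs]) (use T.derivation_S[OF that(2) Sd] sm[OF that(3)] that(4) in auto)
    show "X1 (X1 (\<lambda>z. \<phi> (w (prod.swap z)))) z = Y1 (Y1 (\<lambda>z. \<phi> (w z))) (prod.swap z)"
      using eq[of X1 X1 Y1, OF T.derXY(1) T.derXY(1) Sx(3) sw(1)] XY_swap(1)[OF V Sx(3) z] by simp
    show "X2 (X2 (\<lambda>z. \<phi> (w (prod.swap z)))) z = Y2 (Y2 (\<lambda>z. \<phi> (w z))) (prod.swap z)"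
      using eq[of X2 X2 Y2, OF T.derXY(2) T.derXY(2) Sx(4) sw(2)] XY_swap(2)[OF V Sx(4) z] by simp
    show "Y1 (Y1 (\<lambda>z. \<phi> (w (prod.swap z)))) z = X1 (X1 (\<lambda>z. \<phi> (w z))) (prod.swap z)"
      using eq[of Y1 Y1 X1, OF T.derXY(3) T.derXY(3) Sx(1) sw(3)] XY_swap(3)[OF V Sx(1) z] by simp
    show "Y2 (Y2 (\<lambda>z. \<phi> (w (prod.swap z)))) z = X2 (X2 (\<lambda>z. \<phi> (w z))) (prod.swap z)"
      using eq[of Y2 Y2 X2, OF T.derXY(4) T.derXY(4) Sx(2) sw(4)] XY_swap(4)[OF V Sx(2) z] by simp
  qed
  show ?thesis
  proof
    fix z assume "z \<in> prod.swap -` V"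
    then have z: "prod.swap z \<in> V" by simp
    show "(X1 (\<lambda>z. \<phi> (w (prod.swap z))) z)\<^sup>2 + (X2 (\<lambda>z. \<phi> (w (prod.swap z))) z)\<^sup>2
       + ((Y1 (\<lambda>z. \<phi> (w (prod.swap z))) z)\<^sup>2 + (Y2 (\<lambda>z. \<phi> (w (prod.swap z))) z)\<^sup>2) = 1"
      unfolding sw[OF z] using unit[OF z] by simp
    show "\<psi> (w (prod.swap z)) = X1 (X1 (\<lambda>z. \<phi> (w (prod.swap z)))) z + X2 (X2 (\<lambda>z. \<phi> (w (prod.swap z)))) z - X2 (\<lambda>z. \<phi> (w (prod.swap z))) z
       + (Y1 (Y1 (\<lambda>z. \<phi> (w (prod.swap z)))) z + Y2 (Y2 (\<lambda>z. \<phi> (w (prod.swap z)))) z - Y2 (\<lambda>z. \<phi> (w (prod.swap z))) z)"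
      unfolding sw[OF z] sw2[OF z] using lapl[OF z] by simp
  qed (use o J sm[OF w(1)] w(2) smooth phi psi in auto)
qed

text \<open>The antiderivative for the integrating factor may exist only on a smaller interval
  around \<open>l\<close>, and A = 1 holds only near the level set; both are arranged by shrinking
  \<open>V\<close> and \<open>J\<close>.\<close>

lemma cylinder_at:
  assumes conn: "connected {z\<in>V. w z = l}" and z0: "z0 \<in> V" "w z0 = l" and A: "A z0 = 1"
  shows "\<exists>T. is_cylinder T \<and> local_level {z. hp (fst z) \<in> T}"
proof -
  have "smooth_on J (\<lambda>x. \<psi> x * g x)" using smooth J by (intro smooth_on_mult)
  from smooth_antiderivative[OF J this] obtain e E where e: "e > 0" "{l-e<..<l+e} \<subseteq> J"
    and E: "smooth_on {l-e<..<l+e} E" "E l = 0" "\<And>x. x \<in> {l-e<..<l+e} \<Longrightarrow> (E has_real_derivative \<psi> x * g x) (at x)" by blast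
  define V' where "V' = {z\<in>V. A z = 1} \<inter> (V \<inter> w -` {l-e<..<l+e})"
  have o: "open V'" unfolding V'_def
    by (intro open_Int XYflat_level_open[OF V A_flat] continuous_open_preimage[OF Sm_continuous[OF V w(1)] V]) simp
  have V'V: "V' \<subseteq> V" by (auto simp: V'_def)
  have M: "{z\<in>V. w z = l} \<subseteq> V'"
  proof
    fix z assume z: "z \<in> {z\<in>V. w z = l}"
    then have "A z = 1" using level_const(1)[OF conn z0 A_flat, of z] A by simp
    then show "z \<in> V'" using z e by (simp add: V'_def)
  qed
  interpret I: iso_chart V' "{l-e<..<l+e}" w \<phi> g \<psi> \<kappa> l
  proof
    show "w \<in> Sm V'" using Sm_mono[OF w(1) V'V] .
    show "smooth_on {l-e<..<l+e} \<phi>" "smooth_on {l-e<..<l+e} g" "smooth_on {l-e<..<l+e} \<psi>" "smooth_on {l-e<..<l+e} \<kappa>"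
      using smooth smooth_on_mono e(2) by blast+
  qed (use o e phi psi unit lapl V'V in \<open>auto simp: V'_def\<close>)
  have Meq: "{z\<in>V'. w z = l} = {z\<in>V. w z = l}" using M V'V by auto
  have z0': "z0 \<in> V'" using M z0 by blast
  have A1: "I.A z = 1" if "z \<in> V'" for z using that by (simp add: V'_def)
  have "\<exists>p v t k. lorentz_onb p v t \<and> p \<in> H2 \<and> I.local_level {z. lor (hp (fst z)) (k *\<^sub>R p - v) = - k}"
    by (rule I.cylinder_case[OF conn[folded Meq] z0' z0(2) _ E(1,2)]) (erule A1 E(3))+
  then obtain p v t k where c: "lorentz_onb p v t" "p \<in> H2" "I.local_level {z. lor (hp (fst z)) (k *\<^sub>R p - v) = - k}"
    by blast
  have I2: "iso_chart V' J w \<phi> g \<psi> \<kappa> l" by (rule restrict[OF o V'V])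
  have "local_level {z. lor (hp (fst z)) (k *\<^sub>R p - v) = - k}"
    by (rule local_level_restrict[OF _ I2 V'V]) (use c(3) M in auto)
  then show ?thesis using c by (intro exI[of _ "{y. lor y (k *\<^sub>R p - v) = - k}"]) (auto simp: is_cylinder_def)
qed

text \<open>By flatness the value of \<open>A\<close> at one point of the level set is its value
  near the whole level set. The values 1 and 0 give cylinders; between them, \<open>kappa\<close> at
  \<open>l\<close> separates the surfaces at fixed distance from the horocycle products.\<close>

theorem chart_classification:
  assumes conn: "connected {z\<in>V. w z = l}" and z0: "z0 \<in> V" "w z0 = l"
  shows "(\<exists>T. is_cylinder T \<and> local_level {z. hp (fst z) \<in> T}) \<or> (\<exists>T. is_cylinder T \<and> local_level {z. hp (snd z) \<in> T})
    \<or> (\<exists>T. (is_horo T \<or> is_tau T) \<and> local_level {z. chart z \<in> T})"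
proof -
  consider "A z0 = 1" | "A z0 = 0" | "0 < A z0" "A z0 < 1"
    using AB(1)[OF z0(1)] AB(2)[of z0] AB(3)[of z0] by linarith
  then show ?thesis
  proof cases
    case 1
    then show ?thesis using cylinder_at[OF conn z0] by blast
  next
    case 2
    interpret W: iso_chart "prod.swap -` V" J "\<lambda>z. w (prod.swap z)" \<phi> g \<psi> \<kappa> l by (rule iso_chart_swap)
    have cs: "{z \<in> prod.swap -` V. w (prod.swap z) = l} = prod.swap ` {z\<in>V. w z = l}"
      by (auto simp: image_iff)
    have "connected (prod.swap ` {z\<in>V. w z = l})"
      by (intro connected_continuous_image conn) (auto simp: prod.swap_def[abs_def] intro!: continuous_intros)
    moreover have "W.A (prod.swap z0) = 1"
    proof -
      have "W.A (prod.swap z0) = B z0"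
        unfolding W.A_def B_def W.d_def[abs_def] d_def[abs_def]
        using XY_swap[OF V S_dH(1)[unfolded d_def[abs_def]], of "prod.swap z0"] z0 by simp
      then show ?thesis using AB(1)[OF z0(1)] 2 by simp
    qed
    ultimately obtain T where T: "is_cylinder T" "W.local_level {z. hp (fst z) \<in> T}"
      using W.cylinder_at[of "prod.swap z0"] z0 unfolding cs by auto
    have "local_level {z. hp (snd z) \<in> T}"
      unfolding local_level_def
    proof (intro ballI impI conjI)
      fix z assume z: "z \<in> V" "w z = l"
      then have *: "prod.swap z \<in> prod.swap -` V" "w (prod.swap (prod.swap z)) = l" by auto
      show "z \<in> {z. hp (snd z) \<in> T}" using T(2) * unfolding W.local_level_def by fastforce
      obtain e where e: "e > 0" "ball (prod.swap z) e \<subseteq> prod.swap -` V"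
        "\<And>y. y \<in> ball (prod.swap z) e \<Longrightarrow> hp (fst y) \<in> T \<Longrightarrow> w (prod.swap y) = l"
        using T(2) * unfolding W.local_level_def by blast
      have d: "dist (prod.swap x) (prod.swap y) = dist x y" for x y :: pt
        by (simp add: dist_prod_def add.commute)
      show "\<exists>e>0. ball z e \<subseteq> V \<and> (\<forall>y\<in>ball z e. y \<in> {z. hp (snd z) \<in> T} \<longrightarrow> w y = l)"
      proof (intro exI[of _ e] conjI ballI impI subsetI e(1))
        fix y assume "y \<in> ball z e"
        then have y: "prod.swap y \<in> ball (prod.swap z) e" using d by simp
        then show "y \<in> V" using e(2) by auto
        assume "y \<in> {z. hp (snd z) \<in> T}"
        then show "w y = l" using e(3)[OF y] by simp
      qed
    qed
    then show ?thesis using T(1) by blast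
  next
    case 3
    define V1 where "V1 = {z\<in>V. A z = A z0}"
    have o: "open V1" unfolding V1_def by (rule XYflat_level_open[OF V A_flat])
    have V1: "V1 \<subseteq> V" by (auto simp: V1_def)
    have M1: "{z\<in>V. w z = l} \<subseteq> V1" using level_const(1)[OF conn z0 A_flat] by (auto simp: V1_def)
    interpret I: iso_chart_const V1 J w \<phi> g \<psi> \<kappa> l "A z0"
      by (intro iso_chart_const.intro restrict[OF o V1] iso_chart_const_axioms.intro)
        (use 3 in \<open>simp_all add: V1_def\<close>)
    have z01: "z0 \<in> V1" using M1 z0 by auto
    have Meq: "{z\<in>V1. w z = l} = {z\<in>V. w z = l}" using M1 V1 by auto
    show ?thesis
    proof (cases "\<kappa> l = 0")
      case False
      obtain L \<tau> where "\<tau> < -1" "linear L" "\<forall>u v. lor (L u) (L v) = lor u v" "\<forall>q\<in>H2. L q \<in> H2"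
        and L: "I.local_level {z. lor (hp (fst z)) (L (hp (snd z))) = \<tau>}"
        using I.tau_case[OF conn[folded Meq] z01 z0(2) False] by blast
      then have "is_tau {x. lor (fst x) (L (snd x)) = \<tau>}" unfolding is_tau_def by blast
      moreover have "local_level {z. chart z \<in> {x. lor (fst x) (L (snd x)) = \<tau>}}"
        by (rule local_level_restrict[OF _ I.iso_chart_axioms V1]) (use L M1 in \<open>auto simp: chart_def\<close>)
      ultimately show ?thesis by blast
    next
      case True
      obtain V2 where V2: "open V2" "V2 \<subseteq> V1" "{z\<in>V1. w z = l} \<subseteq> V2" "\<forall>z\<in>V2. I.H z = \<psi> l"
        using I.H_const_near_level[OF True] by blast
      interpret I2: iso_chart_const V2 J w \<phi> g \<psi> \<kappa> l "A z0" by (rule I.restrict_const[OF V2(1,2)])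
      have Meq2: "{z\<in>V2. w z = l} = {z\<in>V. w z = l}" using V2(2,3) Meq by auto
      have z02: "z0 \<in> V2" using Meq2 z0 by auto
      obtain \<nu> \<omega> \<alpha> \<beta> k where n: "lor \<nu> \<nu> = 0" "\<nu> $ 1 = 1" "lor \<omega> \<omega> = 0" "\<omega> $ 1 = 1" "\<alpha> \<noteq> 0" "\<beta> \<noteq> 0" "\<alpha>\<^sup>2 + \<beta>\<^sup>2 = 1"
        and L: "I2.local_level {z. \<alpha> * ln (- lor (hp (fst z)) \<nu>) + \<beta> * ln (- lor (hp (snd z)) \<omega>) = k}"
        using I2.horo_case[OF conn[folded Meq2] z02 z0(2), of "\<psi> l"] V2(4) by blast
      have "is_horo {x. \<alpha> * ln (- lor (fst x) \<nu>) + \<beta> * ln (- lor (snd x) \<omega>) = k}" unfolding is_horo_def using n by blast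
      moreover have "local_level {z. chart z \<in> {x. \<alpha> * ln (- lor (fst x) \<nu>) + \<beta> * ln (- lor (snd x) \<omega>) = k}}"
        by (rule local_level_restrict[OF _ I2.iso_chart_axioms]) (use L V2 V1 Meq2 in \<open>auto simp: chart_def\<close>)
      ultimately show ?thesis by blast
    qed
  qed
qed

end

subsection \<open>From local to global\<close>

text \<open>Regularity of the value \<open>l\<close> makes \<open>f\<close> positive near
  \<open>l\<close>, so the gradient can be normalised there. As the chart is global, the whole
  hypersurface corresponds to one level set in an open subset of R^4.\<close>

lemma isoparametric_iso_chart:
  assumes M: "isoparametric_hypersurface M" and ne: "M \<noteq> {}"
    and surj: "\<And>x. x \<in> HH \<Longrightarrow> \<exists>z. chart z = x"
  shows "M \<subseteq> HH \<and> (\<exists>V J w \<phi> g \<psi> \<kappa> l. iso_chart V J w \<phi> g \<psi> \<kappa> l \<and> chart -` M = {z\<in>V. w z = l})"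
proof -
  obtain U F f h l where U: "openin (top_of_set HH) U" and F: "smooth_fun_on U F"
    and f: "smooth_on (UNIV::real set) f" and h: "smooth_on (UNIV::real set) h"
    and fh: "\<And>x. x \<in> U \<Longrightarrow> grad_sq F x = f (F x) \<and> lap F x = h (F x)"
    and reg: "\<And>x. x \<in> U \<Longrightarrow> F x = l \<Longrightarrow> grad_sq F x \<noteq> 0" and Ml: "M = {x\<in>U. F x = l}"
    using M unfolding isoparametric_hypersurface_def by blast
  have UHH: "U \<subseteq> HH" using U openin_imp_subset by blast
  obtain w where V0: "open (chart -` U)" and w0: "smooth_on (chart -` U) w"
    and w: "\<And>z. z \<in> chart -` U \<Longrightarrow> w z = F (chart z)"
    and gr: "\<And>z. z \<in> chart -` U \<Longrightarrow> grad_sq F (chart z) = (X1 w z)\<^sup>2 + (X2 w z)\<^sup>2 + (Y1 w z)\<^sup>2 + (Y2 w z)\<^sup>2"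
    and la: "\<And>z. z \<in> chart -` U \<Longrightarrow> lap F (chart z) = X1 (X1 w) z + X2 (X2 w) z - X2 w z + (Y1 (Y1 w) z + Y2 (Y2 w) z - Y2 w z)"
    using chart_pullback[OF U F] by blast
  have fl: "0 < f l"
  proof -
    obtain x where x: "x \<in> U" "F x = l" using ne Ml by auto
    obtain z where z: "chart z = x" using surj x(1) UHH by blast
    have "z \<in> chart -` U" using z x by simp
    then have "0 \<le> grad_sq F x" using gr[of z] z by simp
    moreover have "grad_sq F x = f l" using fh[OF x(1)] x(2) by simp
    ultimately show ?thesis using reg[OF x] by simp
  qed
  have "C_k 0 UNIV f" using f unfolding smooth_on_def by blast
  then have "open (f -` {0<..})" by (intro open_vimage) auto
  then have J0: "open {x. 0 < f x}" "l \<in> {x. 0 < f x}" using fl by (auto simp: vimage_def)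
  \<comment> \<open>The derivative of the normalising function: the squared gradient of d = phi(w)
    is g^2 f = 1.\<close>
  define g where "g x = f x powr (-1/2)" for x
  have sg0: "smooth_on {x. 0 < f x} g" unfolding g_def[abs_def]
    by (rule smooth_on_powr[OF J0(1) smooth_on_mono[OF f]]) auto
  obtain e \<phi> where e: "e > 0" "{l-e<..<l+e} \<subseteq> {x. 0 < f x}"
    and \<phi>: "smooth_on {l-e<..<l+e} \<phi>" "\<And>x. x \<in> {l-e<..<l+e} \<Longrightarrow> (\<phi> has_real_derivative g x) (at x)"
    using smooth_antiderivative[OF J0 sg0] by blast
  define J where "J = {l-e<..<l+e}"
  have J: "open J" "l \<in> J" and fJ: "\<And>x. x \<in> J \<Longrightarrow> 0 < f x" using e by (auto simp: J_def)
  have sg: "smooth_on J g" using smooth_on_mono[OF sg0 e(2)] by (simp add: J_def)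
  obtain g' where g': "smooth_on J g'" "\<And>x. x \<in> J \<Longrightarrow> (g has_real_derivative g' x) (at x)"
    using smooth_on_real_derivative[OF J(1) sg] by blast
  \<comment> \<open>The Laplacian of phi(w) is phi'' |grad w|^2 + phi' lap w, where phi' =
    g.\<close>
  define \<psi> where "\<psi> x = g' x * f x + g x * h x" for x
  have sf: "smooth_on J f" "smooth_on J h" using f h smooth_on_mono by blast+
  have s\<psi>: "smooth_on J \<psi>" unfolding \<psi>_def[abs_def]
    by (intro smooth_on_add smooth_on_mult J(1) g'(1) sf sg)
  obtain \<psi>' where \<psi>': "smooth_on J \<psi>'" "\<And>x. x \<in> J \<Longrightarrow> (\<psi> has_real_derivative \<psi>' x) (at x)"
    using smooth_on_real_derivative[OF J(1) s\<psi>] by blast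
  \<comment> \<open>The derivative of the Laplacian with respect to \<open>d\<close> instead of
    \<open>w\<close>: psi' divided by \<open>g\<close>, and 1 / g is the square root of
    \<open>f\<close>.\<close>
  define \<kappa> where "\<kappa> x = \<psi>' x * f x powr (1/2)" for x
  have s\<kappa>: "smooth_on J \<kappa>" unfolding \<kappa>_def[abs_def]
    by (intro smooth_on_mult J(1) \<psi>'(1) smooth_on_powr[OF J(1) sf(1)] fJ)
  have gg: "g x * g x * f x = 1" "\<kappa> x * g x = \<psi>' x" if "x \<in> J" for x
  proof -
    have s: "f x powr (-1/2) = inverse (sqrt (f x))" "f x powr (1/2) = sqrt (f x)" "sqrt (f x) * sqrt (f x) = f x" "0 < sqrt (f x)"
      using fJ[OF that] powr_minus[of "f x" "1/2"] by (simp_all add: powr_half_sqrt)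
    show "g x * g x * f x = 1" unfolding g_def s(1) using s(3,4) by (simp add: field_simps)
    show "\<kappa> x * g x = \<psi>' x" unfolding g_def \<kappa>_def s(1,2) using s(4) by simp
  qed
  define V where "V = chart -` U \<inter> w -` J"
  have wS0: "w \<in> Sm (chart -` U)" using w0 by (simp add: Sm_def)
  have V: "open V" unfolding V_def by (rule continuous_open_preimage[OF Sm_continuous[OF V0 wS0] V0 J(1)])
  have wS: "w \<in> Sm V" by (rule Sm_mono[OF wS0]) (simp add: V_def)
  have VU: "z \<in> chart -` U" "w z \<in> J" if "z \<in> V" for z using that by (auto simp: V_def)
  interpret G: group_frame V "Sm V" X1 X2 Y1 Y2 "\<lambda>z. hp (fst z)" "\<lambda>z. hf1 (fst z)" "\<lambda>z. hf2 (fst z)"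
    "\<lambda>z. hp (snd z)" "\<lambda>z. hf1 (snd z)" "\<lambda>z. hf2 (snd z)" by (rule group_frame_chart[OF V])
  have wJ: "w ` V \<subseteq> J" using VU by auto
  have Sd: "(\<lambda>z. \<phi> (w z)) \<in> Sm V" by (rule Sm_compose[OF V wS J(1) wJ \<phi>(1)[folded J_def]])
  have Sg: "(\<lambda>z. g (w z)) \<in> Sm V" by (rule Sm_compose[OF V wS J(1) wJ sg])
  have c: "X1 (\<lambda>z. \<phi> (w z)) z = g (w z) * X1 w z" "X2 (\<lambda>z. \<phi> (w z)) z = g (w z) * X2 w z"
    "Y1 (\<lambda>z. \<phi> (w z)) z = g (w z) * Y1 w z" "Y2 (\<lambda>z. \<phi> (w z)) z = g (w z) * Y2 w z" if "z \<in> V" for z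
    using XY_compose[OF V wS that \<phi>(2)[folded J_def, OF VU(2)[OF that]]] by auto
  have c2: "X (X (\<lambda>z. \<phi> (w z))) z = g (w z) * X (X w) z + g' (w z) * X w z * X w z"
    if z: "z \<in> V" and X: "G.derivation X" "\<And>z. z \<in> V \<Longrightarrow> X (\<lambda>z. \<phi> (w z)) z = g (w z) * X w z"
      "X (\<lambda>z. g (w z)) z = g' (w z) * X w z" for X z
    using G.hd_eq[OF X(1) G.hd_self[OF G.derivation_S[OF X(1) Sd]]
        G.hd_mult[OF X(1) G.hd_self[OF Sg] G.hd_self[OF G.derivation_S[OF X(1) wS]]] X(2) z] X(3) by simp
  have "iso_chart V J w \<phi> g \<psi> \<kappa> l"
  proof
    show "(\<psi> has_real_derivative \<kappa> x * g x) (at x)" if "x \<in> J" for x using \<psi>'(2)[OF that] gg(2)[OF that] by simp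
    show "0 < g x" if "x \<in> J" for x using fJ[OF that] by (simp add: g_def)
    fix z assume z: "z \<in> V"
    note zU = VU(1)[OF z] and zJ = VU(2)[OF z]
    have fw: "(X1 w z)\<^sup>2 + (X2 w z)\<^sup>2 + (Y1 w z)\<^sup>2 + (Y2 w z)\<^sup>2 = f (w z)"
      and hw: "X1 (X1 w) z + X2 (X2 w) z - X2 w z + (Y1 (Y1 w) z + Y2 (Y2 w) z - Y2 w z) = h (w z)"
      using gr[OF zU] la[OF zU] fh[of "chart z"] zU w[OF zU] by auto
    have "(g (w z) * X1 w z)\<^sup>2 + (g (w z) * X2 w z)\<^sup>2 + ((g (w z) * Y1 w z)\<^sup>2 + (g (w z) * Y2 w z)\<^sup>2)
        = g (w z) * g (w z) * ((X1 w z)\<^sup>2 + (X2 w z)\<^sup>2 + (Y1 w z)\<^sup>2 + (Y2 w z)\<^sup>2)"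
      by (simp add: power2_eq_square algebra_simps)
    then show "(X1 (\<lambda>z. \<phi> (w z)) z)\<^sup>2 + (X2 (\<lambda>z. \<phi> (w z)) z)\<^sup>2 + ((Y1 (\<lambda>z. \<phi> (w z)) z)\<^sup>2 + (Y2 (\<lambda>z. \<phi> (w z)) z)\<^sup>2) = 1"
      unfolding c[OF z] fw using gg(1)[OF zJ] by simp
    note cg = XY_compose[OF V wS z g'(2)[OF zJ]]
    have cc: "X1 (X1 (\<lambda>z. \<phi> (w z))) z = g (w z) * X1 (X1 w) z + g' (w z) * X1 w z * X1 w z"
      "X2 (X2 (\<lambda>z. \<phi> (w z))) z = g (w z) * X2 (X2 w) z + g' (w z) * X2 w z * X2 w z"
      "Y1 (Y1 (\<lambda>z. \<phi> (w z))) z = g (w z) * Y1 (Y1 w) z + g' (w z) * Y1 w z * Y1 w z"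
      "Y2 (Y2 (\<lambda>z. \<phi> (w z))) z = g (w z) * Y2 (Y2 w) z + g' (w z) * Y2 w z * Y2 w z"
      by (rule c2[OF z G.derXY(1) _ cg(1)] c2[OF z G.derXY(2) _ cg(2)] c2[OF z G.derXY(3) _ cg(3)] c2[OF z G.derXY(4) _ cg(4)]; erule c)+
    show "\<psi> (w z) = X1 (X1 (\<lambda>z. \<phi> (w z))) z + X2 (X2 (\<lambda>z. \<phi> (w z))) z - X2 (\<lambda>z. \<phi> (w z)) z
       + (Y1 (Y1 (\<lambda>z. \<phi> (w z))) z + Y2 (Y2 (\<lambda>z. \<phi> (w z))) z - Y2 (\<lambda>z. \<phi> (w z)) z)"
      unfolding cc c[OF z] \<psi>_def fw[symmetric] hw[symmetric] by (simp add: power2_eq_square algebra_simps)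
  qed (use V J wS wJ \<phi>[folded J_def] sg s\<psi> s\<kappa> in auto)
  moreover have "chart -` M = {z\<in>V. w z = l}"
    using Ml w J(2) by (auto simp: V_def)
  moreover have "M \<subseteq> HH" using Ml UHH by blast
  ultimately show ?thesis by blast
qed

text \<open>The horocycle through a point is read off from p1 - p3, which is e^(-t) in horospherical
  coordinates and positive on all of \<open>H2\<close>.\<close>

definition hinv :: "real^3 \<Rightarrow> real \<times> real" where
  "hinv p = (p $ 2 / (p $ 1 - p $ 3), - ln (p $ 1 - p $ 3))"

lemma H2_diff_pos: "p \<in> H2 \<Longrightarrow> 0 < p $ 1 - p $ 3" "p \<in> H2 \<Longrightarrow> \<bar>p $ 3\<bar> < p $ 1"
proof -
  assume p: "p \<in> H2"
  have "(p$1)\<^sup>2 = 1 + (p$2)\<^sup>2 + (p$3)\<^sup>2" "0 < p$1" using p by (auto simp: H2_def lor_def power2_eq_square)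
  then have "\<bar>p$3\<bar>\<^sup>2 < (p$1)\<^sup>2" by (simp add: add_pos_nonneg)
  then show "\<bar>p $ 3\<bar> < p $ 1" by (rule power2_less_imp_less) (use \<open>0 < p$1\<close> in simp)
  then show "0 < p $ 1 - p $ 3" by simp
qed

lemma hp_hinv: "p \<in> H2 \<Longrightarrow> hp (hinv p) = p"
proof -
  assume p: "p \<in> H2"
  define m where "m = p$1 - p$3"
  have m: "0 < m" using H2_diff_pos[OF p] by (simp add: m_def)
  have e: "exp (snd (hinv p)) = 1 / m" "exp (- snd (hinv p)) = m" "fst (hinv p) = p$2 / m"
    using m by (simp_all add: hinv_def m_def[symmetric] exp_minus divide_inverse)
  have "1 + (p$2)\<^sup>2 = m * (p$1 + p$3)" using p by (simp add: m_def H2_def lor_def power2_eq_square algebra_simps)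
  then have k: "1 / m + (p$2)\<^sup>2 / m = p$1 + p$3" using m by (simp add: field_simps)
  have x: "(p$2 / m)\<^sup>2 * m = (p$2)\<^sup>2 / m" using m by (simp add: power2_eq_square field_simps)
  show ?thesis
    unfolding vec_eq_iff forall_3 hp_nth e distrib_right left_diff_distrib x using k m by (simp add: m_def)
qed

lemma hinv_hp: "hinv (hp y) = y"
proof -
  have "hp y $ 1 - hp y $ 3 = exp (- snd y)" by (simp add: hp_nth field_simps)
  then show ?thesis by (simp add: hinv_def hp_nth prod_eq_iff)
qed

definition chart_inv :: "(real^3) \<times> (real^3) \<Rightarrow> pt" where
  "chart_inv x = (hinv (fst x), hinv (snd x))"

lemma chart_chart_inv: "x \<in> HH \<Longrightarrow> chart (chart_inv x) = x"
  by (auto simp: HH_def chart_def chart_inv_def hp_hinv)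

lemma chart_inv_chart: "chart_inv (chart z) = z"
  by (simp add: chart_def chart_inv_def hinv_hp)

lemma continuous_chart_inv: "continuous_on HH chart_inv"
proof -
  have h: "continuous_on H2 hinv" unfolding hinv_def
    by (intro continuous_intros) (use H2_diff_pos in force)+
  show ?thesis unfolding chart_inv_def HH_def
    by (intro continuous_on_Pair continuous_on_compose2[OF h] continuous_intros) auto
qed

text \<open>A ball in the chart corresponds to a relatively open subset of \<open>HH\<close>, cut
  out by an open set \<open>Q\<close> of the ambient space. A linear bijection maps \<open>Q\<close>
  to an open set; intersected with the target, it contains only points of the image of
  \<open>M\<close>.\<close>

lemma open_part_transfer:
  fixes \<Phi> :: "(real^3) \<times> (real^3) \<Rightarrow> (real^3) \<times> (real^3)"
  assumes I: "iso_chart V J w \<phi> g \<psi> \<kappa> l" and L: "iso_chart.local_level V w l {z. chart z \<in> T}"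
    and M: "M \<subseteq> HH" "chart -` M = {z\<in>V. w z = l}"
    and \<Phi>: "linear \<Phi>" "bij \<Phi>" "\<Phi> ` HH = HH" and X: "X \<subseteq> HH" "\<And>x. x \<in> HH \<Longrightarrow> \<Phi> x \<in> X \<longleftrightarrow> x \<in> T"
  shows "open_part (\<Phi> ` M) X"
proof -
  have L': "z \<in> {z. chart z \<in> T} \<and> (\<exists>e>0. ball z e \<subseteq> V \<and> (\<forall>y\<in>ball z e. y \<in> {z. chart z \<in> T} \<longrightarrow> w y = l))"
    if "z \<in> V" "w z = l" for z
    using L that unfolding iso_chart.local_level_def[OF I] by blast
  have zM: "chart_inv x \<in> V" "w (chart_inv x) = l" if "x \<in> M" for x
  proof -
    have "chart (chart_inv x) \<in> M" using chart_chart_inv[of x] M(1) that by auto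
    then have "chart_inv x \<in> chart -` M" by simp
    then show "chart_inv x \<in> V" "w (chart_inv x) = l" unfolding M(2) by auto
  qed
  have sub: "\<Phi> ` M \<subseteq> X"
  proof
    fix y assume "y \<in> \<Phi> ` M"
    then obtain x where x: "x \<in> M" "y = \<Phi> x" by blast
    have "chart (chart_inv x) \<in> T" using L'[OF zM[OF x(1)]] by simp
    then show "y \<in> X" using x X(2)[of x] M(1) chart_chart_inv[of x] by auto
  qed
  have "\<exists>S. open S \<and> y \<in> S \<and> S \<inter> X \<subseteq> \<Phi> ` M" if y: "y \<in> \<Phi> ` M" for y
  proof -
    obtain x where x: "x \<in> M" "y = \<Phi> x" using y by blast
    have xH: "x \<in> HH" using x M(1) by blast
    obtain e where e: "e > 0" "ball (chart_inv x) e \<subseteq> V" "\<And>z. z \<in> ball (chart_inv x) e \<Longrightarrow> chart z \<in> T \<Longrightarrow> w z = l"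
      using L'[OF zM[OF x(1)]] by blast
    have "openin (top_of_set HH) (HH \<inter> chart_inv -` ball (chart_inv x) e)"
      using continuous_chart_inv by (rule continuous_openin_preimage_gen) simp
    then obtain Q where Q: "open Q" "HH \<inter> chart_inv -` ball (chart_inv x) e = HH \<inter> Q" by (auto simp: openin_open)
    have oS: "open (\<Phi> ` Q)" using open_bijective_linear_image_eq[OF \<Phi>(1,2)] Q(1) by simp
    have "x \<in> Q" using Q(2) xH e(1) by auto
    moreover have "\<Phi> ` Q \<inter> X \<subseteq> \<Phi> ` M"
    proof
      fix y' assume "y' \<in> \<Phi> ` Q \<inter> X"
      then obtain x' where x': "x' \<in> Q" "y' = \<Phi> x'" "y' \<in> X" by blast
      have "x' \<in> HH"
      proof -
        have "y' \<in> \<Phi> ` HH" unfolding \<Phi>(3) using X(1) x'(3) by (rule subsetD)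
        then obtain x'' where "x'' \<in> HH" "\<Phi> x'' = y'" by (metis imageE)
        then show ?thesis using x'(2) bij_is_inj[OF \<Phi>(2)] by (metis injD)
      qed
      then have "x' \<in> T" using X(2)[of x'] x' by simp
      have "x' \<in> HH \<inter> chart_inv -` ball (chart_inv x) e" unfolding Q(2) using \<open>x' \<in> HH\<close> x'(1) by blast
      then have "chart_inv x' \<in> ball (chart_inv x) e" by blast
      then have "w (chart_inv x') = l" "chart_inv x' \<in> V"
        using e(2) e(3)[of "chart_inv x'"] chart_chart_inv[OF \<open>x' \<in> HH\<close>] \<open>x' \<in> T\<close> by auto
      then have "chart_inv x' \<in> chart -` M" unfolding M(2) by simp
      then have "x' \<in> M" using chart_chart_inv[OF \<open>x' \<in> HH\<close>] by simp
      then show "y' \<in> \<Phi> ` M" using x' by blast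
    qed
    ultimately show ?thesis using oS x by blast
  qed
  then have "openin (top_of_set X) (\<Phi> ` M)"
    using sub by (subst openin_subopen) (metis (no_types, lifting) IntI inf_commute openin_open subsetD)
  then show ?thesis using sub by (simp add: open_part_def)
qed

section \<open>Isometries of the product induced by Lorentz transformations and by the exchange of
  factors\<close>

definition "lorentz L \<longleftrightarrow> linear L \<and> (\<forall>u v. lor (L u) (L v) = lor u v) \<and> (\<forall>q\<in>H2. L q \<in> H2)"

lemma lorentz_bij:
  assumes "lorentz L" shows "bij L" "L ` H2 = H2"
proof -
  have L: "linear L" "\<And>u v. lor (L u) (L v) = lor u v" "\<And>q. q \<in> H2 \<Longrightarrow> L q \<in> H2" using assms by (auto simp: lorentz_def)
  have "inj L"
  proof (rule linear_injective_0[OF L(1), THEN iffD2], intro allI impI)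
    fix v assume v: "L v = 0"
    have "lor v u = 0" for u using L(2)[of v u] v by (simp add: lor_simps)
    from this[of "axis 1 1"] this[of "axis 2 1"] this[of "axis 3 1"]
    show "v = 0" by (simp add: lor_def axis_def vec_eq_iff forall_3)
  qed
  then show b: "bij L" using linear_injective_imp_surjective[OF L(1)] by (simp add: bij_def)
  show "L ` H2 = H2"
  proof
    show "H2 \<subseteq> L ` H2"
    proof
      fix q assume q: "q \<in> H2"
      obtain p where p: "L p = q" using b by (metis bij_is_surj surjD)
      have pp: "lor p p = -1" using L(2)[of p p] p q by (simp add: H2_def)
      \<comment> \<open>Otherwise - p would lie in \<open>H2\<close>, and so would its image - q,
        although \<open>q\<close> is on the upper sheet.\<close>
      have "0 < p $ 1"
      proof (rule ccontr)
        assume "\<not> 0 < p $ 1"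
        moreover have "p $ 1 \<noteq> 0"
        proof
          assume "p $ 1 = 0"
          then have "0 \<le> lor p p" by (simp add: lor_def)
          then show False using pp by simp
        qed
        ultimately have "- p \<in> H2" using pp by (simp add: H2_def lor_simps)
        then have "- q \<in> H2" using L(3)[of "- p"] linear_neg[OF L(1)] p by simp
        then show False using q by (simp add: H2_def)
      qed
      then show "q \<in> L ` H2" using p pp by (auto simp: H2_def)
    qed
  qed (use L(3) in blast)
qed

lemma lorentz_pair:
  assumes "lorentz L1" "lorentz L2"
  shows "linear (map_prod L1 L2)" "bij (map_prod L1 L2)" "map_prod L1 L2 ` HH = HH" "isometry_HH (map_prod L1 L2)"
proof -
  note b = lorentz_bij[OF assms(1)] lorentz_bij[OF assms(2)]
  have l: "linear L1" "linear L2" using assms by (auto simp: lorentz_def)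
  show "linear (map_prod L1 L2)"
    by (rule linearI) (auto simp: map_prod_def linear_add[OF l(1)] linear_add[OF l(2)] linear_scale[OF l(1)] linear_scale[OF l(2)] split: prod.splits)
  show bij: "bij (map_prod L1 L2)" using b(1,3) by (auto simp: bij_def intro!: prod.inj_map map_prod_surj)
  show im: "map_prod L1 L2 ` HH = HH" unfolding HH_def map_prod_image[symmetric] using b by (simp add: map_prod_image)
  show "isometry_HH (map_prod L1 L2)"
    unfolding isometry_HH_def
  proof (intro conjI ballI)
    show "bij_betw (map_prod L1 L2) HH HH" unfolding bij_betw_def using im bij inj_on_subset[OF bij_is_inj[OF bij]] by auto
    fix x y :: "(real^3) \<times> (real^3)"
    show "pdist (map_prod L1 L2 x) (map_prod L1 L2 y) = pdist x y"
      using assms by (simp add: pdist_def hdist_def lorentz_def)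
  qed
qed

lemma isometry_swap: "linear (prod.swap :: (real^3) \<times> (real^3) \<Rightarrow> _)" "bij (prod.swap :: (real^3) \<times> (real^3) \<Rightarrow> _)"
  "prod.swap ` HH = HH" "isometry_HH prod.swap"
proof -
  show "linear (prod.swap :: (real^3) \<times> (real^3) \<Rightarrow> _)" by (rule linearI) (auto simp: prod.swap_def)
  show b: "bij (prod.swap :: (real^3) \<times> (real^3) \<Rightarrow> _)" by (rule bij_swap)
  show im: "prod.swap ` HH = HH" by (auto simp: HH_def product_swap)
  show "isometry_HH prod.swap"
    unfolding isometry_HH_def
  proof (intro conjI ballI)
    show "bij_betw prod.swap HH HH" unfolding bij_betw_def using im b by (auto intro: inj_on_subset[OF bij_is_inj])
  qed (simp add: pdist_def add.commute)
qed

lemma lorentz_id: "lorentz (\<lambda>x. x)"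
  by (auto simp: lorentz_def intro: linearI)

subsection \<open>The model hypersurfaces\<close>

text \<open>S and C stand for sinh, the identity or sin, according to the sign of m, and for the
  corresponding primitive.\<close>

lemma conic_functions:
  fixes m :: real assumes "m \<le> 1"
  shows "\<exists>S C :: real \<Rightarrow> real. smooth_on UNIV S \<and> smooth_on UNIV C \<and>
    (\<forall>x. (C has_real_derivative S x) (at x)) \<and> (\<forall>x. (S has_real_derivative 1 + m * C x) (at x)) \<and>
    (\<forall>x. (S x)\<^sup>2 = 2 * C x + m * (C x)\<^sup>2 \<and> 0 \<le> C x) \<and>
    (\<forall>u v. u\<^sup>2 = 2 * v + m * v\<^sup>2 \<longrightarrow> -1 < v \<longrightarrow> (\<exists>x. S x = u \<and> C x = v))"
proof -
  have id: "smooth_on UNIV (\<lambda>x::real. k * x)" for k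
    by (rule smooth_on_linear) (auto intro: bounded_linear_mult_right)
  consider "m = 0" | "m > 0" | "m < 0" by linarith
  then show ?thesis
  proof cases
    case 1
    have "smooth_on UNIV (\<lambda>x::real. (1 * x))" "smooth_on UNIV (\<lambda>x::real. (1/2 * x) * (1 * x))"
      by (rule id, rule smooth_on_mult[OF _ id id]) simp
    then have "smooth_on UNIV (\<lambda>x::real. x)" "smooth_on UNIV (\<lambda>x::real. x\<^sup>2 / 2)" by (simp_all add: power2_eq_square)
    then show ?thesis
      by (intro exI[of _ "\<lambda>x. x"] exI[of _ "\<lambda>x. x\<^sup>2 / 2"]) (use 1 in \<open>auto intro!: derivative_eq_intros\<close>)
  next
    case 2
    define r where "r = sqrt m"
    have r: "0 < r" "r * r = m" using 2 by (simp_all add: r_def)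
    have e: "smooth_on UNIV (\<lambda>x. exp (k * x))" for k :: real by (rule smooth_on_exp[OF _ id]) simp
    have c: "smooth_on UNIV (\<lambda>_::real. k :: real)" for k by (rule smooth_on_const) simp
    note sm = smooth_on_add[OF open_UNIV] smooth_on_mult[OF open_UNIV]
    have "smooth_on UNIV (\<lambda>x. 1/(2*r) * exp (r * x) + - 1/(2*r) * exp (- r * x))"
      "smooth_on UNIV (\<lambda>x. 1/(2*m) * exp (r * x) + 1/(2*m) * exp (- r * x) + - 1/m)" by (intro sm c e)+
    moreover have "(\<lambda>x. 1/(2*r) * exp (r * x) + - 1/(2*r) * exp (- r * x)) = (\<lambda>x. sinh (r * x) / r)"
      "(\<lambda>x. 1/(2*m) * exp (r * x) + 1/(2*m) * exp (- r * x) + - 1/m) = (\<lambda>x. (cosh (r * x) - 1) / m)"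
      using r 2 by (auto simp: fun_eq_iff sinh_field_def cosh_field_def field_simps)
    ultimately have s: "smooth_on UNIV (\<lambda>x. sinh (r * x) / r)" "smooth_on UNIV (\<lambda>x. (cosh (r * x) - 1) / m)" by simp_all
    have "((\<lambda>x. (cosh (r * x) - 1) / m) has_real_derivative sinh (r * x) / r) (at x)" for x
      using r 2 by (auto intro!: derivative_eq_intros simp: field_simps)
    moreover have "((\<lambda>x. sinh (r * x) / r) has_real_derivative 1 + m * ((cosh (r * x) - 1) / m)) (at x)" for x
      using r 2 by (auto intro!: derivative_eq_intros simp: field_simps)
    moreover have "(sinh (r * x) / r)\<^sup>2 = 2 * ((cosh (r * x) - 1) / m) + m * ((cosh (r * x) - 1) / m)\<^sup>2" for x
    proof -
      have "(sinh (r * x) / r)\<^sup>2 = ((cosh (r * x))\<^sup>2 - 1) / m"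
        using r hyperbolic_pythagoras[of "r * x"] by (simp add: power_divide power2_eq_square[of r])
      also have "\<dots> = 2 * ((cosh (r * x) - 1) / m) + m * ((cosh (r * x) - 1) / m)\<^sup>2"
        using 2 by (simp add: field_simps power2_eq_square)
      finally show ?thesis .
    qed
    moreover have "0 \<le> (cosh (r * x) - 1) / m" for x using 2 cosh_real_ge_1[of "r * x"] by simp
    moreover have "\<exists>x. sinh (r * x) / r = u \<and> (cosh (r * x) - 1) / m = v" if uv: "u\<^sup>2 = 2 * v + m * v\<^sup>2" "-1 < v" for u v
    proof (intro exI[of _ "arsinh (r * u) / r"] conjI)
      have x: "r * (arsinh (r * u) / r) = arsinh (r * u)" using r by simp
      show "sinh (r * (arsinh (r * u) / r)) / r = u" unfolding x using r by (simp add: sinh_arsinh_real)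
      have "(cosh (arsinh (r * u)))\<^sup>2 = 1 + m * u\<^sup>2"
        using hyperbolic_pythagoras[of "arsinh (r * u)"] r by (simp add: sinh_arsinh_real power_mult_distrib power2_eq_square[of r])
      also have "\<dots> = (1 + m * v)\<^sup>2" unfolding uv(1) by (simp add: power2_eq_square algebra_simps)
      finally have "cosh (arsinh (r * u)) = 1 + m * v"
      proof (rule power2_eq_imp_eq)
        \<comment> \<open>For positive \<open>m\<close> the quadratic equation describes both
          branches of a hyperbola. The bounds v > -1 and m at most 1 select the branch 1 + m v >= 0,
          on which cosh takes its values.\<close>
        have "- m \<le> m * v" using mult_left_mono[of "-1" v m] uv(2) 2 by simp
        then show "0 \<le> 1 + m * v" using assms by simp
      qed simp
      then show "(cosh (r * (arsinh (r * u) / r)) - 1) / m = v" unfolding x using 2 by simp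
    qed
    ultimately show ?thesis using s
      by (intro exI[of _ "\<lambda>x. sinh (r * x) / r"] exI[of _ "\<lambda>x. (cosh (r * x) - 1) / m"]) blast
  next
    case 3
    define r where "r = sqrt (- m)"
    have r: "0 < r" "r * r = - m" using 3 by (simp_all add: r_def)
    have "smooth_on UNIV (sin :: real \<Rightarrow> real)" "smooth_on UNIV (cos :: real \<Rightarrow> real)" using C_k_sin_cos by (auto simp: smooth_on_def)
    then have e: "smooth_on UNIV (\<lambda>x. sin (r * x))" "smooth_on UNIV (\<lambda>x. cos (r * x))"
      using smooth_on_compose[OF open_UNIV open_UNIV, of "\<lambda>x. r * x"] id by auto
    have c: "smooth_on UNIV (\<lambda>_::real. k :: real)" for k by (rule smooth_on_const) simp
    note sm = smooth_on_add[OF open_UNIV] smooth_on_mult[OF open_UNIV]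
    have "smooth_on UNIV (\<lambda>x. 1/r * sin (r * x))" "smooth_on UNIV (\<lambda>x. 1/m * cos (r * x) + - 1/m)" by (intro sm c e)+
    moreover have "(\<lambda>x. 1/r * sin (r * x)) = (\<lambda>x. sin (r * x) / r)" "(\<lambda>x. 1/m * cos (r * x) + - 1/m) = (\<lambda>x. (cos (r * x) - 1) / m)"
      by (auto simp: fun_eq_iff diff_divide_distrib)
    ultimately have s: "smooth_on UNIV (\<lambda>x. sin (r * x) / r)" "smooth_on UNIV (\<lambda>x. (cos (r * x) - 1) / m)" by simp_all
    have mr: "m = - (r * r)" using r by simp
    have "((\<lambda>x. (cos (r * x) - 1) / m) has_real_derivative sin (r * x) / r) (at x)" for x
      unfolding mr using r(1) by (auto intro!: derivative_eq_intros simp: field_simps)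
    moreover have "((\<lambda>x. sin (r * x) / r) has_real_derivative 1 + m * ((cos (r * x) - 1) / m)) (at x)" for x
      using r(1) 3 by (auto intro!: derivative_eq_intros simp: field_simps)
    moreover have "(sin (r * x) / r)\<^sup>2 = 2 * ((cos (r * x) - 1) / m) + m * ((cos (r * x) - 1) / m)\<^sup>2" for x
    proof -
      have "(sin (r * x) / r)\<^sup>2 = ((cos (r * x))\<^sup>2 - 1) / m"
        using r sin_squared_eq[of "r * x"] 3 by (simp add: power_divide power2_eq_square[of r] field_simps)
      also have "\<dots> = 2 * ((cos (r * x) - 1) / m) + m * ((cos (r * x) - 1) / m)\<^sup>2"
        using 3 by (simp add: field_simps power2_eq_square)
      finally show ?thesis .
    qed
    moreover have "0 \<le> (cos (r * x) - 1) / m" for x using 3 cos_le_one[of "r * x"] by (intro divide_nonpos_neg) auto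
    moreover have "\<exists>x. sin (r * x) / r = u \<and> (cos (r * x) - 1) / m = v" if uv: "u\<^sup>2 = 2 * v + m * v\<^sup>2" for u v
    proof -
      have "(r * u)\<^sup>2 = - m * u\<^sup>2" using r by (simp add: power_mult_distrib power2_eq_square[of r])
      then have "(1 + m * v)\<^sup>2 + (r * u)\<^sup>2 = 1" unfolding uv by (simp add: power2_eq_square algebra_simps)
      then obtain \<theta> where \<theta>: "1 + m * v = cos \<theta>" "r * u = sin \<theta>" using sincos_total_2pi by metis
      have "r * (\<theta> / r) = \<theta>" using r by simp
      then have "sin (r * (\<theta> / r)) / r = u" "(cos (r * (\<theta> / r)) - 1) / m = v"
        using \<theta>(2)[symmetric] \<theta>(1)[symmetric] r(1) 3 by simp_all
      then show ?thesis by blast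
    qed
    ultimately show ?thesis using s
      by (intro exI[of _ "\<lambda>x. sin (r * x) / r"] exI[of _ "\<lambda>x. (cos (r * x) - 1) / m"]) blast
  qed
qed

text \<open>The intersection of an affine plane with the hyperboloid: an equidistant curve, a
  horocycle or a circle according to whether m = 1 - k^2 is positive, zero or negative. The point
  \<open>p\<close> lies on it, and the squared length of the acceleration is k^2.\<close>

lemma cylinder_const_curv:
  assumes "is_cylinder T"
  shows "const_curv_curve (T \<inter> H2)"
proof -
  obtain p v t k where o: "lorentz_onb p v t" and p: "p \<in> H2" and T: "T = {y. lor y (k *\<^sub>R p - v) = - k}"
    using assms unfolding is_cylinder_def by blast
  have L: "lor p p = -1" "lor v v = 1" "lor t t = 1" "lor p v = 0" "lor v p = 0" "lor p t = 0" "lor t p = 0" "lor v t = 0" "lor t v = 0"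
    using o by (auto simp: lorentz_onb_def lor_commute)
  define m where "m = 1 - k\<^sup>2"
  have "m \<le> 1" by (simp add: m_def)
  from conic_functions[OF this] obtain S C :: "real \<Rightarrow> real" where sm: "smooth_on UNIV S" "smooth_on UNIV C"
    and dC: "\<And>x. (C has_real_derivative S x) (at x)" and dS: "\<And>x. (S has_real_derivative 1 + m * C x) (at x)"
    and SC: "\<And>x. (S x)\<^sup>2 = 2 * C x + m * (C x)\<^sup>2" "\<And>x. 0 \<le> C x"
    and onto: "\<And>u v. u\<^sup>2 = 2 * v + m * v\<^sup>2 \<Longrightarrow> -1 < v \<Longrightarrow> \<exists>x. S x = u \<and> C x = v" by blast
  \<comment> \<open>\<open>t\<close> and p - k v span the direction of the plane, since both are
    orthogonal to k p - v. The squared length of p - k v is - m, which is why \<open>S\<close> and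
    \<open>C\<close> depend on \<open>m\<close>.\<close>
  define \<gamma> where "\<gamma> x = p + S x *\<^sub>R t + C x *\<^sub>R (p - k *\<^sub>R v)" for x
  have d1: "(\<gamma> has_vector_derivative (1 + m * C x) *\<^sub>R t + S x *\<^sub>R (p - k *\<^sub>R v)) (at x)" for x
    unfolding \<gamma>_def by (auto intro!: derivative_eq_intros dC dS)
  have v1: "vector_derivative \<gamma> (at x) = (1 + m * C x) *\<^sub>R t + S x *\<^sub>R (p - k *\<^sub>R v)" for x
    using d1 by (rule vector_derivative_at)
  have d2: "((\<lambda>x. vector_derivative \<gamma> (at x)) has_vector_derivative (m * S x) *\<^sub>R t + (1 + m * C x) *\<^sub>R (p - k *\<^sub>R v)) (at x)" for x
    unfolding v1 by (auto intro!: derivative_eq_intros dC dS)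
  have smg: "smooth_on UNIV \<gamma>"
  proof -
    have "C_k n UNIV \<gamma>" for n unfolding \<gamma>_def
      using sm by (intro C_k_add C_k_scaleR C_k_const open_UNIV) (auto simp: smooth_on_def)
    then show ?thesis by (simp add: smooth_on_def)
  qed
  have sp: "lor (x1 *\<^sub>R p + x2 *\<^sub>R v + x3 *\<^sub>R t) (x1 *\<^sub>R p + x2 *\<^sub>R v + x3 *\<^sub>R t) = - x1\<^sup>2 + x2\<^sup>2 + x3\<^sup>2" for x1 x2 x3
    unfolding lor_simps L by (simp add: power2_eq_square)
  have g: "\<gamma> x = (1 + C x) *\<^sub>R p + (- k * C x) *\<^sub>R v + S x *\<^sub>R t" for x
    by (simp add: \<gamma>_def algebra_simps)
  have gH: "\<gamma> x \<in> H2" for x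
  proof -
    have "lor (\<gamma> x) (\<gamma> x) = -1" unfolding g sp using SC(1)[of x] by (simp add: m_def power2_eq_square algebra_simps)
    moreover have "lor p (\<gamma> x) = - (1 + C x)" unfolding g lor_simps L by simp
    ultimately show ?thesis using H2_lor_neg[OF p, of "\<gamma> x"] SC(2)[of x] by (simp add: H2_def)
  qed
  have gT: "\<gamma> x \<in> T" for x
    unfolding T g by (simp add: lor_simps L algebra_simps)
  have im: "T \<inter> H2 = \<gamma> ` UNIV"
  proof
    show "\<gamma> ` UNIV \<subseteq> T \<inter> H2" using gH gT by auto
    show "T \<inter> H2 \<subseteq> \<gamma> ` UNIV"
    proof
      fix y assume y: "y \<in> T \<inter> H2"
      define c0 c1 c2 where c: "c0 = - lor y p" "c1 = lor y v" "c2 = lor y t"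
      have ye: "y = c0 *\<^sub>R p + c1 *\<^sub>R v + c2 *\<^sub>R t" using lorentz_onb_expand[OF o, of y] by (simp add: c)
      have c1: "c1 = k * (1 - c0)" using y by (simp add: T lor_simps c algebra_simps)
      have "lor y y = -1" using y by (simp add: H2_def)
      then have q: "- c0\<^sup>2 + c1\<^sup>2 + c2\<^sup>2 = -1" unfolding ye sp .
      have "c2\<^sup>2 = 2 * (c0 - 1) + m * (c0 - 1)\<^sup>2"
        using q unfolding c1 m_def by (simp add: power2_eq_square algebra_simps)
      moreover have "-1 < c0 - 1" using H2_lor_lt_0[OF _ p, of y] y by (simp add: c)
      ultimately obtain x where x: "S x = c2" "C x = c0 - 1" using onto by blast
      have "\<gamma> x = y" unfolding g ye c1 x by (simp add: algebra_simps)
      then show "y \<in> \<gamma> ` UNIV" by blast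
    qed
  qed
  have cur: "lor (vector_derivative \<gamma> (at x)) (vector_derivative \<gamma> (at x)) = 1" for x
  proof -
    have "vector_derivative \<gamma> (at x) = S x *\<^sub>R p + (- k * S x) *\<^sub>R v + (1 + m * C x) *\<^sub>R t"
      unfolding v1 by (simp add: algebra_simps)
    then have "lor (vector_derivative \<gamma> (at x)) (vector_derivative \<gamma> (at x)) = - (S x)\<^sup>2 + (- k * S x)\<^sup>2 + (1 + m * C x)\<^sup>2"
      by (simp only: sp)
    also have "\<dots> = (1 + m * C x)\<^sup>2 - m * (S x)\<^sup>2" by (simp add: m_def power2_eq_square algebra_simps)
    also have "\<dots> = 1" unfolding SC(1) by (simp add: power2_eq_square algebra_simps)
    finally show ?thesis .
  qed
  have acc: "lor (vector_derivative (\<lambda>s. vector_derivative \<gamma> (at s)) (at x) - \<gamma> x) (vector_derivative (\<lambda>s. vector_derivative \<gamma> (at s)) (at x) - \<gamma> x) = k\<^sup>2" for x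
  proof -
    have e: "vector_derivative (\<lambda>s. vector_derivative \<gamma> (at s)) (at x) - \<gamma> x
        = (- k\<^sup>2 * C x) *\<^sub>R p + (- k * (1 - k\<^sup>2 * C x)) *\<^sub>R v + (- k\<^sup>2 * S x) *\<^sub>R t"
      unfolding vector_derivative_at[OF d2] g m_def by (simp add: algebra_simps power2_eq_square)
    have "lor (vector_derivative (\<lambda>s. vector_derivative \<gamma> (at s)) (at x) - \<gamma> x) (vector_derivative (\<lambda>s. vector_derivative \<gamma> (at s)) (at x) - \<gamma> x)
        = - (- k\<^sup>2 * C x)\<^sup>2 + (- k * (1 - k\<^sup>2 * C x))\<^sup>2 + (k\<^sup>2)\<^sup>2 * (S x)\<^sup>2"
      unfolding e sp by (simp add: power_mult_distrib)
    also have "\<dots> = k\<^sup>2" unfolding SC(1) m_def by (simp add: power2_eq_square algebra_simps)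
    finally show ?thesis .
  qed
  show ?thesis
    unfolding const_curv_curve_def
    by (intro exI[of _ \<gamma>] exI[of _ UNIV] exI[of _ "k\<^sup>2"]) (use smg im gH cur acc in \<open>simp add: Let_def\<close>)
qed

text \<open>A rotation of the spatial plane moves \<open>\<nu>\<close> to (1, 0, 1), whose product
  with y is - (y1 - y3). The boost along that direction then scales the height y1 - y3 by exp (- c),
  which allows an additive constant to be absorbed into the isometry.\<close>

lemma rotation_boost:
  assumes \<nu>: "lor \<nu> \<nu> = 0" "\<nu> $ 1 = 1"
  shows "\<exists>L. lorentz L \<and> (\<forall>y. L y $ 1 - L y $ 3 = exp (- c) * (- lor y \<nu>)) \<and> (\<forall>y\<in>H2. 0 < - lor y \<nu>)"
proof -
  define a b where "a = \<nu> $ 2" and "b = \<nu> $ 3"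
  have ab: "a * a + b * b = 1" using \<nu> by (simp add: lor_def a_def b_def)
  define L :: "real^3 \<Rightarrow> real^3" where "L y = vector [cosh c * y$1 + sinh c * (a * y$2 + b * y$3), b * y$2 - a * y$3,
     sinh c * y$1 + cosh c * (a * y$2 + b * y$3)]" for y
  have L: "L y $ 1 = cosh c * y$1 + sinh c * (a * y$2 + b * y$3)" "L y $ 2 = b * y$2 - a * y$3"
    "L y $ 3 = sinh c * y$1 + cosh c * (a * y$2 + b * y$3)" for y by (simp_all add: L_def)
  have lin: "linear L" by (rule linearI) (simp_all add: vec_eq_iff forall_3 L algebra_simps)
  have ch: "cosh c * cosh c - sinh c * sinh c - 1 = 0" using hyperbolic_pythagoras[of c] by (simp add: power2_eq_square)
  have iso: "lor (L u) (L v) = lor u v" for u v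
    unfolding lor_def L using ch ab[THEN eq_iff_diff_eq_0[THEN iffD1]] by algebra
  have diff: "L y $ 1 - L y $ 3 = exp (- c) * (- lor y \<nu>)" for y
  proof -
    have e: "exp (- c) = cosh c - sinh c" by (simp add: cosh_minus_sinh)
    show ?thesis unfolding e L lor_def \<nu>(2) a_def b_def by (simp add: algebra_simps)
  qed
  have pos: "0 < - lor y \<nu>" if y: "y \<in> H2" for y
  proof -
    have "(a * y$2 + b * y$3)\<^sup>2 + (b * y$2 - a * y$3)\<^sup>2 = (a * a + b * b) * ((y$2)\<^sup>2 + (y$3)\<^sup>2)"
      by (simp add: power2_eq_square algebra_simps)
    moreover have "(y$2)\<^sup>2 + (y$3)\<^sup>2 = (y$1)\<^sup>2 - 1" "0 < y$1" using y by (auto simp: H2_def lor_def power2_eq_square)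
    ultimately have "(a * y$2 + b * y$3)\<^sup>2 + (b * y$2 - a * y$3)\<^sup>2 = (y$1)\<^sup>2 - 1" using ab by simp
    then have "(a * y$2 + b * y$3)\<^sup>2 < (y$1)\<^sup>2" using zero_le_power2[of "b * y$2 - a * y$3"] by linarith
    then have "a * y$2 + b * y$3 < y$1" by (rule power2_less_imp_less) (use \<open>0 < y$1\<close> in simp)
    then show ?thesis using \<nu>(2) by (simp add: lor_def a_def b_def mult.commute)
  qed
  have "L q \<in> H2" if q: "q \<in> H2" for q
  proof -
    have l: "lor (L q) (L q) = -1" using iso[of q q] q by (simp add: H2_def)
    have d: "0 < L q $ 1 - L q $ 3" unfolding diff by (rule mult_pos_pos) (use pos[OF q] in simp_all)
    have "0 < L q $ 1"
    proof (rule ccontr)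
      assume "\<not> 0 < L q $ 1"
      then have "(- L q $ 1)\<^sup>2 \<le> (- L q $ 3)\<^sup>2" using d by (intro power_mono) auto
      then show False using l unfolding lor_def by (simp add: power2_eq_square) (smt (verit) zero_le_square)
    qed
    then show ?thesis using l by (simp add: H2_def)
  qed
  then show ?thesis using lin iso diff pos unfolding lorentz_def by blast
qed

text \<open>\<open>gam\<close> parametrises the horocycle at height t = 0, and the geodesics normal
  to it are the vertical coordinate lines. Reversing the normal reverses the sign of
  \<open>t\<close>.\<close>

lemma gam_hp: "cosh t *\<^sub>R gam r + sinh t *\<^sub>R Nv r = hp (r, t)" "cosh t *\<^sub>R gam r + sinh t *\<^sub>R Nt_p r = hp (r, t)"
  "cosh t *\<^sub>R gam r + sinh t *\<^sub>R Nt_m r = hp (r, - t)"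
proof -
  have e: "exp t = cosh t + sinh t" "exp (- t) = cosh t - sinh t" by (simp_all add: cosh_plus_sinh cosh_minus_sinh)
  show 1: "cosh t *\<^sub>R gam r + sinh t *\<^sub>R Nv r = hp (r, t)"
    by (simp add: vec_eq_iff forall_3 hp_nth gam_def Nv_def e field_simps)
  show "cosh t *\<^sub>R gam r + sinh t *\<^sub>R Nt_p r = hp (r, t)" unfolding 1[symmetric] Nv_def Nt_p_def ..
  show "cosh t *\<^sub>R gam r + sinh t *\<^sub>R Nt_m r = hp (r, - t)"
    by (simp add: vec_eq_iff forall_3 hp_nth gam_def Nt_m_def e field_simps)
qed

lemma hp_height: "hp y $ 1 - hp y $ 3 = exp (- snd y)"
  by (simp add: hp_nth field_simps)

text \<open>In horospherical coordinates the surfaces are given by linear relations between the two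
  vertical coordinates, and ln (p1 - p3) is minus the vertical coordinate.\<close>

lemma M_c_iff:
  assumes c: "0 < c" "c < 1"
  shows "M_c_1_1 c \<subseteq> HH" "M_c_1_m1 c \<subseteq> HH"
    "x \<in> HH \<Longrightarrow> x \<in> M_c_1_1 c \<longleftrightarrow> sqrt (1 - c) * ln (fst x $ 1 - fst x $ 3) = sqrt c * ln (snd x $ 1 - snd x $ 3)"
    "x \<in> HH \<Longrightarrow> x \<in> M_c_1_m1 c \<longleftrightarrow> sqrt (1 - c) * ln (fst x $ 1 - fst x $ 3) = - (sqrt c * ln (snd x $ 1 - snd x $ 3))"
proof -
  have m: "M_c_1_1 c = {(hp (r, sqrt c * t), hp (s, sqrt (1 - c) * t)) | t r s. True}"
    "M_c_1_m1 c = {(hp (r, sqrt c * t), hp (s, - (sqrt (1 - c) * t))) | t r s. True}"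
    unfolding M_c_1_1_def M_c_1_m1_def gam_hp by (auto simp: image_def)
  show "M_c_1_1 c \<subseteq> HH" "M_c_1_m1 c \<subseteq> HH" unfolding m by (auto simp: HH_def hp_in_H2)
  have s: "0 < sqrt c" "0 < sqrt (1 - c)" using c by auto
  assume "x \<in> HH"
  then obtain z where z: "x = chart z" using chart_chart_inv by metis
  obtain r t r' t' where zz: "z = ((r, t), (r', t'))" by (metis surj_pair)
  have ln: "ln (fst x $ 1 - fst x $ 3) = - t" "ln (snd x $ 1 - snd x $ 3) = - t'"
    unfolding z zz by (simp_all add: chart_def hp_height)
  have inj: "hp y = hp y' \<longleftrightarrow> y = y'" for y y' using hinv_hp by metis
  show "x \<in> M_c_1_1 c \<longleftrightarrow> sqrt (1 - c) * ln (fst x $ 1 - fst x $ 3) = sqrt c * ln (snd x $ 1 - snd x $ 3)"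
  proof -
    have "x \<in> M_c_1_1 c \<longleftrightarrow> (\<exists>q. t = sqrt c * q \<and> t' = sqrt (1 - c) * q)"
      unfolding m z zz chart_def by (auto simp: inj)
    also have "\<dots> \<longleftrightarrow> sqrt (1 - c) * t = sqrt c * t'"
    proof
      assume "sqrt (1 - c) * t = sqrt c * t'"
      then show "\<exists>q. t = sqrt c * q \<and> t' = sqrt (1 - c) * q"
        using s by (intro exI[of _ "t / sqrt c"]) (auto simp: field_simps)
    qed auto
    finally show ?thesis unfolding ln by simp
  qed
  show "x \<in> M_c_1_m1 c \<longleftrightarrow> sqrt (1 - c) * ln (fst x $ 1 - fst x $ 3) = - (sqrt c * ln (snd x $ 1 - snd x $ 3))"
  proof -
    have "x \<in> M_c_1_m1 c \<longleftrightarrow> (\<exists>q. t = sqrt c * q \<and> t' = - (sqrt (1 - c) * q))"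
      unfolding m z zz chart_def by (auto simp: inj)
    also have "\<dots> \<longleftrightarrow> sqrt (1 - c) * t = - (sqrt c * t')"
    proof
      assume "sqrt (1 - c) * t = - (sqrt c * t')"
      then show "\<exists>q. t = sqrt c * q \<and> t' = - (sqrt (1 - c) * q)"
        using s by (intro exI[of _ "t / sqrt c"]) (auto simp: field_simps)
    qed auto
    finally show ?thesis unfolding ln by auto
  qed
qed

text \<open>Both ideal points are moved to the standard one; then the equation is a linear relation
  between the two heights, and only the signs of its coefficients and their ratio remain.\<close>

lemma horo_target:
  assumes "is_horo T"
  shows "\<exists>L1 L2 c X. lorentz L1 \<and> lorentz L2 \<and> 0 < c \<and> c < 1 \<and> (X = M_c_1_1 c \<or> X = M_c_1_m1 c) \<and> X \<subseteq> HH \<and>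
    (\<forall>x\<in>HH. map_prod L1 L2 x \<in> X \<longleftrightarrow> x \<in> T)"
proof -
  obtain \<nu> \<omega> \<alpha> \<beta> k where n: "lor \<nu> \<nu> = 0" "\<nu> $ 1 = 1" "lor \<omega> \<omega> = 0" "\<omega> $ 1 = 1"
    and ab: "\<alpha> \<noteq> 0" "\<beta> \<noteq> 0" "\<alpha>\<^sup>2 + \<beta>\<^sup>2 = 1" and T: "T = {x. \<alpha> * ln (- lor (fst x) \<nu>) + \<beta> * ln (- lor (snd x) \<omega>) = k}"
    using assms unfolding is_horo_def by blast
  obtain L1 where L1: "lorentz L1" "\<And>y. L1 y $ 1 - L1 y $ 3 = exp (- (k / \<alpha>)) * (- lor y \<nu>)" "\<And>y. y \<in> H2 \<Longrightarrow> 0 < - lor y \<nu>"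
    using rotation_boost[OF n(1,2), of "k / \<alpha>"] by blast
  obtain L2 where L2: "lorentz L2" "\<And>y. L2 y $ 1 - L2 y $ 3 = exp (- 0) * (- lor y \<omega>)" "\<And>y. y \<in> H2 \<Longrightarrow> 0 < - lor y \<omega>"
    using rotation_boost[OF n(3,4), of 0] by blast
  define c where "c = \<beta>\<^sup>2"
  have c: "0 < c" "c < 1" "sqrt c = \<bar>\<beta>\<bar>" "sqrt (1 - c) = \<bar>\<alpha>\<bar>"
  proof -
    have "1 - c = \<alpha>\<^sup>2" using ab(3) by (simp add: c_def)
    moreover have "0 < \<alpha>\<^sup>2" "0 < c" using ab by (simp_all add: c_def)
    ultimately show "0 < c" "c < 1" by linarith+
    show "sqrt (1 - c) = \<bar>\<alpha>\<bar>" unfolding \<open>1 - c = \<alpha>\<^sup>2\<close> by simp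
    show "sqrt c = \<bar>\<beta>\<bar>" by (simp add: c_def)
  qed
  \<comment> \<open>Coefficients of opposite sign make the two heights increase together, as for
    \<open>M_c_1_1\<close>; equal signs make them move in opposite directions.\<close>
  define X where "X = (if \<alpha> * \<beta> < 0 then M_c_1_1 c else M_c_1_m1 c)"
  have XH: "X \<subseteq> HH" using M_c_iff(1,2)[OF c(1,2)] by (simp add: X_def)
  have X: "y \<in> X \<longleftrightarrow> \<alpha> * ln (fst y $ 1 - fst y $ 3) + \<beta> * ln (snd y $ 1 - snd y $ 3) = 0" if y: "y \<in> HH" for y
    using M_c_iff(3,4)[OF c(1,2) y] ab(1,2) unfolding X_def c(3,4)
    by (auto simp: abs_if mult_less_0_iff split: if_splits)
  have "map_prod L1 L2 x \<in> X \<longleftrightarrow> x \<in> T" if x: "x \<in> HH" for x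
  proof -
    have "map_prod L1 L2 x \<in> HH" using lorentz_pair(3)[OF L1(1) L2(1)] x by blast
    then have "map_prod L1 L2 x \<in> X \<longleftrightarrow> \<alpha> * ln (L1 (fst x) $ 1 - L1 (fst x) $ 3) + \<beta> * ln (L2 (snd x) $ 1 - L2 (snd x) $ 3) = 0"
      using X by simp
    also have "ln (L1 (fst x) $ 1 - L1 (fst x) $ 3) = ln (- lor (fst x) \<nu>) - k / \<alpha>"
      unfolding L1(2) using L1(3)[of "fst x"] x by (subst ln_mult) (auto simp: HH_def)
    also have "ln (L2 (snd x) $ 1 - L2 (snd x) $ 3) = ln (- lor (snd x) \<omega>)" unfolding L2(2) by simp
    finally show ?thesis using ab(1) by (auto simp: T right_diff_distrib)
  qed
  then show ?thesis using L1(1) L2(1) c XH by (intro exI[of _ L1] exI[of _ L2] exI[of _ c] exI[of _ X]) (auto simp: X_def)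
qed

theorem theorem1p2:
  fixes M :: "((real^3) \<times> (real^3)) set"
  assumes "isoparametric_hypersurface M"
    and "connected M"
  shows "\<exists>\<Phi>. isometry_HH \<Phi> \<and>
     ((\<exists>\<Gamma>. const_curv_curve \<Gamma> \<and> open_part (\<Phi> ` M) (M_Gamma \<Gamma>))
    \<or> (\<exists>c. 0 < c \<and> c < 1 \<and> open_part (\<Phi> ` M) (M_c_1_m1 c))
    \<or> (\<exists>c. 0 < c \<and> c < 1 \<and> open_part (\<Phi> ` M) (M_c_1_1 c))
    \<or> (\<exists>\<tau>. \<tau> < -1 \<and> open_part (\<Phi> ` M) (M_tau \<tau>)))"
proof (cases "M = {}")
  case True
  have "isometry_HH (map_prod (\<lambda>x. x) (\<lambda>x. x))" by (rule lorentz_pair(4)[OF lorentz_id lorentz_id])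
  \<comment> \<open>The empty set is open in every model; -2 is an arbitrary admissible
    parameter.\<close>
  moreover have "open_part ((map_prod (\<lambda>x. x) (\<lambda>x. x)) ` M) (M_tau (-2))" by (simp add: True open_part_def)
  moreover have "(-2::real) < -1" by simp
  ultimately show ?thesis by blast
next
  case False
  have "\<exists>z. chart z = x" if "x \<in> HH" for x using chart_chart_inv[OF that] by blast
  from isoparametric_iso_chart[OF assms(1) False this]
  obtain V J w \<phi> g \<psi> \<kappa> l where MH: "M \<subseteq> HH" and I: "iso_chart V J w \<phi> g \<psi> \<kappa> l" and Ml: "chart -` M = {z\<in>V. w z = l}"
    by blast
  interpret iso_chart V J w \<phi> g \<psi> \<kappa> l by (rule I)
  have im: "chart -` M = chart_inv ` M"
  proof
    show "chart -` M \<subseteq> chart_inv ` M" by (metis chart_inv_chart image_eqI subsetI vimage_eq)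
    show "chart_inv ` M \<subseteq> chart -` M" using chart_chart_inv MH by auto
  qed
  have "connected (chart -` M)"
    unfolding im by (rule connected_continuous_image[OF continuous_on_subset[OF continuous_chart_inv MH] assms(2)])
  then have conn: "connected {z\<in>V. w z = l}" unfolding Ml .
  obtain z0 where z0: "z0 \<in> V" "w z0 = l" using False im Ml by blast
  note id = lorentz_pair[OF lorentz_id lorentz_id]
  consider T where "is_cylinder T" "local_level {z. hp (fst z) \<in> T}" | T where "is_cylinder T" "local_level {z. hp (snd z) \<in> T}"
    | T where "is_horo T" "local_level {z. chart z \<in> T}" | T where "is_tau T" "local_level {z. chart z \<in> T}"
    using chart_classification[OF conn z0] by blast
  then show ?thesis
  proof cases
    case (1 T)
    have "open_part (map_prod (\<lambda>x. x) (\<lambda>x. x) ` M) (M_Gamma (T \<inter> H2))"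
      by (rule open_part_transfer[OF I _ MH Ml id(1-3), where T = "{x. fst x \<in> T}"])
        (use 1(2) in \<open>auto simp: chart_def M_Gamma_def HH_def\<close>)
    then show ?thesis using id(4) cylinder_const_curv[OF 1(1)] by blast
  next
    case (2 T)
    \<comment> \<open>The curve lies in the second factor here, and the exchange of factors moves it
      to the first one.\<close>
    have "open_part (prod.swap ` M) (M_Gamma (T \<inter> H2))"
      by (rule open_part_transfer[OF I _ MH Ml isometry_swap(1-3), where T = "{x. snd x \<in> T}"])
        (use 2(2) in \<open>auto simp: chart_def M_Gamma_def HH_def\<close>)
    then show ?thesis using isometry_swap(4) cylinder_const_curv[OF 2(1)] by blast
  next
    case (3 T)
    obtain L1 L2 c X where L: "lorentz L1" "lorentz L2" "0 < c" "c < 1" "X = M_c_1_1 c \<or> X = M_c_1_m1 c" "X \<subseteq> HH"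
      "\<And>x. x \<in> HH \<Longrightarrow> map_prod L1 L2 x \<in> X \<longleftrightarrow> x \<in> T" using horo_target[OF 3(1)] by blast
    note p = lorentz_pair[OF L(1,2)]
    have "open_part (map_prod L1 L2 ` M) X"
      by (rule open_part_transfer[OF I 3(2) MH Ml p(1-3) L(6,7)])
    then show ?thesis using p(4) L(3-5) by blast
  next
    case (4 T)
    obtain L \<tau> where t: "\<tau> < -1" and L: "lorentz L" and T: "T = {x. lor (fst x) (L (snd x)) = \<tau>}"
      using 4(1) unfolding is_tau_def lorentz_def by blast
    note p = lorentz_pair[OF lorentz_id L]
    have "open_part (map_prod (\<lambda>x. x) L ` M) (M_tau \<tau>)"
    proof (rule open_part_transfer[OF I 4(2) MH Ml p(1-3)])
      show "M_tau \<tau> \<subseteq> HH" by (auto simp: M_tau_def HH_def)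
      show "map_prod (\<lambda>x. x) L x \<in> M_tau \<tau> \<longleftrightarrow> x \<in> T" if "x \<in> HH" for x
        using that L by (auto simp: T M_tau_def HH_def lorentz_def map_prod_def split: prod.splits)
    qed
    then show ?thesis using p(4) t by blast
  qed
qed

end
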